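(* Let $T>0$, let $\chi\in L^2(\mathbb R^3)$ be a bounded function, let $f$ be such that $\hat f\in L^1(\mathbb R^3)$, and let $\mathbf S$ be the ($\mathbb C^4$-valued) profile of a localized source. Let $A_\varepsilon(\mathbf x)=\mathrm{Diag}(\rho_\varepsilon,\rho_\varepsilon,\rho_\varepsilon,\kappa_\varepsilon)(\mathbf x)$ be a family of positive definite matrices which is uniformly bounded and continuous, with limit $A_0$ in $\mathcal C(\mathbb R^3)$ as $\varepsilon\to0$ (in particular $A_0=A$ if $A_\varepsilon=A$ does not depend on $\varepsilon$). Let $\Gamma=\mathrm{Diag}(-1,-1,-1,1)$, let $W_\varepsilon(t,\mathbf x,\mathbf k)$ be the Wigner transform defined in the context, and let $W\in\mathcal A'$ be its weak limit as $\varepsilon\to0$ (along a subsequence $\varepsilon_k\to0$). Then the back-propagated signal $$\mathbf u^B_\varepsilon(\boldsymbol\xi;\mathbf x_0)=\int_{\mathbb R^6}e^{i\mathbf k\cdot(\boldsymbol\xi-\mathbf z)}\,\Gamma\, W_\varepsilon\Big(T,\mathbf x_0+\varepsilon\frac{\mathbf z+\boldsymbol\xi}{2},\mathbf k\Big)\,\Gamma\, A_\varepsilon(\mathbf x_0+\varepsilon\mathbf z)\,\mathbf S(\mathbf z)\,\frac{d\mathbf z\,d\mathbf k}{(2\pi)^3}$$ converges weakly in $\mathcal S'(\mathbb R^3\times\mathbb R^3)$ (in the variables $(\boldsymbol\xi,\mathbf x_0)$) as $\varepsilon\to0$ (along that subsequence) to the limit $$\mathbf u^B(\boldsymbol\xi;\mathbf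 x_0)=\int_{\mathbb R^6}e^{i\mathbf k\cdot(\boldsymbol\xi-\mathbf z)}\,\Gamma\, W(T,\mathbf x_0,\mathbf k)\,\Gamma\, A_0(\mathbf x_0)\,\mathbf S(\mathbf z)\,\frac{d\mathbf z\,d\mathbf k}{(2\pi)^3}.$$
   Context: Setting: one-step time reversal of acoustic waves $\mathbf u=(\mathbf v,p)$ (velocity and pressure) in a medium with density $\rho_\varepsilon$ and compressibility $\kappa_\varepsilon$. The wave starts from the localized initial pulse $\mathbf u(0,\mathbf x)=\mathbf S((\mathbf x-\mathbf x_0)/\varepsilon)$, solves $A_\varepsilon\partial_t\mathbf u+D^j\partial_{x^j}\mathbf u=0$ up to time $T$, is recorded with amplification function $\chi$ and blurring kernel $\varepsilon^{-3}f(\cdot/\varepsilon)$, is multiplied by $\Gamma$ (velocity reversed, pressure kept), and propagates in the same medium for a further time $T$; $\mathbf u^B_\varepsilon(\boldsymbol\xi;\mathbf x_0)=\Gamma\mathbf u(2T,\mathbf x_0+\varepsilon\boldsymbol\xi)$ can be written in the form given in the claim. Here $D^j$, $j=1,2,3$, is the symmetric $4\times4$ matrix with entries $D^j_{mn}=\delta_{m4}\delta_{nj}+\delta_{n4}\delta_{mj}$; repeated indices are summed; $\hat f(\mathbf q)=\int_{\mathbb R^3}e^{-i\mathbf q\cdot\mathbf x}f(\mathbf x)\,d\mathbf x$. For $\mathbf q\in\mathbb R^3$, the $4\times4$ matrix-valued functions $Q(t,\mathbf x;\mathbf q)$ and $Q_*(t,\mathbf x;\mathbf q)$ (depending on $\varepsilon$)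 solve $$A_\varepsilon(\mathbf x)\frac{\partial Q}{\partial t}+D^j\frac{\partial Q}{\partial x^j}=0,\qquad Q(0,\mathbf x;\mathbf q)=\chi(\mathbf x)e^{i\mathbf q\cdot\mathbf x/\varepsilon}I,$$ $$\frac{\partial Q_*}{\partial t}A_\varepsilon(\mathbf x)+\frac{\partial Q_*}{\partial x^j}D^j=0,\qquad Q_*(0,\mathbf x;\mathbf q)=A_\varepsilon^{-1}(\mathbf x)\chi(\mathbf x)e^{-i\mathbf q\cdot\mathbf x/\varepsilon}.$$ The Wigner transform is $$W_\varepsilon(t,\mathbf x,\mathbf k)=\int_{\mathbb R^3}\hat f(\mathbf q)\,U_\varepsilon(t,\mathbf x,\mathbf k;\mathbf q)\,d\mathbf q,\qquad U_\varepsilon(t,\mathbf x,\mathbf k;\mathbf q)=\int_{\mathbb R^3}e^{i\mathbf k\cdot\mathbf y}\,Q\big(t,\mathbf x-\tfrac{\varepsilon\mathbf y}{2};\mathbf q\big)\,Q_*\big(t,\mathbf x+\tfrac{\varepsilon\mathbf y}{2};\mathbf q\big)\frac{d\mathbf y}{(2\pi)^3}.$$ $\mathcal A$ is the space of matrix-valued functions $\phi(\mathbf x,\mathbf k)$ with finite norm $\|\phi\|_{\mathcal A}=\int_{\mathbb R^3}\sup_{\mathbf x}\|\tilde\phi(\mathbf x,\mathbf y)\|\,d\mathbf y$, where $\tilde\phi(\mathbf x,\mathbf y)=\int_{\mathbb R^3}e^{-i\mathbf k\cdot\mathbf y}\phi(\mathbf x,\mathbf k)\,d\mathbf k$, and $\mathcal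 A'$ is its dual. The family $W_\varepsilon(t)$ is bounded in $\mathcal A'$ uniformly in $\varepsilon>0$ and $t\ge0$, so that weak limits along subsequences $\varepsilon_k\to0$ exist in $\mathcal A'$. The integrals defining $\mathbf u^B_\varepsilon$ and $\mathbf u^B$ are understood in the sense of distributions in $(\boldsymbol\xi,\mathbf x_0)$. With the matrix duality product $\langle A,B\rangle=\sum_{i,k}\langle A_{ik},B_{ik}\rangle$ and $\boldsymbol\phi$ a vector-valued test function in $\mathcal S(\mathbb R^3\times\mathbb R^3)$, the limit satisfies $\langle\mathbf u^B,\boldsymbol\phi\rangle=\langle W(T),Z\rangle$, where $Z(\mathbf x_0,\mathbf k)=\int_{\mathbb R^6}e^{i\mathbf k\cdot(\mathbf z-\boldsymbol\xi)}\,\Gamma\,\boldsymbol\phi(\boldsymbol\xi,\mathbf x_0)\,\mathbf S^*(\mathbf z)\,A_0(\mathbf x_0)\,\Gamma\,\frac{d\mathbf z\,d\boldsymbol\xi}{(2\pi)^3}$ and $\mathbf S^*$ is the conjugate transpose of $\mathbf S$. *)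

theory Defs
  imports "HOL-Analysis.Analysis"
begin

section \<open>Matrices\<close>

type_synonym cmat = "complex ^ 4 ^ 4"
type_synonym cvec = "complex ^ 4"

definition cscale :: "complex \<Rightarrow> cmat \<Rightarrow> cmat" where
  "cscale c M = (\<chi> i j. c * M $ i $ j)"

definition diag_mat :: "real \<Rightarrow> real \<Rightarrow> cmat" where
  "diag_mat a b = (\<chi> i j. if i = j then (if i = 4 then of_real b else of_real a) else 0)"

definition Gam :: cmat where
  "Gam = diag_mat (- 1) 1"

text \<open>In the numeral types the index \<^term>\<open>3 :: 3\<close> is \<^term>\<open>0 :: 3\<close> and \<^term>\<open>4 :: 4\<close> is
  \<^term>\<open>0 :: 4\<close>; spatial directions 1, 2, 3 are identified with the velocity components 1, 2, 3.\<close>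

definition vel_index :: "3 \<Rightarrow> 4" where
  "vel_index j = (if j = 1 then 1 else if j = 2 then 2 else 3)"

definition Dmat :: "3 \<Rightarrow> cmat" where
  "Dmat j = (\<chi> m n. (if m = 4 \<and> n = vel_index j then 1 else 0)
                    + (if n = 4 \<and> m = vel_index j then 1 else 0))"

text \<open>The column-times-conjugated-row product \<open>u v\<^sup>*\<close>.\<close>

definition outer :: "cvec \<Rightarrow> cvec \<Rightarrow> cmat" where
  "outer u v = (\<chi> i j. u $ i * cnj (v $ j))"

text \<open>All duality products are sesquilinear, \<open>\<langle>a, b\<rangle> = \<integral> a cnj(b)\<close>, summed over the components.
  This is the convention for which the adjoint of \<open>W \<mapsto> \<Gamma> W \<Gamma> A\<^sub>0 S\<close> is
  \<open>\<phi> \<mapsto> \<Gamma> \<phi> S\<^sup>* A\<^sub>0 \<Gamma>\<close>, with the conjugate transpose of \<open>S\<close>. Accordingly, elements of dual spaces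
  are conjugate-linear functionals.\<close>

definition mat_dual :: "cmat \<Rightarrow> cmat \<Rightarrow> complex" where
  "mat_dual M N = (\<Sum>i\<in>UNIV. \<Sum>j\<in>UNIV. M $ i $ j * cnj (N $ i $ j))"

definition vec_dual :: "cvec \<Rightarrow> cvec \<Rightarrow> complex" where
  "vec_dual u v = (\<Sum>i\<in>UNIV. u $ i * cnj (v $ i))"

section \<open>Function spaces\<close>

primrec pderivs :: "'a list \<Rightarrow> ('a::euclidean_space \<Rightarrow> 'b::real_normed_vector) \<Rightarrow> 'a \<Rightarrow> 'b" where
  "pderivs [] f = f"
| "pderivs (b # bs) f = (\<lambda>x. frechet_derivative (pderivs bs f) (at x) b)"

definition schwartz :: "('a::euclidean_space \<Rightarrow> 'b::real_normed_vector) \<Rightarrow> bool" where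
  "schwartz f \<longleftrightarrow> (\<forall>bs \<in> lists Basis.
      (\<forall>x. pderivs bs f differentiable (at x)) \<and>
      (\<forall>n::nat. bounded (range (\<lambda>x. (1 + norm x) ^ n *\<^sub>R pderivs bs f x))))"

text \<open>Conjugate-linear functionals on the vector-valued Schwartz space, bounded by finitely many
  of its seminorms.\<close>

definition tempered :: "(('a::euclidean_space \<Rightarrow> cvec) \<Rightarrow> complex) \<Rightarrow> bool" where
  "tempered u \<longleftrightarrow>
     (\<forall>\<phi> \<psi>. schwartz \<phi> \<longrightarrow> schwartz \<psi> \<longrightarrow> u (\<lambda>x. \<phi> x + \<psi> x) = u \<phi> + u \<psi>) \<and>
     (\<forall>\<phi> c. schwartz \<phi> \<longrightarrow> u (\<lambda>x. c *s \<phi> x) = cnj c * u \<phi>) \<and>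
     (\<exists>C. \<exists>N::nat. \<forall>\<phi> M. schwartz \<phi> \<longrightarrow>
        (\<forall>bs \<in> lists Basis. length bs \<le> N \<longrightarrow> (\<forall>x. (1 + norm x) ^ N * norm (pderivs bs \<phi> x) \<le> M)) \<longrightarrow>
        cmod (u \<phi>) \<le> C * M)"

definition tempered_weakly_converges ::
    "(nat \<Rightarrow> ('a::euclidean_space \<Rightarrow> cvec) \<Rightarrow> complex) \<Rightarrow> (('a \<Rightarrow> cvec) \<Rightarrow> complex) \<Rightarrow> bool" where
  "tempered_weakly_converges u v \<longleftrightarrow>
     (\<forall>n. tempered (u n)) \<and> tempered v \<and> (\<forall>\<phi>. schwartz \<phi> \<longrightarrow> (\<lambda>n. u n \<phi>) \<longlonglongrightarrow> v \<phi>)"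

definition L2 :: "(real^3 \<Rightarrow> 'b::real_normed_vector) \<Rightarrow> bool" where
  "L2 u \<longleftrightarrow> u \<in> borel_measurable borel \<and> integrable lborel (\<lambda>x. (norm (u x))\<^sup>2)"

definition fourier :: "(real^3 \<Rightarrow> complex) \<Rightarrow> real^3 \<Rightarrow> complex" where
  "fourier f q = (\<integral>x. cis (- (q \<bullet> x)) * f x \<partial>lborel)"

section \<open>The acoustic system\<close>

text \<open>\<open>Q \<in> C([0,\<infinity>); L\<^sup>2)\<close>.\<close>

definition L2_curve :: "(real \<Rightarrow> real^3 \<Rightarrow> cmat) \<Rightarrow> bool" where
  "L2_curve Q \<longleftrightarrow> (\<forall>t\<ge>0. L2 (Q t)) \<and>
     (\<forall>t\<ge>0. ((\<lambda>s. \<integral>x. (norm (Q s x - Q t x))\<^sup>2 \<partial>lborel) \<longlongrightarrow> 0) (at t within {0..}))"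

definition partial :: "3 \<Rightarrow> (real^3 \<Rightarrow> complex) \<Rightarrow> real^3 \<Rightarrow> complex" where
  "partial j \<psi> x = frechet_derivative \<psi> (at x) (axis j 1)"

text \<open>The coefficients and the initial data are not differentiable, so the equations
  \<open>A \<partial>\<^sub>t Q + D\<^sup>j \<partial>\<^sub>j Q = 0\<close> and \<open>\<partial>\<^sub>t Q A + \<partial>\<^sub>j Q D\<^sup>j = 0\<close> are understood weakly: they are integrated
  over \<open>[0,t]\<close> and tested against scalar Schwartz functions of \<open>x\<close>.\<close>

definition solves_forward ::
    "(real^3 \<Rightarrow> cmat) \<Rightarrow> (real^3 \<Rightarrow> cmat) \<Rightarrow> (real \<Rightarrow> real^3 \<Rightarrow> cmat) \<Rightarrow> bool" where
  "solves_forward A Q0 Q \<longleftrightarrow> L2_curve Q \<and> (AE x in lborel. Q 0 x = Q0 x) \<and>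
     (\<forall>t\<ge>0. \<forall>\<psi>. schwartz \<psi> \<longrightarrow>
        (\<integral>x. cscale (\<psi> x) (A x ** (Q t x - Q 0 x)) \<partial>lborel)
        = (LBINT s:{0..t}. (\<integral>x. (\<Sum>j\<in>UNIV. cscale (partial j \<psi> x) (Dmat j ** Q s x)) \<partial>lborel)))"

definition solves_adjoint ::
    "(real^3 \<Rightarrow> cmat) \<Rightarrow> (real^3 \<Rightarrow> cmat) \<Rightarrow> (real \<Rightarrow> real^3 \<Rightarrow> cmat) \<Rightarrow> bool" where
  "solves_adjoint A Q0 Q \<longleftrightarrow> L2_curve Q \<and> (AE x in lborel. Q 0 x = Q0 x) \<and>
     (\<forall>t\<ge>0. \<forall>\<psi>. schwartz \<psi> \<longrightarrow>
        (\<integral>x. cscale (\<psi> x) ((Q t x - Q 0 x) ** A x) \<partial>lborel)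
        = (LBINT s:{0..t}. (\<integral>x. (\<Sum>j\<in>UNIV. cscale (partial j \<psi> x) (Q s x ** Dmat j)) \<partial>lborel)))"

text \<open>For a family indexed by the wave vector \<open>q\<close>: the representatives \<open>Q(t,x;q)\<close> are chosen jointly
  Borel measurable, so that integrals in \<open>q\<close> make sense.\<close>

definition jointly_measurable :: "(real \<Rightarrow> real^3 \<Rightarrow> real^3 \<Rightarrow> cmat) \<Rightarrow> bool" where
  "jointly_measurable Q \<longleftrightarrow>
     (\<lambda>(t, x, q). Q t x q) \<in> borel_measurable (restrict_space borel ({0..} \<times> UNIV))"

section \<open>The Wigner transform\<close>

definition wigner_U ::
    "(real^3 \<Rightarrow> cmat) \<Rightarrow> (real^3 \<Rightarrow> cmat) \<Rightarrow> real \<Rightarrow> real^3 \<Rightarrow> real^3 \<Rightarrow> cmat" where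
  "wigner_U Q Qs e x k =
     (\<integral>y. cscale (cis (k \<bullet> y) / (2 * of_real pi) ^ 3)
             (Q (x - (e / 2) *\<^sub>R y) ** Qs (x + (e / 2) *\<^sub>R y)) \<partial>lborel)"

definition wigner ::
    "(real^3 \<Rightarrow> complex) \<Rightarrow> (real^3 \<Rightarrow> real^3 \<Rightarrow> cmat) \<Rightarrow> (real^3 \<Rightarrow> real^3 \<Rightarrow> cmat)
       \<Rightarrow> real \<Rightarrow> real^3 \<Rightarrow> real^3 \<Rightarrow> cmat" where
  "wigner f Q Qs e x k =
     (\<integral>q. cscale (fourier f q) (wigner_U (\<lambda>x. Q x q) (\<lambda>x. Qs x q) e x k) \<partial>lborel)"

text \<open>The space \<open>\<A>\<close> and its dual. Since \<open>\<phi>(x,\<cdot>)\<close> is integrable, \<open>fourier_k \<phi> x\<close> is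
  continuous, so the supremum over \<open>x\<close> is lower semicontinuous and hence measurable in \<open>y\<close>.\<close>

definition fourier_k :: "(real^3 \<Rightarrow> real^3 \<Rightarrow> cmat) \<Rightarrow> real^3 \<Rightarrow> real^3 \<Rightarrow> cmat" where
  "fourier_k \<phi> x y = (\<integral>k. cscale (cis (- (k \<bullet> y))) (\<phi> x k) \<partial>lborel)"

definition A_norm :: "(real^3 \<Rightarrow> real^3 \<Rightarrow> cmat) \<Rightarrow> ennreal" where
  "A_norm \<phi> = (\<integral>\<^sup>+ y. (SUP x. ennreal (norm (fourier_k \<phi> x y))) \<partial>lborel)"

definition A_space :: "(real^3 \<Rightarrow> real^3 \<Rightarrow> cmat) set" where
  "A_space = {\<phi>. (\<lambda>(x, k). \<phi> x k) \<in> borel_measurable borel \<and>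
                 (\<forall>x. integrable lborel (\<phi> x)) \<and> A_norm \<phi> < \<infinity>}"

definition A_dual :: "((real^3 \<Rightarrow> real^3 \<Rightarrow> cmat) \<Rightarrow> complex) set" where
  "A_dual = {W.
     (\<forall>\<phi>\<in>A_space. \<forall>\<psi>\<in>A_space. W (\<lambda>x k. \<phi> x k + \<psi> x k) = W \<phi> + W \<psi>) \<and>
     (\<forall>\<phi>\<in>A_space. \<forall>c. W (\<lambda>x k. cscale c (\<phi> x k)) = cnj c * W \<phi>) \<and>
     (\<exists>C. \<forall>\<phi>\<in>A_space. cmod (W \<phi>) \<le> C * enn2real (A_norm \<phi>))}"

text \<open>A function of \<open>(x,k)\<close> as a functional on \<open>\<A>\<close>. A Wigner transform is in general not
  jointly integrable against \<open>\<phi> \<in> \<A>\<close>, but it is bounded in \<open>k\<close> and the iterated integral converges.\<close>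

definition A_functional :: "(real^3 \<Rightarrow> real^3 \<Rightarrow> cmat) \<Rightarrow> (real^3 \<Rightarrow> real^3 \<Rightarrow> cmat) \<Rightarrow> complex" where
  "A_functional w \<phi> = (\<integral>x. (\<integral>k. mat_dual (w x k) (\<phi> x k) \<partial>lborel) \<partial>lborel)"

section \<open>The back-propagated signal\<close>

text \<open>Test functions depend on \<open>(\<xi>, x\<^sub>0)\<close>. For given \<open>k\<close>, \<open>back_integrand\<close> is the integrand of
  \<open>\<langle>u\<^sup>B, \<phi>\<rangle>\<close> as a function of \<open>(\<xi>, x\<^sub>0, z)\<close>. The integral over \<open>k\<close> converges only after
  integration against \<open>\<phi>\<close>, so it is taken last; this is the distributional reading of
  the integral defining \<open>u\<^sup>B\<close>.\<close>

definition back_integrand ::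
    "(real^3 \<Rightarrow> real^3 \<Rightarrow> cmat) \<Rightarrow> (real^3 \<Rightarrow> cmat) \<Rightarrow> (real^3 \<Rightarrow> cvec) \<Rightarrow> real
       \<Rightarrow> ((real^3) \<times> (real^3) \<Rightarrow> cvec) \<Rightarrow> real^3 \<Rightarrow> (real^3) \<times> (real^3) \<times> (real^3) \<Rightarrow> complex" where
  "back_integrand w A S e \<phi> k = (\<lambda>(\<xi>, x0, z).
     vec_dual
       ((cis (k \<bullet> (\<xi> - z)) / (2 * of_real pi) ^ 3) *s
          ((Gam ** w (x0 + (e / 2) *\<^sub>R (z + \<xi>)) k ** Gam ** A (x0 + e *\<^sub>R z)) *v S z))
       (\<phi> (\<xi>, x0)))"

definition back_signal ::
    "(real^3 \<Rightarrow> real^3 \<Rightarrow> cmat) \<Rightarrow> (real^3 \<Rightarrow> cmat) \<Rightarrow> (real^3 \<Rightarrow> cvec) \<Rightarrow> real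
       \<Rightarrow> ((real^3) \<times> (real^3) \<Rightarrow> cvec) \<Rightarrow> complex" where
  "back_signal w A S e \<phi> = (\<integral>k. (\<integral>p. back_integrand w A S e \<phi> k p \<partial>lborel) \<partial>lborel)"

definition back_signal_converges ::
    "(real^3 \<Rightarrow> real^3 \<Rightarrow> cmat) \<Rightarrow> (real^3 \<Rightarrow> cmat) \<Rightarrow> (real^3 \<Rightarrow> cvec) \<Rightarrow> real \<Rightarrow> bool" where
  "back_signal_converges w A S e \<longleftrightarrow> (\<forall>\<phi>. schwartz \<phi> \<longrightarrow>
     (\<forall>k. integrable lborel (back_integrand w A S e \<phi> k)) \<and>
     integrable lborel (\<lambda>k. \<integral>p. back_integrand w A S e \<phi> k p \<partial>lborel))"

text \<open>For the limit, \<open>W \<in> \<A>'\<close> is only a functional, and the integral defining \<open>u\<^sup>B\<close> is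
  \<open>\<langle>u\<^sup>B, \<phi>\<rangle> = \<langle>W, Z\<rangle>\<close>.\<close>

definition Z_fun ::
    "(real^3 \<Rightarrow> cmat) \<Rightarrow> (real^3 \<Rightarrow> cvec) \<Rightarrow> ((real^3) \<times> (real^3) \<Rightarrow> cvec)
       \<Rightarrow> real^3 \<Rightarrow> real^3 \<Rightarrow> cmat" where
  "Z_fun A0 S \<phi> x0 k =
     (\<integral>(z, \<xi>). cscale (cis (k \<bullet> (z - \<xi>)) / (2 * of_real pi) ^ 3)
        (Gam ** outer (\<phi> (\<xi>, x0)) (S z) ** A0 x0 ** Gam) \<partial>lborel)"

definition back_signal_limit ::
    "((real^3 \<Rightarrow> real^3 \<Rightarrow> cmat) \<Rightarrow> complex) \<Rightarrow> (real^3 \<Rightarrow> cmat) \<Rightarrow> (real^3 \<Rightarrow> cvec)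
       \<Rightarrow> ((real^3) \<times> (real^3) \<Rightarrow> cvec) \<Rightarrow> complex" where
  "back_signal_limit W A0 S \<phi> = W (Z_fun A0 S \<phi>)"

end

(* Tested against \<phi>, the back-propagated signal is a trilinear pairing of Q(T,x - \<epsilon>y/2;q),
   Q_*(T,x + \<epsilon>y/2;q) and S(z) with the kernel
   a_\<epsilon>(x + \<epsilon>y/2) \<phi>(z - y, x - \<epsilon>z + \<epsilon>y/2), averaged over q with the weight given by the
   Fourier transform of f; the functional W_\<epsilon>, tested against Z, is the same pairing with the kernel
   a_0(x) \<phi>(z - y, x). Conservation of energy bounds Q and Q_* in L^2 uniformly in \<epsilon> and q, so by
   Cauchy-Schwarz in x the difference of the two pairings is at most a constant times the integral
   over (y,z) of |S(z)| sup_x |difference of the kernels|, which tends to 0 by dominated convergence.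

   Two points need care. The solutions are only weak and only L^2 in space, so the energy identity is
   derived from the equation mollified by a Gaussian, using that D^j \<partial>_j is skew. And the integral over k
   comes last: it converges absolutely because, after Fourier inversion in \<xi>, its integrand is
   controlled by the Fourier transforms of Q and Q_*, to which Plancherel applies; its value is then
   found by Fourier inversion in k at the origin. *)
theory Submission
  imports Defs "HOL-Probability.Probability"
begin

section \<open>Integration on Euclidean spaces\<close>

text \<open>Two bounds on u(x - e y / 2) v(x + e y / 2) have different roles. Its integral over x is
  at most 2M for every e, and this governs the limit. Its integral over y is only bounded by a
  multiple of M / e^3 and serves Fubini at fixed e. The Wigner function is merely bounded in k, so
  the integral over k cannot be estimated pointwise. It converges because the Fourier transform in x
  of a scalar Wigner function is a product of transforms of u and v: once the test function is
  expanded in its \<xi>-frequency l, the factor from u depends on l alone. At fixed l the k-integral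
  pairs the transform of v with that of a decaying amplitude in L^2, and a weight in l makes the
  outer integral finite. The bound sees u and v only through M, so truncation and Fatou's lemma
  cover general L^2 data. Matrix products are split into scalar entries throughout. Since W is
  tested against a Z built from the limit coefficients, the scalar theory is instantiated twice with
  the same fields, with the coefficients at scale e and with their limits.\<close>

lemma nn_integral_lborel_affine:
  fixes f :: "'a::euclidean_space \<Rightarrow> ennreal"
  assumes [measurable]: "f \<in> borel_measurable borel" and c: "c \<noteq> 0"
  shows "(\<integral>\<^sup>+x. f (t + c *\<^sub>R x) \<partial>lborel) = ennreal (1 / \<bar>c\<bar> ^ DIM('a)) * (\<integral>\<^sup>+x. f x \<partial>lborel)"
proof -
  have "(\<integral>\<^sup>+x. f x \<partial>lborel) = ennreal (\<bar>c\<bar> ^ DIM('a)) * (\<integral>\<^sup>+x. f (t + c *\<^sub>R x) \<partial>lborel)"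
    by (subst lborel_affine[OF c, of t])
      (simp add: nn_integral_density nn_integral_distr nn_integral_cmult)
  then show ?thesis
    using c by (simp add: mult.assoc[symmetric] ennreal_mult[symmetric])
qed

lemma integrable_lborel_affine:
  fixes f :: "'a::euclidean_space \<Rightarrow> 'b::{banach, second_countable_topology}"
  assumes f: "integrable lborel f" and c: "c \<noteq> 0"
  shows "integrable lborel (\<lambda>x. f (t + c *\<^sub>R x))"
proof -
  have [measurable]: "f \<in> borel_measurable borel" using f by auto
  show ?thesis
    using f c unfolding integrable_iff_bounded
    by (auto simp: nn_integral_lborel_affine[where f="\<lambda>x. ennreal (norm (f x))"] ennreal_mult_less_top)
qed

lemma integrable_lborel_affine_iff:
  fixes f :: "'a::euclidean_space \<Rightarrow> 'b::{banach, second_countable_topology}"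
  assumes c: "c \<noteq> 0"
  shows "integrable lborel (\<lambda>x. f (t + c *\<^sub>R x)) \<longleftrightarrow> integrable lborel f"
  using integrable_lborel_affine[of f c t] c
    integrable_lborel_affine[of "\<lambda>x. f (t + c *\<^sub>R x)" "1/c" "- (1/c) *\<^sub>R t"]
  by (auto simp: algebra_simps)

text \<open>Integrability is not among the hypotheses because both sides are 0 otherwise: an affine
  substitution preserves non-integrability, and the Bochner integral of a non-integrable function is
  0. The shift and reflection rules inherit this.\<close>

lemma integral_lborel_affine:
  fixes f :: "'a::euclidean_space \<Rightarrow> 'b::{banach, second_countable_topology}"
  assumes c: "c \<noteq> 0"
  shows "(\<integral>x. f (t + c *\<^sub>R x) \<partial>lborel) = (1 / \<bar>c\<bar> ^ DIM('a)) *\<^sub>R (\<integral>x. f x \<partial>lborel)"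
proof (cases "integrable lborel f")
  case True
  then have [measurable]: "f \<in> borel_measurable borel" by auto
  have "(\<integral>x. f x \<partial>lborel) = (\<bar>c\<bar> ^ DIM('a)) *\<^sub>R (\<integral>x. f (t + c *\<^sub>R x) \<partial>lborel)"
    by (subst lborel_affine[OF c, of t]) (simp add: integral_density integral_distr)
  then show ?thesis using c by simp
next
  case False
  with integrable_lborel_affine_iff[OF c, of f t] show ?thesis by (simp add: not_integrable_integral_eq)
qed

lemma integral_lborel_shift:
  fixes f :: "'a::euclidean_space \<Rightarrow> 'b::{banach, second_countable_topology}"
  shows "(\<integral>x. f (x + t) \<partial>lborel) = (\<integral>x. f x \<partial>lborel)"
  using integral_lborel_affine[of 1 f t] by (simp add: add.commute)

lemma integrable_lborel_shift_iff:
  fixes f :: "'a::euclidean_space \<Rightarrow> 'b::{banach, second_countable_topology}"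
  shows "integrable lborel (\<lambda>x. f (x + t)) \<longleftrightarrow> integrable lborel f"
  using integrable_lborel_affine_iff[of 1 f t] by (simp add: add.commute)

lemma nn_integral_lborel_shift:
  fixes f :: "'a::euclidean_space \<Rightarrow> ennreal"
  assumes "f \<in> borel_measurable borel"
  shows "(\<integral>\<^sup>+x. f (x + t) \<partial>lborel) = (\<integral>\<^sup>+x. f x \<partial>lborel)"
  using nn_integral_lborel_affine[OF assms, of 1 t] by (simp add: add.commute)

lemma integral_lborel_reflect:
  fixes f :: "'a::euclidean_space \<Rightarrow> 'b::{banach, second_countable_topology}"
  shows "(\<integral>x. f (t - x) \<partial>lborel) = (\<integral>x. f x \<partial>lborel)"
  using integral_lborel_affine[of "-1" f t] by simp

lemma integrable_lborel_reflect_iff: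
  fixes f :: "'a::euclidean_space \<Rightarrow> 'b::{banach, second_countable_topology}"
  shows "integrable lborel (\<lambda>x. f (t - x)) \<longleftrightarrow> integrable lborel f"
  using integrable_lborel_affine_iff[of "-1" f t] by simp

lemma nn_integral_lborel_reflect:
  fixes f :: "'a::euclidean_space \<Rightarrow> ennreal"
  assumes "f \<in> borel_measurable borel"
  shows "(\<integral>\<^sup>+x. f (t - x) \<partial>lborel) = (\<integral>\<^sup>+x. f x \<partial>lborel)"
  using nn_integral_lborel_affine[OF assms, of "-1" t] by simp

lemma integrable_lborel_iterated:
  fixes f :: "'a::euclidean_space \<Rightarrow> 'b::euclidean_space \<Rightarrow> 'c::{banach, second_countable_topology}"
  assumes "integrable lborel (\<lambda>(x, y). f x y)"
  shows "integrable lborel (\<lambda>x. \<integral>y. f x y \<partial>lborel)"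
    and "integrable lborel (\<lambda>y. \<integral>x. f x y \<partial>lborel)"
    and "(\<integral>(x, y). f x y \<partial>lborel) = (\<integral>x. \<integral>y. f x y \<partial>lborel \<partial>lborel)"
    and "(\<integral>(x, y). f x y \<partial>lborel) = (\<integral>y. \<integral>x. f x y \<partial>lborel \<partial>lborel)"
    and "AE x in lborel. integrable lborel (f x)"
    and "AE y in lborel. integrable lborel (\<lambda>x. f x y)"
  using lborel_pair.integrable_fst[of f] lborel_pair.integrable_snd[of f] lborel_pair.integral_fst[of f]
    lborel_pair.integral_snd[of f] lborel_pair.AE_integrable_fst[of f] lborel_pair.AE_integrable_snd[of f] assms
  by (auto simp: lborel_prod)

lemma integral_lborel_swap:
  fixes f :: "'a::euclidean_space \<Rightarrow> 'b::euclidean_space \<Rightarrow> 'c::{banach, second_countable_topology}"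
  assumes "integrable lborel (\<lambda>(x, y). f x y)"
  shows "(\<integral>x. \<integral>y. f x y \<partial>lborel \<partial>lborel) = (\<integral>y. \<integral>x. f x y \<partial>lborel \<partial>lborel)"
  using integrable_lborel_iterated(3,4)[OF assms] by simp

lemma nn_integral_lborel_prod_iterated:
  fixes f :: "'a::euclidean_space \<times> 'b::euclidean_space \<Rightarrow> ennreal"
  assumes "f \<in> borel_measurable borel"
  shows "(\<integral>\<^sup>+p. f p \<partial>lborel) = (\<integral>\<^sup>+x. \<integral>\<^sup>+y. f (x, y) \<partial>lborel \<partial>lborel)"
    and "(\<integral>\<^sup>+p. f p \<partial>lborel) = (\<integral>\<^sup>+y. \<integral>\<^sup>+x. f (x, y) \<partial>lborel \<partial>lborel)"
proof -
  note [simp] = assms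
  have m: "f \<in> borel_measurable (lborel \<Otimes>\<^sub>M lborel)"
    unfolding lborel_prod by simp
  show "(\<integral>\<^sup>+p. f p \<partial>lborel) = (\<integral>\<^sup>+x. \<integral>\<^sup>+y. f (x, y) \<partial>lborel \<partial>lborel)"
    by (subst lborel.nn_integral_fst[OF m]) (simp add: lborel_prod)
  show "(\<integral>\<^sup>+p. f p \<partial>lborel) = (\<integral>\<^sup>+y. \<integral>\<^sup>+x. f (x, y) \<partial>lborel \<partial>lborel)"
    by (subst lborel_pair.nn_integral_snd) (use m in \<open>simp_all add: lborel_prod\<close>)
qed

lemma integrable_lborel_prodI:
  fixes f :: "'a::euclidean_space \<Rightarrow> 'b::euclidean_space \<Rightarrow> 'c::{banach, second_countable_topology}"
  assumes m: "(\<lambda>(x, y). f x y) \<in> borel_measurable (borel \<Otimes>\<^sub>M borel)"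
    and b: "(\<integral>\<^sup>+x. \<integral>\<^sup>+y. ennreal (norm (f x y)) \<partial>lborel \<partial>lborel) < \<infinity>"
  shows "integrable lborel (\<lambda>(x, y). f x y)"
proof (rule integrableI_bounded)
  show "(\<lambda>(x, y). f x y) \<in> borel_measurable lborel" using m by (simp add: borel_prod)
  have "(\<lambda>p. ennreal (norm (case p of (x, y) \<Rightarrow> f x y))) \<in> borel_measurable borel"
    using m unfolding borel_prod by measurable
  from nn_integral_lborel_prod_iterated(1)[OF this] b
  show "(\<integral>\<^sup>+p. ennreal (norm (case p of (x, y) \<Rightarrow> f x y)) \<partial>lborel) < \<infinity>" by simp
qed

lemma integrable_lborel_prodI':
  fixes f :: "'a::euclidean_space \<Rightarrow> 'b::euclidean_space \<Rightarrow> 'c::{banach, second_countable_topology}"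
  assumes m: "(\<lambda>(x, y). f x y) \<in> borel_measurable (borel \<Otimes>\<^sub>M borel)"
    and b: "(\<integral>\<^sup>+y. \<integral>\<^sup>+x. ennreal (norm (f x y)) \<partial>lborel \<partial>lborel) < \<infinity>"
  shows "integrable lborel (\<lambda>(x, y). f x y)"
proof (rule integrableI_bounded)
  show "(\<lambda>(x, y). f x y) \<in> borel_measurable lborel" using m by (simp add: borel_prod)
  have "(\<lambda>p. ennreal (norm (case p of (x, y) \<Rightarrow> f x y))) \<in> borel_measurable borel"
    using m unfolding borel_prod by measurable
  from nn_integral_lborel_prod_iterated(2)[OF this] b
  show "(\<integral>\<^sup>+p. ennreal (norm (case p of (x, y) \<Rightarrow> f x y)) \<partial>lborel) < \<infinity>" by simp
qed

text \<open>If \<open>g\<close> is integrable, so is the modulus of \<open>C * g\<close>; hence no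
  sign of \<open>C\<close> or \<open>g\<close> has to be established where the rule is
  applied.\<close>

lemma integrable_const_mult_bound:
  fixes f :: "'a \<Rightarrow> 'b::{banach, second_countable_topology}"
  assumes "integrable M g" "f \<in> borel_measurable M" "\<And>x. norm (f x) \<le> C * (g x :: real)"
  shows "integrable M f"
  by (rule Bochner_Integration.integrable_bound[of M "\<lambda>x. C * g x"])
    (use assms order_trans[OF assms(3) abs_ge_self] in auto)

section \<open>A weight function\<close>

text \<open>The exponent provides two powers of \<open>1 + norm x\<close> per coordinate, enough to
  stay below the product of the one-dimensional integrable functions 1 / (1 + t^2). On
  \<open>real^3\<close> the exponent is 6.\<close>

definition wt :: "'a::euclidean_space \<Rightarrow> real" where
  "wt x = 1 / (1 + norm x) ^ (2 * DIM('a))"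

lemma wt_pos: "0 < wt x"
proof -
  have "0 < 1 + norm x" using norm_ge_zero[of x] by linarith
  then show ?thesis unfolding wt_def by (intro divide_pos_pos zero_less_power zero_less_one)
qed

lemma wt_nonneg [simp]: "0 \<le> wt x"
  using wt_pos[of x] by simp

lemma wt_le_1: "wt x \<le> 1"
proof -
  have "1 \<le> (1 + norm x) ^ (2 * DIM('a))" by (simp add: one_le_power)
  then show ?thesis unfolding wt_def by (subst divide_le_eq_1_pos) linarith+
qed

lemma wt_minus: "wt (x - y) = wt (y - x)"
  by (simp add: wt_def norm_minus_commute)

lemma continuous_wt: "continuous_on UNIV wt"
  unfolding wt_def
  by (intro continuous_intros) (auto simp: add_nonneg_eq_0_iff)

lemma borel_measurable_wt [measurable]: "wt \<in> borel_measurable borel"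
  by (intro borel_measurable_continuous_onI continuous_wt)

lemma integrable_inverse_1_plus_square_lborel: "integrable lborel (\<lambda>x::real. 1 / (1 + x\<^sup>2))"
  using integrable_inverse_1_plus_square
  by (simp add: set_integrable_def einterval_def inverse_eq_divide)

text \<open>\<open>lborel\<close> is the image of a product of one-dimensional Lebesgue measures
  under the coordinate map, so separated functions reduce to the rules for product measures.\<close>

lemma integrable_lborel_prod:
  fixes f :: "'a::euclidean_space \<Rightarrow> real \<Rightarrow> 'b::{real_normed_field, banach, second_countable_topology}"
  assumes "\<And>b. b \<in> Basis \<Longrightarrow> integrable lborel (f b)"
  shows "integrable lborel (\<lambda>x. \<Prod>b\<in>Basis. f b (x \<bullet> b))"
    and "(\<integral>x. (\<Prod>b\<in>Basis. f b (x \<bullet> b)) \<partial>lborel) = (\<Prod>b\<in>Basis. \<integral>x. f b x \<partial>lborel)"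
proof -
  interpret product_sigma_finite "\<lambda>_::'a. lborel :: real measure" ..
  have [measurable]: "\<And>b. b \<in> Basis \<Longrightarrow> f b \<in> borel_measurable borel"
    using assms by auto
  have *: "(\<Prod>b\<in>Basis. f b ((\<Sum>c\<in>Basis. y c *\<^sub>R c) \<bullet> b)) = (\<Prod>b\<in>Basis. f b (y b))" for y
    by (intro prod.cong refl) simp
  show "integrable lborel (\<lambda>x. \<Prod>b\<in>Basis. f b (x \<bullet> b))"
    by (subst lborel_eq, subst integrable_distr_eq) (auto simp: * intro!: product_integrable_prod assms)
  show "(\<integral>x. (\<Prod>b\<in>Basis. f b (x \<bullet> b)) \<partial>lborel) = (\<Prod>b\<in>Basis. \<integral>x. f b x \<partial>lborel)"
    by (subst lborel_eq, subst integral_distr) (auto simp: * intro!: product_integral_prod assms)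
qed

lemma integrable_wt: "integrable lborel (wt :: 'a::euclidean_space \<Rightarrow> real)"
proof (rule Bochner_Integration.integrable_bound)
  show "integrable lborel (\<lambda>x::'a. \<Prod>b\<in>Basis. 1 / (1 + (x \<bullet> b)\<^sup>2))"
    by (rule integrable_lborel_prod(1)) (rule integrable_inverse_1_plus_square_lborel)
  show "AE x :: 'a in lborel. norm (wt x) \<le> norm (\<Prod>b\<in>Basis. 1 / (1 + (x \<bullet> b)\<^sup>2))"
  proof (intro AE_I2)
    fix x :: 'a
    have 1: "1 / (1 + norm x)\<^sup>2 \<le> 1 / (1 + (x \<bullet> b)\<^sup>2)" if "b \<in> Basis" for b
    proof (rule divide_left_mono)
      have "(x \<bullet> b)\<^sup>2 \<le> (norm x)\<^sup>2"
        using Basis_le_norm[OF that, of x] abs_le_square_iff by fastforce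
      then show "1 + (x \<bullet> b)\<^sup>2 \<le> (1 + norm x)\<^sup>2"
        using norm_ge_zero[of x] by (simp add: power2_sum add_increasing2)
    qed (use norm_ge_zero[of x] in \<open>auto intro!: mult_pos_pos zero_less_power add_pos_nonneg\<close>)
    have "wt x = (\<Prod>b\<in>(Basis::'a set). 1 / (1 + norm x)\<^sup>2)"
      by (simp add: wt_def power_mult power_one_over)
    also have "\<dots> \<le> (\<Prod>b\<in>Basis. 1 / (1 + (x \<bullet> b)\<^sup>2))"
      using 1 by (intro prod_mono) auto
    finally show "norm (wt x) \<le> norm (\<Prod>b\<in>Basis. 1 / (1 + (x \<bullet> b)\<^sup>2))"
      by simp
  qed
qed measurable

text \<open>Both component norms are at most the norm of the pair. This converts decay of a Schwartz
  function on the product space into separate decay in each variable.\<close>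

lemma wt_pair_le: "1 / (1 + norm (x, y)) ^ (2 * DIM('a) + 2 * DIM('b)) \<le> wt x * wt y"
  for x :: "'a::euclidean_space" and y :: "'b::euclidean_space"
proof -
  have "norm x \<le> norm (x, y)" "norm y \<le> norm (x, y)"
    by (auto simp: norm_Pair intro: real_le_rsqrt)
  then have "(1 + norm x) ^ (2 * DIM('a)) * (1 + norm y) ^ (2 * DIM('b))
      \<le> (1 + norm (x, y)) ^ (2 * DIM('a)) * (1 + norm (x, y)) ^ (2 * DIM('b))"
    by (intro mult_mono power_mono) auto
  moreover have "0 < (1 + norm x) ^ (2 * DIM('a)) * (1 + norm y) ^ (2 * DIM('b))"
    by (intro mult_pos_pos zero_less_power add_pos_nonneg) auto
  ultimately show ?thesis
    unfolding wt_def times_divide_times_eq mult_1 power_add by (intro divide_left_mono mult_pos_pos zero_less_power add_pos_nonneg) auto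
qed

section \<open>Square-integrable functions\<close>

lemma L2_D:
  assumes "L2 u"
  shows "u \<in> borel_measurable borel" "integrable lborel (\<lambda>x. (norm (u x))\<^sup>2)"
  using assms by (auto simp: L2_def)

lemma two_mult_le_squares: "2 * (a * b) \<le> a\<^sup>2 + (b::real)\<^sup>2"
  using sum_squares_bound[of a b] by simp

lemma L2_norm_mult_integrable:
  fixes u :: "real^3 \<Rightarrow> 'b::real_normed_vector" and v :: "real^3 \<Rightarrow> 'c::real_normed_vector"
  assumes u: "L2 u" and v: "L2 v"
  shows "integrable lborel (\<lambda>x. norm (u x) * norm (v x))"
proof (rule Bochner_Integration.integrable_bound)
  note [measurable] = L2_D(1)[OF u] L2_D(1)[OF v]
  show "integrable lborel (\<lambda>x. (norm (u x))\<^sup>2 + (norm (v x))\<^sup>2)"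
    using L2_D(2)[OF u] L2_D(2)[OF v] by simp
  show "(\<lambda>x. norm (u x) * norm (v x)) \<in> borel_measurable lborel"
    by measurable
  show "AE x in lborel. norm (norm (u x) * norm (v x)) \<le> norm ((norm (u x))\<^sup>2 + (norm (v x))\<^sup>2)"
  proof (intro AE_I2)
    fix x
    have "norm (u x) * norm (v x) \<ge> 0" "\<bar>norm (u x) * norm (v x)\<bar> = norm (u x) * norm (v x)" by simp_all
    with two_mult_le_squares[of "norm (u x)" "norm (v x)"]
    show "norm (norm (u x) * norm (v x)) \<le> norm ((norm (u x))\<^sup>2 + (norm (v x))\<^sup>2)"
      unfolding real_norm_def by linarith
  qed
qed

lemma L2_Cauchy_Schwarz:
  fixes u :: "real^3 \<Rightarrow> 'b::real_normed_vector" and v :: "real^3 \<Rightarrow> 'c::real_normed_vector"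
  assumes u: "L2 u" and v: "L2 v"
  shows "(\<integral>x. norm (u x) * norm (v x) \<partial>lborel)
    \<le> sqrt (\<integral>x. (norm (u x))\<^sup>2 \<partial>lborel) * sqrt (\<integral>x. (norm (v x))\<^sup>2 \<partial>lborel)"
proof -
  note [measurable] = L2_D(1)[OF u] L2_D(1)[OF v]
  define a where "a = (\<integral>x. norm (u x) * norm (v x) \<partial>lborel)"
  have a0: "0 \<le> a" by (simp add: a_def)
  have "(\<integral>\<^sup>+x. ennreal (norm (u x)) * ennreal (norm (v x)) \<partial>lborel)\<^sup>2
      \<le> (\<integral>\<^sup>+x. (ennreal (norm (u x)))\<^sup>2 \<partial>lborel) * (\<integral>\<^sup>+x. (ennreal (norm (v x)))\<^sup>2 \<partial>lborel)"
    by (rule Cauchy_Schwarz_nn_integral) auto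
  also have "(\<integral>\<^sup>+x. ennreal (norm (u x)) * ennreal (norm (v x)) \<partial>lborel) = ennreal a"
    unfolding a_def using L2_norm_mult_integrable[OF u v]
    by (subst nn_integral_eq_integral[symmetric]) (auto simp: ennreal_mult)
  also have "(\<integral>\<^sup>+x. (ennreal (norm (u x)))\<^sup>2 \<partial>lborel) = ennreal (\<integral>x. (norm (u x))\<^sup>2 \<partial>lborel)"
    using L2_D(2)[OF u]
    by (subst nn_integral_eq_integral[symmetric]) (auto simp: ennreal_power)
  also have "(\<integral>\<^sup>+x. (ennreal (norm (v x)))\<^sup>2 \<partial>lborel) = ennreal (\<integral>x. (norm (v x))\<^sup>2 \<partial>lborel)"
    using L2_D(2)[OF v]
    by (subst nn_integral_eq_integral[symmetric]) (auto simp: ennreal_power)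
  finally have "a\<^sup>2 \<le> (\<integral>x. (norm (u x))\<^sup>2 \<partial>lborel) * (\<integral>x. (norm (v x))\<^sup>2 \<partial>lborel)"
    using a0 by (simp add: ennreal_power ennreal_mult[symmetric])
  then show ?thesis
    unfolding a_def[symmetric] real_sqrt_mult[symmetric] by (rule real_le_rsqrt)
qed

lemma L2_add:
  fixes u v :: "real^3 \<Rightarrow> 'b::{second_countable_topology, real_normed_vector}"
  assumes u: "L2 u" and v: "L2 v"
  shows "L2 (\<lambda>x. u x + v x)"
  unfolding L2_def
proof
  note [measurable] = L2_D(1)[OF u] L2_D(1)[OF v]
  show "(\<lambda>x. u x + v x) \<in> borel_measurable borel" by measurable
  show "integrable lborel (\<lambda>x. (norm (u x + v x))\<^sup>2)"
  proof (rule Bochner_Integration.integrable_bound)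
    show "integrable lborel (\<lambda>x. 2 * (norm (u x))\<^sup>2 + 2 * (norm (v x))\<^sup>2)"
      using L2_D(2)[OF u] L2_D(2)[OF v] by simp
    show "AE x in lborel. norm ((norm (u x + v x))\<^sup>2) \<le> norm (2 * (norm (u x))\<^sup>2 + 2 * (norm (v x))\<^sup>2)"
    proof (intro AE_I2)
      fix x
      have "(norm (u x + v x))\<^sup>2 \<le> (norm (u x) + norm (v x))\<^sup>2"
        by (intro power_mono norm_triangle_ineq) auto
      also have "\<dots> \<le> 2 * (norm (u x))\<^sup>2 + 2 * (norm (v x))\<^sup>2"
        using two_mult_le_squares[of "norm (u x)" "norm (v x)"] by (simp add: power2_sum)
      finally show "norm ((norm (u x + v x))\<^sup>2) \<le> norm (2 * (norm (u x))\<^sup>2 + 2 * (norm (v x))\<^sup>2)"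
        by simp
    qed
  qed measurable
qed

lemma L2_bound:
  fixes u :: "real^3 \<Rightarrow> 'b::real_normed_vector" and v :: "real^3 \<Rightarrow> 'c::real_normed_vector"
  assumes u: "L2 u" and m: "v \<in> borel_measurable borel" and le: "\<And>x. norm (v x) \<le> C * norm (u x)"
  shows "L2 v"
  unfolding L2_def
proof
  show "integrable lborel (\<lambda>x. (norm (v x))\<^sup>2)"
  proof (rule Bochner_Integration.integrable_bound)
    show "integrable lborel (\<lambda>x. C\<^sup>2 * (norm (u x))\<^sup>2)" using L2_D(2)[OF u] by simp
    show "AE x in lborel. norm ((norm (v x))\<^sup>2) \<le> norm (C\<^sup>2 * (norm (u x))\<^sup>2)"
      using power_mono[OF le, where n=2] by (auto simp: power_mult_distrib)
    show "(\<lambda>x. (norm (v x))\<^sup>2) \<in> borel_measurable lborel" using m by measurable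
  qed
qed (use m in simp)

lemma L2_diff:
  fixes u v :: "real^3 \<Rightarrow> 'b::{second_countable_topology, real_normed_vector}"
  assumes u: "L2 u" and v: "L2 v"
  shows "L2 (\<lambda>x. u x - v x)"
proof -
  have "L2 (\<lambda>x. - v x)"
    by (rule L2_bound[OF v, of _ 1]) (use L2_D(1)[OF v] in auto)
  from L2_add[OF u this] show ?thesis by simp
qed

lemma L2_shift:
  fixes u :: "real^3 \<Rightarrow> 'b::{second_countable_topology, real_normed_vector}"
  assumes "L2 u"
  shows "L2 (\<lambda>x. u (x + t))"
  unfolding L2_def
proof
  note [measurable] = L2_D(1)[OF assms]
  show "(\<lambda>x. u (x + t)) \<in> borel_measurable borel" by measurable
  show "integrable lborel (\<lambda>x. (norm (u (x + t)))\<^sup>2)"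
    using L2_D(2)[OF assms] integrable_lborel_shift_iff[of "\<lambda>x. (norm (u x))\<^sup>2" t] by simp
qed

section \<open>Continuity of translations\<close>

text \<open>For 0-1 functions the modulus of the difference is the sum minus twice the product.
  Translation invariance makes the integral of the sum constant. Openness makes the product converge
  pointwise to \<open>indicator U\<close>: a point of \<open>U\<close> stays in \<open>U\<close>
  under small shifts, and a point outside contributes 0.\<close>

lemma L1_translation_indicator_open:
  fixes U :: "'a::euclidean_space set"
  assumes U: "open U" and fin: "emeasure lborel U < \<infinity>" and X: "X \<longlonglongrightarrow> 0"
  shows "(\<lambda>n. \<integral>x. \<bar>indicator U (x + X n) - indicator U x\<bar> \<partial>lborel) \<longlonglongrightarrow> (0::real)"
proof -
  have [measurable]: "U \<in> sets borel" using U by simp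
  have iU: "integrable lborel (indicator U :: 'a \<Rightarrow> real)"
    using fin by (simp add: integrable_indicator_iff)
  have iUs: "integrable lborel (\<lambda>x. indicator U (x + t) :: real)" for t
    using iU integrable_lborel_shift_iff[of "indicator U :: 'a \<Rightarrow> real" t] by simp
  have iUm: "integrable lborel (\<lambda>x. indicator U x * indicator U (x + t) :: real)" for t
    by (rule Bochner_Integration.integrable_bound[OF iU]) (auto simp: indicator_def)
  have "(\<lambda>n. \<integral>x. indicator U x * indicator U (x + X n) \<partial>lborel) \<longlonglongrightarrow> (\<integral>x. (indicator U x :: real) \<partial>lborel)"
  proof (rule integral_dominated_convergence[where w="indicator U"])
    show "AE x in lborel. (\<lambda>i. indicator U x * indicator U (x + X i)) \<longlonglongrightarrow> (indicator U x :: real)"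
    proof (intro AE_I2)
      fix x
      show "(\<lambda>i. indicator U x * indicator U (x + X i)) \<longlonglongrightarrow> (indicator U x :: real)"
      proof (cases "x \<in> U")
        case True
        have "(\<lambda>i. x + X i) \<longlonglongrightarrow> x + 0" by (intro tendsto_intros X)
        then have "eventually (\<lambda>i. x + X i \<in> U) sequentially"
          using U True by (auto simp: topological_tendstoD)
        then have "eventually (\<lambda>i. indicator U x * indicator U (x + X i) = (indicator U x :: real)) sequentially"
          by eventually_elim (simp add: True)
        then show ?thesis by (rule tendsto_eventually)
      qed simp
    qed
  qed (use iU in \<open>auto simp: indicator_def\<close>)
  then have "(\<lambda>n. 2 * (\<integral>x. indicator U x \<partial>lborel) - 2 * (\<integral>x. indicator U x * indicator U (x + X n) \<partial>lborel))
     \<longlonglongrightarrow> 2 * (\<integral>x. (indicator U x::real) \<partial>lborel) - 2 * (\<integral>x. indicator U x \<partial>lborel)"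
    by (intro tendsto_intros)
  moreover have "(\<integral>x. \<bar>indicator U (x + t) - indicator U x\<bar> \<partial>lborel)
      = 2 * (\<integral>x. indicator U x \<partial>lborel) - 2 * (\<integral>x. indicator U x * (indicator U (x + t) :: real) \<partial>lborel)" for t
  proof -
    have "(\<integral>x. \<bar>indicator U (x + t) - indicator U x\<bar> \<partial>lborel)
       = (\<integral>x. indicator U (x + t) + indicator U x - 2 * (indicator U x * (indicator U (x + t) :: real)) \<partial>lborel)"
      by (intro Bochner_Integration.integral_cong) (auto simp: indicator_def)
    also have "\<dots> = (\<integral>x. indicator U (x + t) \<partial>lborel) + (\<integral>x. indicator U x \<partial>lborel)
        - 2 * (\<integral>x. indicator U x * (indicator U (x + t) :: real) \<partial>lborel)"
      using iU iUs iUm by simp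
    also have "(\<integral>x. (indicator U (x + t) :: real) \<partial>lborel) = (\<integral>x. indicator U x \<partial>lborel)"
      by (rule integral_lborel_shift)
    finally show ?thesis by simp
  qed
  ultimately show ?thesis by simp
qed

text \<open>A density argument. A measurable set of finite measure is compared with an open superset
  of nearly the same measure; a limit of simple functions is handled by a close member of the
  sequence, since translation preserves the L1 error.\<close>

lemma L1_translation_continuous:
  fixes f :: "'a::euclidean_space \<Rightarrow> 'b::{banach, second_countable_topology}"
  assumes "integrable lborel f" and X: "X \<longlonglongrightarrow> 0"
  shows "(\<lambda>n. \<integral>x. norm (f (x + X n) - f x) \<partial>lborel) \<longlonglongrightarrow> 0"
  using assms(1)
proof (induction rule: integrable_induct)
  case (base A c)
  have A[measurable]: "A \<in> sets borel" using base by simp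
  have iA: "integrable lborel (indicator A :: 'a \<Rightarrow> real)"
    using base by (simp add: integrable_indicator_iff)
  have "(\<lambda>n. \<integral>x. \<bar>indicator A (x + X n) - indicator A x\<bar> \<partial>lborel) \<longlonglongrightarrow> (0::real)"
  proof (rule LIMSEQ_I)
    fix r :: real assume r: "0 < r"
    \<comment> \<open>The excess \<open>U - A\<close> enters twice, shifted and unshifted; two
      quarters of r and r/2 for the open set add up to r.\<close>
    obtain U where U: "open U" "A \<subseteq> U" "emeasure lborel (U - A) < ennreal (r/4)"
      using outer_regular_lborel[OF A, of "r/4"] r by auto
    have [measurable]: "U \<in> sets borel" using U by simp
    have "emeasure lborel U \<le> emeasure lborel (U - A) + emeasure lborel A"
      using emeasure_subadditive[of "U - A" lborel A] U(2) by (simp add: Un_absorb2)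
    also have "\<dots> < \<infinity>" using base U(3) by (auto simp: less_top[symmetric])
    finally have finU: "emeasure lborel U < \<infinity>" .
    have iU: "integrable lborel (indicator U :: 'a \<Rightarrow> real)"
      using finU by (simp add: integrable_indicator_iff)
    have finD: "emeasure lborel (U - A) < \<infinity>" using U(3) by (rule order.strict_trans) simp
    have iD: "integrable lborel (indicator (U - A) :: 'a \<Rightarrow> real)"
      using finD by (simp add: integrable_indicator_iff)
    have mD: "measure lborel (U - A) < r / 4"
      using U(3) r finD by (simp add: emeasure_eq_ennreal_measure ennreal_less_iff)
    have iS: "integrable lborel (\<lambda>x. f (x + t))" if "integrable lborel f" for f :: "'a \<Rightarrow> real" and t
      using that integrable_lborel_shift_iff[of f t] by simp
    obtain N where N: "\<And>n. n \<ge> N \<Longrightarrow> norm ((\<integral>x. \<bar>indicator U (x + X n) - indicator U x\<bar> \<partial>lborel) - (0::real)) < r / 2"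
      using LIMSEQ_D[OF L1_translation_indicator_open[OF U(1) finU X], of "r/2"] r by auto
    have "norm ((\<integral>x. \<bar>indicator A (x + X n) - indicator A x\<bar> \<partial>lborel) - (0::real)) < r" if n: "n \<ge> N" for n
    proof -
      have "(\<integral>x. \<bar>indicator A (x + X n) - indicator A x\<bar> \<partial>lborel)
         \<le> (\<integral>x. \<bar>indicator U (x + X n) - indicator U x\<bar> + (indicator (U-A) (x + X n) + indicator (U-A) x) \<partial>lborel :: real)"
      proof (intro integral_mono Bochner_Integration.integrable_add integrable_abs Bochner_Integration.integrable_diff iS iA iU iD)
        fix x
        show "\<bar>indicator A (x + X n) - indicator A x\<bar> \<le> \<bar>indicator U (x + X n) - indicator U x\<bar>
            + (indicator (U-A) (x + X n) + indicator (U-A) x :: real)"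
          using U(2) by (auto simp: indicator_def split: if_splits)
      qed
      also have "\<dots> = (\<integral>x. \<bar>indicator U (x + X n) - indicator U x\<bar> \<partial>lborel)
          + ((\<integral>x. indicator (U-A) (x + X n) \<partial>lborel) + measure lborel (U - A))"
        using iS[OF iU] iS[OF iD] iU iD by simp
      also have "(\<integral>x. indicator (U-A) (x + X n) \<partial>lborel) = measure lborel (U - A)"
        using integral_lborel_shift[of "indicator (U - A) :: 'a \<Rightarrow> real"] by simp
      finally show ?thesis using N[OF n] mD by simp
    qed
    then show "\<exists>no. \<forall>n\<ge>no. norm ((\<integral>x. \<bar>indicator A (x + X n) - indicator A x\<bar> \<partial>lborel) - (0::real)) < r"
      by blast
  qed
  then have "(\<lambda>n. (\<integral>x. \<bar>indicator A (x + X n) - indicator A x\<bar> \<partial>lborel) * norm c) \<longlonglongrightarrow> 0 * norm c"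
    by (intro tendsto_intros)
  then show ?case
    by (simp add: scaleR_diff_left[symmetric])
next
  case (add f g)
  have iS: "integrable lborel (\<lambda>x. f (x + t))" if "integrable lborel f" for f :: "'a \<Rightarrow> 'b" and t
    using that integrable_lborel_shift_iff[of f t] by simp
  have "(\<lambda>n. (\<integral>x. norm (f (x + X n) - f x) \<partial>lborel) + (\<integral>x. norm (g (x + X n) - g x) \<partial>lborel)) \<longlonglongrightarrow> 0 + 0"
    by (intro tendsto_intros add)
  then have lim: "(\<lambda>n. (\<integral>x. norm (f (x + X n) - f x) \<partial>lborel) + (\<integral>x. norm (g (x + X n) - g x) \<partial>lborel)) \<longlonglongrightarrow> 0" by simp
  show ?case
  proof (rule tendsto_sandwich[OF _ _ tendsto_const lim]; intro always_eventually allI)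
    fix n
    show "0 \<le> (\<integral>x. norm (f (x + X n) + g (x + X n) - (f x + g x)) \<partial>lborel)" by simp
    have "(\<integral>x. norm (f (x + X n) + g (x + X n) - (f x + g x)) \<partial>lborel)
      \<le> (\<integral>x. norm (f (x + X n) - f x) + norm (g (x + X n) - g x) \<partial>lborel)"
      by (intro integral_mono Bochner_Integration.integrable_add integrable_norm Bochner_Integration.integrable_diff iS add)
        (simp only: add_diff_add norm_triangle_ineq)
    also have "\<dots> = (\<integral>x. norm (f (x + X n) - f x) \<partial>lborel) + (\<integral>x. norm (g (x + X n) - g x) \<partial>lborel)"
      by (intro Bochner_Integration.integral_add integrable_norm Bochner_Integration.integrable_diff iS add)
    finally show "(\<integral>x. norm (f (x + X n) + g (x + X n) - (f x + g x)) \<partial>lborel) \<le> \<dots>" .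
  qed
next
  case (lim f s)
  have iS: "integrable lborel (\<lambda>x. f (x + t))" if "integrable lborel f" for f :: "'a \<Rightarrow> 'b" and t
    using that integrable_lborel_shift_iff[of f t] by simp
  have [measurable]: "f \<in> borel_measurable borel" "\<And>i. s i \<in> borel_measurable borel"
    using lim by auto
  have conv: "(\<lambda>i. \<integral>x. norm (s i x - f x) \<partial>lborel) \<longlonglongrightarrow> (\<integral>x. norm (0::'b) \<partial>(lborel::'a measure))"
  proof (rule integral_dominated_convergence[where w="\<lambda>x. 3 * norm (f x)"])
    show "AE x in lborel. (\<lambda>i. norm (s i x - f x)) \<longlonglongrightarrow> norm (0::'b)"
      using lim.hyps(2) by (intro AE_I2 tendsto_norm LIM_zero) simp
    show "AE x in lborel. norm (norm (s i x - f x)) \<le> 3 * norm (f x)" for i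
    proof (intro AE_I2)
      fix x show "norm (norm (s i x - f x)) \<le> 3 * norm (f x)"
        using norm_triangle_ineq4[of "s i x" "f x"] lim.hyps(3)[of x i] by simp
    qed
  qed (use lim in auto)
  show ?case
  proof (rule LIMSEQ_I)
    fix r :: real assume r: "0 < r"
    obtain i where i: "(\<integral>x. norm (s i x - f x) \<partial>lborel) < r / 4"
      using LIMSEQ_D[OF conv, of "r/4"] r by auto
    obtain N where N: "\<And>n. n \<ge> N \<Longrightarrow> norm ((\<integral>x. norm (s i (x + X n) - s i x) \<partial>lborel) - 0) < r / 2"
      using LIMSEQ_D[OF lim.IH[of i], of "r/2"] r by auto
    have "norm ((\<integral>x. norm (f (x + X n) - f x) \<partial>lborel) - 0) < r" if n: "n \<ge> N" for n
    proof -
      have "(\<integral>x. norm (f (x + X n) - f x) \<partial>lborel)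
        \<le> (\<integral>x. norm (s i (x + X n) - s i x) + (norm (s i (x + X n) - f (x + X n)) + norm (s i x - f x)) \<partial>lborel)"
      proof (intro integral_mono Bochner_Integration.integrable_add integrable_norm Bochner_Integration.integrable_diff iS lim)
        fix x
        have "f (x + X n) - f x = (s i (x + X n) - s i x) - (s i (x + X n) - f (x + X n)) + (s i x - f x)"
          by simp
        then show "norm (f (x + X n) - f x) \<le> norm (s i (x + X n) - s i x) + (norm (s i (x + X n) - f (x + X n)) + norm (s i x - f x))"
          by (smt (verit) norm_triangle_ineq norm_triangle_ineq4)
      qed
      also have "\<dots> = (\<integral>x. norm (s i (x + X n) - s i x) \<partial>lborel)
         + ((\<integral>x. norm (s i (x + X n) - f (x + X n)) \<partial>lborel) + (\<integral>x. norm (s i x - f x) \<partial>lborel))"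
        using iS[OF lim.hyps(1)[of i], of "X n"] iS[OF lim.hyps(4), of "X n"] lim.hyps(1)[of i] lim.hyps(4) by simp
      also have "(\<integral>x. norm (s i (x + X n) - f (x + X n)) \<partial>lborel) = (\<integral>x. norm (s i x - f x) \<partial>lborel)"
        using integral_lborel_shift[of "\<lambda>x. norm (s i x - f x)" "X n"] by simp
      finally show ?thesis using N[OF n] i by simp
    qed
    then show "\<exists>no. \<forall>n\<ge>no. norm ((\<integral>x. norm (f (x + X n) - f x) \<partial>lborel) - 0) < r" by blast
  qed
qed

text \<open>The values of \<open>u\<close> are cut off from below and from above. The lower cut
  makes \<open>s m\<close> integrable and the upper one makes it bounded, so the squared difference
  of translates is at most \<open>B\<close> times the plain difference, and the L1 result
  applies.\<close>

lemma L2_translation_continuous: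
  fixes u :: "real^3 \<Rightarrow> 'b::{banach, second_countable_topology}"
  assumes u: "L2 u" and X: "X \<longlonglongrightarrow> 0"
  shows "(\<lambda>n. \<integral>x. (norm (u (x + X n) - u x))\<^sup>2 \<partial>lborel) \<longlonglongrightarrow> 0"
proof -
  note [measurable] = L2_D(1)[OF u]
  define E where "E m = {x. 1 / real (Suc m) \<le> norm (u x) \<and> norm (u x) \<le> real (Suc m)}" for m
  define s where "s m x = indicat_real (E m) x *\<^sub>R u x" for m x
  have [measurable]: "E m \<in> sets borel" for m unfolding E_def by measurable
  have [measurable]: "s m \<in> borel_measurable borel" for m unfolding s_def by measurable
  have sle: "norm (s m x) \<le> norm (u x)" for m x by (auto simp: s_def indicator_def)
  have sb: "norm (s m x) \<le> real (Suc m)" for m x by (auto simp: s_def E_def indicator_def)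
  have L2s: "L2 (s m)" for m
    by (rule L2_bound[OF u, of _ 1]) (use sle in auto)
  have L1s: "integrable lborel (s m)" for m
  proof (rule Bochner_Integration.integrable_bound)
    show "integrable lborel (\<lambda>x. real (Suc m) * (norm (u x))\<^sup>2)" using L2_D(2)[OF u] by simp
    show "AE x in lborel. norm (s m x) \<le> norm (real (Suc m) * (norm (u x))\<^sup>2)"
    proof (intro AE_I2)
      fix x
      show "norm (s m x) \<le> norm (real (Suc m) * (norm (u x))\<^sup>2)"
      proof (cases "x \<in> E m")
        case True
        then have "1 \<le> real (Suc m) * norm (u x)" by (simp add: E_def field_simps)
        then have "1 * norm (u x) \<le> (real (Suc m) * norm (u x)) * norm (u x)"
          by (intro mult_right_mono) auto
        then show ?thesis using True by (simp add: s_def power2_eq_square mult.assoc)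
      qed (simp add: s_def)
    qed
  qed measurable
  have L2S: "L2 (\<lambda>x. v (x + t) - v x)" if "L2 v" for v :: "real^3 \<Rightarrow> 'b" and t
    by (intro L2_diff L2_shift that)
  have conv: "(\<lambda>m. \<integral>x. (norm (s m x - u x))\<^sup>2 \<partial>lborel) \<longlonglongrightarrow> (\<integral>x. (norm (0::'b))\<^sup>2 \<partial>(lborel::(real^3) measure))"
  proof (rule integral_dominated_convergence[where w="\<lambda>x. (norm (u x))\<^sup>2"])
    show "AE x in lborel. (\<lambda>m. (norm (s m x - u x))\<^sup>2) \<longlonglongrightarrow> (norm (0::'b))\<^sup>2"
    proof (intro AE_I2 tendsto_intros LIM_zero)
      fix x
      show "(\<lambda>m. s m x) \<longlonglongrightarrow> u x"
      proof (cases "u x = 0")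
        case False
        obtain m1 where m1: "norm (u x) < real m1" using reals_Archimedean2 by blast
        obtain m2 where m2: "1 / real (Suc m2) < norm (u x)"
          using False nat_approx_posE[of "norm (u x)"] by auto
        have "s m x = u x" if "m \<ge> max m1 m2" for m
        proof -
          have "1 / real (Suc m) \<le> 1 / real (Suc m2)" using that by (intro divide_left_mono) auto
          then have "x \<in> E m" using m1 m2 that by (auto simp: E_def)
          then show ?thesis by (simp add: s_def)
        qed
        then show ?thesis by (intro tendsto_eventually eventually_sequentiallyI[of "max m1 m2"]) auto
      qed (simp add: s_def)
    qed
    show "AE x in lborel. norm ((norm (s m x - u x))\<^sup>2) \<le> (norm (u x))\<^sup>2" for m
      by (auto simp: s_def indicator_def)
  qed (use L2_D(2)[OF u] in auto)
  show ?thesis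
  proof (rule LIMSEQ_I)
    fix r :: real assume r: "0 < r"
    \<comment> \<open>In the final estimate the L1 term carries the factor 3 and the truncation
      errors carry 6 in total; r/6 for the former and r/12 for the latter give r/2 each.\<close>
    obtain m where m: "(\<integral>x. (norm (s m x - u x))\<^sup>2 \<partial>lborel) < r / 12"
      using LIMSEQ_D[OF conv, of "r/12"] r by auto
    define B where "B = 2 * real (Suc m)"
    have B: "B > 0" by (simp add: B_def)
    obtain N where N: "\<And>n. n \<ge> N \<Longrightarrow> norm ((\<integral>x. norm (s m (x + X n) - s m x) \<partial>lborel) - 0) < r / (6 * B)"
      using LIMSEQ_D[OF L1_translation_continuous[OF L1s[of m] X], of "r / (6 * B)"] r B by auto
    have "norm ((\<integral>x. (norm (u (x + X n) - u x))\<^sup>2 \<partial>lborel) - 0) < r" if n: "n \<ge> N" for n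
    proof -
      have i1: "integrable lborel (\<lambda>x. (norm (s m (x + X n) - u (x + X n)))\<^sup>2)"
        using L2_D(2)[OF L2_shift[OF L2_diff[OF L2s[of m] u], of "X n"]] .
      have i2: "integrable lborel (\<lambda>x. (norm (s m x - u x))\<^sup>2)"
        using L2_D(2)[OF L2_diff[OF L2s[of m] u]] .
      have i3: "integrable lborel (\<lambda>x. B * norm (s m (x + X n) - s m x))"
        using L1s[of m] integrable_lborel_shift_iff[of "s m" "X n"] by simp
      have "(\<integral>x. (norm (u (x + X n) - u x))\<^sup>2 \<partial>lborel)
        \<le> (\<integral>x. 3 * (B * norm (s m (x + X n) - s m x)) + (3 * (norm (s m (x + X n) - u (x + X n)))\<^sup>2 + 3 * (norm (s m x - u x))\<^sup>2) \<partial>lborel)"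
      proof (intro integral_mono Bochner_Integration.integrable_add integrable_mult_right[OF i1]
          integrable_mult_right[OF i2] integrable_mult_right[OF i3] L2_D(2)[OF L2S[OF u]])
        fix x
        have eq: "u (x + X n) - u x = (s m (x + X n) - s m x) - (s m (x + X n) - u (x + X n)) + (s m x - u x)"
          by simp
        have le: "norm (u (x + X n) - u x) \<le> norm (s m (x + X n) - s m x) + norm (s m (x + X n) - u (x + X n)) + norm (s m x - u x)"
          by (subst eq) (smt (verit) norm_triangle_ineq norm_triangle_ineq4)
        have sq: "(a + b + c)\<^sup>2 \<le> 3 * a\<^sup>2 + 3 * b\<^sup>2 + 3 * c\<^sup>2" for a b c :: real
          using two_mult_le_squares[of a b] two_mult_le_squares[of a c] two_mult_le_squares[of b c]
          by (simp add: power2_eq_square algebra_simps)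
        have "(norm (u (x + X n) - u x))\<^sup>2
           \<le> 3 * (norm (s m (x + X n) - s m x))\<^sup>2 + 3 * (norm (s m (x + X n) - u (x + X n)))\<^sup>2 + 3 * (norm (s m x - u x))\<^sup>2"
          by (rule order_trans[OF power_mono[OF le norm_ge_zero] sq])
        moreover have "norm (s m (x + X n) - s m x) \<le> B"
          using sb[of m "x + X n"] sb[of m x] norm_triangle_ineq4[of "s m (x + X n)" "s m x"] by (simp add: B_def)
        then have "(norm (s m (x + X n) - s m x))\<^sup>2 \<le> B * norm (s m (x + X n) - s m x)"
          unfolding power2_eq_square by (intro mult_right_mono) auto
        ultimately show "(norm (u (x + X n) - u x))\<^sup>2 \<le> 3 * (B * norm (s m (x + X n) - s m x)) + (3 * (norm (s m (x + X n) - u (x + X n)))\<^sup>2 + 3 * (norm (s m x - u x))\<^sup>2)"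
          by simp
      qed
      also have "\<dots> = 3 * (B * (\<integral>x. norm (s m (x + X n) - s m x) \<partial>lborel))
          + (3 * (\<integral>x. (norm (s m (x + X n) - u (x + X n)))\<^sup>2 \<partial>lborel) + 3 * (\<integral>x. (norm (s m x - u x))\<^sup>2 \<partial>lborel))"
        using i1 i2 i3 by simp
      also have "(\<integral>x. (norm (s m (x + X n) - u (x + X n)))\<^sup>2 \<partial>lborel) = (\<integral>x. (norm (s m x - u x))\<^sup>2 \<partial>lborel)"
        using integral_lborel_shift[of "\<lambda>x. (norm (s m x - u x))\<^sup>2" "X n"] by simp
      finally have "(\<integral>x. (norm (u (x + X n) - u x))\<^sup>2 \<partial>lborel)
        \<le> 3 * (B * (\<integral>x. norm (s m (x + X n) - s m x) \<partial>lborel)) + 6 * (\<integral>x. (norm (s m x - u x))\<^sup>2 \<partial>lborel)"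
        by simp
      moreover have "B * (\<integral>x. norm (s m (x + X n) - s m x) \<partial>lborel) < r / 6"
        using N[OF n] B by (simp add: field_simps)
      ultimately show ?thesis using m by simp
    qed
    then show "\<exists>no. \<forall>n\<ge>no. norm ((\<integral>x. (norm (u (x + X n) - u x))\<^sup>2 \<partial>lborel) - 0) < r" by blast
  qed
qed

section \<open>The Fourier transform\<close>

lemma borel_measurable_cis [measurable]: "cis \<in> borel_measurable borel"
  by (intro borel_measurable_continuous_onI continuous_intros)

lemma borel_measurable_cnj [measurable]: "cnj \<in> borel_measurable borel"
  by (intro borel_measurable_continuous_onI continuous_intros)

lemma integrable_lborel_prod_bound:
  fixes f :: "'a::euclidean_space \<Rightarrow> 'c::{banach, second_countable_topology}"
    and g :: "'b::euclidean_space \<Rightarrow> 'd::{banach, second_countable_topology}"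
    and h :: "'a \<Rightarrow> 'b \<Rightarrow> 'e::{banach, second_countable_topology}"
  assumes f: "integrable lborel f" and g: "integrable lborel g"
    and m: "(\<lambda>(x, y). h x y) \<in> borel_measurable (borel \<Otimes>\<^sub>M borel)"
    and le: "\<And>x y. norm (h x y) \<le> norm (f x) * norm (g y)"
  shows "integrable lborel (\<lambda>(x, y). h x y)"
proof (rule integrable_lborel_prodI[OF m])
  have [measurable]: "f \<in> borel_measurable borel" "g \<in> borel_measurable borel" using f g by auto
  have "(\<integral>\<^sup>+x. \<integral>\<^sup>+y. ennreal (norm (h x y)) \<partial>lborel \<partial>lborel)
      \<le> (\<integral>\<^sup>+x. \<integral>\<^sup>+y. ennreal (norm (f x)) * ennreal (norm (g y)) \<partial>lborel \<partial>lborel)"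
    by (intro nn_integral_mono) (auto simp: ennreal_mult[symmetric] le)
  also have "\<dots> = (\<integral>\<^sup>+x. ennreal (norm (f x)) \<partial>lborel) * (\<integral>\<^sup>+y. ennreal (norm (g y)) \<partial>lborel)"
    by (simp add: nn_integral_cmult nn_integral_multc)
  also have "\<dots> < \<infinity>"
    using f g by (auto simp: integrable_iff_bounded ennreal_mult_less_top)
  finally show "(\<integral>\<^sup>+x. \<integral>\<^sup>+y. ennreal (norm (h x y)) \<partial>lborel \<partial>lborel) < \<infinity>" .
qed

definition gauss :: "real \<Rightarrow> real^3 \<Rightarrow> real" where
  "gauss d x = exp (- d * (norm x)\<^sup>2)"

lemma gauss_nonneg [simp]: "0 \<le> gauss d x"
  by (simp add: gauss_def)

lemma borel_measurable_gauss [measurable]: "gauss d \<in> borel_measurable borel"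
  unfolding gauss_def by measurable

lemma gauss_prod: "gauss d x = (\<Prod>b\<in>Basis. exp (- d * (x \<bullet> b)\<^sup>2))"
  unfolding gauss_def power2_norm_eq_inner
  by (subst euclidean_inner) (simp add: exp_sum[symmetric] sum_distrib_left power2_eq_square)

text \<open>Rescaling by \<open>sqrt (2 * d)\<close> reduces the integral to the characteristic
  function of the standard normal distribution.\<close>

lemma gauss_integral_1d:
  fixes d t :: real
  assumes d: "0 < d"
  shows "integrable lborel (\<lambda>x. exp (- d * x\<^sup>2))"
    and "(\<integral>x. cis (t * x) * of_real (exp (- d * x\<^sup>2)) \<partial>lborel) = of_real (sqrt (pi / d) * exp (- t\<^sup>2 / (4 * d)))"
proof -
  define c where "c = sqrt (2 * d)"
  have c: "c > 0" "c\<^sup>2 = 2 * d" using d by (auto simp: c_def)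
  have "integrable lborel std_normal_density" by simp
  then have "integrable lborel (\<lambda>x. sqrt (2 * pi) * std_normal_density x)"
    by (rule integrable_mult_right)
  then have 1: "integrable lborel (\<lambda>x::real. exp (- x\<^sup>2 / 2))"
    by (simp add: std_normal_density_def)
  from lborel_integrable_real_affine[OF 1, of c 0] c
  show "integrable lborel (\<lambda>x. exp (- d * x\<^sup>2))"
    by (simp add: power_mult_distrib)
  have "char std_normal_distribution s = (\<integral>x. of_real (1 / sqrt (2 * pi)) * (cis (s * x) * of_real (exp (- x\<^sup>2 / 2))) \<partial>lborel)" for s
    unfolding char_def
    by (subst integral_density)
      (auto simp: normal_density_nonneg cis_conv_exp std_normal_density_def scaleR_conv_of_real mult_ac
        intro!: Bochner_Integration.integral_cong)
  then have char: "of_real (1 / sqrt (2 * pi)) * (\<integral>x. cis (s * x) * of_real (exp (- x\<^sup>2 / 2)) \<partial>lborel) = complex_of_real (exp (- s\<^sup>2 / 2))" for s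
    unfolding char_std_normal_distribution integral_mult_right_zero by (rule sym)
  have 2: "(\<integral>x. cis (s * x) * of_real (exp (- x\<^sup>2 / 2)) \<partial>lborel) = complex_of_real (sqrt (2 * pi) * exp (- s\<^sup>2 / 2))" for s
  proof -
    have "a = complex_of_real (sqrt (2 * pi)) * (of_real (1 / sqrt (2 * pi)) * a)" for a
      by (simp add: mult.assoc[symmetric] flip: of_real_mult)
    from this[of "\<integral>x. cis (s * x) * of_real (exp (- x\<^sup>2 / 2)) \<partial>lborel"]
    show ?thesis unfolding char of_real_mult .
  qed
  have "(\<integral>x. cis (t / c * x) * of_real (exp (- x\<^sup>2 / 2)) \<partial>lborel)
      = c *\<^sub>R (\<integral>x. cis (t * x) * of_real (exp (- d * x\<^sup>2)) \<partial>lborel)"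
    using lborel_integral_real_affine[of c "\<lambda>x. cis (t / c * x) * complex_of_real (exp (- x\<^sup>2 / 2))" 0] c
    by (simp add: power_mult_distrib)
  then have "c *\<^sub>R (\<integral>x. cis (t * x) * of_real (exp (- d * x\<^sup>2)) \<partial>lborel) = complex_of_real (sqrt (2 * pi) * exp (- (t / c)\<^sup>2 / 2))"
    by (simp only: 2)
  then have "(1 / c) *\<^sub>R c *\<^sub>R (\<integral>x. cis (t * x) * of_real (exp (- d * x\<^sup>2)) \<partial>lborel) = (1 / c) *\<^sub>R complex_of_real (sqrt (2 * pi) * exp (- (t / c)\<^sup>2 / 2))"
    by (simp only:)
  then have "(\<integral>x. cis (t * x) * of_real (exp (- d * x\<^sup>2)) \<partial>lborel) = (1 / c) *\<^sub>R complex_of_real (sqrt (2 * pi) * exp (- (t / c)\<^sup>2 / 2))"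
    using c by (simp only: scaleR_scaleR) simp
  also have "\<dots> = of_real (sqrt (2 * pi) / c * exp (- t\<^sup>2 / (4 * d)))"
    using c by (simp add: scaleR_conv_of_real power_divide)
  also have "sqrt (2 * pi) / c = sqrt (pi / d)"
    by (simp add: c_def real_sqrt_divide[symmetric])
  finally show "(\<integral>x. cis (t * x) * of_real (exp (- d * x\<^sup>2)) \<partial>lborel) = of_real (sqrt (pi / d) * exp (- t\<^sup>2 / (4 * d)))" .
qed

lemma integrable_gauss: "0 < d \<Longrightarrow> integrable lborel (gauss d)"
  using integrable_lborel_prod(1)[of "\<lambda>(b::real^3) x. exp (- d * x\<^sup>2)"] gauss_integral_1d(1)[of d]
  by (simp add: gauss_prod[abs_def])

lemma cis_sum: "finite B \<Longrightarrow> cis (\<Sum>b\<in>B. f b) = (\<Prod>b\<in>B. cis (f b))"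
  by (induction B rule: finite_induct) (auto simp: cis_mult[symmetric])

text \<open>The Fourier transform of \<open>gauss d\<close>, again a Gaussian, of total mass
  \<open>(2 * pi) ^ 3\<close> for every \<open>d\<close>. As \<open>d\<close> tends to 0 it
  concentrates at the origin, hence it is an approximate identity up to this factor.\<close>

definition gauss_hat :: "real \<Rightarrow> real^3 \<Rightarrow> real" where
  "gauss_hat d y = sqrt (pi / d) ^ 3 * gauss (1 / (4 * d)) y"

lemma gauss_hat_nonneg [simp]: "0 < d \<Longrightarrow> 0 \<le> gauss_hat d x"
  by (simp add: gauss_hat_def)

lemma borel_measurable_gauss_hat [measurable]: "gauss_hat d \<in> borel_measurable borel"
  unfolding gauss_hat_def by measurable

lemma gauss_hat_minus: "gauss_hat d (x - y) = gauss_hat d (y - x)"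
  by (simp add: gauss_hat_def gauss_def norm_minus_commute)

lemma fourier_gauss:
  assumes d: "0 < d"
  shows "(\<integral>k. cis (k \<bullet> y) * of_real (gauss d k) \<partial>lborel) = of_real (gauss_hat d y)"
proof -
  have eq: "cis (k \<bullet> y) * of_real (gauss d k) = (\<Prod>b\<in>Basis. cis ((y \<bullet> b) * (k \<bullet> b)) * of_real (exp (- d * (k \<bullet> b)\<^sup>2)))" for k :: "real^3"
    by (subst euclidean_inner) (simp add: gauss_prod cis_sum prod.distrib mult.commute)
  have "(\<integral>k. cis (k \<bullet> y) * of_real (gauss d k) \<partial>lborel)
    = (\<Prod>b\<in>(Basis::(real^3) set). \<integral>x. cis ((y \<bullet> b) * x) * of_real (exp (- d * x\<^sup>2)) \<partial>lborel)"
    unfolding eq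
  proof (rule integrable_lborel_prod(2))
    fix b :: "real^3"
    show "integrable lborel (\<lambda>x. cis ((y \<bullet> b) * x) * complex_of_real (exp (- d * x\<^sup>2)))"
      by (rule Bochner_Integration.integrable_bound[OF gauss_integral_1d(1)[OF d]]) (auto simp: norm_mult)
  qed
  also have "\<dots> = (\<Prod>b\<in>(Basis::(real^3) set). of_real (sqrt (pi / d) * exp (- (y \<bullet> b)\<^sup>2 / (4 * d))))"
    by (simp only: gauss_integral_1d(2)[OF d])
  also have "\<dots> = of_real (gauss_hat d y)"
    by (simp add: gauss_hat_def gauss_prod prod.distrib)
  finally show ?thesis .
qed

lemma integral_gauss: "0 < d \<Longrightarrow> (\<integral>x. gauss d x \<partial>lborel) = sqrt (pi / d) ^ 3"
proof -
  assume d: "0 < d"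
  have "complex_of_real (\<integral>x. gauss d x \<partial>lborel) = (\<integral>k. cis (k \<bullet> 0) * of_real (gauss d k) \<partial>lborel)"
    by simp
  also have "\<dots> = of_real (gauss_hat d 0)" by (rule fourier_gauss[OF d])
  finally show ?thesis by (simp add: gauss_hat_def gauss_def del: of_real_power)
qed

lemma integrable_gauss_hat: "0 < d \<Longrightarrow> integrable lborel (gauss_hat d)"
  unfolding gauss_hat_def by (intro integrable_mult_right integrable_gauss) simp

lemma integral_gauss_hat: "0 < d \<Longrightarrow> (\<integral>x. gauss_hat d x \<partial>lborel) = (2 * pi) ^ 3"
proof -
  assume d: "0 < d"
  have "sqrt (pi / d) * sqrt (pi / (1 / (4 * d))) = sqrt ((2 * pi)\<^sup>2)"
    using d by (simp add: real_sqrt_mult[symmetric] power2_eq_square)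
  then have "sqrt (pi / d) * sqrt (pi / (1 / (4 * d))) = 2 * pi"
    unfolding real_sqrt_abs by simp
  then show ?thesis
    using d integral_gauss[of "1 / (4 * d)"] by (simp add: gauss_hat_def power_mult_distrib[symmetric])
qed

lemma fourier_integrand_integrable:
  fixes f :: "real^3 \<Rightarrow> complex"
  assumes "integrable lborel f" and [measurable]: "t \<in> borel_measurable borel"
  shows "integrable lborel (\<lambda>x. cis (t x) * f x)"
proof -
  have [measurable]: "f \<in> borel_measurable borel" using assms by auto
  show ?thesis
    by (rule Bochner_Integration.integrable_bound[OF assms(1)]) (auto simp: norm_mult)
qed

lemma norm_fourier_le:
  "norm (fourier f k) \<le> (\<integral>x. norm (f x) \<partial>lborel)"
  unfolding fourier_def
  by (rule order_trans[OF integral_norm_bound]) (simp add: norm_mult)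

lemma borel_measurable_fourier [measurable]:
  assumes [measurable]: "f \<in> borel_measurable borel"
  shows "fourier f \<in> borel_measurable borel"
  unfolding fourier_def by measurable

lemma integrable_fourier_mult:
  assumes f: "integrable lborel f" and g: "integrable lborel g"
  shows "integrable lborel (\<lambda>k. fourier f k * g k)"
proof (rule Bochner_Integration.integrable_bound)
  have [measurable]: "f \<in> borel_measurable borel" "g \<in> borel_measurable borel" using f g by auto
  show "integrable lborel (\<lambda>k. (\<integral>x. norm (f x) \<partial>lborel) * norm (g k))" using g by simp
  show "AE k in lborel. norm (fourier f k * g k) \<le> norm ((\<integral>x. norm (f x) \<partial>lborel) * norm (g k))"
    by (auto simp: norm_mult intro!: mult_right_mono norm_fourier_le)
  show "(\<lambda>k. fourier f k * g k) \<in> borel_measurable lborel" by measurable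
qed

text \<open>Fubini for the kernel \<open>cis (- (k \<bullet> x))\<close>. It moves the transform
  from a function of low regularity to one whose transform is known explicitly.\<close>

lemma integral_fourier_mult:
  assumes f: "integrable lborel f" and g: "integrable lborel g"
  shows "(\<integral>k. fourier f k * g k \<partial>lborel) = (\<integral>x. f x * fourier g x \<partial>lborel)"
proof -
  have [measurable]: "f \<in> borel_measurable borel" "g \<in> borel_measurable borel" using f g by auto
  have "integrable lborel (\<lambda>(k, x). cis (- (k \<bullet> x)) * f x * g k)"
    by (rule integrable_lborel_prod_bound[OF g f]) (auto simp: norm_mult)
  from integral_lborel_swap[OF this]
  have "(\<integral>k. (\<integral>x. cis (- (k \<bullet> x)) * f x \<partial>lborel) * g k \<partial>lborel) = (\<integral>x. f x * (\<integral>k. cis (- (x \<bullet> k)) * g k \<partial>lborel) \<partial>lborel)"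
    by (simp add: inner_commute mult_ac flip: integral_mult_left_zero integral_mult_right_zero)
  then show ?thesis by (simp add: fourier_def)
qed

lemma fourier_gauss':
  assumes d: "0 < d"
  shows "fourier (\<lambda>k. cis (k \<bullet> x) * of_real (gauss d k)) y = of_real (gauss_hat d (x - y))"
  unfolding fourier_def fourier_gauss[OF d, symmetric]
  by (intro Bochner_Integration.integral_cong refl)
    (simp add: mult.assoc[symmetric] cis_mult inner_diff_right inner_commute)

text \<open>The multiplication formula with the modulated Gaussian, whose transform is
  \<open>gauss_hat d\<close> centred at \<open>x\<close>. The damping makes the left side converge
  absolutely even when \<open>fourier f\<close> is not integrable.\<close>

lemma gauss_damped_inversion:
  assumes f: "integrable lborel f" and d: "0 < d"
  shows "(\<integral>k. cis (k \<bullet> x) * of_real (gauss d k) * fourier f k \<partial>lborel) = (\<integral>y. f y * of_real (gauss_hat d (x - y)) \<partial>lborel)"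
proof -
  have "integrable lborel (\<lambda>k. cis (k \<bullet> x) * complex_of_real (gauss d k))"
    by (rule fourier_integrand_integrable) (use integrable_gauss[OF d] in auto)
  from integral_fourier_mult[OF f this] show ?thesis
    by (simp add: fourier_gauss'[OF d] mult.commute)
qed

lemma gauss_tendsto_1: "(\<lambda>n. gauss (1 / real (Suc n)) k) \<longlonglongrightarrow> 1"
proof -
  have "(\<lambda>n. exp (- (1 / real (Suc n)) * (norm k)\<^sup>2)) \<longlonglongrightarrow> exp (- 0 * (norm k)\<^sup>2)"
    by (intro tendsto_intros) (use LIMSEQ_inverse_real_of_nat in \<open>simp add: inverse_eq_divide\<close>)
  then show ?thesis by (simp add: gauss_def)
qed

lemma gauss_le_1: "0 \<le> d \<Longrightarrow> gauss d k \<le> 1"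
  by (simp add: gauss_def)

text \<open>The substitution y = x + s u, with s twice the square root of d, freezes the kernel to a
  multiple of \<open>gauss 1\<close>, which then dominates. Boundedness of \<open>f\<close> and
  continuity at the single point \<open>x\<close> suffice.\<close>

lemma gauss_hat_approximates:
  fixes f :: "real^3 \<Rightarrow> complex"
  assumes f[measurable]: "f \<in> borel_measurable borel" and b: "\<And>y. norm (f y) \<le> B" and c: "isCont f x"
  shows "(\<lambda>n. \<integral>y. f y * of_real (gauss_hat (1 / real (Suc n)) (x - y)) \<partial>lborel) \<longlonglongrightarrow> of_real ((2 * pi) ^ 3) * f x"
proof -
  define s where "s n = 2 * sqrt (1 / real (Suc n))" for n
  have s: "s n > 0" for n by (simp add: s_def)
  have s0: "s \<longlonglongrightarrow> 0"
    unfolding s_def by real_asymp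
  have eq: "(\<integral>y. f y * of_real (gauss_hat (1 / real (Suc n)) (x - y)) \<partial>lborel)
     = (\<integral>u. f (x + s n *\<^sub>R u) * of_real ((2 * sqrt pi) ^ 3 * gauss 1 u) \<partial>lborel)" for n
  proof -
    let ?d = "1 / real (Suc n)"
    have g: "gauss_hat ?d (x - (x + s n *\<^sub>R u)) = sqrt (pi / ?d) ^ 3 * gauss 1 u" for u
    proof -
      have "1 / (4 * ?d) * (norm (s n *\<^sub>R u))\<^sup>2 = (norm u)\<^sup>2"
        using s[of n] by (simp add: s_def power_mult_distrib field_simps)
      then show ?thesis by (simp add: gauss_hat_def gauss_def)
    qed
    have e1: "\<bar>s n\<bar> ^ 3 * sqrt (pi / ?d) ^ 3 = (2 * sqrt pi) ^ 3"
      by (simp add: s_def power_mult_distrib[symmetric] real_sqrt_mult[symmetric])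
    have "(\<integral>u. f (x + s n *\<^sub>R u) * of_real (gauss_hat ?d (x - (x + s n *\<^sub>R u))) \<partial>lborel)
      = (1 / \<bar>s n\<bar> ^ 3) *\<^sub>R (\<integral>y. f y * of_real (gauss_hat ?d (x - y)) \<partial>lborel)"
      using integral_lborel_affine[of "s n" "\<lambda>y. f y * of_real (gauss_hat ?d (x - y))" x] s[of n] by simp
    then have "(\<integral>y. f y * of_real (gauss_hat ?d (x - y)) \<partial>lborel)
      = (\<bar>s n\<bar> ^ 3) *\<^sub>R (\<integral>u. f (x + s n *\<^sub>R u) * of_real (sqrt (pi / ?d) ^ 3 * gauss 1 u) \<partial>lborel)"
      using s[of n] unfolding g by simp
    also have "\<dots> = (\<integral>u. f (x + s n *\<^sub>R u) * of_real ((2 * sqrt pi) ^ 3 * gauss 1 u) \<partial>lborel)"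
      unfolding e1[symmetric] integral_scaleR_right[symmetric]
      by (intro Bochner_Integration.integral_cong refl) (simp add: scaleR_conv_of_real mult_ac)
    finally show ?thesis .
  qed
  have "(\<lambda>n. \<integral>u. f (x + s n *\<^sub>R u) * of_real ((2 * sqrt pi) ^ 3 * gauss 1 u) \<partial>lborel)
      \<longlonglongrightarrow> (\<integral>u. f x * of_real ((2 * sqrt pi) ^ 3 * gauss 1 u) \<partial>lborel)"
  proof (rule integral_dominated_convergence[where w="\<lambda>u. B * ((2 * sqrt pi) ^ 3 * gauss 1 u)"])
    show "integrable lborel (\<lambda>u. B * ((2 * sqrt pi) ^ 3 * gauss 1 u))"
      by (intro integrable_mult_right integrable_gauss) simp
    show "AE u in lborel. (\<lambda>n. f (x + s n *\<^sub>R u) * of_real ((2 * sqrt pi) ^ 3 * gauss 1 u))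
       \<longlonglongrightarrow> f x * of_real ((2 * sqrt pi) ^ 3 * gauss 1 u)"
    proof (intro AE_I2 tendsto_mult tendsto_const)
      fix u
      have "(\<lambda>n. x + s n *\<^sub>R u) \<longlonglongrightarrow> x + 0 *\<^sub>R u" by (intro tendsto_intros s0)
      then show "(\<lambda>n. f (x + s n *\<^sub>R u)) \<longlonglongrightarrow> f x"
        using isCont_tendsto_compose[OF c] by simp
    qed
    show "AE u in lborel. norm (f (x + s n *\<^sub>R u) * of_real ((2 * sqrt pi) ^ 3 * gauss 1 u)) \<le> B * ((2 * sqrt pi) ^ 3 * gauss 1 u)" for n
      by (intro AE_I2) (auto simp: norm_mult norm_power intro!: mult_right_mono b)
  qed auto
  moreover have "(\<integral>u. f x * of_real ((2 * sqrt pi) ^ 3 * gauss 1 u) \<partial>lborel) = of_real ((2 * pi) ^ 3) * f x"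
  proof -
    have "(\<integral>u. f x * complex_of_real ((2 * sqrt pi) ^ 3 * gauss 1 u) \<partial>lborel)
        = f x * of_real ((2 * sqrt pi) ^ 3 * (\<integral>u. gauss 1 u \<partial>lborel))"
      by (simp del: of_real_mult of_real_power add: integral_mult_right_zero)
    also have "(2 * sqrt pi) ^ 3 * (\<integral>u. gauss 1 u \<partial>lborel) = (2 * pi) ^ 3"
      by (simp add: integral_gauss power_mult_distrib[symmetric])
    finally show ?thesis by simp
  qed
  ultimately show ?thesis unfolding eq by (simp only:)
qed

text \<open>The damping is removed on both sides of \<open>gauss_damped_inversion\<close>: by
  dominated convergence with \<open>fourier f\<close> in frequency, by the approximate identity in
  space. Continuity is asked at one point, the form in which inversion at the origin uses
  it.\<close>

theorem fourier_inversion: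
  fixes f :: "real^3 \<Rightarrow> complex"
  assumes f: "integrable lborel f" and b: "\<And>y. norm (f y) \<le> B" and c: "isCont f x"
    and h: "integrable lborel (fourier f)"
  shows "(\<integral>k. cis (k \<bullet> x) * fourier f k \<partial>lborel) = of_real ((2 * pi) ^ 3) * f x"
proof (rule LIMSEQ_unique)
  have [measurable]: "f \<in> borel_measurable borel" using f by auto
  show "(\<lambda>n. \<integral>y. f y * of_real (gauss_hat (1 / real (Suc n)) (x - y)) \<partial>lborel) \<longlonglongrightarrow> of_real ((2 * pi) ^ 3) * f x"
    by (rule gauss_hat_approximates[OF _ b c]) measurable
  have "(\<lambda>n. \<integral>k. cis (k \<bullet> x) * of_real (gauss (1 / real (Suc n)) k) * fourier f k \<partial>lborel)
     \<longlonglongrightarrow> (\<integral>k. cis (k \<bullet> x) * fourier f k \<partial>lborel)"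
  proof (rule integral_dominated_convergence[where w="\<lambda>k. norm (fourier f k)"])
    show "AE k in lborel. (\<lambda>n. cis (k \<bullet> x) * of_real (gauss (1 / real (Suc n)) k) * fourier f k) \<longlonglongrightarrow> cis (k \<bullet> x) * fourier f k"
    proof (intro AE_I2)
      fix k
      have "(\<lambda>n. cis (k \<bullet> x) * of_real (gauss (1 / real (Suc n)) k) * fourier f k) \<longlonglongrightarrow> cis (k \<bullet> x) * of_real 1 * fourier f k"
        by (intro tendsto_intros gauss_tendsto_1)
      then show "(\<lambda>n. cis (k \<bullet> x) * of_real (gauss (1 / real (Suc n)) k) * fourier f k) \<longlonglongrightarrow> cis (k \<bullet> x) * fourier f k" by simp
    qed
    show "AE k in lborel. norm (cis (k \<bullet> x) * of_real (gauss (1 / real (Suc n)) k) * fourier f k) \<le> norm (fourier f k)" for n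
      by (auto simp: norm_mult intro!: mult_left_le_one_le gauss_le_1)
  qed (use h in auto)
  then show "(\<lambda>n. \<integral>y. f y * of_real (gauss_hat (1 / real (Suc n)) (x - y)) \<partial>lborel) \<longlonglongrightarrow> (\<integral>k. cis (k \<bullet> x) * fourier f k \<partial>lborel)"
    by (simp add: gauss_damped_inversion[OF f])
qed

text \<open>The damped integral of the squared transform is a double integral of f(x) and the
  conjugate of f(y) with the kernel \<open>gauss_hat d (x - y)\<close>. Bounding the product by the
  mean of the squares and using symmetry and mass of the kernel gives the estimate even when the
  right side is infinite; Fatou's lemma removes the damping.\<close>

theorem Plancherel_inequality:
  fixes f :: "real^3 \<Rightarrow> complex"
  assumes f: "integrable lborel f"
  shows "(\<integral>\<^sup>+k. ennreal ((norm (fourier f k))\<^sup>2) \<partial>lborel) \<le> ennreal ((2 * pi) ^ 3) * (\<integral>\<^sup>+x. ennreal ((norm (f x))\<^sup>2) \<partial>lborel)"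
proof -
  have [measurable]: "f \<in> borel_measurable borel" using f by auto
  let ?R = "ennreal ((2 * pi) ^ 3) * (\<integral>\<^sup>+x. ennreal ((norm (f x))\<^sup>2) \<partial>lborel)"
  have damped: "(\<integral>\<^sup>+k. ennreal (gauss d k * (norm (fourier f k))\<^sup>2) \<partial>lborel) \<le> ?R" if d: "0 < d" for d
  proof -
    have [measurable]: "gauss_hat d \<in> borel_measurable borel" by measurable
    \<comment> \<open>The factor 1/2 from 2ab \<le> a^2 + b^2; the two halves, equal by the symmetry
      of the kernel, recombine at the end.\<close>
    define c where "c = (1 / 2 :: real)"
    have c: "0 \<le> c" "c + c = 1" by (simp_all add: c_def)
    define F where "F k = of_real (gauss d k) * cnj (fourier f k)" for k
    have iF: "integrable lborel F"
    proof (rule Bochner_Integration.integrable_bound)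
      show "integrable lborel (\<lambda>k. (\<integral>x. norm (f x) \<partial>lborel) * gauss d k)" using integrable_gauss[OF d] by simp
      show "F \<in> borel_measurable lborel" unfolding F_def by measurable
      show "AE k in lborel. norm (F k) \<le> norm ((\<integral>x. norm (f x) \<partial>lborel) * gauss d k)"
        by (auto simp: F_def norm_mult mult.commute intro!: mult_left_mono norm_fourier_le)
    qed
    have fF: "fourier F x = cnj (\<integral>y. f y * of_real (gauss_hat d (x - y)) \<partial>lborel)" for x
    proof -
      have "fourier F x = (\<integral>k. cnj (cis (k \<bullet> x) * of_real (gauss d k) * fourier f k) \<partial>lborel)"
        unfolding fourier_def[of F]
        by (intro Bochner_Integration.integral_cong refl) (simp add: F_def cis_cnj inner_commute)
      then show ?thesis
        unfolding Bochner_Integration.integral_cnj gauss_damped_inversion[OF f d] .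
    qed
    have "ennreal (\<integral>k. gauss d k * (norm (fourier f k))\<^sup>2 \<partial>lborel) = ennreal (norm (\<integral>k. fourier f k * F k \<partial>lborel))"
    proof -
      have "fourier f k * F k = of_real (gauss d k * (norm (fourier f k))\<^sup>2)" for k
        unfolding F_def of_real_mult complex_norm_square by simp
      then have "(\<integral>k. fourier f k * F k \<partial>lborel) = of_real (\<integral>k. gauss d k * (norm (fourier f k))\<^sup>2 \<partial>lborel)"
        by (simp only: integral_complex_of_real)
      moreover have "0 \<le> (\<integral>k. gauss d k * (norm (fourier f k))\<^sup>2 \<partial>lborel)" by (intro Bochner_Integration.integral_nonneg) simp
      ultimately show ?thesis by simp
    qed
    also have "(\<integral>k. fourier f k * F k \<partial>lborel) = (\<integral>x. f x * fourier F x \<partial>lborel)"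
      by (rule integral_fourier_mult[OF f iF])
    also have "ennreal (norm \<dots>) \<le> (\<integral>\<^sup>+x. ennreal (norm (f x * fourier F x)) \<partial>lborel)"
      by (rule integral_norm_bound_ennreal)
        (use integrable_fourier_mult[OF iF f] in \<open>simp add: mult.commute\<close>)
    also have "\<dots> \<le> (\<integral>\<^sup>+x. ennreal (norm (f x)) * (\<integral>\<^sup>+y. ennreal (norm (f y) * gauss_hat d (x - y)) \<partial>lborel) \<partial>lborel)"
    proof (intro nn_integral_mono)
      fix x
      have i: "integrable lborel (\<lambda>y. f y * of_real (gauss_hat d (x - y)))"
      proof (rule Bochner_Integration.integrable_bound)
        show "integrable lborel (\<lambda>y. sqrt (pi / d) ^ 3 * norm (f y))" using f by simp
        show "AE y in lborel. norm (f y * of_real (gauss_hat d (x - y))) \<le> norm (sqrt (pi / d) ^ 3 * norm (f y))"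
          using d gauss_le_1[of "1 / (4 * d)"]
          by (auto simp: norm_mult norm_power gauss_hat_def mult.commute power_abs intro!: mult_left_mono mult_left_le_one_le)
      qed measurable
      have "ennreal (norm (f x * fourier F x)) = ennreal (norm (f x)) * ennreal (norm (\<integral>y. f y * of_real (gauss_hat d (x - y)) \<partial>lborel))"
        by (simp add: fF norm_mult ennreal_mult)
      also have "\<dots> \<le> ennreal (norm (f x)) * (\<integral>\<^sup>+y. ennreal (norm (f y * of_real (gauss_hat d (x - y)))) \<partial>lborel)"
        by (intro mult_left_mono integral_norm_bound_ennreal i) simp
      finally show "ennreal (norm (f x * fourier F x)) \<le> ennreal (norm (f x)) * (\<integral>\<^sup>+y. ennreal (norm (f y) * gauss_hat d (x - y)) \<partial>lborel)"
        using d by (simp add: norm_mult)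
    qed
    also have "\<dots> = (\<integral>\<^sup>+x. \<integral>\<^sup>+y. ennreal (norm (f x)) * ennreal (norm (f y) * gauss_hat d (x - y)) \<partial>lborel \<partial>lborel)"
      by (simp add: nn_integral_cmult)
    also have "\<dots> \<le> (\<integral>\<^sup>+x. \<integral>\<^sup>+y. ennreal c * (ennreal ((norm (f x))\<^sup>2) * ennreal (gauss_hat d (x - y))) + ennreal c * (ennreal ((norm (f y))\<^sup>2) * ennreal (gauss_hat d (x - y))) \<partial>lborel \<partial>lborel)"
    proof (intro nn_integral_mono)
      fix x y
      have "norm (f x) * (norm (f y) * gauss_hat d (x - y)) \<le> (c * (norm (f x))\<^sup>2 + c * (norm (f y))\<^sup>2) * gauss_hat d (x - y)"
        unfolding mult.assoc[symmetric]
        by (rule mult_right_mono) (use two_mult_le_squares[of "norm (f x)" "norm (f y)"] d in \<open>auto simp: c_def\<close>)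
      then show "ennreal (norm (f x)) * ennreal (norm (f y) * gauss_hat d (x - y))
         \<le> ennreal c * (ennreal ((norm (f x))\<^sup>2) * ennreal (gauss_hat d (x - y))) + ennreal c * (ennreal ((norm (f y))\<^sup>2) * ennreal (gauss_hat d (x - y)))"
        using d c by (simp add: ennreal_mult[symmetric] ennreal_plus[symmetric] ennreal_leI algebra_simps del: ennreal_plus)
    qed
    also have "\<dots> = (\<integral>\<^sup>+x. \<integral>\<^sup>+y. ennreal c * (ennreal ((norm (f x))\<^sup>2) * ennreal (gauss_hat d (x - y))) \<partial>lborel \<partial>lborel)
        + (\<integral>\<^sup>+x. \<integral>\<^sup>+y. ennreal c * (ennreal ((norm (f y))\<^sup>2) * ennreal (gauss_hat d (x - y))) \<partial>lborel \<partial>lborel)"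
      by (simp add: nn_integral_add)
    also have "(\<integral>\<^sup>+x. \<integral>\<^sup>+y. ennreal c * (ennreal ((norm (f y))\<^sup>2) * ennreal (gauss_hat d (x - y))) \<partial>lborel \<partial>lborel)
       = (\<integral>\<^sup>+x. \<integral>\<^sup>+y. ennreal c * (ennreal ((norm (f x))\<^sup>2) * ennreal (gauss_hat d (x - y))) \<partial>lborel \<partial>lborel)"
      by (subst lborel_pair.Fubini') (auto simp: gauss_hat_minus)
    also have "(\<integral>\<^sup>+x. \<integral>\<^sup>+y. ennreal c * (ennreal ((norm (f x))\<^sup>2) * ennreal (gauss_hat d (x - y))) \<partial>lborel \<partial>lborel)
       = (\<integral>\<^sup>+x. ennreal c * (ennreal ((norm (f x))\<^sup>2) * ennreal ((2 * pi)^3)) \<partial>lborel)"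
    proof -
      have "(\<integral>\<^sup>+y. ennreal (gauss_hat d (x - y)) \<partial>lborel) = ennreal ((2 * pi)^3)" for x
        using nn_integral_lborel_reflect[of "\<lambda>y. ennreal (gauss_hat d y)" x] d
        by (simp add: nn_integral_eq_integral integrable_gauss_hat integral_gauss_hat)
      then show ?thesis by (simp add: nn_integral_cmult)
    qed
    also have "\<dots> = ennreal c * ?R"
      by (simp add: nn_integral_cmult nn_integral_multc mult.commute)
    also have "ennreal c * ?R + ennreal c * ?R = ?R"
      unfolding distrib_right[symmetric] ennreal_plus[OF c(1) c(1), symmetric] c(2) by simp
    finally have "ennreal (\<integral>k. gauss d k * (norm (fourier f k))\<^sup>2 \<partial>lborel) \<le> ?R" .
    moreover have "integrable lborel (\<lambda>k. gauss d k * (norm (fourier f k))\<^sup>2)"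
    proof (rule Bochner_Integration.integrable_bound)
      show "integrable lborel (\<lambda>k. fourier f k * F k)" by (rule integrable_fourier_mult[OF f iF])
    qed (auto simp: F_def norm_mult power2_eq_square)
    ultimately show ?thesis by (subst nn_integral_eq_integral) auto
  qed
  have "(\<integral>\<^sup>+k. ennreal ((norm (fourier f k))\<^sup>2) \<partial>lborel)
     = (\<integral>\<^sup>+k. liminf (\<lambda>n. ennreal (gauss (1 / real (Suc n)) k * (norm (fourier f k))\<^sup>2)) \<partial>lborel)"
  proof (intro nn_integral_cong lim_imp_Liminf[symmetric])
    fix k
    have "(\<lambda>n. gauss (1 / real (Suc n)) k * (norm (fourier f k))\<^sup>2) \<longlonglongrightarrow> 1 * (norm (fourier f k))\<^sup>2"
      by (intro tendsto_intros gauss_tendsto_1)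
    then show "(\<lambda>n. ennreal (gauss (1 / real (Suc n)) k * (norm (fourier f k))\<^sup>2)) \<longlonglongrightarrow> ennreal ((norm (fourier f k))\<^sup>2)"
      by (intro tendsto_ennrealI) simp
  qed simp
  also have "\<dots> \<le> liminf (\<lambda>n. \<integral>\<^sup>+k. ennreal (gauss (1 / real (Suc n)) k * (norm (fourier f k))\<^sup>2) \<partial>lborel)"
    by (rule nn_integral_liminf) simp
  also have "\<dots> \<le> ?R"
  proof (rule order_trans[OF Liminf_le_Limsup Limsup_bounded])
    show "\<forall>\<^sub>F n in sequentially. (\<integral>\<^sup>+k. ennreal (gauss (1 / real (Suc n)) k * (norm (fourier f k))\<^sup>2) \<partial>lborel) \<le> ?R"
      by (intro always_eventually allI damped) simp
  qed simp
  finally show ?thesis .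
qed

section \<open>Gaussians as test functions\<close>

text \<open>\<open>K\<close> comes from raising t \<le> exp t, with t = (1 + r) / n, to the power n,
  and from completing the square: r - a r^2 \<le> 1 / (4a). The exponent is raised to
  \<open>Suc N\<close> to keep n nonzero.\<close>

lemma gauss_decay:
  assumes a: "0 < a"
  obtains K where "0 \<le> K" "\<And>x. (1 + norm x) ^ N * gauss a x \<le> K"
proof -
  define n where "n = Suc N"
  define K where "K = real n ^ n * exp (1 + 1 / (4 * a))"
  have "(1 + norm x) ^ N * gauss a x \<le> K" for x :: "real^3"
  proof -
    define r where "r = norm x"
    have r: "0 \<le> r" by (simp add: r_def)
    have "(1 + r) / real n \<le> exp ((1 + r) / real n)"
      using exp_ge_add_one_self[of "(1 + r) / real n"] by linarith
    then have "((1 + r) / real n) ^ n \<le> exp ((1 + r) / real n) ^ n"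
      using r by (intro power_mono) auto
    also have "\<dots> = exp (real n * ((1 + r) / real n))" by (rule exp_of_nat_mult[symmetric])
    also have "real n * ((1 + r) / real n) = 1 + r" by (simp add: n_def)
    finally have 1: "(1 + r) ^ n \<le> real n ^ n * exp (1 + r)"
      by (simp add: power_divide divide_le_eq n_def mult.commute)
    have "0 \<le> (2 * a * r - 1)\<^sup>2 / (4 * a)" using a by simp
    also have "\<dots> = a * r\<^sup>2 - r + 1 / (4 * a)" using a by (simp add: field_simps power2_eq_square)
    finally have 2: "r - a * r\<^sup>2 \<le> 1 / (4 * a)" by simp
    have "(1 + r) ^ N * gauss a x \<le> (1 + r) ^ n * gauss a x"
      using r by (intro mult_right_mono power_increasing) (auto simp: n_def)
    also have "\<dots> \<le> real n ^ n * exp (1 + r) * gauss a x"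
      by (intro mult_right_mono 1) simp
    also have "\<dots> = real n ^ n * exp (1 + (r - a * r\<^sup>2))"
      by (simp add: gauss_def r_def exp_add[symmetric] mult.assoc)
    also have "\<dots> \<le> K"
      unfolding K_def using 2 by (intro mult_left_mono) auto
    finally show ?thesis by (simp add: r_def)
  qed
  moreover have "0 \<le> K" by (simp add: K_def)
  ultimately show ?thesis using that by blast
qed

text \<open>Polynomiality is recorded for each directional derivative separately, since
  \<open>pderivs\<close> evaluates the derivative on fixed vectors; this is the form in which the
  induction over \<open>pderivs\<close> closes.\<close>

lemma real_polynomial_function_has_derivative:
  fixes p :: "'a::real_normed_vector \<Rightarrow> real"
  assumes "real_polynomial_function p"
  shows "\<exists>D. (\<forall>x. (p has_derivative D x) (at x)) \<and> (\<forall>b. real_polynomial_function (\<lambda>x. D x b))"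
  using assms
proof (induction p rule: real_polynomial_function.induct)
  case (linear f)
  then show ?case
    by (intro exI[of _ "\<lambda>_. f"]) (auto intro: bounded_linear_imp_has_derivative)
next
  case (const c)
  then show ?case by (intro exI[of _ "\<lambda>_ _. 0"]) auto
next
  case (add f g)
  then obtain D E where D: "\<And>x. (f has_derivative D x) (at x)" "\<And>b. real_polynomial_function (\<lambda>x. D x b)"
    and E: "\<And>x. (g has_derivative E x) (at x)" "\<And>b. real_polynomial_function (\<lambda>x. E x b)" by blast
  show ?case
    by (intro exI[of _ "\<lambda>x b. D x b + E x b"] conjI allI has_derivative_add D E real_polynomial_function.intros(3))
next
  case (mult f g)
  then obtain D E where D: "\<And>x. (f has_derivative D x) (at x)" "\<And>b. real_polynomial_function (\<lambda>x. D x b)"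
    and E: "\<And>x. (g has_derivative E x) (at x)" "\<And>b. real_polynomial_function (\<lambda>x. E x b)" by blast
  show ?case
    by (intro exI[of _ "\<lambda>x b. f x * E x b + D x b * g x"] conjI allI has_derivative_mult D E
        real_polynomial_function.intros(3,4) mult.hyps)
qed

lemma real_polynomial_function_growth:
  fixes p :: "'a::real_normed_vector \<Rightarrow> real"
  assumes "real_polynomial_function p"
  shows "\<exists>C m. 0 \<le> C \<and> (\<forall>x. \<bar>p x\<bar> \<le> C * (1 + norm x) ^ m)"
  using assms
proof (induction p rule: real_polynomial_function.induct)
  case (linear f)
  then obtain K where K: "0 \<le> K" "\<And>x. norm (f x) \<le> norm x * K"
    using bounded_linear.nonneg_bounded by blast
  have "\<bar>f x\<bar> \<le> K * (1 + norm x) ^ 1" for x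
    using K(1) K(2)[of x] by (simp add: algebra_simps)
  then show ?case using K(1) by blast
next
  case (const c)
  show ?case by (intro exI[of _ "\<bar>c\<bar>"] exI[of _ 0]) auto
next
  case (add f g)
  then obtain C m D n where C: "0 \<le> C" "\<And>x. \<bar>f x\<bar> \<le> C * (1 + norm x) ^ m"
    and D: "0 \<le> D" "\<And>x. \<bar>g x\<bar> \<le> D * (1 + norm x) ^ n" by blast
  have "\<bar>f x + g x\<bar> \<le> (C + D) * (1 + norm x) ^ (m + n)" for x
  proof -
    have "(1 + norm x) ^ m \<le> (1 + norm x) ^ (m + n)" "(1 + norm x) ^ n \<le> (1 + norm x) ^ (m + n)"
      by (auto intro: power_increasing)
    then have "C * (1 + norm x) ^ m + D * (1 + norm x) ^ n \<le> (C + D) * (1 + norm x) ^ (m + n)"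
      unfolding distrib_right using C D by (intro add_mono mult_left_mono) auto
    then show ?thesis using C(2)[of x] D(2)[of x] by linarith
  qed
  then show ?case using C(1) D(1) by (intro exI[of _ "C + D"]) auto
next
  case (mult f g)
  then obtain C m D n where C: "0 \<le> C" "\<And>x. \<bar>f x\<bar> \<le> C * (1 + norm x) ^ m"
    and D: "0 \<le> D" "\<And>x. \<bar>g x\<bar> \<le> D * (1 + norm x) ^ n" by blast
  have "\<bar>f x * g x\<bar> \<le> (C * D) * (1 + norm x) ^ (m + n)" for x
  proof -
    have "\<bar>f x * g x\<bar> \<le> (C * (1 + norm x) ^ m) * (D * (1 + norm x) ^ n)"
      unfolding abs_mult using C D by (intro mult_mono) auto
    then show ?thesis by (simp add: power_add mult_ac)
  qed
  then show ?case using C(1) D(1) by (intro exI[of _ "C * D"]) auto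
qed

lemma gauss_has_derivative:
  "((\<lambda>x. gauss d (x - y)) has_derivative (\<lambda>h. - 2 * d * ((x - y) \<bullet> h) * gauss d (x - y))) (at x)"
  unfolding gauss_def power2_norm_eq_inner
  by (auto intro!: derivative_eq_intros simp: inner_commute algebra_simps)

text \<open>Polynomials times a fixed Gaussian form a class closed under partial derivatives:
  differentiating the Gaussian only produces a further linear factor.\<close>

lemma pderivs_poly_gauss:
  assumes "real_polynomial_function p"
  shows "\<exists>q. real_polynomial_function q \<and>
    pderivs bs (\<lambda>x. complex_of_real (p x * gauss d (x - y))) = (\<lambda>x. of_real (q x * gauss d (x - y)))"
proof (induction bs)
  case Nil
  then show ?case using assms by auto
next
  case (Cons b bs)
  then obtain q where q: "real_polynomial_function q"
    and eq: "pderivs bs (\<lambda>x. complex_of_real (p x * gauss d (x - y))) = (\<lambda>x. of_real (q x * gauss d (x - y)))" by blast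
  obtain D where D: "\<And>x. (q has_derivative D x) (at x)" "\<And>b. real_polynomial_function (\<lambda>x. D x b)"
    using real_polynomial_function_has_derivative[OF q] by blast
  define r where "r x = q x * (- 2 * d * ((x - y) \<bullet> b)) + D x b" for x
  have "real_polynomial_function (\<lambda>x. q x * ((- 2 * d) * (x \<bullet> b + (- (y \<bullet> b)))) + D x b)"
    by (intro real_polynomial_function.intros q D bounded_linear_inner_left)
  then have "real_polynomial_function r"
    by (simp add: r_def[abs_def] inner_diff_left)
  moreover have "frechet_derivative (\<lambda>x. complex_of_real (q x * gauss d (x - y))) (at x) b = of_real (r x * gauss d (x - y))" for x
  proof -
    have "((\<lambda>x. complex_of_real (q x * gauss d (x - y))) has_derivative
       (\<lambda>h. of_real (q x * (- 2 * d * ((x - y) \<bullet> h) * gauss d (x - y)) + D x h * gauss d (x - y)))) (at x)"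
      by (intro has_derivative_of_real has_derivative_mult D gauss_has_derivative)
    from frechet_derivative_at[OF this, symmetric]
    show ?thesis by (simp add: r_def algebra_simps)
  qed
  ultimately show ?case unfolding pderivs.simps eq by auto
qed

lemma schwartz_gauss:
  assumes d: "0 < d"
  shows "schwartz (\<lambda>x. complex_of_real (gauss d (x - y)))"
  unfolding schwartz_def
proof (intro ballI conjI allI)
  fix bs :: "(real^3) list" and n :: nat
  obtain q where q: "real_polynomial_function q"
    and eq: "pderivs bs (\<lambda>x. complex_of_real (gauss d (x - y))) = (\<lambda>x. of_real (q x * gauss d (x - y)))"
    using pderivs_poly_gauss[of "\<lambda>_. 1" bs d y] by auto
  obtain D where D: "\<And>x. (q has_derivative D x) (at x)"
    using real_polynomial_function_has_derivative[OF q] by blast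
  show "pderivs bs (\<lambda>x. complex_of_real (gauss d (x - y))) differentiable at x" for x
    unfolding eq differentiable_def
    by (rule exI, rule has_derivative_of_real[OF has_derivative_mult[OF D gauss_has_derivative]])
  obtain C m where C: "0 \<le> C" "\<And>x. \<bar>q x\<bar> \<le> C * (1 + norm x) ^ m"
    using real_polynomial_function_growth[OF q] by blast
  obtain K where K: "0 \<le> K" "\<And>x::real^3. (1 + norm x) ^ (n + m) * gauss d x \<le> K"
    using gauss_decay[OF d, of "n + m"] by blast
  show "bounded (range (\<lambda>x. (1 + norm x) ^ n *\<^sub>R pderivs bs (\<lambda>x. complex_of_real (gauss d (x - y))) x))"
    unfolding eq bounded_iff
  proof (intro exI[of _ "C * ((1 + norm y) ^ (n + m) * K)"] ballI, clarify)
    fix x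
    \<comment> \<open>Decay around the centre \<open>y\<close> is traded for decay around the
      origin, at the price of a factor depending on \<open>y\<close>.\<close>
    have "1 + norm x \<le> (1 + norm y) * (1 + norm (x - y))"
    proof -
      have "0 \<le> norm y * norm (x - y)" by simp
      moreover have "norm x \<le> norm (x - y) + norm y"
        using norm_triangle_ineq[of "x - y" y] by simp
      moreover have "(1 + norm y) * (1 + norm (x - y)) = 1 + norm y + norm (x - y) + norm y * norm (x - y)"
        by (simp add: algebra_simps)
      ultimately show ?thesis by linarith
    qed
    then have 1: "(1 + norm x) ^ (n + m) \<le> (1 + norm y) ^ (n + m) * (1 + norm (x - y)) ^ (n + m)"
      unfolding power_mult_distrib[symmetric] by (intro power_mono) auto
    have "norm ((1 + norm x) ^ n *\<^sub>R complex_of_real (q x * gauss d (x - y))) = (1 + norm x) ^ n * \<bar>q x\<bar> * gauss d (x - y)"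
      by (simp add: norm_mult mult.assoc)
    also have "\<dots> \<le> (1 + norm x) ^ n * (C * (1 + norm x) ^ m) * gauss d (x - y)"
      by (intro mult_right_mono mult_left_mono C) auto
    also have "\<dots> = C * ((1 + norm x) ^ (n + m) * gauss d (x - y))"
      by (simp add: power_add mult_ac)
    also have "\<dots> \<le> C * (((1 + norm y) ^ (n + m) * (1 + norm (x - y)) ^ (n + m)) * gauss d (x - y))"
      by (intro mult_left_mono mult_right_mono 1 C) auto
    also have "\<dots> \<le> C * ((1 + norm y) ^ (n + m) * K)"
      unfolding mult.assoc by (intro mult_left_mono K C) auto
    finally show "norm ((1 + norm x) ^ n *\<^sub>R complex_of_real (q x * gauss d (x - y))) \<le> C * ((1 + norm y) ^ (n + m) * K)" .
  qed
qed

text \<open>The partial derivative of \<open>gauss d\<close>, kept real. Its oddness becomes the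
  skew-adjointness of the mollified operator D^j \<partial>_j.\<close>

definition gauss_deriv :: "real \<Rightarrow> 3 \<Rightarrow> real^3 \<Rightarrow> real" where
  "gauss_deriv d j z = - 2 * d * (z $ j) * gauss d z"

lemma borel_measurable_gauss_deriv [measurable]: "gauss_deriv d j \<in> borel_measurable borel"
  unfolding gauss_deriv_def by measurable

lemma gauss_deriv_odd: "gauss_deriv d j (x - y) = - gauss_deriv d j (y - x)"
  by (simp add: gauss_deriv_def gauss_def norm_minus_commute algebra_simps)

lemma partial_gauss:
  "partial j (\<lambda>x. complex_of_real (gauss d (x - y))) x = of_real (gauss_deriv d j (x - y))"
  unfolding partial_def
  by (subst frechet_derivative_at[OF has_derivative_of_real[OF gauss_has_derivative], symmetric])
    (simp add: gauss_deriv_def inner_axis)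

text \<open>Seven powers of decay are drawn from the Gaussian: six for \<open>wt\<close> on
  \<open>real^3\<close> and one for the factor \<open>z $ j\<close>.\<close>

lemma gauss_deriv_bound:
  assumes d: "0 < d"
  obtains K where "0 \<le> K" "\<And>j z. \<bar>gauss_deriv d j z\<bar> \<le> K * wt z"
proof -
  obtain K where K: "0 \<le> K" "\<And>x::real^3. (1 + norm x) ^ 7 * gauss d x \<le> K"
    using gauss_decay[OF d, of 7] by blast
  have "\<bar>gauss_deriv d j z\<bar> \<le> (2 * d * K) * wt z" for j z
  proof -
    have "(1 + norm z) ^ 7 = (1 + norm z) * (1 + norm z) ^ 6"
      by (simp add: power_Suc[symmetric])
    then have "(1 + norm z) * gauss d z * (1 + norm z) ^ 6 \<le> K" using K(2)[of z] by (simp add: mult_ac)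
    then have "(1 + norm z) * gauss d z \<le> K * wt z"
    proof -
      have "0 < (1 + norm z) ^ 6" using norm_ge_zero[of z] by (intro zero_less_power) linarith
      then show "(1 + norm z) * gauss d z \<le> K * wt z" if "(1 + norm z) * gauss d z * (1 + norm z) ^ 6 \<le> K"
        using that unfolding wt_def by (simp add: pos_le_divide_eq)
    qed
    moreover have "\<bar>z $ j\<bar> * gauss d z \<le> (1 + norm z) * gauss d z"
      using component_le_norm_cart[of z j] by (intro mult_right_mono) auto
    ultimately have "\<bar>z $ j\<bar> * gauss d z \<le> K * wt z" by linarith
    then have "2 * d * (\<bar>z $ j\<bar> * gauss d z) \<le> 2 * d * (K * wt z)"
      using d by (intro mult_left_mono) auto
    then show ?thesis using d by (simp add: gauss_deriv_def abs_mult mult.assoc)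
  qed
  then show ?thesis using that[of "2 * d * K"] K(1) d by simp
qed

section \<open>Mollification of a pairing\<close>

lemma L2_inner_integrable:
  fixes f g :: "real^3 \<Rightarrow> 'b::euclidean_space"
  assumes f: "L2 f" and g: "L2 g"
  shows "integrable lborel (\<lambda>x. f x \<bullet> g x)"
proof (rule Bochner_Integration.integrable_bound[OF L2_norm_mult_integrable[OF f g]])
  note [measurable] = L2_D(1)[OF f] L2_D(1)[OF g]
  show "(\<lambda>x. f x \<bullet> g x) \<in> borel_measurable lborel" by measurable
qed (auto intro!: AE_I2 Cauchy_Schwarz_ineq2)

lemma L2_inner_bound:
  fixes f g :: "real^3 \<Rightarrow> 'b::euclidean_space"
  assumes f: "L2 f" and g: "L2 g"
  shows "\<bar>\<integral>x. f x \<bullet> g x \<partial>lborel\<bar> \<le> sqrt (\<integral>x. (norm (f x))\<^sup>2 \<partial>lborel) * sqrt (\<integral>x. (norm (g x))\<^sup>2 \<partial>lborel)"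
proof -
  have "\<bar>\<integral>x. f x \<bullet> g x \<partial>lborel\<bar> \<le> (\<integral>x. norm (f x) * norm (g x) \<partial>lborel)"
    using L2_inner_integrable[OF f g] L2_norm_mult_integrable[OF f g]
    by (intro integral_abs_bound[THEN order_trans] integral_mono Cauchy_Schwarz_ineq2) auto
  then show ?thesis using L2_Cauchy_Schwarz[OF f g] by linarith
qed

lemma L2_norm_shift:
  "(\<integral>x. (norm (f (x + t)))\<^sup>2 \<partial>lborel) = (\<integral>x. (norm (f x))\<^sup>2 \<partial>lborel)" for f :: "real^3 \<Rightarrow> 'b::real_normed_vector"
  by (rule integral_lborel_shift)

text \<open>After x = y + z the mollified pairing is the integral of \<open>gauss_hat d\<close>
  against K(z), the pairing of the translate of \<open>P\<close> with \<open>v\<close>.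
  \<open>K\<close> is bounded by Cauchy-Schwarz and continuous at 0 because translations are
  continuous in L2, so the approximate identity acts on \<open>K\<close> and not on the L2 functions
  themselves.\<close>

lemma mollified_pairing:
  fixes P v :: "real^3 \<Rightarrow> 'b::euclidean_space"
  assumes P: "L2 P" and v: "L2 v"
  shows mollified_pairing_eq: "0 < d \<Longrightarrow> (\<integral>y. (\<integral>x. gauss_hat d (x - y) *\<^sub>R P x \<partial>lborel) \<bullet> v y \<partial>lborel)
      = (\<integral>z. gauss_hat d z * (\<integral>y. P (y + z) \<bullet> v y \<partial>lborel) \<partial>lborel)"
    and mollified_pairing_le: "0 < d \<Longrightarrow> \<bar>\<integral>y. (\<integral>x. gauss_hat d (x - y) *\<^sub>R P x \<partial>lborel) \<bullet> v y \<partial>lborel\<bar>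
      \<le> (2 * pi) ^ 3 * (sqrt (\<integral>x. (norm (P x))\<^sup>2 \<partial>lborel) * sqrt (\<integral>x. (norm (v x))\<^sup>2 \<partial>lborel))"
    and mollified_pairing_lim: "(\<lambda>n. \<integral>y. (\<integral>x. gauss_hat (1 / real (Suc n)) (x - y) *\<^sub>R P x \<partial>lborel) \<bullet> v y \<partial>lborel)
      \<longlonglongrightarrow> (2 * pi) ^ 3 * (\<integral>x. P x \<bullet> v x \<partial>lborel)"
proof -
  note [measurable] = L2_D(1)[OF P] L2_D(1)[OF v]
  define K where "K z = (\<integral>y. P (y + z) \<bullet> v y \<partial>lborel)" for z
  define B where "B = sqrt (\<integral>x. (norm (P x))\<^sup>2 \<partial>lborel) * sqrt (\<integral>x. (norm (v x))\<^sup>2 \<partial>lborel)"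
  have [measurable]: "K \<in> borel_measurable borel" unfolding K_def by measurable
  have KB: "\<bar>K z\<bar> \<le> B" for z
    using L2_inner_bound[OF L2_shift[OF P, of z] v] unfolding K_def B_def L2_norm_shift .
  have B0: "0 \<le> B" using KB[of 0] by linarith
  have PvB: "(\<integral>\<^sup>+y. ennreal (norm (P (y + z)) * norm (v y)) \<partial>lborel) \<le> ennreal B" for z
    using L2_Cauchy_Schwarz[OF L2_shift[OF P, of z] v] L2_norm_mult_integrable[OF L2_shift[OF P, of z] v]
    unfolding L2_norm_shift by (subst nn_integral_eq_integral) (auto simp: B_def intro!: ennreal_leI)
  have eq: "(\<integral>y. (\<integral>x. gauss_hat d (x - y) *\<^sub>R P x \<partial>lborel) \<bullet> v y \<partial>lborel) = (\<integral>z. gauss_hat d z * K z \<partial>lborel)" if d: "0 < d" for d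
  proof -
    have int: "integrable lborel (\<lambda>x. gauss_hat d (x - y) *\<^sub>R P x)" for y
    proof (rule Bochner_Integration.integrable_bound)
      show "integrable lborel (\<lambda>x. (gauss_hat d (x - y))\<^sup>2 + (norm (P x))\<^sup>2)"
      proof (rule Bochner_Integration.integrable_add[OF _ L2_D(2)[OF P]])
        have "(gauss_hat d z)\<^sup>2 \<le> sqrt (pi / d) ^ 3 * gauss_hat d z" for z
        proof -
          have "gauss_hat d z \<le> sqrt (pi / d) ^ 3"
            using d gauss_le_1[of "1 / (4 * d)" z] by (simp add: gauss_hat_def mult_left_le)
          then show ?thesis using d by (simp add: power2_eq_square mult_right_mono)
        qed
        then have "integrable lborel (\<lambda>z. (gauss_hat d z)\<^sup>2)"
          using d by (intro integrable_const_mult_bound[OF integrable_gauss_hat[OF d]]) auto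
        then show "integrable lborel (\<lambda>x. (gauss_hat d (x - y))\<^sup>2)"
          using integrable_lborel_shift_iff[of "\<lambda>z. (gauss_hat d z)\<^sup>2" "- y"] by simp
      qed
      show "AE x in lborel. norm (gauss_hat d (x - y) *\<^sub>R P x) \<le> norm ((gauss_hat d (x - y))\<^sup>2 + (norm (P x))\<^sup>2)"
      proof (intro AE_I2)
        fix x
        have "0 \<le> gauss_hat d (x - y) * norm (P x)" using d by simp
        with two_mult_le_squares[of "gauss_hat d (x - y)" "norm (P x)"] d
        show "norm (gauss_hat d (x - y) *\<^sub>R P x) \<le> norm ((gauss_hat d (x - y))\<^sup>2 + (norm (P x))\<^sup>2)"
          by (simp only: norm_scaleR real_norm_def abs_of_nonneg[OF gauss_hat_nonneg] abs_of_nonneg[OF add_nonneg_nonneg[OF zero_le_power2 zero_le_power2]])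
      qed
      show "(\<lambda>x. gauss_hat d (x - y) *\<^sub>R P x) \<in> borel_measurable lborel" by measurable
    qed
    have "(\<integral>y. (\<integral>x. gauss_hat d (x - y) *\<^sub>R P x \<partial>lborel) \<bullet> v y \<partial>lborel)
        = (\<integral>y. (\<integral>z. gauss_hat d z * (P (y + z) \<bullet> v y) \<partial>lborel) \<partial>lborel)"
    proof (intro Bochner_Integration.integral_cong refl)
      fix y
      have "(\<integral>x. gauss_hat d (x - y) *\<^sub>R P x \<partial>lborel) \<bullet> v y = (\<integral>x. (gauss_hat d (x - y) *\<^sub>R P x) \<bullet> v y \<partial>lborel)"
        by (rule integral_inner_left[symmetric]) (rule int)
      also have "\<dots> = (\<integral>z. gauss_hat d z * (P (y + z) \<bullet> v y) \<partial>lborel)"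
        using integral_lborel_shift[of "\<lambda>x. (gauss_hat d (x - y) *\<^sub>R P x) \<bullet> v y" y] by (simp add: add.commute)
      finally show "(\<integral>x. gauss_hat d (x - y) *\<^sub>R P x \<partial>lborel) \<bullet> v y = (\<integral>z. gauss_hat d z * (P (y + z) \<bullet> v y) \<partial>lborel)" .
    qed
    also have "\<dots> = (\<integral>z. \<integral>y. gauss_hat d z * (P (y + z) \<bullet> v y) \<partial>lborel \<partial>lborel)"
    proof (rule integral_lborel_swap, rule integrable_lborel_prodI')
      have "(\<integral>\<^sup>+z. \<integral>\<^sup>+y. ennreal (norm (gauss_hat d z * (P (y + z) \<bullet> v y))) \<partial>lborel \<partial>lborel)
          \<le> (\<integral>\<^sup>+z. \<integral>\<^sup>+y. ennreal (gauss_hat d z) * ennreal (norm (P (y + z)) * norm (v y)) \<partial>lborel \<partial>lborel)"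
        using d by (intro nn_integral_mono) (auto simp: abs_mult ennreal_mult[symmetric] intro!: ennreal_leI mult_left_mono Cauchy_Schwarz_ineq2)
      also have "\<dots> \<le> (\<integral>\<^sup>+z. ennreal (gauss_hat d z) * ennreal B \<partial>lborel)"
        by (subst nn_integral_cmult) (auto intro!: nn_integral_mono mult_left_mono PvB)
      also have "\<dots> < \<infinity>"
        using integrable_gauss_hat[OF d] d
        by (simp add: nn_integral_multc nn_integral_eq_integral ennreal_mult_less_top)
      finally show "(\<integral>\<^sup>+z. \<integral>\<^sup>+y. ennreal (norm (gauss_hat d z * (P (y + z) \<bullet> v y))) \<partial>lborel \<partial>lborel) < \<infinity>" .
    qed measurable
    finally show ?thesis by (simp add: K_def)
  qed
  show "(\<integral>y. (\<integral>x. gauss_hat d (x - y) *\<^sub>R P x \<partial>lborel) \<bullet> v y \<partial>lborel)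
      = (\<integral>z. gauss_hat d z * (\<integral>y. P (y + z) \<bullet> v y \<partial>lborel) \<partial>lborel)" if d: "0 < d"
    using eq[OF d] by (simp add: K_def)
  show "\<bar>\<integral>y. (\<integral>x. gauss_hat d (x - y) *\<^sub>R P x \<partial>lborel) \<bullet> v y \<partial>lborel\<bar> \<le> (2 * pi) ^ 3 * (sqrt (\<integral>x. (norm (P x))\<^sup>2 \<partial>lborel) * sqrt (\<integral>x. (norm (v x))\<^sup>2 \<partial>lborel))"
    if d: "0 < d"
  proof -
    have i: "integrable lborel (\<lambda>z. B * gauss_hat d z)" using integrable_gauss_hat[OF d] by simp
    have le: "\<bar>gauss_hat d z * K z\<bar> \<le> B * gauss_hat d z" for z
      using KB[of z] d by (simp add: abs_mult mult.commute mult_right_mono)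
    have i2: "integrable lborel (\<lambda>z. gauss_hat d z * K z)"
      by (rule Bochner_Integration.integrable_bound[OF i]) (use le B0 d in \<open>auto simp: abs_mult\<close>)
    have "\<bar>\<integral>z. gauss_hat d z * K z \<partial>lborel\<bar> \<le> (\<integral>z. B * gauss_hat d z \<partial>lborel)"
      by (rule order_trans[OF integral_abs_bound]) (intro integral_mono integrable_abs i i2 le)
    then show ?thesis using d unfolding eq[OF d] B_def[symmetric] by (simp add: integral_gauss_hat mult.commute)
  qed
  have cont: "isCont (\<lambda>z. complex_of_real (K z)) 0"
  proof (rule continuous_at_sequentiallyI)
    fix X :: "nat \<Rightarrow> real^3" assume X: "X \<longlonglongrightarrow> 0"
    have "(\<lambda>n. K (X n)) \<longlonglongrightarrow> K 0"
    proof (rule LIM_zero_cancel, rule tendsto_rabs_zero_cancel)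
      have lim: "(\<lambda>n. sqrt (\<integral>x. (norm (P (x + X n) - P x))\<^sup>2 \<partial>lborel) * sqrt (\<integral>x. (norm (v x))\<^sup>2 \<partial>lborel)) \<longlonglongrightarrow> 0"
        using tendsto_mult[OF tendsto_real_sqrt[OF L2_translation_continuous[OF P X]] tendsto_const[of "sqrt (\<integral>x. (norm (v x))\<^sup>2 \<partial>lborel)"]] by simp
      show "(\<lambda>n. \<bar>K (X n) - K 0\<bar>) \<longlonglongrightarrow> 0"
      proof (rule tendsto_sandwich[OF _ _ tendsto_const lim]; intro always_eventually allI)
        fix n
        have "K (X n) - K 0 = (\<integral>x. (P (x + X n) - P x) \<bullet> v x \<partial>lborel)"
          unfolding K_def
          using L2_inner_integrable[OF L2_shift[OF P, of "X n"] v] L2_inner_integrable[OF P v]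
          by (simp add: inner_diff_left)
        then show "\<bar>K (X n) - K 0\<bar> \<le> sqrt (\<integral>x. (norm (P (x + X n) - P x))\<^sup>2 \<partial>lborel) * sqrt (\<integral>x. (norm (v x))\<^sup>2 \<partial>lborel)"
          using L2_inner_bound[OF L2_diff[OF L2_shift[OF P, of "X n"] P] v] by simp
      qed simp
    qed
    then show "(\<lambda>n. complex_of_real (K (X n))) \<longlonglongrightarrow> complex_of_real (K 0)" by (intro tendsto_of_real)
  qed
  have "(\<lambda>n. \<integral>y. complex_of_real (K y) * of_real (gauss_hat (1 / real (Suc n)) (0 - y)) \<partial>lborel) \<longlonglongrightarrow> of_real ((2 * pi) ^ 3) * complex_of_real (K 0)"
    by (rule gauss_hat_approximates[OF _ _ cont, of B]) (use KB in auto)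
  moreover have "(\<integral>y. complex_of_real (K y) * of_real (gauss_hat d (0 - y)) \<partial>lborel) = of_real (\<integral>z. gauss_hat d z * K z \<partial>lborel)" for d
    unfolding integral_complex_of_real[symmetric]
    by (intro Bochner_Integration.integral_cong refl) (simp add: gauss_hat_def gauss_def)
  ultimately have "(\<lambda>n. complex_of_real (\<integral>z. gauss_hat (1 / real (Suc n)) z * K z \<partial>lborel)) \<longlonglongrightarrow> of_real ((2 * pi) ^ 3 * K 0)"
    by (simp only: of_real_mult)
  then have "(\<lambda>n. \<integral>z. gauss_hat (1 / real (Suc n)) z * K z \<partial>lborel) \<longlonglongrightarrow> (2 * pi) ^ 3 * K 0"
    by (simp only: tendsto_of_real_iff)
  then show "(\<lambda>n. \<integral>y. (\<integral>x. gauss_hat (1 / real (Suc n)) (x - y) *\<^sub>R P x \<partial>lborel) \<bullet> v y \<partial>lborel)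
      \<longlonglongrightarrow> (2 * pi) ^ 3 * (\<integral>x. P x \<bullet> v x \<partial>lborel)"
    by (subst eq) (simp_all add: K_def)
qed

section \<open>Conservation of energy\<close>

lemma integral_Icc_reflect:
  fixes f :: "real \<Rightarrow> real"
  shows "integral {0..h} (\<lambda>r. f (h - r)) = integral {0..h} f"
  using Henstock_Kurzweil_Integration.integral_reflect_real[of 0 "-h" "\<lambda>x. f (h + x)"] integral_shift_Icc_real[of "-h" 0 f h]
  by (simp add: o_def)

text \<open>The kernel is \<open>G s s' = \<langle>A u(s), u(s')\<rangle>\<close>; the hypothesis on \<open>G\<close> is
  \<open>\<langle>A (u b - u a), \<integral>\<^sub>a\<^sup>b u\<rangle> = 0\<close>. Since \<open>u\<close> is not differentiable in time, this is averaged
  over all \<open>a\<close>, with \<open>b - a = h\<close> fixed, which leaves only boundary terms.\<close>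

lemma diagonal_constant:
  fixes G :: "real \<Rightarrow> real \<Rightarrow> real"
  assumes cont: "continuous_on UNIV (\<lambda>(s, r). G s r)"
    and sym: "\<And>s r. G s r = G r s"
    and skew: "\<And>a b. 0 \<le> a \<Longrightarrow> a \<le> b \<Longrightarrow> integral {a..b} (\<lambda>s. G b s - G a s) = 0"
    and T: "0 \<le> T"
  shows "G T T = G 0 0"
proof -
  have contG: "continuous_on S (\<lambda>x. G (f x) (g x))" if "continuous_on S f" "continuous_on S g" for S :: "'x::topological_space set" and f g
    using continuous_on_compose2[OF cont, of S "\<lambda>x. (f x, g x)"] that by (simp add: continuous_on_Pair)
  \<comment> \<open>The first argument of \<open>G\<close> runs ahead of the second by the lag
    \<open>r\<close>. \<open>D\<close> compares both ends of the time interval, and the claim is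
    that it vanishes at the origin.\<close>
  define D where "D v r = G (T + v + r) (T + v) - G (v + r) v" for v r
  have contD: "continuous_on S (\<lambda>x. D (f x) (g x))" if "continuous_on S f" "continuous_on S g" for S :: "'x::topological_space set" and f g
    unfolding D_def by (intro continuous_intros contG that)
  \<comment> \<open>After averaging over the left endpoint, both terms are integrals of the same
    function of v at fixed lag \<open>r\<close>, over ranges displaced by h - r. The common part
    cancels and two strips of length h - r remain, one at each end.\<close>
  have zero: "integral {0..h} (\<lambda>r. integral {0..h - r} (\<lambda>v. D v r)) = 0" if h: "0 \<le> h" for h
  proof -
    have i1: "(\<lambda>t. G (t + r) t) integrable_on {a..b}" for a b r
      by (intro integrable_continuous_real contG continuous_intros)
    have i2: "(\<lambda>t. G (t + h) (t + r)) integrable_on {a..b}" for a b r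
      by (intro integrable_continuous_real contG continuous_intros)
    have shiftG: "integral {0..T} (\<lambda>t. G (t + h) (t + (h - r))) = integral {h - r..T + (h - r)} (\<lambda>v. G (v + r) v)" for r
    proof -
      have "(\<lambda>v. G (v + r) v) \<circ> (+) (h - r) = (\<lambda>t. G (t + h) (t + (h - r)))"
        by (rule ext) (simp add: algebra_simps)
      then show ?thesis
        using integral_shift_Icc_real[of 0 T "\<lambda>v. G (v + r) v" "h - r"] by simp
    qed
    have "0 = integral {0..T} (\<lambda>t. integral {0..h} (\<lambda>r. G (t + h) (t + r) - G t (t + r)))"
    proof -
      have "integral {0..h} (\<lambda>r. G (t + h) (t + r) - G t (t + r)) = 0" if "t \<in> {0..T}" for t
        using skew[of t "t + h"] that h integral_shift_Icc_real[of 0 h "\<lambda>s. G (t + h) s - G t s" t]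
        by (simp add: o_def add.commute)
      then have "integral {0..T} (\<lambda>t. integral {0..h} (\<lambda>r. G (t + h) (t + r) - G t (t + r))) = integral {0..T} (\<lambda>t. 0)"
        by (intro Henstock_Kurzweil_Integration.integral_cong) auto
      then show ?thesis by simp
    qed
    also have "\<dots> = integral {0..h} (\<lambda>r. integral {0..T} (\<lambda>t. G (t + h) (t + r) - G t (t + r)))"
    proof -
      have "continuous_on (cbox (0, 0) (T, h)) (\<lambda>(t, r). G (t + h) (t + r) - G t (t + r))"
        unfolding split_def by (intro continuous_intros contG)
      from integral_swap_continuous[OF this] show ?thesis by simp
    qed
    also have "\<dots> = integral {0..h} (\<lambda>r. integral {0..T} (\<lambda>t. G (t + h) (t + r)) - integral {0..T} (\<lambda>t. G (t + r) t))"
    proof (rule Henstock_Kurzweil_Integration.integral_cong)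
      fix r
      have "integral {0..T} (\<lambda>t. G (t + h) (t + r) - G t (t + r)) = integral {0..T} (\<lambda>t. G (t + h) (t + r) - G (t + r) t)"
        by (intro Henstock_Kurzweil_Integration.integral_cong) (simp add: sym)
      then show "integral {0..T} (\<lambda>t. G (t + h) (t + r) - G t (t + r)) = integral {0..T} (\<lambda>t. G (t + h) (t + r)) - integral {0..T} (\<lambda>t. G (t + r) t)"
        by (simp only: Henstock_Kurzweil_Integration.integral_diff[OF i2 i1])
    qed
    also have "\<dots> = integral {0..h} (\<lambda>r. integral {0..T} (\<lambda>t. G (t + h) (t + r))) - integral {0..h} (\<lambda>r. integral {0..T} (\<lambda>t. G (t + r) t))"
    proof (rule Henstock_Kurzweil_Integration.integral_diff)
      have "continuous_on ({0..h} \<times> cbox 0 T) (\<lambda>(r, t). G (t + h) (t + r))" "continuous_on ({0..h} \<times> cbox 0 T) (\<lambda>(r, t). G (t + r) t)"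
        unfolding split_def by (intro continuous_intros contG)+
      from this[THEN integral_continuous_on_param]
      show "(\<lambda>r. integral {0..T} (\<lambda>t. G (t + h) (t + r))) integrable_on {0..h}" "(\<lambda>r. integral {0..T} (\<lambda>t. G (t + r) t)) integrable_on {0..h}"
        by (auto intro!: integrable_continuous_real)
    qed
    \<comment> \<open>This term has lag h - r; reflecting \<open>r\<close> gives it the lag
      \<open>r\<close> of the other term.\<close>
    also have "integral {0..h} (\<lambda>r. integral {0..T} (\<lambda>t. G (t + h) (t + r)))
       = integral {0..h} (\<lambda>r. integral {0..T} (\<lambda>t. G (t + h) (t + (h - r))))"
      by (rule integral_Icc_reflect[symmetric])
    also have "\<dots> = integral {0..h} (\<lambda>r. integral {h - r..T + (h - r)} (\<lambda>v. G (v + r) v))"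
      by (simp only: shiftG)
    also have "\<dots> - integral {0..h} (\<lambda>r. integral {0..T} (\<lambda>t. G (t + r) t))
        = integral {0..h} (\<lambda>r. integral {h - r..T + (h - r)} (\<lambda>v. G (v + r) v) - integral {0..T} (\<lambda>t. G (t + r) t))"
    proof (rule Henstock_Kurzweil_Integration.integral_diff[symmetric])
      have c1: "continuous_on ({0..h} \<times> cbox 0 T) (\<lambda>(r, t). G (t + h) (t + (h - r)))" and c2: "continuous_on ({0..h} \<times> cbox 0 T) (\<lambda>(r, t). G (t + r) t)"
        unfolding split_def by (intro continuous_intros contG)+
      from c2[THEN integral_continuous_on_param]
      show "(\<lambda>r. integral {0..T} (\<lambda>t. G (t + r) t)) integrable_on {0..h}"
        by (auto intro!: integrable_continuous_real)
      have "(\<lambda>r. integral {0..T} (\<lambda>t. G (t + h) (t + (h - r)))) integrable_on {0..h}"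
        using c1[THEN integral_continuous_on_param] by (auto intro!: integrable_continuous_real)
      then show "(\<lambda>r. integral {h - r..T + (h - r)} (\<lambda>v. G (v + r) v)) integrable_on {0..h}"
        by (simp only: shiftG)
    qed
    also have "\<dots> = integral {0..h} (\<lambda>r. integral {0..h - r} (\<lambda>v. D v r))"
    proof (rule Henstock_Kurzweil_Integration.integral_cong)
      fix r assume r: "r \<in> {0..h}"
      have "integral {0..h - r} (\<lambda>v. D v r) = integral {0..h - r} (\<lambda>v. G (T + v + r) (T + v)) - integral {0..h - r} (\<lambda>v. G (v + r) v)"
        unfolding D_def by (intro Henstock_Kurzweil_Integration.integral_diff integrable_continuous_real contG continuous_intros)
      also have "integral {0..h - r} (\<lambda>v. G (T + v + r) (T + v)) = integral {T..T + (h - r)} (\<lambda>v. G (v + r) v)"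
        using integral_shift_Icc_real[of 0 "h - r" "\<lambda>v. G (v + r) v" T] by (simp add: o_def add.commute)
      finally show "integral {h - r..T + (h - r)} (\<lambda>v. G (v + r) v) - integral {0..T} (\<lambda>t. G (t + r) t) = integral {0..h - r} (\<lambda>v. D v r)"
        using Henstock_Kurzweil_Integration.integral_combine[OF _ _ i1[of r 0 "T + (h - r)"], of T]
          Henstock_Kurzweil_Integration.integral_combine[OF _ _ i1[of r 0 "T + (h - r)"], of "h - r"] r T by simp
    qed
    finally show ?thesis ..
  qed
  \<comment> \<open>Near the origin \<open>D\<close> would keep the sign of its value there, and its
    integral over a small triangle could not vanish. The factor e, taken as 1 and -1 below, treats
    both signs at once.\<close>
  have "\<not> 0 < e * D 0 0" for e :: real
  proof
    assume pos: "0 < e * D 0 0"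
    have "isCont (\<lambda>x. e * D (fst x) (snd x)) (0, 0)"
      using contD[of UNIV fst snd] by (simp add: continuous_on_eq_continuous_at continuous_on_fst continuous_on_snd continuous_intros)
    then obtain d where d: "d > 0" "\<And>x. dist x (0, 0) < d \<Longrightarrow> \<bar>e * D (fst x) (snd x) - e * D 0 0\<bar> < e * D 0 0 / 2"
      using pos unfolding continuous_at_eps_delta dist_real_def
      by (metis fst_conv half_gt_zero snd_conv)
    \<comment> \<open>On the square of side d / 3 the two coordinates add up to less than d.\<close>
    define h where "h = d / 3"
    define m where "m = e * D 0 0 / 2"
    have m: "0 < m" using pos by (simp add: m_def)
    have h: "0 < h" using d by (simp add: h_def)
    have low: "m \<le> e * D v r" if "v \<in> {0..h}" "r \<in> {0..h}" for v r
    proof -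
      have "dist (v, r) (0, 0) \<le> dist v 0 + dist r 0"
        by (simp add: dist_Pair_Pair sqrt_sum_squares_le_sum_abs)
      also have "\<dots> < d" using that h by (simp add: h_def)
      finally show ?thesis using d(2)[of "(v, r)"] by (simp add: m_def abs_if split: if_splits)
    qed
    have inner: "m * (h - r) \<le> integral {0..h - r} (\<lambda>v. e * D v r)" if r: "r \<in> {0..h}" for r
    proof -
      have "integral {0..h - r} (\<lambda>v. m) \<le> integral {0..h - r} (\<lambda>v. e * D v r)"
        using r low by (intro integral_le integrable_continuous_real continuous_intros contD) auto
      then show ?thesis using r by (simp add: mult.commute)
    qed
    \<comment> \<open>The upper limit of integration moves with \<open>r\<close>. The substitution v
      = (h - r) w fixes it, so that continuity of parametric integrals applies; at r = h both sides
      are 0.\<close>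
    have c: "continuous_on {0..h} (\<lambda>r. integral {0..h - r} (\<lambda>v. e * D v r))"
    proof -

      have "continuous_on {0..h} (\<lambda>r. integral (cbox 0 1) (\<lambda>w. (h - r) * (e * D ((h - r) * w) r)))"
      proof (rule integral_continuous_on_param)
        show "continuous_on ({0..h} \<times> cbox 0 1) (\<lambda>(r, w). (h - r) * (e * D ((h - r) * w) r))"
          unfolding split_def by (intro continuous_intros contD)
      qed
      moreover have "integral (cbox 0 1) (\<lambda>w. (h - r) * (e * D ((h - r) * w) r)) = integral {0..h - r} (\<lambda>v. e * D v r)" if r: "r \<in> {0..h}" for r
      proof (cases "r = h")
        case False
        then have hr: "0 < h - r" using r by simp
        have "((\<lambda>v. e * D v r) has_integral integral {0..h - r} (\<lambda>v. e * D v r)) (cbox 0 (h - r))"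
          unfolding cbox_interval by (intro integrable_integral integrable_continuous_real continuous_intros contD)
        from has_integral_affinity[OF this, of "h - r" 0] hr
        have "((\<lambda>w. e * D ((h - r) * w) r) has_integral (1 / (h - r)) * integral {0..h - r} (\<lambda>v. e * D v r)) {0..1}"
          by (simp add: image_affinity_cbox content_real_if)
        from integral_unique[OF has_integral_mult_right[OF this, of "h - r"]] hr show ?thesis
          by (simp only: cbox_interval) simp
      qed simp
      ultimately show ?thesis by (rule continuous_on_eq)
    qed
    have "integral {0..h} (\<lambda>r. m * (h - r)) \<le> integral {0..h} (\<lambda>r. integral {0..h - r} (\<lambda>v. e * D v r))"
      using inner by (intro integral_le integrable_continuous_real c continuous_intros) auto
    also have "\<dots> = e * integral {0..h} (\<lambda>r. integral {0..h - r} (\<lambda>v. D v r))"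
      by simp
    also have "\<dots> = 0" using zero[of h] h by simp
    also have "integral {0..h} (\<lambda>r. m * (h - r)) = integral {0..h} (\<lambda>r. m * r)"
      by (rule integral_Icc_reflect)
    also have "\<dots> = m * (h\<^sup>2 / 2)" using h by (simp add: ident_has_integral[THEN integral_unique])
    finally show False using m h by (simp add: mult_le_0_iff)
  qed
  from this[of 1] this[of "-1"] have "D 0 0 = 0" by auto
  then show ?thesis by (simp add: D_def)
qed

section \<open>Energy conservation for an abstract symmetric first-order system\<close>

lemma measurable_fst_borel [measurable]: "fst \<in> borel_measurable (borel :: ('a::second_countable_topology \<times> 'b::second_countable_topology) measure)"
  unfolding borel_prod[symmetric] by measurable

lemma measurable_snd_borel [measurable]: "snd \<in> borel_measurable (borel :: ('a::second_countable_topology \<times> 'b::second_countable_topology) measure)"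
  unfolding borel_prod[symmetric] by measurable

lemma measurable_case_prodD:
  fixes u :: "'a::topological_space \<Rightarrow> 'b::topological_space \<Rightarrow> 'c::topological_space"
  assumes "(\<lambda>(t, x). u t x) \<in> borel_measurable (borel \<Otimes>\<^sub>M borel)"
    and "f \<in> borel_measurable M" "g \<in> borel_measurable M"
  shows "(\<lambda>w. u (f w) (g w)) \<in> borel_measurable M"
  using measurable_compose[OF measurable_Pair[OF assms(2,3)] assms(1)] by simp

lemma emeasure_lborel_Icc_finite [simp]: "emeasure lborel {a..b::real} < \<top>"
  by (simp add: emeasure_lborel_Icc_eq)

text \<open>Pointwise linear maps on a real inner product space cover both left multiplication
  (forward equation) and right multiplication (adjoint equation) of complex matrices. Time runs over
  all reals, solutions being extended to negative times by their initial value, so that continuity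
  in time carries no boundary condition. The equation is required for Gaussian test
  functions.\<close>

locale symmetric_evolution =
  fixes u :: "real \<Rightarrow> real^3 \<Rightarrow> 'b::euclidean_space"
    and A :: "real^3 \<Rightarrow> 'b \<Rightarrow> 'b"
    and D :: "3 \<Rightarrow> 'b \<Rightarrow> 'b"
    and c C :: real
  assumes A_linear: "linear (A x)"
    and A_sym: "A x a \<bullet> b = a \<bullet> A x b"
    and A_le: "norm (A x a) \<le> C * norm a"
    and A_ge: "c * (norm a)\<^sup>2 \<le> A x a \<bullet> a"
    and A_meas: "(\<lambda>(x, a). A x a) \<in> borel_measurable (borel \<Otimes>\<^sub>M borel)"
    and c_pos: "0 < c"
    and D_linear: "linear (D j)"
    and D_sym: "D j a \<bullet> b = a \<bullet> D j b"
    and u_meas: "(\<lambda>(t, x). u t x) \<in> borel_measurable (borel \<Otimes>\<^sub>M borel)"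
    and u_L2: "L2 (u t)"
    and u_cont: "X \<longlonglongrightarrow> t \<Longrightarrow> (\<lambda>n. \<integral>x. (norm (u (X n) x - u t x))\<^sup>2 \<partial>lborel) \<longlonglongrightarrow> 0"
    and weak: "0 \<le> t \<Longrightarrow> 0 < d \<Longrightarrow>
      (\<integral>x. gauss d (x - y) *\<^sub>R A x (u t x - u 0 x) \<partial>lborel)
      = (LBINT s:{0..t}. (\<integral>x. (\<Sum>j\<in>UNIV. gauss_deriv d j (x - y) *\<^sub>R D j (u s x)) \<partial>lborel))"
begin

lemmas A_measurable [measurable (raw)] = measurable_case_prodD[OF A_meas]
lemmas u_measurable [measurable (raw)] = measurable_case_prodD[OF u_meas]

lemma D_measurable [measurable]: "D j \<in> borel_measurable borel"
  by (intro borel_measurable_continuous_onI linear_continuous_on D_linear linear_conv_bounded_linear[THEN iffD1])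

lemma L2_A: "L2 f \<Longrightarrow> L2 (\<lambda>x. A x (f x))"
proof -
  assume f: "L2 f"
  note [measurable] = L2_D(1)[OF f]
  show ?thesis by (rule L2_bound[OF f _ A_le]) measurable
qed

lemma D_bounded: obtains K where "0 < K" "\<And>j a. norm (D j a) \<le> K * norm a"
proof -
  have "\<exists>B>0. \<forall>a. norm (D j a) \<le> B * norm a" for j
    using linear_bounded_pos[OF D_linear] by blast
  then obtain B where B: "\<And>j. 0 < B j" "\<And>j a. norm (D j a) \<le> B j * norm a" by metis
  have "norm (D j a) \<le> (\<Sum>j\<in>UNIV. B j) * norm a" for j a
    by (rule order_trans[OF B(2)]) (auto intro!: mult_right_mono member_le_sum less_imp_le[OF B(1)])
  then show ?thesis using that[of "\<Sum>j\<in>UNIV. B j"] B(1) by (simp add: sum_pos)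
qed

definition N :: "real \<Rightarrow> real" where "N t = (\<integral>x. (norm (u t x))\<^sup>2 \<partial>lborel)"
text \<open>The energy pairing between two times; the diagonal is the energy.\<close>

definition G :: "real \<Rightarrow> real \<Rightarrow> real" where "G s r = (\<integral>x. A x (u s x) \<bullet> u r x \<partial>lborel)"

lemma G_sym: "G s r = G r s"
  unfolding G_def by (intro Bochner_Integration.integral_cong refl) (metis A_sym inner_commute)

lemma C_nonneg: "0 \<le> C"
proof -
  obtain b :: 'b where "b \<in> Basis" using nonempty_Basis by blast
  then have "0 \<le> C * norm b" "norm b = 1"
    using norm_ge_zero[THEN order_trans, OF A_le[of _ b]] by auto
  then show ?thesis by simp
qed

lemma A_pairing_le:
  assumes f: "L2 f" and g: "L2 g"
  shows "\<bar>\<integral>x. A x (f x) \<bullet> g x \<partial>lborel\<bar> \<le> C * (sqrt (\<integral>x. (norm (f x))\<^sup>2 \<partial>lborel) * sqrt (\<integral>x. (norm (g x))\<^sup>2 \<partial>lborel))"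
proof -
  have "\<bar>\<integral>x. A x (f x) \<bullet> g x \<partial>lborel\<bar> \<le> (\<integral>x. C * (norm (f x) * norm (g x)) \<partial>lborel)"
  proof (rule order_trans[OF integral_abs_bound], intro integral_mono)
    show "integrable lborel (\<lambda>x. \<bar>A x (f x) \<bullet> g x\<bar>)" using L2_inner_integrable[OF L2_A[OF f] g] by simp
    show "integrable lborel (\<lambda>x. C * (norm (f x) * norm (g x)))" using L2_norm_mult_integrable[OF f g] by simp
    show "\<bar>A x (f x) \<bullet> g x\<bar> \<le> C * (norm (f x) * norm (g x))" for x
      unfolding mult.assoc[symmetric]
      by (rule order_trans[OF Cauchy_Schwarz_ineq2]) (intro mult_right_mono A_le norm_ge_zero)
  qed
  also have "\<dots> \<le> C * (sqrt (\<integral>x. (norm (f x))\<^sup>2 \<partial>lborel) * sqrt (\<integral>x. (norm (g x))\<^sup>2 \<partial>lborel))"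
    using L2_Cauchy_Schwarz[OF f g] C_nonneg by (simp add: mult_left_mono)
  finally show ?thesis .
qed

text \<open>G(X,Y) - G(s,r) splits into the pairing of u(X) - u(s) with u(Y) and that of u(s) with
  u(Y) - u(r). The norm at the moving time Y is controlled by its distance to the limit
  time.\<close>

lemma G_continuous: "continuous_on UNIV (\<lambda>(s, r). G s r)"
proof (rule continuous_on_sequentiallyI)
  fix w :: "nat \<Rightarrow> real \<times> real" and a
  assume w: "w \<longlonglongrightarrow> a"
  define X where "X n = fst (w n)" for n
  define Y where "Y n = snd (w n)" for n
  define s r where "s = fst a" and "r = snd a"
  have X: "X \<longlonglongrightarrow> s" and Y: "Y \<longlonglongrightarrow> r"
    unfolding X_def Y_def s_def r_def using w by (auto intro!: tendsto_fst tendsto_snd)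
  define dX where "dX n = (\<integral>x. (norm (u (X n) x - u s x))\<^sup>2 \<partial>lborel)" for n
  define dY where "dY n = (\<integral>x. (norm (u (Y n) x - u r x))\<^sup>2 \<partial>lborel)" for n
  have dX0: "dX \<longlonglongrightarrow> 0" and dY0: "dY \<longlonglongrightarrow> 0"
    unfolding dX_def dY_def by (intro u_cont X Y)+
  have NY: "N (Y n) \<le> 2 * dY n + 2 * N r" for n
  proof -
    have "N (Y n) \<le> (\<integral>x. 2 * (norm (u (Y n) x - u r x))\<^sup>2 + 2 * (norm (u r x))\<^sup>2 \<partial>lborel)"
      unfolding N_def
    proof (intro integral_mono Bochner_Integration.integrable_add integrable_mult_right L2_D(2) u_L2 L2_diff)
      fix x
      have "(norm (u (Y n) x))\<^sup>2 \<le> (norm (u (Y n) x - u r x) + norm (u r x))\<^sup>2"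
        using norm_triangle_ineq[of "u (Y n) x - u r x" "u r x"] by (intro power_mono) auto
      then show "(norm (u (Y n) x))\<^sup>2 \<le> 2 * (norm (u (Y n) x - u r x))\<^sup>2 + 2 * (norm (u r x))\<^sup>2"
        using two_mult_le_squares[of "norm (u (Y n) x - u r x)" "norm (u r x)"] by (simp add: power2_sum)
    qed
    also have "\<dots> = 2 * dY n + 2 * N r"
      using L2_D(2)[OF L2_diff[OF u_L2 u_L2, of "Y n" r]] L2_D(2)[OF u_L2, of r] by (simp add: dY_def N_def)
    finally show ?thesis .
  qed
  have lim: "(\<lambda>n. C * (sqrt (dX n) * sqrt (2 * dY n + 2 * N r)) + C * (sqrt (N s) * sqrt (dY n))) \<longlonglongrightarrow> C * (sqrt 0 * sqrt (2 * 0 + 2 * N r)) + C * (sqrt (N s) * sqrt 0)"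
    by (intro tendsto_intros dX0 dY0)
  have "(\<lambda>n. G (X n) (Y n)) \<longlonglongrightarrow> G s r"
  proof (rule LIM_zero_cancel, rule tendsto_rabs_zero_cancel)
    show "(\<lambda>n. \<bar>G (X n) (Y n) - G s r\<bar>) \<longlonglongrightarrow> 0"
    proof (rule tendsto_sandwich[OF _ _ tendsto_const]; (intro always_eventually allI)?)
      show "(\<lambda>n. C * (sqrt (dX n) * sqrt (2 * dY n + 2 * N r)) + C * (sqrt (N s) * sqrt (dY n))) \<longlonglongrightarrow> 0"
        using lim by simp
      fix n
      have "G (X n) (Y n) - G s r = (\<integral>x. A x (u (X n) x - u s x) \<bullet> u (Y n) x \<partial>lborel) + (\<integral>x. A x (u s x) \<bullet> (u (Y n) x - u r x) \<partial>lborel)"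
        unfolding G_def
        by (simp add: linear_diff[OF A_linear] inner_diff_left inner_diff_right L2_inner_integrable L2_A u_L2)
      moreover have "\<bar>\<integral>x. A x (u (X n) x - u s x) \<bullet> u (Y n) x \<partial>lborel\<bar> \<le> C * (sqrt (dX n) * sqrt (N (Y n)))"
        unfolding dX_def N_def by (intro A_pairing_le L2_diff u_L2)
      moreover have "C * (sqrt (dX n) * sqrt (N (Y n))) \<le> C * (sqrt (dX n) * sqrt (2 * dY n + 2 * N r))"
        using NY[of n] by (intro mult_left_mono C_nonneg) (auto simp: dX_def)
      moreover have "\<bar>\<integral>x. A x (u s x) \<bullet> (u (Y n) x - u r x) \<partial>lborel\<bar> \<le> C * (sqrt (N s) * sqrt (dY n))"
        unfolding dY_def N_def by (intro A_pairing_le L2_diff u_L2)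
      ultimately show "\<bar>G (X n) (Y n) - G s r\<bar> \<le> C * (sqrt (dX n) * sqrt (2 * dY n + 2 * N r)) + C * (sqrt (N s) * sqrt (dY n))"
        by linarith
    qed simp
  qed
  then show "(\<lambda>n. case w n of (s, r) \<Rightarrow> G s r) \<longlonglongrightarrow> (case a of (s, r) \<Rightarrow> G s r)"
    by (simp add: X_def Y_def s_def r_def split_def)
qed

lemma G_continuous': "continuous_on S f \<Longrightarrow> continuous_on S g \<Longrightarrow> continuous_on S (\<lambda>x. G (f x) (g x))"
  for S :: "'x::topological_space set"
  using continuous_on_compose2[OF G_continuous, of S "\<lambda>x. (f x, g x)"] by (simp add: continuous_on_Pair)

lemma N_le_G: "c * N t \<le> G t t"
proof -
  have "c * N t = (\<integral>x. c * (norm (u t x))\<^sup>2 \<partial>lborel)" by (simp add: N_def)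
  also have "\<dots> \<le> G t t"
    unfolding G_def using L2_D(2)[OF u_L2, of t]
    by (intro integral_mono A_ge L2_inner_integrable L2_A u_L2) auto
  finally show ?thesis .
qed

text \<open>Coercivity bounds the norm by the energy, which is continuous in time and hence bounded
  on a compact interval.\<close>

lemma N_bounded: obtains B where "0 \<le> B" "\<And>s. s \<in> {a..b} \<Longrightarrow> N s \<le> B"
proof -
  have "compact ((\<lambda>s. G s s) ` {a..b})"
    by (intro compact_continuous_image G_continuous' continuous_intros) auto
  then have "bounded ((\<lambda>s. G s s) ` {a..b})" by (rule compact_imp_bounded)
  then obtain B where "\<forall>s\<in>{a..b}. \<bar>G s s\<bar> \<le> B" unfolding bounded_iff by auto
  then have B: "\<And>s. s \<in> {a..b} \<Longrightarrow> \<bar>G s s\<bar> \<le> B" by blast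
  have "N s \<le> \<bar>B\<bar> / c" if "s \<in> {a..b}" for s
    using N_le_G[of s] B[OF that] c_pos by (simp add: pos_le_divide_eq mult.commute)
  then show ?thesis using that[of "\<bar>B\<bar> / c"] c_pos by simp
qed

lemma slab_square_integrable: "integrable lborel (\<lambda>(s, x). indicator {a..b} s * (norm (u s x))\<^sup>2)"
proof (rule integrable_lborel_prodI)
  obtain B where B: "0 \<le> B" "\<And>s. s \<in> {a..b} \<Longrightarrow> N s \<le> B" using N_bounded by blast
  have "(\<integral>\<^sup>+s. \<integral>\<^sup>+x. ennreal (norm (indicator {a..b} s * (norm (u s x))\<^sup>2)) \<partial>lborel \<partial>lborel) \<le> (\<integral>\<^sup>+s. ennreal B * indicator {a..b} s \<partial>lborel)"
  proof (intro nn_integral_mono)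
    fix s
    have "(\<integral>\<^sup>+x. ennreal ((norm (u s x))\<^sup>2) \<partial>lborel) = ennreal (N s)"
      unfolding N_def by (intro nn_integral_eq_integral L2_D(2) u_L2) simp
    then show "(\<integral>\<^sup>+x. ennreal (norm (indicator {a..b} s * (norm (u s x))\<^sup>2)) \<partial>lborel) \<le> ennreal B * indicator {a..b} s"
      using B(2)[of s] by (auto simp: indicator_def intro: ennreal_leI)
  qed
  also have "\<dots> < \<infinity>"
    by (simp add: nn_integral_cmult_indicator ennreal_mult_less_top)
  finally show "(\<integral>\<^sup>+s. \<integral>\<^sup>+x. ennreal (norm (indicator {a..b} s * (norm (u s x))\<^sup>2)) \<partial>lborel \<partial>lborel) < \<infinity>" .
qed measurable

text \<open>The solution cut off to a time interval and read as one function on space-time. Time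
  integration then becomes part of the integration over a point, and the double pairing below can be
  antisymmetrised in two points.\<close>

definition slab :: "real \<Rightarrow> real \<Rightarrow> real \<times> (real^3) \<Rightarrow> 'b" where
  "slab a b X = indicator {a..b} (fst X) *\<^sub>R u (fst X) (snd X)"

lemma slab_measurable [measurable]: "slab a b \<in> borel_measurable borel"
  unfolding slab_def by measurable

text \<open>The kernel of D^j \<partial>_j applied to the Gaussian mollifier, acting on a
  vector.\<close>

definition flux :: "real \<Rightarrow> real^3 \<Rightarrow> 'b \<Rightarrow> 'b" where
  "flux d z a = (\<Sum>j\<in>UNIV. gauss_deriv d j z *\<^sub>R D j a)"

lemma flux_measurable [measurable (raw)]:
  "f \<in> borel_measurable M \<Longrightarrow> g \<in> borel_measurable M \<Longrightarrow> (\<lambda>w. flux d (f w) (g w)) \<in> borel_measurable M"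
  unfolding flux_def
  by (intro borel_measurable_sum borel_measurable_scaleR measurable_compose[OF _ borel_measurable_gauss_deriv]
      measurable_compose[OF _ D_measurable])

lemma flux_scaleR: "flux d z (r *\<^sub>R a) = r *\<^sub>R flux d z a"
  unfolding flux_def scaleR_sum_right
  by (intro sum.cong refl) (simp add: linear_scale[OF D_linear])

text \<open>Oddness of the derivative of the Gaussian, combined with the symmetry of every
  \<open>D j\<close>.\<close>

lemma flux_antisym: "flux d (x - y) a \<bullet> b = - (flux d (y - x) b \<bullet> a)"
proof -
  have "D j a \<bullet> b = D j b \<bullet> a" for j by (metis D_sym inner_commute)
  then show ?thesis
    unfolding flux_def inner_sum_left sum_negf[symmetric]
    by (intro sum.cong refl) (simp add: gauss_deriv_odd[of d _ x y])
qed

lemma flux_bound: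
  assumes d: "0 < d"
  obtains K where "0 \<le> K" "\<And>z a. norm (flux d z a) \<le> K * (wt z * norm a)"
proof -
  obtain K where K: "0 \<le> K" "\<And>j z. \<bar>gauss_deriv d j z\<bar> \<le> K * wt z" using gauss_deriv_bound[OF d] by blast
  obtain L where L: "0 < L" "\<And>j a. norm (D j a) \<le> L * norm a" using D_bounded by blast
  have "norm (flux d z a) \<le> (\<Sum>j\<in>(UNIV::3 set). K * wt z * (L * norm a))" for z a
    unfolding flux_def
    by (intro sum_norm_le) (use K L(2) in \<open>auto intro!: mult_mono\<close>)
  then have "norm (flux d z a) \<le> (3 * K * L) * (wt z * norm a)" for z a
    by (simp add: mult_ac)
  then show ?thesis using that[of "3 * K * L"] K(1) L(1) by simp
qed

lemma flux_slab_integrable: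
  assumes d: "0 < d"
  shows "integrable lborel (\<lambda>X. flux d (snd X - y) (slab a b X))"
proof -
  obtain K where K: "0 \<le> K" "\<And>z a. norm (flux d z a) \<le> K * (wt z * norm a)" using flux_bound[OF d] by blast
  have 1: "integrable lborel (\<lambda>(s, x). indicator {a..b} s * wt (x - y) :: real)"
  proof (rule integrable_lborel_prod_bound)
    show "integrable lborel (indicat_real {a..b})" by (simp add: integrable_indicator_iff)
    show "integrable lborel (\<lambda>x::real^3. wt (x - y))"
      using integrable_wt integrable_lborel_shift_iff[of "wt :: real^3 \<Rightarrow> real" "- y"] by simp
  qed (auto simp: abs_mult)
  have 2: "integrable lborel (\<lambda>X. (\<lambda>(s, x). indicator {a..b} s * wt (x - y)) X + (\<lambda>(s, x). indicator {a..b} s * (norm (u s x))\<^sup>2) X)"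
    by (intro Bochner_Integration.integrable_add 1 slab_square_integrable)
  show ?thesis
  proof (rule integrable_const_mult_bound[OF 2, of _ K])
    fix X :: "real \<times> (real^3)"
    obtain s x where X: "X = (s, x)" by (cases X)
    have "wt (x - y) * norm (u s x) \<le> wt (x - y) + (norm (u s x))\<^sup>2"
    proof -
      have "2 * (wt (x - y) * norm (u s x)) \<le> (wt (x - y))\<^sup>2 + (norm (u s x))\<^sup>2" by (rule two_mult_le_squares)
      moreover have "(wt (x - y))\<^sup>2 \<le> wt (x - y)"
        using wt_le_1[of "x - y"] by (simp add: power2_eq_square mult_left_le)
      moreover have "0 \<le> wt (x - y) * norm (u s x)" by simp
      ultimately show ?thesis by linarith
    qed
    then have "K * (wt (x - y) * norm (u s x)) \<le> K * (wt (x - y) + (norm (u s x))\<^sup>2)"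
      using K(1) by (rule mult_left_mono)
    then show "norm (flux d (snd X - y) (slab a b X)) \<le> K * ((\<lambda>(s, x). indicator {a..b} s * wt (x - y)) X + (\<lambda>(s, x). indicator {a..b} s * (norm (u s x))\<^sup>2) X)"
      using K(2)[of "x - y" "u s x"]
      by (auto simp: X slab_def indicator_def flux_scaleR intro: order_trans)
  qed measurable
qed

text \<open>The integrated equation starts at time 0. Subtracting it at \<open>a\<close> from that
  at \<open>b\<close> leaves the time integral over \<open>{a..b}\<close>, which Fubini merges with
  the spatial one.\<close>

lemma weak_slab:
  assumes ab: "0 \<le> a" "a \<le> b" and d: "0 < d"
  shows "(\<integral>x. gauss d (x - y) *\<^sub>R A x (u b x - u a x) \<partial>lborel) = (\<integral>X. flux d (snd X - y) (slab a b X) \<partial>lborel)"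
proof -
  define V where "V s = (\<integral>x. flux d (x - y) (u s x) \<partial>lborel)" for s
  have eqV: "(\<integral>x. flux d (x - y) (slab a b (s, x)) \<partial>lborel) = indicator {a..b} s *\<^sub>R V s" for s a b
    by (simp add: slab_def flux_scaleR V_def)
  have int: "integrable lborel (\<lambda>(s, x). flux d (x - y) (slab a b (s, x)))" for a b
    using flux_slab_integrable[OF d, of y a b] by (simp add: split_def)
  have si: "set_integrable lborel {a..b} V" for a b
    unfolding set_integrable_def using integrable_lborel_iterated(1)[OF int, of a b] by (simp add: eqV)
  have ig: "integrable lborel (\<lambda>x. gauss d (x - y) *\<^sub>R A x (u t x - u 0 x))" for t
  proof (rule Bochner_Integration.integrable_bound)
    have L: "L2 (\<lambda>x. A x (u t x - u 0 x))" by (intro L2_A L2_diff u_L2)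
    note [measurable] = L2_D(1)[OF L]
    have g2: "integrable lborel (\<lambda>x. gauss d (x - y))"
      using integrable_gauss[OF d] integrable_lborel_shift_iff[of "gauss d" "- y"] by simp
    then show "integrable lborel (\<lambda>x. gauss d (x - y) + (norm (A x (u t x - u 0 x)))\<^sup>2)"
      using L2_D(2)[OF L] by simp
    show "AE x in lborel. norm (gauss d (x - y) *\<^sub>R A x (u t x - u 0 x)) \<le> norm (gauss d (x - y) + (norm (A x (u t x - u 0 x)))\<^sup>2)"
    proof (intro AE_I2)
      fix x
      let ?g = "gauss d (x - y)" and ?n = "norm (A x (u t x - u 0 x))"
      have "2 * (?g * ?n) \<le> ?g\<^sup>2 + ?n\<^sup>2" by (rule two_mult_le_squares)
      moreover have "?g\<^sup>2 \<le> ?g"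
        using gauss_le_1[of d "x - y"] d by (simp add: power2_eq_square mult_left_le)
      moreover have "0 \<le> ?g * ?n" by simp
      ultimately have "?g * ?n \<le> ?g + ?n\<^sup>2" by linarith
      then show "norm (?g *\<^sub>R A x (u t x - u 0 x)) \<le> norm (?g + ?n\<^sup>2)" by simp
    qed
    show "(\<lambda>x. gauss d (x - y) *\<^sub>R A x (u t x - u 0 x)) \<in> borel_measurable lborel" by measurable
  qed
  have "(\<integral>x. gauss d (x - y) *\<^sub>R A x (u b x - u a x) \<partial>lborel)
      = (\<integral>x. gauss d (x - y) *\<^sub>R A x (u b x - u 0 x) - gauss d (x - y) *\<^sub>R A x (u a x - u 0 x) \<partial>lborel)"
    by (intro Bochner_Integration.integral_cong refl) (simp add: linear_diff[OF A_linear] scaleR_diff_right)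
  also have "\<dots> = (LBINT s:{0..b}. V s) - (LBINT s:{0..a}. V s)"
    using ig ab d weak[of b d y] weak[of a d y] by (simp add: V_def flux_def)
  also have "\<dots> = (LBINT s:{a..b}. V s)"
  proof -
    have "(LBINT s:{0..b}. V s) = integral {0..b} V" "(LBINT s:{0..a}. V s) = integral {0..a} V" "(LBINT s:{a..b}. V s) = integral {a..b} V"
      by (intro set_borel_integral_eq_integral si)+
    moreover have "integral {0..a} V + integral {a..b} V = integral {0..b} V"
      by (intro Henstock_Kurzweil_Integration.integral_combine ab set_borel_integral_eq_integral si)
    ultimately show ?thesis by (simp add: algebra_simps)
  qed
  also have "\<dots> = (\<integral>X. flux d (snd X - y) (slab a b X) \<partial>lborel)"
    using integrable_lborel_iterated(3)[OF int, of a b]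
    by (simp add: split_def eqV set_lebesgue_integral_def)
  finally show ?thesis .
qed

text \<open>The product of the two norms is bounded by the sum of their squares, each keeping the
  time indicator of the other point. A summand then has integrable mass in one point and, in the
  other, a factor whose integral is the same constant by translation invariance.\<close>

lemma slab_pair_integrable:
  assumes d: "0 < d"
  shows "integrable lborel (\<lambda>(X, Y). flux d (snd X - snd Y) (slab a b X) \<bullet> slab a b Y)"
proof -
  obtain K where K: "0 \<le> K" "\<And>z a. norm (flux d z a) \<le> K * (wt z * norm a)" using flux_bound[OF d] by blast
  define f where "f X Y = indicator {a..b} (fst Y) * wt (snd X - snd Y) * (norm (slab a b X))\<^sup>2" for X Y :: "real \<times> (real^3)"
  have f_nn: "0 \<le> f X Y" for X Y by (simp add: f_def)
  have sq: "integrable lborel (\<lambda>X. (norm (slab a b X))\<^sup>2)"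
  proof -
    have "(norm (slab a b X))\<^sup>2 = (\<lambda>(s, x). indicator {a..b} s * (norm (u s x))\<^sup>2) X" for X
      by (cases X) (simp add: slab_def indicator_def)
    then show ?thesis using slab_square_integrable[of a b] by simp
  qed
  have wint: "(\<integral>\<^sup>+Y. ennreal (indicator {a..b} (fst Y) * wt (x - snd Y)) \<partial>lborel) = emeasure lborel {a..b} * (\<integral>\<^sup>+y. ennreal (wt (y :: real^3)) \<partial>lborel)" for x :: "real^3"
  proof -
    have "(\<integral>\<^sup>+Y. ennreal (indicator {a..b} (fst Y) * wt (x - snd Y)) \<partial>lborel)
      = (\<integral>\<^sup>+s. \<integral>\<^sup>+y. indicator {a..b} s * ennreal (wt (x - y)) \<partial>lborel \<partial>lborel)"
      by (subst nn_integral_lborel_prod_iterated(1)) (auto simp: ennreal_mult ennreal_indicator)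
    also have "\<dots> = (\<integral>\<^sup>+s. indicator {a..b} s * (\<integral>\<^sup>+y. ennreal (wt (y :: real^3)) \<partial>lborel) \<partial>lborel)"
      using nn_integral_lborel_reflect[of "\<lambda>y::real^3. ennreal (wt y)" x]
      by (simp add: nn_integral_cmult)
    finally show ?thesis by (simp add: nn_integral_multc)
  qed
  have 1: "integrable lborel (\<lambda>(X, Y). f X Y)"
  proof (rule integrable_lborel_prodI)
    have "(\<integral>\<^sup>+X. \<integral>\<^sup>+Y. ennreal (norm (f X Y)) \<partial>lborel \<partial>lborel)
      = (\<integral>\<^sup>+X. (\<integral>\<^sup>+Y. ennreal (indicator {a..b} (fst Y) * wt (snd X - snd Y)) \<partial>lborel) * ennreal ((norm (slab a b X))\<^sup>2) \<partial>lborel)"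
      unfolding f_def by (subst nn_integral_multc[symmetric]) (auto simp: ennreal_mult)
    also have "\<dots> < \<infinity>"
      unfolding wint using sq integrable_wt[where 'a="real^3"]
      by (simp add: nn_integral_cmult nn_integral_eq_integral ennreal_mult_less_top emeasure_lborel_Icc_eq)
    finally show "(\<integral>\<^sup>+X. \<integral>\<^sup>+Y. ennreal (norm (f X Y)) \<partial>lborel \<partial>lborel) < \<infinity>" .
    show "(\<lambda>(X, Y). f X Y) \<in> borel_measurable (borel \<Otimes>\<^sub>M borel)" unfolding f_def by measurable
  qed
  have 2: "integrable lborel (\<lambda>(X, Y). f Y X)"
    using lborel_pair.integrable_product_swap[of "\<lambda>(X, Y). f X Y"] 1 by (simp add: lborel_prod)
  have 3: "integrable lborel (\<lambda>P. (\<lambda>(X, Y). f X Y) P + (\<lambda>(X, Y). f Y X) P)"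
    by (rule Bochner_Integration.integrable_add[OF 1 2])
  show ?thesis
  proof (rule integrable_const_mult_bound[OF 3, of _ K])
    have "(\<lambda>(X, Y). flux d (snd X - snd Y) (slab a b X) \<bullet> slab a b Y) \<in> borel_measurable (borel \<Otimes>\<^sub>M borel)" by measurable
    then show "(\<lambda>(X, Y). flux d (snd X - snd Y) (slab a b X) \<bullet> slab a b Y) \<in> borel_measurable lborel" by (simp add: borel_prod)
    fix P :: "(real \<times> (real^3)) \<times> (real \<times> (real^3))"
    obtain X Y where P: "P = (X, Y)" by (cases P)
    let ?p = "norm (slab a b X)" and ?q = "norm (slab a b Y)" and ?w = "wt (snd X - snd Y)"
    have "\<bar>flux d (snd X - snd Y) (slab a b X) \<bullet> slab a b Y\<bar> \<le> (K * (?w * ?p)) * ?q"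
      by (rule order_trans[OF Cauchy_Schwarz_ineq2]) (intro mult_right_mono K norm_ge_zero)
    also have "\<dots> = K * (?w * (?p * ?q))" by simp
    also have "\<dots> \<le> K * (f X Y + f Y X)"
    proof (rule mult_left_mono[OF _ K(1)])
      have "?p * ?q \<le> indicator {a..b} (fst Y) * ?p\<^sup>2 + indicator {a..b} (fst X) * ?q\<^sup>2"
      proof (cases "fst X \<in> {a..b} \<and> fst Y \<in> {a..b}")
        case True
        have "0 \<le> ?p * ?q" by simp
        with two_mult_le_squares[of ?p ?q] have "?p * ?q \<le> ?p\<^sup>2 + ?q\<^sup>2" by linarith
        then show ?thesis using True by simp
      qed (auto simp: slab_def)
      then have "?w * (?p * ?q) \<le> ?w * (indicator {a..b} (fst Y) * ?p\<^sup>2 + indicator {a..b} (fst X) * ?q\<^sup>2)"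
        by (rule mult_left_mono) simp
      then show "?w * (?p * ?q) \<le> f X Y + f Y X"
        by (simp add: f_def algebra_simps wt_minus[of "snd Y" "snd X"])
    qed
    finally show "norm ((\<lambda>(X, Y). flux d (snd X - snd Y) (slab a b X) \<bullet> slab a b Y) P) \<le> K * ((\<lambda>(X, Y). f X Y) P + (\<lambda>(X, Y). f Y X) P)"
      by (simp add: P)
  qed
qed

text \<open>The operator \<open>D\<^sup>j \<partial>\<^sub>j\<close> is skew-adjoint: exchanging the two copies of space-time changes the
  sign of the mollified pairing.\<close>

lemma slab_pair_zero:
  assumes d: "0 < d"
  shows "(\<integral>Y. (\<integral>X. flux d (snd X - snd Y) (slab a b X) \<partial>lborel) \<bullet> slab a b Y \<partial>lborel) = 0"
    and "integrable lborel (\<lambda>Y. (\<integral>X. flux d (snd X - snd Y) (slab a b X) \<partial>lborel) \<bullet> slab a b Y)"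
proof -
  define k where "k X Y = flux d (snd X - snd Y) (slab a b X) \<bullet> slab a b Y" for X Y
  have int: "integrable lborel (\<lambda>(X, Y). k X Y)"
    unfolding k_def by (rule slab_pair_integrable[OF d])
  have eq: "(\<integral>X. flux d (snd X - snd Y) (slab a b X) \<partial>lborel) \<bullet> slab a b Y = (\<integral>X. k X Y \<partial>lborel)" for Y
    unfolding k_def by (rule integral_inner_left[symmetric]) (rule flux_slab_integrable[OF d])
  have anti: "k X Y = - k Y X" for X Y
    unfolding k_def by (rule flux_antisym)
  have "(\<integral>Y. \<integral>X. k X Y \<partial>lborel \<partial>lborel) = (\<integral>X. \<integral>Y. k X Y \<partial>lborel \<partial>lborel)"
    by (rule integral_lborel_swap[OF int, symmetric])
  also have "\<dots> = - (\<integral>X. \<integral>Y. k Y X \<partial>lborel \<partial>lborel)"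
    by (subst anti) simp
  finally show "(\<integral>Y. (\<integral>X. flux d (snd X - snd Y) (slab a b X) \<partial>lborel) \<bullet> slab a b Y \<partial>lborel) = 0"
    unfolding eq by simp
  show "integrable lborel (\<lambda>Y. (\<integral>X. flux d (snd X - snd Y) (slab a b X) \<partial>lborel) \<bullet> slab a b Y)"
    unfolding eq by (rule integrable_lborel_iterated(2)[OF int])
qed

text \<open>The integrand is the pairing of A (u b - u a) with \<open>u s\<close>. Mollified by a
  Gaussian, the difference is the flux of the slab by the weak equation, and the pairing of flux and
  slab vanishes for every width; the width then tends to 0 under the time integral.\<close>

lemma G_skew:
  assumes ab: "0 \<le> a" "a \<le> b"
  shows "integral {a..b} (\<lambda>s. G b s - G a s) = 0"
proof -
  define P where "P x = A x (u b x - u a x)" for x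
  have P: "L2 P" unfolding P_def by (intro L2_A L2_diff u_L2)
  define M where "M n s = (\<integral>y. (\<integral>x. gauss_hat (1 / real (Suc n)) (x - y) *\<^sub>R P x \<partial>lborel) \<bullet> u s y \<partial>lborel)" for n s
  have PG: "(\<integral>x. P x \<bullet> u s x \<partial>lborel) = G b s - G a s" for s
    unfolding P_def G_def
    by (simp add: linear_diff[OF A_linear] inner_diff_left L2_inner_integrable L2_A u_L2)
  obtain B where B: "0 \<le> B" "\<And>s. s \<in> {a..b} \<Longrightarrow> N s \<le> B" using N_bounded by blast
  have M0: "(\<integral>s. indicator {a..b} s *\<^sub>R M n s \<partial>lborel) = 0" for n
  proof -
    \<comment> \<open>\<open>gauss_hat\<close> at parameter 1 / (n + 1) equals \<open>cn\<close>
      times \<open>gauss d\<close>: the weak equation is available for \<open>gauss\<close>, the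
      approximate identity for \<open>gauss_hat\<close>.\<close>
    define d where "d = 1 / (4 * (1 / real (Suc n)))"
    define cn where "cn = sqrt (pi / (1 / real (Suc n))) ^ 3"
    have d: "0 < d" by (simp add: d_def)
    have gh: "gauss_hat (1 / real (Suc n)) z = cn * gauss d z" for z
      by (simp add: gauss_hat_def d_def cn_def)
    define I where "I y = (\<integral>x. gauss d (x - y) *\<^sub>R P x \<partial>lborel)" for y
    have I: "(\<integral>X. flux d (snd X - y) (slab a b X) \<partial>lborel) = I y" for y
      unfolding I_def P_def by (rule weak_slab[OF ab d, symmetric])
    have "integrable lborel (\<lambda>(s, y). I y \<bullet> slab a b (s, y))"
      using slab_pair_zero(2)[OF d, of a b] by (simp add: I split_def)
    from integrable_lborel_iterated(3)[OF this]
    have "(\<integral>s. \<integral>y. I y \<bullet> slab a b (s, y) \<partial>lborel \<partial>lborel) = (\<integral>Y. I (snd Y) \<bullet> slab a b Y \<partial>lborel)"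
      by (simp add: split_def)
    also have "\<dots> = 0" using slab_pair_zero(1)[OF d, of a b] by (simp add: I)
    finally have "(\<integral>s. indicator {a..b} s * (\<integral>y. I y \<bullet> u s y \<partial>lborel) \<partial>lborel) = 0"
      by (simp add: slab_def)
    moreover have "M n s = cn * (\<integral>y. I y \<bullet> u s y \<partial>lborel)" for s
    proof -
      have "(\<integral>x. gauss_hat (1 / real (Suc n)) (x - y) *\<^sub>R P x \<partial>lborel) = cn *\<^sub>R I y" for y
        unfolding I_def gh scaleR_scaleR[symmetric] by (rule integral_scaleR_right)
      then show ?thesis by (simp add: M_def)
    qed
    ultimately show ?thesis by (simp add: mult.left_commute)
  qed
  have "(\<lambda>n. \<integral>s. indicator {a..b} s *\<^sub>R M n s \<partial>lborel) \<longlonglongrightarrow> (\<integral>s. indicator {a..b} s *\<^sub>R ((2 * pi) ^ 3 * (G b s - G a s)) \<partial>lborel)"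
  proof (rule integral_dominated_convergence)
    let ?w = "\<lambda>s. indicator {a..b} s *\<^sub>R ((2 * pi) ^ 3 * (sqrt (\<integral>x. (norm (P x))\<^sup>2 \<partial>lborel) * sqrt B))"
    show "integrable lborel ?w" by (intro integrable_scaleR_left) (simp add: integrable_indicator_iff)
    show "AE s in lborel. norm (indicator {a..b} s *\<^sub>R M n s) \<le> ?w s" for n
    proof (intro AE_I2)
      fix s
      have "\<bar>M n s\<bar> \<le> (2 * pi) ^ 3 * (sqrt (\<integral>x. (norm (P x))\<^sup>2 \<partial>lborel) * sqrt B)" if "s \<in> {a..b}"
      proof -
        have "\<bar>M n s\<bar> \<le> (2 * pi) ^ 3 * (sqrt (\<integral>x. (norm (P x))\<^sup>2 \<partial>lborel) * sqrt (N s))"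
          unfolding M_def N_def by (intro mollified_pairing_le P u_L2) simp
        also have "\<dots> \<le> (2 * pi) ^ 3 * (sqrt (\<integral>x. (norm (P x))\<^sup>2 \<partial>lborel) * sqrt B)"
          using B(2)[OF that] by (intro mult_left_mono) auto
        finally show ?thesis .
      qed
      then show "norm (indicator {a..b} s *\<^sub>R M n s) \<le> ?w s" by (simp add: indicator_def)
    qed
    show "AE s in lborel. (\<lambda>n. indicator {a..b} s *\<^sub>R M n s) \<longlonglongrightarrow> indicator {a..b} s *\<^sub>R ((2 * pi) ^ 3 * (G b s - G a s))"
    proof (intro AE_I2 tendsto_scaleR tendsto_const)
      fix s
      show "(\<lambda>n. M n s) \<longlonglongrightarrow> (2 * pi) ^ 3 * (G b s - G a s)"
        unfolding M_def PG[symmetric] by (rule mollified_pairing_lim[OF P u_L2])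
    qed
    note [measurable] = L2_D(1)[OF P]
    show "(\<lambda>s. indicator {a..b} s *\<^sub>R M n s) \<in> borel_measurable lborel" for n
      unfolding M_def by measurable
    show "(\<lambda>s. indicator {a..b} s *\<^sub>R ((2 * pi) ^ 3 * (G b s - G a s))) \<in> borel_measurable lborel"
      unfolding G_def by measurable
  qed
  then have "(\<integral>s. indicator {a..b} s *\<^sub>R ((2 * pi) ^ 3 * (G b s - G a s)) \<partial>lborel) = 0"
    unfolding M0 by (rule LIMSEQ_unique[OF _ tendsto_const])
  moreover have "(\<integral>s. indicator {a..b} s *\<^sub>R ((2 * pi) ^ 3 * (G b s - G a s)) \<partial>lborel) = integral {a..b} (\<lambda>s. (2 * pi) ^ 3 * (G b s - G a s))"
    unfolding set_lebesgue_integral_def[symmetric]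
    by (intro set_borel_integral_eq_integral(2) borel_integrable_atLeastAtMost' continuous_intros G_continuous')
  ultimately show ?thesis by simp
qed

text \<open>Coercivity at time \<open>t\<close>, constancy of the energy, boundedness of
  \<open>A\<close> at time 0.\<close>

theorem energy_bound:
  assumes "0 \<le> t"
  shows "c * (\<integral>x. (norm (u t x))\<^sup>2 \<partial>lborel) \<le> C * (\<integral>x. (norm (u 0 x))\<^sup>2 \<partial>lborel)"
proof -
  have "c * N t \<le> G t t" by (rule N_le_G)
  also have "\<dots> = G 0 0"
    by (rule diagonal_constant[OF G_continuous G_sym G_skew assms])
  also have "\<dots> \<le> C * (sqrt (N 0) * sqrt (N 0))"
    unfolding G_def N_def using A_pairing_le[OF u_L2 u_L2, of 0 0] by linarith
  also have "\<dots> = C * N 0" by (simp add: N_def)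
  finally show ?thesis by (simp add: N_def)
qed

end

section \<open>Matrix-valued solutions\<close>

lemma cscale_of_real: "cscale (complex_of_real r) M = r *\<^sub>R M"
  by (simp add: cscale_def vec_eq_iff scaleR_conv_of_real[where 'a=complex])

text \<open>Realness is part of the notion because the inner product on \<open>cmat\<close> is the
  real part of the Hermitian one; a real symmetric factor moves across it unchanged.\<close>

definition real_symmetric :: "cmat \<Rightarrow> bool" where
  "real_symmetric R \<longleftrightarrow> (\<forall>i j. R $ i $ j = R $ j $ i \<and> Im (R $ i $ j) = 0)"

lemma real_symmetric_diag_mat: "real_symmetric (diag_mat a b)"
  by (simp add: real_symmetric_def diag_mat_def)

lemma real_symmetric_Dmat: "real_symmetric (Dmat j)"
  by (simp add: real_symmetric_def Dmat_def)

lemma inner_real_mult: "Im r = 0 \<Longrightarrow> (r * z) \<bullet> w = Re r * (z \<bullet> w)"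
  for r z w :: complex
  by (simp add: inner_complex_def algebra_simps)

lemma inner_real_mult_right: "Im r = 0 \<Longrightarrow> z \<bullet> (r * w) = Re r * (z \<bullet> w)"
  for r z w :: complex
  by (simp add: inner_complex_def algebra_simps)

lemma real_symmetric_mult_left:
  fixes M N :: cmat
  assumes "real_symmetric R"
  shows "(R ** M) \<bullet> N = M \<bullet> (R ** N)"
proof -
  have R: "Im (R $ i $ j) = 0" "R $ i $ j = R $ j $ i" for i j
    using assms by (simp_all add: real_symmetric_def)
  have "(R ** M) \<bullet> N = (\<Sum>i\<in>UNIV. \<Sum>j\<in>UNIV. \<Sum>k\<in>UNIV. Re (R $ i $ k) * (M $ k $ j \<bullet> N $ i $ j))"
    by (simp add: matrix_matrix_mult_def inner_vec_def inner_sum_left inner_real_mult R(1))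
  also have "\<dots> = (\<Sum>j\<in>UNIV. \<Sum>i\<in>UNIV. \<Sum>k\<in>UNIV. Re (R $ i $ k) * (M $ k $ j \<bullet> N $ i $ j))"
    by (rule sum.swap)
  also have "\<dots> = (\<Sum>j\<in>UNIV. \<Sum>k\<in>UNIV. \<Sum>i\<in>UNIV. Re (R $ i $ k) * (M $ k $ j \<bullet> N $ i $ j))"
    by (intro sum.cong refl sum.swap)
  also have "\<dots> = (\<Sum>k\<in>UNIV. \<Sum>j\<in>UNIV. \<Sum>i\<in>UNIV. Re (R $ k $ i) * (M $ k $ j \<bullet> N $ i $ j))"
    by (subst sum.swap) (simp add: R(2)[of _ k for k])
  also have "\<dots> = M \<bullet> (R ** N)"
    by (simp add: matrix_matrix_mult_def inner_vec_def inner_sum_right inner_real_mult_right R(1))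
  finally show ?thesis .
qed

lemma inner_transpose: "transpose M \<bullet> transpose N = M \<bullet> (N :: cmat)"
  by (simp add: transpose_def inner_vec_def) (rule sum.swap)

lemma norm_transpose_cmat: "norm (transpose M) = norm (M :: cmat)"
  by (simp add: norm_eq_sqrt_inner inner_transpose)

lemma transpose_real_symmetric: "real_symmetric R \<Longrightarrow> transpose R = R"
  by (simp add: real_symmetric_def transpose_def vec_eq_iff)

text \<open>Reduces the right multiplications of the adjoint equation to left ones, so that the
  estimates for \<open>diag_mat\<close> are made once.\<close>

lemma transpose_mult_right: "real_symmetric R \<Longrightarrow> M ** R = transpose (R ** transpose (M :: cmat))"
  by (simp add: matrix_transpose_mul transpose_real_symmetric)

lemma real_symmetric_mult_right:
  fixes M N :: cmat
  assumes "real_symmetric R"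
  shows "(M ** R) \<bullet> N = M \<bullet> (N ** R)"
proof -
  have "(M ** R) \<bullet> N = (R ** transpose M) \<bullet> transpose N"
    using inner_transpose[of "R ** transpose M" "transpose N"] by (simp add: transpose_mult_right[OF assms])
  also have "\<dots> = M \<bullet> (N ** R)"
    unfolding real_symmetric_mult_left[OF assms]
    using inner_transpose[of "transpose M" "R ** transpose N"] by (simp add: transpose_mult_right[OF assms])
  finally show ?thesis .
qed

lemma diag_mat_mult_left: "(diag_mat a b ** M) $ i $ j = (if i = 4 then of_real b else of_real a) * M $ i $ j"
proof -
  have "(diag_mat a b ** M) $ i $ j = (\<Sum>k\<in>UNIV. if k = i then (if i = 4 then of_real b else of_real a) * M $ i $ j else 0)"
    by (simp only: matrix_matrix_mult_def vec_lambda_beta diag_mat_def) (rule sum.cong, auto)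
  then show ?thesis by simp
qed

lemma diag_mat_mult_right: "(M ** diag_mat a b) $ i $ j = M $ i $ j * (if j = 4 then of_real b else of_real a)"
proof -
  have "(M ** diag_mat a b) $ i $ j = (\<Sum>k\<in>UNIV. if k = j then M $ i $ j * (if j = 4 then of_real b else of_real a) else 0)"
    by (simp only: matrix_matrix_mult_def vec_lambda_beta diag_mat_def) (rule sum.cong, auto)
  then show ?thesis by simp
qed

lemma diag_mat_ge:
  fixes M :: cmat
  assumes "c \<le> a" "c \<le> b"
  shows "c * (norm M)\<^sup>2 \<le> (diag_mat a b ** M) \<bullet> M"
proof -
  have "c * (norm M)\<^sup>2 = (\<Sum>i\<in>UNIV. \<Sum>j\<in>UNIV. c * (M $ i $ j \<bullet> M $ i $ j))"
    by (simp add: power2_norm_eq_inner inner_vec_def sum_distrib_left)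
  also have "\<dots> \<le> (\<Sum>i\<in>UNIV. \<Sum>j\<in>UNIV. (diag_mat a b ** M) $ i $ j \<bullet> M $ i $ j)"
    unfolding diag_mat_mult_left
    by (intro sum_mono) (auto simp: inner_real_mult intro!: mult_right_mono assms)
  also have "\<dots> = (diag_mat a b ** M) \<bullet> M" by (simp add: inner_vec_def)
  finally show ?thesis .
qed

lemma diag_mat_le:
  fixes M :: cmat
  assumes "0 \<le> a" "0 \<le> b" "a \<le> C" "b \<le> C"
  shows "norm (diag_mat a b ** M) \<le> C * norm M"
proof (rule power2_le_imp_le)
  have "(norm (diag_mat a b ** M))\<^sup>2 = (\<Sum>i\<in>UNIV. \<Sum>j\<in>UNIV. (diag_mat a b ** M) $ i $ j \<bullet> (diag_mat a b ** M) $ i $ j)"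
    by (simp add: power2_norm_eq_inner inner_vec_def)
  also have "\<dots> \<le> (\<Sum>i\<in>UNIV. \<Sum>j\<in>UNIV. C\<^sup>2 * (M $ i $ j \<bullet> M $ i $ j))"
  proof (intro sum_mono)
    fix i j :: 4
    define d where "d = (if i = 4 then b else a)"
    have d: "0 \<le> d" "d \<le> C" using assms by (auto simp: d_def)
    have "(diag_mat a b ** M) $ i $ j = of_real d * M $ i $ j" by (simp add: diag_mat_mult_left d_def)
    then have "(diag_mat a b ** M) $ i $ j \<bullet> (diag_mat a b ** M) $ i $ j = d\<^sup>2 * (M $ i $ j \<bullet> M $ i $ j)"
      by (simp add: inner_real_mult inner_real_mult_right power2_eq_square)
    also have "\<dots> \<le> C\<^sup>2 * (M $ i $ j \<bullet> M $ i $ j)"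
      using d by (intro mult_right_mono power_mono) auto
    finally show "(diag_mat a b ** M) $ i $ j \<bullet> (diag_mat a b ** M) $ i $ j \<le> C\<^sup>2 * (M $ i $ j \<bullet> M $ i $ j)" .
  qed
  also have "\<dots> = (C * norm M)\<^sup>2"
    by (simp add: power_mult_distrib power2_norm_eq_inner[of M] inner_vec_def sum_distrib_left)
  finally show "(norm (diag_mat a b ** M))\<^sup>2 \<le> (C * norm M)\<^sup>2" .
qed (use assms in auto)

lemma borel_measurable_vec_lambda:
  fixes f :: "'a \<Rightarrow> 'c::finite \<Rightarrow> 'b::euclidean_space"
  assumes "\<And>i. (\<lambda>x. f x i) \<in> borel_measurable M"
  shows "(\<lambda>x. (\<chi> i. f x i) :: 'b^'c) \<in> borel_measurable M"
proof (subst borel_measurable_euclidean_space, intro ballI)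
  fix b :: "'b^'c" assume "b \<in> Basis"
  have "(\<lambda>x. \<Sum>i\<in>UNIV. f x i \<bullet> b $ i) \<in> borel_measurable M"
    using assms by measurable
  then show "(\<lambda>x. (\<chi> i. f x i) \<bullet> b) \<in> borel_measurable M"
    by (simp add: inner_vec_def)
qed

lemma borel_measurable_nth [measurable (raw)]:
  fixes f :: "'a \<Rightarrow> 'b::real_normed_vector^'c"
  assumes "f \<in> borel_measurable M"
  shows "(\<lambda>x. f x $ i) \<in> borel_measurable M"
  by (rule measurable_compose[OF assms]) (intro borel_measurable_continuous_onI continuous_intros)

lemma borel_measurable_matrix_mult:
  fixes f g :: "'a \<Rightarrow> cmat"
  assumes [measurable]: "f \<in> borel_measurable M" "g \<in> borel_measurable M"
  shows "(\<lambda>x. f x ** g x) \<in> borel_measurable M"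
  unfolding matrix_matrix_mult_def
  by (intro borel_measurable_vec_lambda) measurable

text \<open>\<open>L2_curve\<close> speaks of nonnegative times. Precomposition with
  \<open>max 0\<close> extends the curve by a constant and, being continuous, preserves convergence
  of times.\<close>

lemma L2_curve_cont:
  assumes Q: "L2_curve Q" and X: "X \<longlonglongrightarrow> t"
  shows "(\<lambda>n. \<integral>x. (norm (Q (max 0 (X n)) x - Q (max 0 t) x))\<^sup>2 \<partial>lborel) \<longlonglongrightarrow> 0"
proof -
  define F where "F s = (\<integral>x. (norm (Q s x - Q (max 0 t) x))\<^sup>2 \<partial>lborel)" for s
  have "(F \<longlongrightarrow> F (max 0 t)) (at (max 0 t) within {0..})"
    using Q unfolding L2_curve_def F_def by auto
  then have "continuous (at (max 0 t) within {0..}) F" by (simp add: continuous_within)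
  moreover have "(\<lambda>n. max 0 (X n)) \<longlonglongrightarrow> max 0 t" by (intro tendsto_intros X)
  ultimately have "(\<lambda>n. F (max 0 (X n))) \<longlonglongrightarrow> F (max 0 t)"
    unfolding continuous_within_sequentially by (auto simp: o_def)
  then show ?thesis by (simp add: F_def)
qed

lemma weak_form_gauss:
  fixes F :: "real \<Rightarrow> real^3 \<Rightarrow> cmat" and H :: "3 \<Rightarrow> real \<Rightarrow> real^3 \<Rightarrow> cmat"
  assumes weak: "\<And>t \<psi>. 0 \<le> t \<Longrightarrow> schwartz \<psi> \<Longrightarrow>
        (\<integral>x. cscale (\<psi> x) (F t x) \<partial>lborel)
        = (LBINT s:{0..t}. (\<integral>x. (\<Sum>j\<in>UNIV. cscale (partial j \<psi> x) (H j s x)) \<partial>lborel))"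
    and "0 \<le> t" "0 < d"
  shows "(\<integral>x. gauss d (x - y) *\<^sub>R F t x \<partial>lborel)
        = (LBINT s:{0..t}. (\<integral>x. (\<Sum>j\<in>UNIV. gauss_deriv d j (x - y) *\<^sub>R H j s x) \<partial>lborel))"
  using weak[OF assms(2) schwartz_gauss[OF assms(3), of y]]
  by (simp add: cscale_of_real partial_gauss)

text \<open>The time argument is kept nonnegative, hence inside the restricted space of
  \<open>jointly_measurable\<close>, by \<open>max 0\<close> or by assumption.\<close>

lemma solution_measurable:
  fixes Q :: "real \<Rightarrow> real^3 \<Rightarrow> real^3 \<Rightarrow> cmat"
  assumes "jointly_measurable Q"
  shows "(\<lambda>(t, x). Q (max 0 t) x q) \<in> borel_measurable (borel \<Otimes>\<^sub>M borel)"
    and "0 \<le> t \<Longrightarrow> (\<lambda>(x, q). Q t x q) \<in> borel_measurable (borel \<Otimes>\<^sub>M borel)"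
proof -
  have *: "(\<lambda>w. Q (f w) (g w) (h w)) \<in> borel_measurable M"
    if "f \<in> borel_measurable M" "g \<in> borel_measurable M" "h \<in> borel_measurable M" "\<And>w. 0 \<le> f w" for f g h and M :: "'w measure"
  proof -
    have "(\<lambda>w. (f w, g w, h w)) \<in> measurable M (restrict_space borel ({0..} \<times> UNIV))"
      using that by (intro measurable_restrict_space2) (auto simp: borel_prod[symmetric])
    from measurable_compose[OF this assms[unfolded jointly_measurable_def]] show ?thesis by simp
  qed
  show "(\<lambda>(t, x). Q (max 0 t) x q) \<in> borel_measurable (borel \<Otimes>\<^sub>M borel)"
    unfolding split_def by (rule *) auto
  show "(\<lambda>(x, q). Q t x q) \<in> borel_measurable (borel \<Otimes>\<^sub>M borel)" if "0 \<le> t"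
    unfolding split_def by (rule *) (use that in auto)
qed

text \<open>Energy conservation yields constants depending on \<open>c\<close> and \<open>C\<close>
  alone. The initial values enter through a pointwise bound from which an oscillating phase
  disappears, so the estimate can be uniform in the scale and in the wave vector.\<close>

lemma solution_bound:
  fixes Q :: "real \<Rightarrow> real^3 \<Rightarrow> cmat" and A :: "real^3 \<Rightarrow> cmat"
  assumes sol: "solves_forward A Q0 Q \<or> solves_adjoint A Q0 Q"
    and A: "\<And>x. A x = diag_mat (\<rho> x) (\<kappa> x)"
    and bd: "\<And>x. c \<le> \<rho> x" "\<And>x. c \<le> \<kappa> x" "\<And>x. \<rho> x \<le> C" "\<And>x. \<kappa> x \<le> C" and c: "0 < c"
    and Ac: "continuous_on UNIV A"
    and m: "(\<lambda>(t, x). Q (max 0 t) x) \<in> borel_measurable (borel \<Otimes>\<^sub>M borel)"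
    and t: "0 \<le> t"
    and init: "\<And>x. norm (Q0 x) \<le> K * norm (h x :: complex)" and h: "L2 h"
  shows "L2 (Q t)" "c * (\<integral>x. (norm (Q t x))\<^sup>2 \<partial>lborel) \<le> C * (K\<^sup>2 * (\<integral>x. (norm (h x))\<^sup>2 \<partial>lborel))"
proof -
  have Am: "(\<lambda>x. A x) \<in> borel_measurable borel"
    using Ac by (rule borel_measurable_continuous_onI)
  have nn: "0 \<le> \<rho> x" "0 \<le> \<kappa> x" for x using bd[of x] c by linarith+
  have curve: "L2_curve Q" and Q0: "AE x in lborel. Q 0 x = Q0 x"
    using sol by (auto simp: solves_forward_def solves_adjoint_def)
  have L2Q: "L2 (Q t)" if "0 \<le> t" for t using curve that by (auto simp: L2_curve_def)
  then show "L2 (Q t)" using t by simp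
  have rs: "real_symmetric (A x)" for x by (simp add: A real_symmetric_diag_mat)
  have main: "c * (\<integral>x. (norm (Q (max 0 t) x))\<^sup>2 \<partial>lborel) \<le> C * (\<integral>x. (norm (Q (max 0 0) x))\<^sup>2 \<partial>lborel)"
    using sol
  proof
    assume "solves_forward A Q0 Q"
    then have weak: "(\<integral>x. cscale (\<psi> x) (A x ** (Q t x - Q 0 x)) \<partial>lborel)
        = (LBINT s:{0..t}. (\<integral>x. (\<Sum>j\<in>UNIV. cscale (partial j \<psi> x) (Dmat j ** Q s x)) \<partial>lborel))"
      if "0 \<le> t" "schwartz \<psi>" for t \<psi>
      using that by (simp add: solves_forward_def)
    interpret symmetric_evolution "\<lambda>t. Q (max 0 t)" "\<lambda>x a. A x ** a" "\<lambda>j a. Dmat j ** a" c C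
    proof (rule symmetric_evolution.intro)
      show "linear (\<lambda>a :: cmat. A x ** a)" for x
        by (rule linearI) (simp_all add: matrix_matrix_mult_def vec_eq_iff scaleR_sum_right distrib_left sum.distrib)
      show "linear (\<lambda>a :: cmat. Dmat j ** a)" for j
        by (rule linearI) (simp_all add: matrix_matrix_mult_def vec_eq_iff scaleR_sum_right distrib_left sum.distrib)
      show "(A x ** a) \<bullet> b = a \<bullet> (A x ** b)" for x and a b :: cmat by (rule real_symmetric_mult_left[OF rs])
      show "(Dmat j ** a) \<bullet> b = a \<bullet> (Dmat j ** b)" for j and a b :: cmat by (rule real_symmetric_mult_left[OF real_symmetric_Dmat])
      show "norm (A x ** a) \<le> C * norm a" for x and a :: cmat unfolding A by (rule diag_mat_le) (use nn bd in auto)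
      show "c * (norm a)\<^sup>2 \<le> (A x ** a) \<bullet> a" for x and a :: cmat unfolding A by (rule diag_mat_ge) (use bd in auto)
      show "(\<lambda>(x, a :: cmat). A x ** a) \<in> borel_measurable (borel \<Otimes>\<^sub>M borel)"
        unfolding split_def by (intro borel_measurable_matrix_mult measurable_compose[OF _ Am]) auto
      show "(\<integral>x. gauss d (x - y) *\<^sub>R (A x ** (Q (max 0 t) x - Q (max 0 0) x)) \<partial>lborel)
        = (LBINT s:{0..t}. (\<integral>x. (\<Sum>j\<in>UNIV. gauss_deriv d j (x - y) *\<^sub>R (Dmat j ** Q (max 0 s) x)) \<partial>lborel))"
        if "0 \<le> t" "0 < d" for t d y
      proof -
        have "(\<integral>x. gauss d (x - y) *\<^sub>R (A x ** (Q t x - Q 0 x)) \<partial>lborel)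
          = (LBINT s:{0..t}. (\<integral>x. (\<Sum>j\<in>UNIV. gauss_deriv d j (x - y) *\<^sub>R (Dmat j ** Q s x)) \<partial>lborel))"
          by (rule weak_form_gauss[where F="\<lambda>t x. A x ** (Q t x - Q 0 x)" and H="\<lambda>j s x. Dmat j ** Q s x"]) (use weak that in auto)
        also have "\<dots> = (LBINT s:{0..t}. (\<integral>x. (\<Sum>j\<in>UNIV. gauss_deriv d j (x - y) *\<^sub>R (Dmat j ** Q (max 0 s) x)) \<partial>lborel))"
          by (rule set_lebesgue_integral_cong) (auto simp: max_absorb2)
        finally show ?thesis unfolding max_absorb2[OF that(1)] max.idem .
      qed
    qed (use c L2Q m L2_curve_cont[OF curve] in auto)
    show ?thesis by (rule energy_bound[OF t])
  next
    assume "solves_adjoint A Q0 Q"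
    then have weak: "(\<integral>x. cscale (\<psi> x) ((Q t x - Q 0 x) ** A x) \<partial>lborel)
        = (LBINT s:{0..t}. (\<integral>x. (\<Sum>j\<in>UNIV. cscale (partial j \<psi> x) (Q s x ** Dmat j)) \<partial>lborel))"
      if "0 \<le> t" "schwartz \<psi>" for t \<psi>
      using that by (simp add: solves_adjoint_def)
    \<comment> \<open>Both multiplications now act from the right; boundedness and coercivity are
      transported by transposition.\<close>
    interpret symmetric_evolution "\<lambda>t. Q (max 0 t)" "\<lambda>x a. a ** A x" "\<lambda>j a. a ** Dmat j" c C
    proof (rule symmetric_evolution.intro)
      show "linear (\<lambda>a :: cmat. a ** A x)" for x
        by (rule linearI) (simp_all add: matrix_matrix_mult_def vec_eq_iff scaleR_sum_right distrib_right sum.distrib)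
      show "linear (\<lambda>a :: cmat. a ** Dmat j)" for j
        by (rule linearI) (simp_all add: matrix_matrix_mult_def vec_eq_iff scaleR_sum_right distrib_right sum.distrib)
      show "(a ** A x) \<bullet> b = a \<bullet> (b ** A x)" for x and a b :: cmat by (rule real_symmetric_mult_right[OF rs])
      show "(a ** Dmat j) \<bullet> b = a \<bullet> (b ** Dmat j)" for j and a b :: cmat by (rule real_symmetric_mult_right[OF real_symmetric_Dmat])
      show "norm (a ** A x) \<le> C * norm a" for x and a :: cmat
      proof -
        have "norm (A x ** transpose a) \<le> C * norm (transpose a)"
          unfolding A by (rule diag_mat_le) (use nn bd in auto)
        then show ?thesis by (simp only: transpose_mult_right[OF rs] norm_transpose_cmat)
      qed
      show "c * (norm a)\<^sup>2 \<le> (a ** A x) \<bullet> a" for x and a :: cmat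
      proof -
        have "c * (norm (transpose a))\<^sup>2 \<le> (A x ** transpose a) \<bullet> transpose a"
          unfolding A by (rule diag_mat_ge) (use bd in auto)
        moreover have "(a ** A x) \<bullet> a = (A x ** transpose a) \<bullet> transpose a"
          using inner_transpose[of "A x ** transpose a" "transpose a"]
          by (simp only: transpose_mult_right[OF rs] transpose_transpose)
        ultimately show ?thesis by (simp only: norm_transpose_cmat)
      qed
      show "(\<lambda>(x, a :: cmat). a ** A x) \<in> borel_measurable (borel \<Otimes>\<^sub>M borel)"
        unfolding split_def by (intro borel_measurable_matrix_mult measurable_compose[OF _ Am]) auto
      show "(\<integral>x. gauss d (x - y) *\<^sub>R ((Q (max 0 t) x - Q (max 0 0) x) ** A x) \<partial>lborel)
        = (LBINT s:{0..t}. (\<integral>x. (\<Sum>j\<in>UNIV. gauss_deriv d j (x - y) *\<^sub>R (Q (max 0 s) x ** Dmat j)) \<partial>lborel))"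
        if "0 \<le> t" "0 < d" for t d y
      proof -
        have "(\<integral>x. gauss d (x - y) *\<^sub>R ((Q t x - Q 0 x) ** A x) \<partial>lborel)
          = (LBINT s:{0..t}. (\<integral>x. (\<Sum>j\<in>UNIV. gauss_deriv d j (x - y) *\<^sub>R (Q s x ** Dmat j)) \<partial>lborel))"
          by (rule weak_form_gauss[where F="\<lambda>t x. (Q t x - Q 0 x) ** A x" and H="\<lambda>j s x. Q s x ** Dmat j"]) (use weak that in auto)
        also have "\<dots> = (LBINT s:{0..t}. (\<integral>x. (\<Sum>j\<in>UNIV. gauss_deriv d j (x - y) *\<^sub>R (Q (max 0 s) x ** Dmat j)) \<partial>lborel))"
          by (rule set_lebesgue_integral_cong) (auto simp: max_absorb2)
        finally show ?thesis unfolding max_absorb2[OF that(1)] max.idem .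
      qed
    qed (use c L2Q m L2_curve_cont[OF curve] in auto)
    show ?thesis by (rule energy_bound[OF t])
  qed
  have "(\<integral>x. (norm (Q 0 x))\<^sup>2 \<partial>lborel) \<le> (\<integral>x. K\<^sup>2 * (norm (h x))\<^sup>2 \<partial>lborel)"
  proof (rule integral_mono_AE)
    show "AE x in lborel. (norm (Q 0 x))\<^sup>2 \<le> K\<^sup>2 * (norm (h x))\<^sup>2"
      using Q0
    proof eventually_elim
      case (elim x)
      then show ?case
        using power_mono[OF init[of x] norm_ge_zero, of 2] by (simp add: power_mult_distrib)
    qed
  qed (use L2_D(2)[OF L2Q, of 0] L2_D(2)[OF h] in auto)
  moreover have "0 \<le> C" using nn(1)[of 0] bd(3)[of 0] by linarith
  ultimately have "C * (\<integral>x. (norm (Q 0 x))\<^sup>2 \<partial>lborel) \<le> C * (K\<^sup>2 * (\<integral>x. (norm (h x))\<^sup>2 \<partial>lborel))"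
    by (intro mult_left_mono) simp_all
  then show "c * (\<integral>x. (norm (Q t x))\<^sup>2 \<partial>lborel) \<le> C * (K\<^sup>2 * (\<integral>x. (norm (h x))\<^sup>2 \<partial>lborel))"
    using main t by (simp add: max_absorb2)
qed

text \<open>\<open>matrix_inv\<close> chooses some two-sided inverse, so the explicit one is
  identified with it by uniqueness.\<close>

lemma matrix_inv_diag_mat:
  assumes "a \<noteq> 0" "b \<noteq> 0"
  shows "matrix_inv (diag_mat a b) = diag_mat (1 / a) (1 / b)"
proof -
  have l: "diag_mat a b ** diag_mat (1 / a) (1 / b) = mat 1"
    using assms by (simp add: vec_eq_iff diag_mat_mult_left) (simp add: diag_mat_def mat_def)
  have r: "diag_mat (1 / a) (1 / b) ** diag_mat a b = mat 1"
    using assms by (simp add: vec_eq_iff diag_mat_mult_left) (simp add: diag_mat_def mat_def)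
  have inv: "matrix_inv (diag_mat a b) ** diag_mat a b = mat 1"
    unfolding matrix_inv_def by (rule someI2[where a="diag_mat (1 / a) (1 / b)"]) (use l r in auto)
  have "matrix_inv (diag_mat a b) = matrix_inv (diag_mat a b) ** (diag_mat a b ** diag_mat (1 / a) (1 / b))"
    by (simp add: l)
  also have "\<dots> = diag_mat (1 / a) (1 / b)"
    by (simp add: matrix_mul_assoc inv)
  finally show ?thesis .
qed

lemma norm_cmat_le_sum: "norm (M :: cmat) \<le> (\<Sum>i\<in>UNIV. \<Sum>j\<in>UNIV. norm (M $ i $ j))"
  unfolding norm_vec_def[of M]
  by (rule order_trans[OF L2_set_le_sum]) (auto intro!: sum_mono simp: norm_vec_def[of "M $ _"] L2_set_le_sum)

lemma norm_cmat_nth_le: "norm ((M :: cmat) $ i $ j) \<le> norm M"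
  by (rule order_trans[OF Finite_Cartesian_Product.norm_nth_le Finite_Cartesian_Product.norm_nth_le])

text \<open>The factor 4 counts the rows, each of which contributes a single entry.\<close>

lemma norm_diagonal_le:
  fixes M :: cmat
  assumes "\<And>i j. i \<noteq> j \<Longrightarrow> M $ i $ j = 0" "\<And>i. norm (M $ i $ i) \<le> B"
  shows "norm M \<le> 4 * B"
proof -
  have "(\<Sum>j\<in>UNIV. norm (M $ i $ j)) = norm (M $ i $ i)" for i
  proof -
    have "(\<Sum>j\<in>UNIV. norm (M $ i $ j)) = (\<Sum>j\<in>UNIV. if j = i then norm (M $ i $ i) else 0)"
      using assms(1) by (intro sum.cong) auto
    then show ?thesis by simp
  qed
  then have "norm M \<le> (\<Sum>i\<in>(UNIV :: 4 set). B)"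
    using norm_cmat_le_sum[of M] sum_mono[of "UNIV :: 4 set" "\<lambda>i. norm (M $ i $ i)" "\<lambda>_. B"] assms(2) by simp
  then show ?thesis by simp
qed

section \<open>The Wigner transform of a pair of functions\<close>

text \<open>The factor 1/2 of the sharp inequality is given up; this is the origin of the 2 in the
  later bounds \<open>2 * M\<close> and \<open>W\<close>.\<close>

lemma nn_integral_mult_le_squares:
  fixes f :: "'a \<Rightarrow> 'b::real_normed_vector" and g :: "'a \<Rightarrow> 'c::real_normed_vector"
  assumes [measurable]: "f \<in> borel_measurable M" "g \<in> borel_measurable M"
  shows "(\<integral>\<^sup>+x. ennreal (norm (f x) * norm (g x)) \<partial>M)
    \<le> (\<integral>\<^sup>+x. ennreal ((norm (f x))\<^sup>2) \<partial>M) + (\<integral>\<^sup>+x. ennreal ((norm (g x))\<^sup>2) \<partial>M)"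
proof -
  have "(\<integral>\<^sup>+x. ennreal (norm (f x) * norm (g x)) \<partial>M) \<le> (\<integral>\<^sup>+x. ennreal ((norm (f x))\<^sup>2) + ennreal ((norm (g x))\<^sup>2) \<partial>M)"
  proof (rule nn_integral_mono)
    fix x
    have "0 \<le> norm (f x) * norm (g x)" by simp
    with two_mult_le_squares[of "norm (f x)" "norm (g x)"]
    have "norm (f x) * norm (g x) \<le> (norm (f x))\<^sup>2 + (norm (g x))\<^sup>2" by linarith
    then show "ennreal (norm (f x) * norm (g x)) \<le> ennreal ((norm (f x))\<^sup>2) + ennreal ((norm (g x))\<^sup>2)"
      by (simp add: ennreal_plus[symmetric] ennreal_leI del: ennreal_plus)
  qed
  also have "\<dots> = (\<integral>\<^sup>+x. ennreal ((norm (f x))\<^sup>2) \<partial>M) + (\<integral>\<^sup>+x. ennreal ((norm (g x))\<^sup>2) \<partial>M)"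
    by (rule nn_integral_add) measurable
  finally show ?thesis .
qed

lemma nn_integral_wt_shift: "(\<integral>\<^sup>+x. ennreal (wt (x + t)) \<partial>lborel) = ennreal (\<integral>x. wt (x :: 'a) \<partial>lborel)"
  for t :: "'a::euclidean_space"
  using nn_integral_lborel_shift[of "\<lambda>x::'a. ennreal (wt x)" t]
  by (simp add: nn_integral_eq_integral integrable_wt)

lemma nn_integral_wt_reflect: "(\<integral>\<^sup>+x. ennreal (wt (t - x)) \<partial>lborel) = ennreal (\<integral>x. wt (x :: 'a) \<partial>lborel)"
  for t :: "'a::euclidean_space"
  using nn_integral_lborel_reflect[of "\<lambda>x::'a. ennreal (wt x)" t]
  by (simp add: nn_integral_eq_integral integrable_wt)

text \<open>For p = (y, z) this is the modulus of the source at z times the decay of the test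
  function at \<xi> = z - y. Up to constants it dominates the pairings, for every
  \<open>e\<close>.\<close>

definition source_weight :: "(real^3 \<Rightarrow> complex) \<Rightarrow> (real^3) \<times> (real^3) \<Rightarrow> real" where
  "source_weight s p = norm (s (snd p)) * wt (snd p - fst p)"

lemma source_weight_nonneg [simp]: "0 \<le> source_weight s p"
  by (simp add: source_weight_def)

lemma source_weight_measurable [measurable]:
  assumes [measurable]: "s \<in> borel_measurable borel"
  shows "source_weight s \<in> borel_measurable borel"
  unfolding source_weight_def by measurable

lemma integrable_source_weight:
  assumes s: "integrable lborel s"
  shows "integrable lborel (source_weight s)"
    and "(\<integral>p. source_weight s p \<partial>lborel) = (\<integral>z. norm (s z) \<partial>lborel) * (\<integral>x. wt (x :: real^3) \<partial>lborel)"
proof -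
  have [measurable]: "s \<in> borel_measurable borel" using s by auto
  have int: "integrable lborel (\<lambda>(y, z). norm (s z) * wt (z - y))"
  proof (rule integrable_lborel_prodI')
    have "(\<integral>\<^sup>+z. \<integral>\<^sup>+y. ennreal (norm (norm (s z) * wt (z - y))) \<partial>lborel \<partial>lborel)
        = (\<integral>\<^sup>+z. ennreal (norm (s z)) * ennreal (\<integral>x. wt (x :: real^3) \<partial>lborel) \<partial>lborel)"
      by (simp add: ennreal_mult nn_integral_cmult nn_integral_wt_reflect)
    also have "\<dots> < \<infinity>"
      using s by (simp add: nn_integral_multc ennreal_mult_less_top integrable_iff_bounded)
    finally show "(\<integral>\<^sup>+z. \<integral>\<^sup>+y. ennreal (norm (norm (s z) * wt (z - y))) \<partial>lborel \<partial>lborel) < \<infinity>" .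
  qed measurable
  then show "integrable lborel (source_weight s)"
    by (simp add: source_weight_def[abs_def] split_def)
  show "(\<integral>p. source_weight s p \<partial>lborel) = (\<integral>z. norm (s z) \<partial>lborel) * (\<integral>x. wt (x :: real^3) \<partial>lborel)"
    using integrable_lborel_iterated(4)[OF int]
    by (simp add: source_weight_def[abs_def] split_def integral_lborel_reflect)
qed

text \<open>\<open>u\<close> and \<open>v\<close> stand for one entry of \<open>Q\<close> and one of
  \<open>Qs\<close> at a fixed time and wave vector. A single \<open>M\<close> bounds both squared
  L2 norms, as energy conservation provides.\<close>

locale wigner_pair =
  fixes u v :: "real^3 \<Rightarrow> complex" and e M :: real
  assumes u_meas [measurable]: "u \<in> borel_measurable borel"
    and v_meas [measurable]: "v \<in> borel_measurable borel"
    and u_sq: "(\<integral>\<^sup>+x. ennreal ((norm (u x))\<^sup>2) \<partial>lborel) \<le> ennreal M"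
    and v_sq: "(\<integral>\<^sup>+x. ennreal ((norm (v x))\<^sup>2) \<partial>lborel) \<le> ennreal M"
    and M_nonneg: "0 \<le> M" and e_pos: "0 < e"
begin

definition uv :: "real^3 \<Rightarrow> real^3 \<Rightarrow> complex" where
  "uv x y = u (x - (e / 2) *\<^sub>R y) * v (x + (e / 2) *\<^sub>R y)"

definition wigner1 :: "real^3 \<Rightarrow> real^3 \<Rightarrow> complex" where
  "wigner1 x k = (\<integral>y. cis (k \<bullet> y) / (2 * of_real pi) ^ 3 * uv x y \<partial>lborel)"

text \<open>Bounds the integral of \<open>uv\<close> over \<open>y\<close> at every
  \<open>x\<close>. The power of 2 / e is the Jacobian of the dilation by e / 2, so this bound
  degenerates as \<open>e\<close> tends to 0 and is used at fixed \<open>e\<close>.\<close>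

definition W :: real where "W = 2 * ((2 / e) ^ 3 * M)"

lemma W_nonneg: "0 \<le> W"
  using e_pos M_nonneg by (simp add: W_def)

lemma uv_measurable [measurable (raw)]:
  assumes [measurable]: "f \<in> borel_measurable N" "g \<in> borel_measurable N"
  shows "(\<lambda>w. uv (f w) (g w)) \<in> borel_measurable N"
  unfolding uv_def by measurable

lemma wigner1_measurable [measurable (raw)]:
  assumes [measurable]: "f \<in> borel_measurable N" "g \<in> borel_measurable N"
  shows "(\<lambda>w. wigner1 (f w) (g w)) \<in> borel_measurable N"
proof -
  have "(\<lambda>(x, k). wigner1 x k) \<in> borel_measurable (borel \<Otimes>\<^sub>M borel)"
    unfolding wigner1_def by measurable
  from measurable_case_prodD[OF this assms] show ?thesis .
qed

lemma nn_integral_uv_y: "(\<integral>\<^sup>+y. ennreal (norm (uv x (t + y))) \<partial>lborel) \<le> ennreal W"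
proof -
  have half: "\<bar>e / 2\<bar> = e / 2" "\<bar>- (e / 2)\<bar> = e / 2" "e / 2 \<noteq> 0" "- (e / 2) \<noteq> 0" using e_pos by auto
  have c: "1 / (e / 2) ^ 3 = (2 / e) ^ 3" by (simp add: power_divide)
  have "(\<integral>\<^sup>+y. ennreal (norm (uv x (t + y))) \<partial>lborel)
      = (\<integral>\<^sup>+y. ennreal (norm (u ((x - (e / 2) *\<^sub>R t) + (- (e / 2)) *\<^sub>R y)) * norm (v ((x + (e / 2) *\<^sub>R t) + (e / 2) *\<^sub>R y))) \<partial>lborel)"
    by (simp add: uv_def norm_mult algebra_simps)
  also have "\<dots> \<le> (\<integral>\<^sup>+y. ennreal ((norm (u ((x - (e / 2) *\<^sub>R t) + (- (e / 2)) *\<^sub>R y)))\<^sup>2) \<partial>lborel)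
      + (\<integral>\<^sup>+y. ennreal ((norm (v ((x + (e / 2) *\<^sub>R t) + (e / 2) *\<^sub>R y)))\<^sup>2) \<partial>lborel)"
    by (rule nn_integral_mult_le_squares) measurable
  also have "\<dots> = ennreal ((2 / e) ^ 3) * (\<integral>\<^sup>+x. ennreal ((norm (u x))\<^sup>2) \<partial>lborel)
      + ennreal ((2 / e) ^ 3) * (\<integral>\<^sup>+x. ennreal ((norm (v x))\<^sup>2) \<partial>lborel)"
    using nn_integral_lborel_affine[of "\<lambda>x. ennreal ((norm (u x))\<^sup>2)" "- (e / 2)" "x - (e / 2) *\<^sub>R t"]
      nn_integral_lborel_affine[of "\<lambda>x. ennreal ((norm (v x))\<^sup>2)" "e / 2" "x + (e / 2) *\<^sub>R t"]
    unfolding half(1,2) using half(3,4) by (simp add: c)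
  also have "\<dots> \<le> ennreal ((2 / e) ^ 3) * ennreal M + ennreal ((2 / e) ^ 3) * ennreal M"
    by (intro add_mono mult_left_mono u_sq v_sq) auto
  also have "\<dots> = ennreal W"
    using e_pos M_nonneg by (simp add: W_def ennreal_mult[symmetric] ennreal_plus[symmetric] del: ennreal_plus)
  finally show ?thesis .
qed

text \<open>In \<open>x\<close> both arguments are pure translations, so no power of
  \<open>e\<close> appears. This is the uniform bound behind the limit.\<close>

lemma nn_integral_uv_x: "(\<integral>\<^sup>+x. ennreal (norm (uv x y)) \<partial>lborel) \<le> ennreal (2 * M)"
proof -
  have "(\<integral>\<^sup>+x. ennreal (norm (uv x y)) \<partial>lborel)
      = (\<integral>\<^sup>+x. ennreal (norm (u (x + - ((e / 2) *\<^sub>R y))) * norm (v (x + (e / 2) *\<^sub>R y))) \<partial>lborel)"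
    by (simp add: uv_def norm_mult)
  also have "\<dots> \<le> (\<integral>\<^sup>+x. ennreal ((norm (u (x + - ((e / 2) *\<^sub>R y))))\<^sup>2) \<partial>lborel) + (\<integral>\<^sup>+x. ennreal ((norm (v (x + (e / 2) *\<^sub>R y)))\<^sup>2) \<partial>lborel)"
    by (rule nn_integral_mult_le_squares) measurable
  also have "\<dots> = (\<integral>\<^sup>+x. ennreal ((norm (u x))\<^sup>2) \<partial>lborel) + (\<integral>\<^sup>+x. ennreal ((norm (v x))\<^sup>2) \<partial>lborel)"
    using nn_integral_lborel_shift[of "\<lambda>x. ennreal ((norm (u x))\<^sup>2)" "- ((e / 2) *\<^sub>R y)"]
      nn_integral_lborel_shift[of "\<lambda>x. ennreal ((norm (v x))\<^sup>2)" "(e / 2) *\<^sub>R y"] by simp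
  also have "\<dots> \<le> ennreal M + ennreal M" by (intro add_mono u_sq v_sq)
  also have "\<dots> = ennreal (2 * M)"
    using M_nonneg by (simp add: ennreal_plus[symmetric] del: ennreal_plus)
  finally show ?thesis .
qed

lemma uv_integrable_y: "integrable lborel (\<lambda>y. uv x y)"
  using nn_integral_uv_y[of x 0] by (intro integrableI_bounded) (auto intro: le_less_trans)

lemma wigner1_bound: "norm (wigner1 x k) \<le> W / (2 * pi) ^ 3"
proof -
  have i: "integrable lborel (\<lambda>y. cis (k \<bullet> y) / (2 * of_real pi) ^ 3 * uv x y)"
    by (rule Bochner_Integration.integrable_bound[of _ "\<lambda>y. 1 / (2 * pi) ^ 3 * norm (uv x y)"])
      (use uv_integrable_y in \<open>auto simp: norm_mult norm_divide norm_power\<close>)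
  have "ennreal (norm (wigner1 x k)) \<le> (\<integral>\<^sup>+y. ennreal (norm (cis (k \<bullet> y) / (2 * of_real pi) ^ 3 * uv x y)) \<partial>lborel)"
    unfolding wigner1_def by (rule integral_norm_bound_ennreal[OF i])
  also have "\<dots> = (\<integral>\<^sup>+y. ennreal (1 / (2 * pi) ^ 3) * ennreal (norm (uv x (0 + y))) \<partial>lborel)"
    by (intro nn_integral_cong) (simp add: norm_mult norm_divide norm_power ennreal_mult[symmetric])
  also have "\<dots> \<le> ennreal (1 / (2 * pi) ^ 3) * ennreal W"
    by (subst nn_integral_cmult) (auto intro!: mult_left_mono nn_integral_uv_y simp del: add_0)
  also have "\<dots> = ennreal (W / (2 * pi) ^ 3)"
    using W_nonneg by (simp add: ennreal_mult[symmetric])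
  finally show ?thesis using W_nonneg by simp
qed

text \<open>The pairing \<open>\<integral> s(z) \<Theta>(y,z,x) u(x - e y/2) v(x + e y/2)\<close>, with the argument \<open>y\<close> of \<open>u\<close>, \<open>v\<close>
  (but not of \<open>\<Theta>\<close>) shifted by \<open>\<eta>\<close>.\<close>

definition pairing_integrand ::
    "(real^3 \<Rightarrow> complex) \<Rightarrow> ((real^3) \<times> (real^3) \<Rightarrow> real^3 \<Rightarrow> complex) \<Rightarrow> real^3 \<Rightarrow> (real^3) \<times> (real^3) \<Rightarrow> real^3 \<Rightarrow> complex" where
  "pairing_integrand s \<Theta> \<eta> p x = s (snd p) * (uv x (fst p + \<eta>) * \<Theta> p x)"

definition pairing :: "(real^3 \<Rightarrow> complex) \<Rightarrow> ((real^3) \<times> (real^3) \<Rightarrow> real^3 \<Rightarrow> complex) \<Rightarrow> real^3 \<Rightarrow> complex" where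
  "pairing s \<Theta> \<eta> = (\<integral>(p, x). pairing_integrand s \<Theta> \<eta> p x \<partial>lborel)"

text \<open>The \<open>x\<close>-integral is innermost and costs 2M; what is left is
  \<open>source_weight\<close>. The bound involves neither \<open>e\<close> nor the shift \<eta>,
  and the fields only through \<open>M\<close>.\<close>

lemma pairing_integrable:
  assumes s: "integrable lborel s" and \<Theta>: "(\<lambda>(p, x). \<Theta> p x) \<in> borel_measurable (borel \<Otimes>\<^sub>M borel)"
    and B: "\<And>p x. norm (\<Theta> p x) \<le> B * wt (snd p - fst p)"
  shows "integrable lborel (\<lambda>(p, x). pairing_integrand s \<Theta> \<eta> p x)"
    and "norm (pairing s \<Theta> \<eta>) \<le> 2 * M * (B * (\<integral>p. source_weight s p \<partial>lborel))"
proof -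
  note [measurable (raw)] = measurable_case_prodD[OF \<Theta>]
  have [measurable]: "s \<in> borel_measurable borel" using s by auto
  have B0: "0 \<le> B"
  proof -
    have "0 \<le> B * wt (0 :: real^3)" using order_trans[OF norm_ge_zero B[of "(0, 0)" 0]] by simp
    then show ?thesis using wt_pos[of "0 :: real^3"] by (simp add: zero_le_mult_iff)
  qed
  have [measurable]: "(\<lambda>(p, x). pairing_integrand s \<Theta> \<eta> p x) \<in> borel_measurable (borel \<Otimes>\<^sub>M borel)"
    unfolding pairing_integrand_def by measurable
  have le: "(\<integral>\<^sup>+p. \<integral>\<^sup>+x. ennreal (norm (pairing_integrand s \<Theta> \<eta> p x)) \<partial>lborel \<partial>lborel)
      \<le> ennreal (2 * M * (B * (\<integral>p. source_weight s p \<partial>lborel)))"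
  proof -
    have "(\<integral>\<^sup>+x. ennreal (norm (pairing_integrand s \<Theta> \<eta> p x)) \<partial>lborel) \<le> ennreal (B * source_weight s p) * ennreal (2 * M)" for p
    proof -
      have "(\<integral>\<^sup>+x. ennreal (norm (pairing_integrand s \<Theta> \<eta> p x)) \<partial>lborel)
         \<le> (\<integral>\<^sup>+x. ennreal (B * source_weight s p) * ennreal (norm (uv x (fst p + \<eta>))) \<partial>lborel)"
      proof (rule nn_integral_mono)
        fix x
        have "norm (pairing_integrand s \<Theta> \<eta> p x) \<le> norm (s (snd p)) * (norm (uv x (fst p + \<eta>)) * (B * wt (snd p - fst p)))"
          unfolding pairing_integrand_def norm_mult by (intro mult_left_mono B) auto
        then show "ennreal (norm (pairing_integrand s \<Theta> \<eta> p x)) \<le> ennreal (B * source_weight s p) * ennreal (norm (uv x (fst p + \<eta>)))"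
          using B0 by (simp add: source_weight_def ennreal_mult[symmetric] ennreal_leI mult_ac)
      qed
      also have "\<dots> \<le> ennreal (B * source_weight s p) * ennreal (2 * M)"
        by (subst nn_integral_cmult) (auto intro!: mult_left_mono nn_integral_uv_x)
      finally show ?thesis .
    qed
    then have "(\<integral>\<^sup>+p. \<integral>\<^sup>+x. ennreal (norm (pairing_integrand s \<Theta> \<eta> p x)) \<partial>lborel \<partial>lborel)
       \<le> (\<integral>\<^sup>+p. ennreal (B * source_weight s p) * ennreal (2 * M) \<partial>lborel)"
      by (rule nn_integral_mono)
    also have "\<dots> = ennreal (B * (\<integral>p. source_weight s p \<partial>lborel)) * ennreal (2 * M)"
      using integrable_source_weight(1)[OF s] B0
      by (simp add: nn_integral_multc nn_integral_eq_integral)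
    finally show ?thesis
      using B0 M_nonneg by (simp add: ennreal_mult[symmetric] mult_ac)
  qed
  show int: "integrable lborel (\<lambda>(p, x). pairing_integrand s \<Theta> \<eta> p x)"
    using le by (intro integrable_lborel_prodI) (auto intro: le_less_trans)
  have "ennreal (norm (pairing s \<Theta> \<eta>)) \<le> (\<integral>\<^sup>+r. ennreal (norm (case r of (p, x) \<Rightarrow> pairing_integrand s \<Theta> \<eta> p x)) \<partial>lborel)"
    unfolding pairing_def by (rule integral_norm_bound_ennreal[OF int])
  also have "\<dots> = (\<integral>\<^sup>+p. \<integral>\<^sup>+x. ennreal (norm (pairing_integrand s \<Theta> \<eta> p x)) \<partial>lborel \<partial>lborel)"
    by (subst nn_integral_lborel_prod_iterated(1)) (use borel_measurable_integrable[OF int] in auto)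
  also note le
  finally show "norm (pairing s \<Theta> \<eta>) \<le> 2 * M * (B * (\<integral>p. source_weight s p \<partial>lborel))"
    using B0 M_nonneg by (simp add: ennreal_le_iff)
qed

lemma pairing_iterated:
  assumes s: "integrable lborel s" and \<Theta>: "(\<lambda>(p, x). \<Theta> p x) \<in> borel_measurable (borel \<Otimes>\<^sub>M borel)"
    and B: "\<And>p x. norm (\<Theta> p x) \<le> B * wt (snd p - fst p)"
  shows "pairing s \<Theta> \<eta> = (\<integral>p. s (snd p) * (\<integral>x. uv x (fst p + \<eta>) * \<Theta> p x \<partial>lborel) \<partial>lborel)"
  unfolding pairing_def integrable_lborel_iterated(3)[OF pairing_integrable(1)[OF assms]]
  by (simp add: pairing_integrand_def[abs_def])

lemma pairing_x_bound:
  assumes B: "\<And>x. norm (F x) \<le> B" and F: "F \<in> borel_measurable borel"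
  shows "integrable lborel (\<lambda>x. uv x y * F x)" "norm (\<integral>x. uv x y * F x \<partial>lborel) \<le> 2 * M * B"
proof -
  note [measurable] = F
  have B0: "0 \<le> B" using order_trans[OF norm_ge_zero B] .
  have le: "(\<integral>\<^sup>+x. ennreal (norm (uv x y * F x)) \<partial>lborel) \<le> ennreal (2 * M * B)"
  proof -
    have "(\<integral>\<^sup>+x. ennreal (norm (uv x y * F x)) \<partial>lborel) \<le> (\<integral>\<^sup>+x. ennreal (norm (uv x y)) * ennreal B \<partial>lborel)"
      using B B0 by (intro nn_integral_mono) (auto simp: norm_mult ennreal_mult[symmetric] intro!: ennreal_leI mult_left_mono)
    also have "\<dots> \<le> ennreal (2 * M) * ennreal B"
      by (subst nn_integral_multc) (auto intro!: mult_right_mono nn_integral_uv_x)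
    finally show ?thesis using B0 M_nonneg by (simp add: ennreal_mult[symmetric])
  qed
  show int: "integrable lborel (\<lambda>x. uv x y * F x)"
    using le by (intro integrableI_bounded) (auto intro: le_less_trans)
  show "norm (\<integral>x. uv x y * F x \<partial>lborel) \<le> 2 * M * B"
    using order_trans[OF integral_norm_bound_ennreal[OF int] le] B0 M_nonneg by (simp add: ennreal_le_iff)
qed

lemma L2_u: "L2 u" and L2_v: "L2 v"
  using u_sq v_sq unfolding L2_def
  by (auto intro!: integrableI_bounded intro: le_less_trans)

text \<open>Shifting \<open>y\<close> translates the two factors by opposite vectors. Both
  translations are continuous in L2, and Cauchy-Schwarz makes the product continuous in L1.\<close>

lemma uv_shift_tendsto:
  assumes X: "X \<longlonglongrightarrow> 0"
  shows "(\<lambda>n. \<integral>x. norm (uv x (y + X n) - uv x y) \<partial>lborel) \<longlonglongrightarrow> 0"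
proof -
  define t where "t n = (e / 2) *\<^sub>R X n" for n
  define Y where "Y = (e / 2) *\<^sub>R y"
  have t0: "t \<longlonglongrightarrow> 0" and mt0: "(\<lambda>n. - t n) \<longlonglongrightarrow> 0"
    unfolding t_def using tendsto_scaleR[OF tendsto_const X, of "e / 2"] tendsto_minus[OF tendsto_scaleR[OF tendsto_const X, of "e / 2"]]
    by auto
  define U where "U x = u (x + - Y)" for x
  define V where "V x = v (x + Y)" for x
  have U: "L2 U" and V: "L2 V" unfolding U_def V_def by (intro L2_shift L2_u L2_v)+
  define dU where "dU n = (\<integral>x. (norm (U (x + - t n) - U x))\<^sup>2 \<partial>lborel)" for n
  define dV where "dV n = (\<integral>x. (norm (V (x + t n) - V x))\<^sup>2 \<partial>lborel)" for n
  have "dU \<longlonglongrightarrow> 0" "dV \<longlonglongrightarrow> 0" unfolding dU_def dV_def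
    by (rule L2_translation_continuous[OF U mt0], rule L2_translation_continuous[OF V t0])
  then have lim: "(\<lambda>n. sqrt (dU n) * sqrt (\<integral>x. (norm (V x))\<^sup>2 \<partial>lborel) + sqrt (\<integral>x. (norm (U x))\<^sup>2 \<partial>lborel) * sqrt (dV n))
     \<longlonglongrightarrow> sqrt 0 * sqrt (\<integral>x. (norm (V x))\<^sup>2 \<partial>lborel) + sqrt (\<integral>x. (norm (U x))\<^sup>2 \<partial>lborel) * sqrt 0"
    by (intro tendsto_intros)
  show ?thesis
  proof (rule tendsto_sandwich[OF _ _ tendsto_const lim[simplified]]; intro always_eventually allI)
    fix n
    have eq: "uv x (y + X n) - uv x y = (U (x + - t n) - U x) * V (x + t n) + U x * (V (x + t n) - V x)" for x
      by (simp add: uv_def U_def V_def t_def Y_def algebra_simps)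
    have LU: "L2 (\<lambda>x. U (x + - t n) - U x)" and LV: "L2 (\<lambda>x. V (x + t n) - V x)" and LV': "L2 (\<lambda>x. V (x + t n))"
      by (intro L2_diff L2_shift U V)+
    note i1 = L2_norm_mult_integrable[OF LU LV'] and i2 = L2_norm_mult_integrable[OF U LV]
    have "(\<integral>x. norm (uv x (y + X n) - uv x y) \<partial>lborel)
      \<le> (\<integral>x. norm (U (x + - t n) - U x) * norm (V (x + t n)) + norm (U x) * norm (V (x + t n) - V x) \<partial>lborel)"
    proof (rule integral_mono')
      show "integrable lborel (\<lambda>x. norm (U (x + - t n) - U x) * norm (V (x + t n)) + norm (U x) * norm (V (x + t n) - V x))"
        by (rule Bochner_Integration.integrable_add[OF i1 i2])
      show "norm (uv x (y + X n) - uv x y) \<le> norm (U (x + - t n) - U x) * norm (V (x + t n)) + norm (U x) * norm (V (x + t n) - V x)" for x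
        unfolding eq norm_mult[symmetric] by (rule norm_triangle_ineq)
    qed auto
    also have "\<dots> = (\<integral>x. norm (U (x + - t n) - U x) * norm (V (x + t n)) \<partial>lborel) + (\<integral>x. norm (U x) * norm (V (x + t n) - V x) \<partial>lborel)"
      by (rule Bochner_Integration.integral_add[OF i1 i2])
    also have "\<dots> \<le> sqrt (dU n) * sqrt (\<integral>x. (norm (V x))\<^sup>2 \<partial>lborel) + sqrt (\<integral>x. (norm (U x))\<^sup>2 \<partial>lborel) * sqrt (dV n)"
      using L2_Cauchy_Schwarz[OF LU LV'] L2_Cauchy_Schwarz[OF U LV]
      unfolding dU_def dV_def L2_norm_shift[of V "t n"] by linarith
    finally show "(\<integral>x. norm (uv x (y + X n) - uv x y) \<partial>lborel)
       \<le> sqrt (dU n) * sqrt (\<integral>x. (norm (V x))\<^sup>2 \<partial>lborel) + sqrt (\<integral>x. (norm (U x))\<^sup>2 \<partial>lborel) * sqrt (dV n)" .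
  qed simp
qed

text \<open>The continuity hypothesis of the Fourier inversion in \<eta> at the origin. Dominated
  convergence in (y, z) reduces it to the L1 continuity of \<open>uv\<close> in
  \<open>y\<close>.\<close>

lemma pairing_continuous:
  assumes s: "integrable lborel s" and \<Theta>: "(\<lambda>(p, x). \<Theta> p x) \<in> borel_measurable (borel \<Otimes>\<^sub>M borel)"
    and B: "\<And>p x. norm (\<Theta> p x) \<le> B * wt (snd p - fst p)"
  shows "isCont (pairing s \<Theta>) 0"
proof (rule continuous_at_sequentiallyI)
  fix X :: "nat \<Rightarrow> real^3" assume X: "X \<longlonglongrightarrow> 0"
  note [measurable (raw)] = measurable_case_prodD[OF \<Theta>]
  have [measurable]: "s \<in> borel_measurable borel" using s by auto
  have B': "norm (\<Theta> p x) \<le> \<bar>B\<bar>" for p x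
  proof -
    have "B * wt (snd p - fst p) \<le> \<bar>B\<bar> * 1"
      by (rule order_trans[OF abs_ge_self]) (simp add: abs_mult wt_le_1 mult_left_le)
    then show ?thesis using B[of p x] by simp
  qed
  have "(\<lambda>n. \<integral>p. s (snd p) * (\<integral>x. uv x (fst p + X n) * \<Theta> p x \<partial>lborel) \<partial>lborel) \<longlonglongrightarrow> (\<integral>p. s (snd p) * (\<integral>x. uv x (fst p + 0) * \<Theta> p x \<partial>lborel) \<partial>lborel)"
  proof (rule integral_dominated_convergence[where w="\<lambda>p. 2 * M * B * source_weight s p"])
    show "integrable lborel (\<lambda>p. 2 * M * B * source_weight s p)"
      using integrable_source_weight(1)[OF s] by simp
    show "AE p in lborel. norm (s (snd p) * (\<integral>x. uv x (fst p + X n) * \<Theta> p x \<partial>lborel)) \<le> 2 * M * B * source_weight s p" for n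
    proof (intro AE_I2)
      fix p
      have "norm (s (snd p) * (\<integral>x. uv x (fst p + X n) * \<Theta> p x \<partial>lborel)) \<le> norm (s (snd p)) * (2 * M * (B * wt (snd p - fst p)))"
        unfolding norm_mult by (intro mult_left_mono pairing_x_bound B) auto
      then show "norm (s (snd p) * (\<integral>x. uv x (fst p + X n) * \<Theta> p x \<partial>lborel)) \<le> 2 * M * B * source_weight s p"
        by (simp add: source_weight_def mult_ac)
    qed
    show "AE p in lborel. (\<lambda>n. s (snd p) * (\<integral>x. uv x (fst p + X n) * \<Theta> p x \<partial>lborel)) \<longlonglongrightarrow> s (snd p) * (\<integral>x. uv x (fst p + 0) * \<Theta> p x \<partial>lborel)"
    proof (intro AE_I2 tendsto_mult tendsto_const)
      fix p
      have i: "integrable lborel (\<lambda>x. uv x y * \<Theta> p x)" "integrable lborel (\<lambda>x. uv x y)" for y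
        using pairing_x_bound(1)[of "\<Theta> p" "\<bar>B\<bar>"] pairing_x_bound(1)[of "\<lambda>_. 1" 1 y] B'[of p] by auto
      have "(\<lambda>n. \<bar>B\<bar> * (\<integral>x. norm (uv x (fst p + X n) - uv x (fst p)) \<partial>lborel)) \<longlonglongrightarrow> \<bar>B\<bar> * 0"
        by (intro tendsto_intros uv_shift_tendsto X)
      then have lim: "(\<lambda>n. \<bar>B\<bar> * (\<integral>x. norm (uv x (fst p + X n) - uv x (fst p)) \<partial>lborel)) \<longlonglongrightarrow> 0" by simp
      have "(\<lambda>n. (\<integral>x. uv x (fst p + X n) * \<Theta> p x \<partial>lborel) - (\<integral>x. uv x (fst p + 0) * \<Theta> p x \<partial>lborel)) \<longlonglongrightarrow> 0"
      proof (rule Lim_null_comparison[OF _ lim]; intro always_eventually allI)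
        fix n
        have "(\<integral>x. uv x (fst p + X n) * \<Theta> p x \<partial>lborel) - (\<integral>x. uv x (fst p + 0) * \<Theta> p x \<partial>lborel)
            = (\<integral>x. (uv x (fst p + X n) - uv x (fst p)) * \<Theta> p x \<partial>lborel)"
          using i by (simp add: left_diff_distrib)
        also have "norm \<dots> \<le> (\<integral>x. \<bar>B\<bar> * norm (uv x (fst p + X n) - uv x (fst p)) \<partial>lborel)"
        proof (rule order_trans[OF integral_norm_bound], rule integral_mono')
          show "integrable lborel (\<lambda>x. \<bar>B\<bar> * norm (uv x (fst p + X n) - uv x (fst p)))" using i by simp
          show "norm ((uv x (fst p + X n) - uv x (fst p)) * \<Theta> p x) \<le> \<bar>B\<bar> * norm (uv x (fst p + X n) - uv x (fst p))" for x
            using mult_right_mono[OF B'[of p x] norm_ge_zero[of "uv x (fst p + X n) - uv x (fst p)"]]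
            by (simp add: norm_mult mult.commute)
        qed auto
        finally show "norm ((\<integral>x. uv x (fst p + X n) * \<Theta> p x \<partial>lborel) - (\<integral>x. uv x (fst p + 0) * \<Theta> p x \<partial>lborel)) \<le> \<bar>B\<bar> * (\<integral>x. norm (uv x (fst p + X n) - uv x (fst p)) \<partial>lborel)"
          by simp
      qed
      then show "(\<lambda>n. \<integral>x. uv x (fst p + X n) * \<Theta> p x \<partial>lborel) \<longlonglongrightarrow> (\<integral>x. uv x (fst p + 0) * \<Theta> p x \<partial>lborel)"
        by (rule LIM_zero_cancel)
    qed
  qed measurable
  then show "(\<lambda>n. pairing s \<Theta> (X n)) \<longlonglongrightarrow> pairing s \<Theta> 0"
    unfolding pairing_iterated[OF assms] .
qed

end

section \<open>A volume-preserving change of variables for the signal\<close>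

definition shear :: "real \<Rightarrow> ((real^3) \<times> (real^3)) \<times> (real^3) \<Rightarrow> (real^3) \<times> (real^3) \<times> (real^3)" where
  "shear e r = (snd (fst r) - fst (fst r), snd r - e *\<^sub>R snd (fst r) + (e / 2) *\<^sub>R fst (fst r), snd (fst r))"

lemma shear_measurable [measurable]: "shear e \<in> borel_measurable borel"
  unfolding shear_def by measurable

text \<open>For r = ((y, z), x) the new variables are \<xi> = z - y, x0 = x - e z + e y / 2 and z.
  They satisfy x0 + e (z + \<xi>) / 2 = x and x0 + e z = x + e y / 2, which are the arguments of the
  Wigner function and of the coefficient. Every step is a translation, a reflection or an exchange
  of integrals, so the Jacobian is 1.\<close>

lemma nn_integral_shear:
  assumes [measurable]: "f \<in> borel_measurable borel"
  shows "(\<integral>\<^sup>+r. f (shear e r) \<partial>lborel) = (\<integral>\<^sup>+r. f r \<partial>lborel)"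
proof -
  have "(\<integral>\<^sup>+r. f (shear e r) \<partial>lborel) = (\<integral>\<^sup>+p. \<integral>\<^sup>+x. f (snd p - fst p, x + (- (e *\<^sub>R snd p) + (e / 2) *\<^sub>R fst p), snd p) \<partial>lborel \<partial>lborel)"
    by (subst nn_integral_lborel_prod_iterated(1)) (simp_all add: shear_def algebra_simps)
  also have "\<dots> = (\<integral>\<^sup>+p. \<integral>\<^sup>+x. f (snd p - fst p, x, snd p) \<partial>lborel \<partial>lborel)"
    by (intro nn_integral_cong nn_integral_lborel_shift[of "\<lambda>x. f (snd p - fst p, x, snd p)" for p]) measurable
  also have "\<dots> = (\<integral>\<^sup>+z. \<integral>\<^sup>+y. \<integral>\<^sup>+x. f (z - y, x, z) \<partial>lborel \<partial>lborel \<partial>lborel)"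
    by (subst nn_integral_lborel_prod_iterated(2)) simp_all
  also have "\<dots> = (\<integral>\<^sup>+z. \<integral>\<^sup>+\<xi>. \<integral>\<^sup>+x. f (\<xi>, x, z) \<partial>lborel \<partial>lborel \<partial>lborel)"
    by (intro nn_integral_cong nn_integral_lborel_reflect[of "\<lambda>\<xi>. \<integral>\<^sup>+x. f (\<xi>, x, z) \<partial>lborel" for z]) measurable
  also have "\<dots> = (\<integral>\<^sup>+\<xi>. \<integral>\<^sup>+z. \<integral>\<^sup>+x. f (\<xi>, x, z) \<partial>lborel \<partial>lborel \<partial>lborel)"
    by (rule lborel_pair.Fubini') measurable
  also have "\<dots> = (\<integral>\<^sup>+\<xi>. \<integral>\<^sup>+q. f (\<xi>, q) \<partial>lborel \<partial>lborel)"
    by (intro nn_integral_cong, subst nn_integral_lborel_prod_iterated(2)) simp_all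
  also have "\<dots> = (\<integral>\<^sup>+r. f r \<partial>lborel)"
    by (subst (2) nn_integral_lborel_prod_iterated(1)) simp_all
  finally show ?thesis .
qed

lemma distr_shear: "distr lborel borel (shear e) = lborel"
proof (rule measure_eqI)
  fix X assume "X \<in> sets (distr lborel borel (shear e))"
  then have [measurable]: "X \<in> sets borel" by simp
  have "emeasure (distr lborel borel (shear e)) X = (\<integral>\<^sup>+r. indicator X r \<partial>distr lborel borel (shear e))"
    by simp
  also have "\<dots> = (\<integral>\<^sup>+r. indicator X (shear e r) \<partial>lborel)"
    by (rule nn_integral_distr) measurable
  also have "\<dots> = emeasure lborel X"
    by (subst nn_integral_shear) simp_all
  finally show "emeasure (distr lborel borel (shear e)) X = emeasure lborel X" .
qed simp

lemma integral_shear: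
  fixes f :: "(real^3) \<times> (real^3) \<times> (real^3) \<Rightarrow> 'b::{banach, second_countable_topology}"
  assumes [measurable]: "f \<in> borel_measurable borel"
  shows "(\<integral>r. f (shear e r) \<partial>lborel) = (\<integral>r. f r \<partial>lborel)"
proof -
  have "(\<integral>r. f r \<partial>lborel) = (\<integral>r. f r \<partial>distr lborel borel (shear e))" by (simp only: distr_shear)
  also have "\<dots> = (\<integral>r. f (shear e r) \<partial>lborel)"
    by (rule integral_distr) measurable
  finally show ?thesis ..
qed

text \<open>The only properties of the test functions that the convergence proof uses.\<close>

definition decaying :: "(real^3 \<Rightarrow> real^3 \<Rightarrow> complex) \<Rightarrow> real \<Rightarrow> bool" where
  "decaying \<theta> B \<longleftrightarrow> continuous_on UNIV (\<lambda>(\<xi>, x). \<theta> \<xi> x)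
     \<and> (\<forall>\<xi> x. norm (\<theta> \<xi> x) \<le> B * (wt \<xi> * wt x))
     \<and> (\<forall>l x. norm (fourier (\<lambda>\<xi>. \<theta> \<xi> x) l) \<le> B * (wt l * wt x))"

lemma decaying_measurable:
  assumes "decaying \<theta> B"
  shows "(\<lambda>(\<xi>, x). \<theta> \<xi> x) \<in> borel_measurable (borel \<Otimes>\<^sub>M borel)"
  using assms unfolding borel_prod decaying_def by (intro borel_measurable_continuous_onI) auto

lemma decaying_nonneg: "decaying \<theta> B \<Longrightarrow> 0 \<le> B"
proof -
  assume "decaying \<theta> B"
  then have "norm (\<theta> 0 0) \<le> B * (wt (0::real^3) * wt (0::real^3))" by (simp add: decaying_def)
  then have "0 \<le> B * (wt (0::real^3) * wt (0::real^3))" by (rule order_trans[OF norm_ge_zero])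
  then show ?thesis using mult_pos_pos[OF wt_pos[of "0::real^3"] wt_pos[of "0::real^3"]]
    by (simp add: zero_le_mult_iff)
qed

lemma decaying_inversion:
  assumes d: "decaying \<theta> B"
  shows "\<theta> \<xi> x = (\<integral>l. cis (l \<bullet> \<xi>) * fourier (\<lambda>\<xi>. \<theta> \<xi> x) l \<partial>lborel) / (2 * of_real pi) ^ 3"
    and "integrable lborel (\<lambda>\<xi>. \<theta> \<xi> x)"
    and "integrable lborel (fourier (\<lambda>\<xi>. \<theta> \<xi> x))"
proof -
  note [measurable (raw)] = measurable_case_prodD[OF decaying_measurable[OF d]]
  have b: "norm (\<theta> \<xi> x) \<le> B * (wt \<xi> * wt x)" "norm (fourier (\<lambda>\<xi>. \<theta> \<xi> x) l) \<le> B * (wt l * wt x)" for \<xi> l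
    using d by (auto simp: decaying_def)
  have iw: "integrable lborel (\<lambda>\<xi> :: real^3. wt \<xi> * wt x)" by (intro integrable_mult_left integrable_wt)
  show i: "integrable lborel (\<lambda>\<xi>. \<theta> \<xi> x)"
    by (rule integrable_const_mult_bound[OF iw _ b(1)]) measurable
  show j: "integrable lborel (fourier (\<lambda>\<xi>. \<theta> \<xi> x))"
    by (rule integrable_const_mult_bound[OF iw _ b(2)]) measurable
  have "continuous_on UNIV (\<lambda>\<xi>. (\<lambda>(\<xi>, x). \<theta> \<xi> x) (\<xi>, x))"
    by (rule continuous_on_compose2[OF _ continuous_on_Pair[OF continuous_on_id continuous_on_const]])
      (use d in \<open>auto simp: decaying_def\<close>)
  then have c: "isCont (\<lambda>\<xi>. \<theta> \<xi> x) \<xi>" by (simp add: continuous_on_eq_continuous_at)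
  have B1: "norm (\<theta> \<xi> x) \<le> B" for \<xi>
  proof -
    have "wt \<xi> * wt x \<le> 1 * 1" by (intro mult_mono wt_le_1) auto
    then have "B * (wt \<xi> * wt x) \<le> B * 1" using decaying_nonneg[OF d] by (intro mult_left_mono) auto
    then show ?thesis using b(1)[of \<xi>] by simp
  qed
  show "\<theta> \<xi> x = (\<integral>l. cis (l \<bullet> \<xi>) * fourier (\<lambda>\<xi>. \<theta> \<xi> x) l \<partial>lborel) / (2 * of_real pi) ^ 3"
    using fourier_inversion[OF i B1 c j] by simp
qed

text \<open>\<open>a\<close> stands for a diagonal entry of the coefficient matrix, \<open>s\<close>
  for a component of the source, and \<theta> for the conjugate of a component of the test
  function.\<close>

locale wigner_source = wigner_pair +
  fixes a :: "real^3 \<Rightarrow> real" and s :: "real^3 \<Rightarrow> complex" and \<theta> :: "real^3 \<Rightarrow> real^3 \<Rightarrow> complex"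
    and Ca B :: real
  assumes a_meas [measurable]: "a \<in> borel_measurable borel"
    and a_le: "\<bar>a x\<bar> \<le> Ca"
    and s_int: "integrable lborel s"
    and \<theta>: "decaying \<theta> B"
begin

lemmas \<theta>_measurable [measurable (raw)] = measurable_case_prodD[OF decaying_measurable[OF \<theta>]]

lemma s_measurable [measurable]: "s \<in> borel_measurable borel"
  using s_int by auto

lemma Ca_nonneg: "0 \<le> Ca"
  using a_le[of 0] by linarith

lemmas B_nonneg = decaying_nonneg[OF \<theta>]

text \<open>The coefficient and the test function written in the variables of \<open>shear\<close>,
  with p = (y, z).\<close>

definition \<Theta> :: "(real^3) \<times> (real^3) \<Rightarrow> real^3 \<Rightarrow> complex" where
  "\<Theta> p x = of_real (a (x + (e / 2) *\<^sub>R fst p)) * \<theta> (snd p - fst p) (x - e *\<^sub>R snd p + (e / 2) *\<^sub>R fst p)"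

lemma \<Theta>_measurable: "(\<lambda>(p, x). \<Theta> p x) \<in> borel_measurable (borel \<Otimes>\<^sub>M borel)"
  unfolding \<Theta>_def by measurable

lemma \<Theta>_bound': "norm (\<Theta> p x) \<le> Ca * B * wt (snd p - fst p) * wt (x + (- (e *\<^sub>R snd p) + (e / 2) *\<^sub>R fst p))"
proof -
  have "norm (\<Theta> p x) \<le> Ca * (B * (wt (snd p - fst p) * wt (x - e *\<^sub>R snd p + (e / 2) *\<^sub>R fst p)))"
    unfolding \<Theta>_def norm_mult using a_le \<theta> Ca_nonneg by (intro mult_mono) (auto simp: decaying_def)
  moreover have "x - e *\<^sub>R snd p + (e / 2) *\<^sub>R fst p = x + (- (e *\<^sub>R snd p) + (e / 2) *\<^sub>R fst p)" by simp
  ultimately show ?thesis by (simp only: mult.assoc)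
qed

lemma \<Theta>_bound: "norm (\<Theta> p x) \<le> Ca * B * wt (snd p - fst p)"
  by (rule order_trans[OF \<Theta>_bound'])
    (use Ca_nonneg B_nonneg wt_le_1 in \<open>auto intro!: mult_left_le\<close>)

text \<open>The argument is r = (\<xi>, x0, z), in the order of \<open>back_integrand\<close>. The
  constant prefactor of the signal is left out here and returns in \<open>coef\<close>.\<close>

definition T_integrand :: "real^3 \<Rightarrow> (real^3) \<times> (real^3) \<times> (real^3) \<Rightarrow> complex" where
  "T_integrand k r = cis (k \<bullet> (fst r - snd (snd r))) * wigner1 (fst (snd r) + (e / 2) *\<^sub>R (snd (snd r) + fst r)) k
     * (of_real (a (fst (snd r) + e *\<^sub>R snd (snd r))) * (s (snd (snd r)) * \<theta> (fst r) (fst (snd r))))"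

definition T :: "real^3 \<Rightarrow> complex" where
  "T k = (\<integral>r. T_integrand k r \<partial>lborel)"

lemma T_integrand_measurable [measurable (raw)]:
  assumes [measurable]: "f \<in> borel_measurable N" "g \<in> borel_measurable N"
  shows "(\<lambda>w. T_integrand (f w) (g w)) \<in> borel_measurable N"
  unfolding T_integrand_def by measurable

lemma T_measurable [measurable]: "T \<in> borel_measurable borel"
  unfolding T_def by measurable

definition majorant :: "(real^3) \<times> (real^3) \<times> (real^3) \<Rightarrow> real" where
  "majorant r = wt (fst r) * (wt (fst (snd r)) * norm (s (snd (snd r))))"

lemma majorant_integrable: "integrable lborel majorant"
proof -
  have "integrable lborel (\<lambda>(x, z). wt (x :: real^3) * norm (s z))"
    by (rule integrable_lborel_prod_bound[OF integrable_wt s_int]) (auto simp: abs_mult)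
  then have "integrable lborel (\<lambda>(\<xi> :: real^3, q). wt \<xi> * (case q of (x, z) \<Rightarrow> wt (x :: real^3) * norm (s z)))"
    by (rule integrable_lborel_prod_bound[OF integrable_wt]) (auto simp: abs_mult split_def)
  then show ?thesis by (simp add: majorant_def[abs_def] split_def)
qed

lemma T_integrand_bound: "norm (T_integrand k r) \<le> W / (2 * pi) ^ 3 * Ca * B * majorant r"
proof -
  have "norm (T_integrand k r) \<le> 1 * (W / (2 * pi) ^ 3) * (Ca * (norm (s (snd (snd r))) * (B * (wt (fst r) * wt (fst (snd r))))))"
    unfolding T_integrand_def norm_mult using a_le \<theta> Ca_nonneg W_nonneg
    by (intro mult_mono wigner1_bound mult_nonneg_nonneg) (auto simp: decaying_def)
  then show ?thesis by (simp add: majorant_def mult_ac)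
qed

lemma T_integrand_integrable: "integrable lborel (T_integrand k)"
  by (rule integrable_const_mult_bound[OF majorant_integrable _ T_integrand_bound]) measurable

text \<open>After \<open>shear\<close> the phase is \<open>cis (- (k \<bullet> y))\<close>. Writing
  the integration variable inside \<open>wigner1\<close> as y + \<eta> combines the phases to
  \<open>cis (k \<bullet> \<eta>)\<close>, so \<open>T\<close> is a reflected multiple of the
  Fourier transform of the shifted pairing. At fixed \<open>e\<close> the integral over \<eta> is
  bounded by \<open>W\<close>.\<close>

lemma T_fourier:
  shows "T k = (\<integral>\<eta>. cis (k \<bullet> \<eta>) * pairing s \<Theta> \<eta> \<partial>lborel) / (2 * of_real pi) ^ 3"
    and "integrable lborel (pairing s \<Theta>)"
proof -
  note [measurable (raw)] = measurable_case_prodD[OF \<Theta>_measurable]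
  have [measurable]: "(\<lambda>((p, x), \<eta>). pairing_integrand s \<Theta> \<eta> p x) \<in> borel_measurable (borel \<Otimes>\<^sub>M borel)"
    unfolding pairing_integrand_def split_def by measurable
  define F where "F m r \<eta> = cis (m \<bullet> \<eta>) * pairing_integrand s \<Theta> \<eta> (fst r) (snd r)" for m r \<eta>
  have F_meas: "(\<lambda>(r, \<eta>). F m r \<eta>) \<in> borel_measurable (borel \<Otimes>\<^sub>M borel)" for m
    unfolding F_def pairing_integrand_def by measurable
  \<comment> \<open>Here the decay of \<theta> in x0 is used: it makes the \<open>x\<close>-integral
    finite, with the same value at every translation, and \<open>source_weight\<close> remains for
    (y, z).\<close>
  have \<Theta>s: "(\<integral>\<^sup>+r. ennreal (norm (s (snd (fst r)) * \<Theta> (fst r) (snd r))) \<partial>lborel) < \<infinity>"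
  proof -
    have "(\<integral>\<^sup>+r. ennreal (norm (s (snd (fst r)) * \<Theta> (fst r) (snd r))) \<partial>lborel)
       = (\<integral>\<^sup>+p. \<integral>\<^sup>+x. ennreal (norm (s (snd p) * \<Theta> p x)) \<partial>lborel \<partial>lborel)"
      by (subst nn_integral_lborel_prod_iterated(1)) simp_all
    also have "\<dots> \<le> (\<integral>\<^sup>+p. \<integral>\<^sup>+x. ennreal (Ca * B * source_weight s p) * ennreal (wt (x + (- (e *\<^sub>R snd p) + (e / 2) *\<^sub>R fst p))) \<partial>lborel \<partial>lborel)"
    proof (intro nn_integral_mono)
      fix p x
      have "norm (s (snd p) * \<Theta> p x) \<le> norm (s (snd p)) * (Ca * B * wt (snd p - fst p) * wt (x + (- (e *\<^sub>R snd p) + (e / 2) *\<^sub>R fst p)))"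
        unfolding norm_mult by (intro mult_left_mono \<Theta>_bound') simp
      then show "ennreal (norm (s (snd p) * \<Theta> p x)) \<le> ennreal (Ca * B * source_weight s p) * ennreal (wt (x + (- (e *\<^sub>R snd p) + (e / 2) *\<^sub>R fst p)))"
        using Ca_nonneg B_nonneg by (simp add: source_weight_def ennreal_mult[symmetric] ennreal_leI mult_ac)
    qed
    also have "\<dots> = (\<integral>\<^sup>+p. ennreal (Ca * B * source_weight s p) * ennreal (\<integral>x. wt (x :: real^3) \<partial>lborel) \<partial>lborel)"
      by (intro nn_integral_cong) (subst nn_integral_cmult, measurable, simp only: nn_integral_wt_shift)
    also have "\<dots> < \<infinity>"
      using integrable_source_weight(1)[OF s_int] Ca_nonneg B_nonneg
      by (simp add: nn_integral_multc nn_integral_eq_integral ennreal_mult_less_top)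
    finally show ?thesis .
  qed
  have F_int: "integrable lborel (\<lambda>(r, \<eta>). F m r \<eta>)" for m
  proof (rule integrable_lborel_prodI[OF F_meas])
    have "(\<integral>\<^sup>+r. \<integral>\<^sup>+\<eta>. ennreal (norm (F m r \<eta>)) \<partial>lborel \<partial>lborel)
       = (\<integral>\<^sup>+r. \<integral>\<^sup>+\<eta>. ennreal (norm (s (snd (fst r)) * \<Theta> (fst r) (snd r))) * ennreal (norm (uv (snd r) (fst (fst r) + \<eta>))) \<partial>lborel \<partial>lborel)"
      by (intro nn_integral_cong) (simp add: F_def pairing_integrand_def norm_mult ennreal_mult[symmetric] mult_ac)
    also have "\<dots> \<le> (\<integral>\<^sup>+r. ennreal (norm (s (snd (fst r)) * \<Theta> (fst r) (snd r))) * ennreal W \<partial>lborel)"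
      by (intro nn_integral_mono, subst nn_integral_cmult) (auto intro!: mult_left_mono nn_integral_uv_y)
    also have "\<dots> < \<infinity>"
      using \<Theta>s by (subst nn_integral_multc) (auto simp: ennreal_mult_less_top)
    finally show "(\<integral>\<^sup>+r. \<integral>\<^sup>+\<eta>. ennreal (norm (F m r \<eta>)) \<partial>lborel \<partial>lborel) < \<infinity>" .
  qed
  have pair: "(\<integral>r. F m r \<eta> \<partial>lborel) = cis (m \<bullet> \<eta>) * pairing s \<Theta> \<eta>" for m \<eta>
    by (simp add: F_def pairing_def split_def)
  show "integrable lborel (pairing s \<Theta>)"
    using integrable_lborel_iterated(2)[OF F_int, of 0] by (simp add: pair)
  have "T k = (\<integral>r. T_integrand k (shear e r) \<partial>lborel)"
    unfolding T_def by (rule integral_shear[symmetric]) measurable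
  also have "\<dots> = (\<integral>r. (\<integral>\<eta>. F k r \<eta> \<partial>lborel) / (2 * of_real pi) ^ 3 \<partial>lborel)"
  proof (intro Bochner_Integration.integral_cong refl)
    fix r :: "((real^3) \<times> (real^3)) \<times> (real^3)"
    obtain y z x where r: "r = ((y, z), x)" by (metis surj_pair)
    have 1: "x - e *\<^sub>R z + (e / 2) *\<^sub>R y + (e / 2) *\<^sub>R (z + (z - y)) = x"
    proof -
      have "(e / 2) *\<^sub>R z + (e / 2) *\<^sub>R z = e *\<^sub>R z" by (simp flip: scaleR_add_left)
      then show ?thesis by (simp add: algebra_simps)
    qed
    have 2: "x - e *\<^sub>R z + (e / 2) *\<^sub>R y + e *\<^sub>R z = x + (e / 2) *\<^sub>R y" by simp
    have "T_integrand k (shear e r) = (cis (- (k \<bullet> y)) * wigner1 x k) * (s z * \<Theta> (y, z) x)"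
      unfolding T_integrand_def shear_def r fst_conv snd_conv 1 2
      by (simp add: \<Theta>_def inner_diff_right mult_ac)
    also have "cis (- (k \<bullet> y)) * wigner1 x k = (\<integral>\<eta>. cis (k \<bullet> \<eta>) * uv x (y + \<eta>) / (2 * of_real pi) ^ 3 \<partial>lborel)"
    proof -
      have "wigner1 x k = (\<integral>\<eta>. cis (k \<bullet> (\<eta> + y)) / (2 * of_real pi) ^ 3 * uv x (\<eta> + y) \<partial>lborel)"
        unfolding wigner1_def by (rule integral_lborel_shift[symmetric])
      then have "cis (- (k \<bullet> y)) * wigner1 x k = (\<integral>\<eta>. cis (- (k \<bullet> y)) * (cis (k \<bullet> (\<eta> + y)) / (2 * of_real pi) ^ 3 * uv x (\<eta> + y)) \<partial>lborel)"
        by simp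
      also have "\<dots> = (\<integral>\<eta>. cis (k \<bullet> \<eta>) * uv x (y + \<eta>) / (2 * of_real pi) ^ 3 \<partial>lborel)"
        by (intro Bochner_Integration.integral_cong refl)
          (simp add: cis_mult inner_add_right add.commute mult.assoc[symmetric])
      finally show ?thesis .
    qed
    also have "\<dots> * (s z * \<Theta> (y, z) x) = (\<integral>\<eta>. cis (k \<bullet> \<eta>) * uv x (y + \<eta>) / (2 * of_real pi) ^ 3 * (s z * \<Theta> (y, z) x) \<partial>lborel)"
      by (rule integral_mult_left_zero[symmetric])
    also have "\<dots> = (\<integral>\<eta>. F k r \<eta> / (2 * of_real pi) ^ 3 \<partial>lborel)"
      by (intro Bochner_Integration.integral_cong refl) (simp add: F_def pairing_integrand_def r)
    finally show "T_integrand k (shear e r) = (\<integral>\<eta>. F k r \<eta> \<partial>lborel) / (2 * of_real pi) ^ 3"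
      by simp
  qed
  also have "\<dots> = (\<integral>r. \<integral>\<eta>. F k r \<eta> \<partial>lborel \<partial>lborel) / (2 * of_real pi) ^ 3"
    by simp
  also have "(\<integral>r. \<integral>\<eta>. F k r \<eta> \<partial>lborel \<partial>lborel) = (\<integral>\<eta>. \<integral>r. F k r \<eta> \<partial>lborel \<partial>lborel)"
    by (rule integral_lborel_swap[OF F_int])
  finally show "T k = (\<integral>\<eta>. cis (k \<bullet> \<eta>) * pairing s \<Theta> \<eta> \<partial>lborel) / (2 * of_real pi) ^ 3"
    by (simp add: pair)
qed

text \<open>Fourier inversion at \<eta> = 0 for the shifted pairing. The integrability of
  \<open>T\<close>, assumed here, is the separate analytic input obtained from Plancherel.\<close>

lemma integral_T:
  assumes "integrable lborel T"
  shows "(\<integral>k. T k \<partial>lborel) = pairing s \<Theta> 0"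
proof -
  have eq: "fourier (pairing s \<Theta>) k = (2 * of_real pi) ^ 3 * T (0 - k)" for k
    unfolding T_fourier(1)[of "0 - k"] by (simp add: fourier_def)
  have "integrable lborel (\<lambda>k. (2 * of_real pi) ^ 3 * T (0 - k))"
    using assms integrable_lborel_reflect_iff[of T 0] by simp
  then have i: "integrable lborel (fourier (pairing s \<Theta>))" by (simp add: eq[abs_def])
  have "(\<integral>k. cis (k \<bullet> 0) * fourier (pairing s \<Theta>) k \<partial>lborel) = of_real ((2 * pi) ^ 3) * pairing s \<Theta> 0"
    by (rule fourier_inversion[OF T_fourier(2) pairing_integrable(2)[OF s_int \<Theta>_measurable \<Theta>_bound]
          pairing_continuous[OF s_int \<Theta>_measurable \<Theta>_bound] i])
  moreover have "(\<integral>k. cis (k \<bullet> 0) * fourier (pairing s \<Theta>) k \<partial>lborel) = (2 * of_real pi) ^ 3 * (\<integral>k. T k \<partial>lborel)"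
    using integral_lborel_reflect[of T 0] by (simp add: eq)
  ultimately show ?thesis by simp
qed

end

section \<open>Absolute convergence of the integral over k\<close>

lemma nn_integral_weighted_product:
  fixes f g :: "'a \<Rightarrow> complex"
  assumes [measurable]: "f \<in> borel_measurable M" "g \<in> borel_measurable M" and w: "0 < w"
  shows "(\<integral>\<^sup>+x. ennreal (norm (f x) * norm (g x)) \<partial>M)
    \<le> ennreal w * (\<integral>\<^sup>+x. ennreal ((norm (f x))\<^sup>2) \<partial>M) + ennreal (1 / w) * (\<integral>\<^sup>+x. ennreal ((norm (g x))\<^sup>2) \<partial>M)"
proof -
  have "(\<integral>\<^sup>+x. ennreal (norm (f x) * norm (g x)) \<partial>M)
     \<le> (\<integral>\<^sup>+x. ennreal w * ennreal ((norm (f x))\<^sup>2) + ennreal (1 / w) * ennreal ((norm (g x))\<^sup>2) \<partial>M)"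
  proof (rule nn_integral_mono)
    fix x
    have "2 * ((sqrt w * norm (f x)) * (norm (g x) / sqrt w)) \<le> (sqrt w * norm (f x))\<^sup>2 + (norm (g x) / sqrt w)\<^sup>2"
      by (rule two_mult_le_squares)
    then have "2 * (norm (f x) * norm (g x)) \<le> w * (norm (f x))\<^sup>2 + 1 / w * (norm (g x))\<^sup>2"
      using w by (simp add: power_mult_distrib power_divide)
    moreover have "0 \<le> norm (f x) * norm (g x)" by simp
    ultimately have "norm (f x) * norm (g x) \<le> w * (norm (f x))\<^sup>2 + 1 / w * (norm (g x))\<^sup>2" by linarith
    then show "ennreal (norm (f x) * norm (g x)) \<le> ennreal w * ennreal ((norm (f x))\<^sup>2) + ennreal (1 / w) * ennreal ((norm (g x))\<^sup>2)"
      using w by (simp add: ennreal_mult[symmetric] ennreal_plus[symmetric] ennreal_leI del: ennreal_plus)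
  qed
  also have "\<dots> = ennreal w * (\<integral>\<^sup>+x. ennreal ((norm (f x))\<^sup>2) \<partial>M) + ennreal (1 / w) * (\<integral>\<^sup>+x. ennreal ((norm (g x))\<^sup>2) \<partial>M)"
    by (simp add: nn_integral_add nn_integral_cmult)
  finally show ?thesis .
qed

text \<open>Integrability gives \<open>u\<close> and \<open>v\<close> Fourier transforms defined by
  integrals. As it is removed by truncation afterwards, the resulting bound must involve the fields
  through \<open>M\<close> alone.\<close>

locale wigner_source_L1 = wigner_source +
  assumes u_int: "integrable lborel u" and v_int: "integrable lborel v"
begin

text \<open>Moving the centre by e y / 2 and then substituting z = x + e y separates the two
  factors: one integral against \<open>u\<close>, one against \<open>v\<close>. The power
  \<open>e ^ 3\<close> is the Jacobian of the second substitution.\<close>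

lemma wigner1_fourier:
  shows "(\<integral>x. cis (m \<bullet> x) * wigner1 x k \<partial>lborel)
    = fourier u (- ((1/2) *\<^sub>R m) + (1/e) *\<^sub>R k) * fourier v (- ((1/2) *\<^sub>R m) - (1/e) *\<^sub>R k) / (of_real (e ^ 3) * (2 * of_real pi) ^ 3)"
    and "integrable lborel (\<lambda>x. wigner1 x k)"
proof -
  define c0 where "c0 = 1 / (2 * complex_of_real pi) ^ 3"
  define F where "F m x y = cis (m \<bullet> x) * (cis (k \<bullet> y) * c0 * uv x y)" for m x y
  have [measurable]: "(\<lambda>(x, y). F m x y) \<in> borel_measurable (borel \<Otimes>\<^sub>M borel)" for m
    unfolding F_def by measurable
  have uv_eq: "uv (x + (e / 2) *\<^sub>R y) y = u x * v (x + e *\<^sub>R y)" for x y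
  proof -
    have "(e / 2) *\<^sub>R y + (e / 2) *\<^sub>R y = e *\<^sub>R y" by (simp flip: scaleR_add_left)
    then show ?thesis unfolding uv_def add_diff_cancel_right' add.assoc by (simp only:)
  qed
  have nu: "(\<integral>\<^sup>+x. ennreal (norm (u x)) \<partial>lborel) < \<infinity>" and nv: "(\<integral>\<^sup>+x. ennreal (norm (v x)) \<partial>lborel) < \<infinity>"
    using u_int v_int by (auto simp: integrable_iff_bounded)
  have fin: "(\<integral>\<^sup>+x. \<integral>\<^sup>+y. ennreal (norm (u x * v (x + e *\<^sub>R y))) \<partial>lborel \<partial>lborel) < \<infinity>"
  proof -
    have "(\<integral>\<^sup>+x. \<integral>\<^sup>+y. ennreal (norm (u x * v (x + e *\<^sub>R y))) \<partial>lborel \<partial>lborel)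
       = (\<integral>\<^sup>+x. ennreal (norm (u x)) * (\<integral>\<^sup>+y. ennreal (norm (v (x + e *\<^sub>R y))) \<partial>lborel) \<partial>lborel)"
      by (simp add: norm_mult ennreal_mult nn_integral_cmult)
    also have "\<dots> = (\<integral>\<^sup>+x. ennreal (norm (u x)) * (ennreal (1 / \<bar>e\<bar> ^ 3) * (\<integral>\<^sup>+y. ennreal (norm (v y)) \<partial>lborel)) \<partial>lborel)"
      using e_pos nn_integral_lborel_affine[of "\<lambda>y. ennreal (norm (v y))" e] by simp
    also have "\<dots> < \<infinity>"
      using nu nv by (simp add: nn_integral_multc ennreal_mult_less_top)
    finally show ?thesis .
  qed
  have F_int: "integrable lborel (\<lambda>(x, y). F m x y)" for m
  proof (rule integrable_lborel_prodI')
    have "(\<integral>\<^sup>+y. \<integral>\<^sup>+x. ennreal (norm (F m x y)) \<partial>lborel \<partial>lborel)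
       = (\<integral>\<^sup>+y. \<integral>\<^sup>+x. ennreal (norm c0) * ennreal (norm (uv x y)) \<partial>lborel \<partial>lborel)"
      by (intro nn_integral_cong) (simp add: F_def norm_mult ennreal_mult)
    also have "\<dots> = ennreal (norm c0) * (\<integral>\<^sup>+y. \<integral>\<^sup>+x. ennreal (norm (uv x y)) \<partial>lborel \<partial>lborel)"
      by (simp add: nn_integral_cmult)
    also have "(\<integral>\<^sup>+y. \<integral>\<^sup>+x. ennreal (norm (uv x y)) \<partial>lborel \<partial>lborel) = (\<integral>\<^sup>+y. \<integral>\<^sup>+x. ennreal (norm (u x * v (x + e *\<^sub>R y))) \<partial>lborel \<partial>lborel)"
    proof (rule nn_integral_cong)
      fix y
      show "(\<integral>\<^sup>+x. ennreal (norm (uv x y)) \<partial>lborel) = (\<integral>\<^sup>+x. ennreal (norm (u x * v (x + e *\<^sub>R y))) \<partial>lborel)"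
        using nn_integral_lborel_shift[of "\<lambda>x. ennreal (norm (uv x y))" "(e / 2) *\<^sub>R y"] by (simp add: uv_eq)
    qed
    also have "\<dots> = (\<integral>\<^sup>+x. \<integral>\<^sup>+y. ennreal (norm (u x * v (x + e *\<^sub>R y))) \<partial>lborel \<partial>lborel)"
      by (rule lborel_pair.Fubini') measurable
    also have "ennreal (norm c0) * \<dots> < \<infinity>" using fin by (simp add: ennreal_mult_less_top)
    finally show "(\<integral>\<^sup>+y. \<integral>\<^sup>+x. ennreal (norm (F m x y)) \<partial>lborel \<partial>lborel) < \<infinity>" .
  qed measurable
  have wF: "(\<integral>y. F m x y \<partial>lborel) = cis (m \<bullet> x) * wigner1 x k" for m x
    by (simp add: F_def wigner1_def c0_def)
  show "integrable lborel (\<lambda>x. wigner1 x k)"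
    using integrable_lborel_iterated(1)[OF F_int, of 0] by (simp add: wF)
  define A where "A x y = cis (m \<bullet> (x + (e / 2) *\<^sub>R y)) * (cis (k \<bullet> y) * c0 * (u x * v (x + e *\<^sub>R y)))" for x y
  have A_int: "integrable lborel (\<lambda>(x, y). A x y)"
  proof (rule integrable_lborel_prodI)
    have "(\<integral>\<^sup>+x. \<integral>\<^sup>+y. ennreal (norm (A x y)) \<partial>lborel \<partial>lborel) = (\<integral>\<^sup>+x. \<integral>\<^sup>+y. ennreal (norm c0) * ennreal (norm (u x * v (x + e *\<^sub>R y))) \<partial>lborel \<partial>lborel)"
      by (intro nn_integral_cong) (simp add: A_def norm_mult ennreal_mult)
    also have "\<dots> = ennreal (norm c0) * (\<integral>\<^sup>+x. \<integral>\<^sup>+y. ennreal (norm (u x * v (x + e *\<^sub>R y))) \<partial>lborel \<partial>lborel)"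
      by (simp add: nn_integral_cmult)
    also have "\<dots> < \<infinity>" using fin by (simp add: ennreal_mult_less_top)
    finally show "(\<integral>\<^sup>+x. \<integral>\<^sup>+y. ennreal (norm (A x y)) \<partial>lborel \<partial>lborel) < \<infinity>" .
    show "(\<lambda>(x, y). A x y) \<in> borel_measurable (borel \<Otimes>\<^sub>M borel)" unfolding A_def by measurable
  qed
  have "(\<integral>x. cis (m \<bullet> x) * wigner1 x k \<partial>lborel) = (\<integral>x. \<integral>y. F m x y \<partial>lborel \<partial>lborel)"
    by (simp add: wF)
  also have "\<dots> = (\<integral>y. \<integral>x. F m x y \<partial>lborel \<partial>lborel)"
    by (rule integral_lborel_swap[OF F_int])
  also have "\<dots> = (\<integral>y. \<integral>x. A x y \<partial>lborel \<partial>lborel)"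
  proof (rule Bochner_Integration.integral_cong[OF refl])
    fix y
    have "(\<integral>x. F m x y \<partial>lborel) = (\<integral>x. F m (x + (e / 2) *\<^sub>R y) y \<partial>lborel)"
      by (rule integral_lborel_shift[symmetric])
    then show "(\<integral>x. F m x y \<partial>lborel) = (\<integral>x. A x y \<partial>lborel)" by (simp add: F_def A_def uv_eq)
  qed
  also have "\<dots> = (\<integral>x. \<integral>y. A x y \<partial>lborel \<partial>lborel)"
    by (rule integral_lborel_swap[OF A_int, symmetric])
  also have "\<dots> = (\<integral>x. (c0 / of_real (e ^ 3)) * (cis (- ((- ((1/2) *\<^sub>R m) + (1/e) *\<^sub>R k) \<bullet> x)) * u x * fourier v (- ((1/2) *\<^sub>R m) - (1/e) *\<^sub>R k)) \<partial>lborel)"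
  proof (rule Bochner_Integration.integral_cong[OF refl])
    fix x
    define g where "g z = (c0 * (cis (- ((- ((1/2) *\<^sub>R m) + (1/e) *\<^sub>R k) \<bullet> x)) * u x)) * (cis (- ((- ((1/2) *\<^sub>R m) - (1/e) *\<^sub>R k) \<bullet> z)) * v z)" for z
    have "A x y = g (x + e *\<^sub>R y)" for y
    proof -
      have ph: "m \<bullet> (x + (e / 2) *\<^sub>R y) + k \<bullet> y
        = - ((- ((1/2) *\<^sub>R m) + (1/e) *\<^sub>R k) \<bullet> x) + - ((- ((1/2) *\<^sub>R m) - (1/e) *\<^sub>R k) \<bullet> (x + e *\<^sub>R y))"
        using e_pos by (simp add: inner_add_left inner_add_right inner_diff_left algebra_simps)
      have "A x y = cis (m \<bullet> (x + (e / 2) *\<^sub>R y) + k \<bullet> y) * (c0 * (u x * v (x + e *\<^sub>R y)))"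
        by (simp add: A_def cis_mult[symmetric])
      also have "\<dots> = g (x + e *\<^sub>R y)"
        unfolding ph cis_mult[symmetric] g_def by simp
      finally show ?thesis .
    qed
    then have "(\<integral>y. A x y \<partial>lborel) = (1 / \<bar>e\<bar> ^ 3) *\<^sub>R (\<integral>z. g z \<partial>lborel)"
      using integral_lborel_affine[of e g x] e_pos by simp
    also have "(\<integral>z. g z \<partial>lborel) = (c0 * (cis (- ((- ((1/2) *\<^sub>R m) + (1/e) *\<^sub>R k) \<bullet> x)) * u x)) * fourier v (- ((1/2) *\<^sub>R m) - (1/e) *\<^sub>R k)"
      unfolding g_def fourier_def by (rule integral_mult_right_zero)
    finally show "(\<integral>y. A x y \<partial>lborel) = (c0 / of_real (e ^ 3)) * (cis (- ((- ((1/2) *\<^sub>R m) + (1/e) *\<^sub>R k) \<bullet> x)) * u x * fourier v (- ((1/2) *\<^sub>R m) - (1/e) *\<^sub>R k))"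
      using e_pos by (simp add: scaleR_conv_of_real mult_ac)
  qed
  also have "\<dots> = (c0 / of_real (e ^ 3)) * ((\<integral>x. cis (- ((- ((1/2) *\<^sub>R m) + (1/e) *\<^sub>R k) \<bullet> x)) * u x \<partial>lborel) * fourier v (- ((1/2) *\<^sub>R m) - (1/e) *\<^sub>R k))"
    by (simp only: integral_mult_right_zero integral_mult_left_zero)
  also have "\<dots> = fourier u (- ((1/2) *\<^sub>R m) + (1/e) *\<^sub>R k) * fourier v (- ((1/2) *\<^sub>R m) - (1/e) *\<^sub>R k) / (of_real (e ^ 3) * (2 * of_real pi) ^ 3)"
    by (simp add: c0_def fourier_def)
  finally show "(\<integral>x. cis (m \<bullet> x) * wigner1 x k \<partial>lborel)
    = fourier u (- ((1/2) *\<^sub>R m) + (1/e) *\<^sub>R k) * fourier v (- ((1/2) *\<^sub>R m) - (1/e) *\<^sub>R k) / (of_real (e ^ 3) * (2 * of_real pi) ^ 3)" .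
qed

definition \<theta>hat :: "real^3 \<Rightarrow> real^3 \<Rightarrow> complex" where
  "\<theta>hat l x = fourier (\<lambda>\<xi>. \<theta> \<xi> x) l"

lemma \<theta>hat_measurable [measurable (raw)]:
  assumes [measurable]: "f \<in> borel_measurable N" "g \<in> borel_measurable N"
  shows "(\<lambda>w. \<theta>hat (f w) (g w)) \<in> borel_measurable N"
  unfolding \<theta>hat_def fourier_def by measurable

lemma \<theta>hat_bound: "norm (\<theta>hat l x) \<le> B * (wt l * wt x)"
  using \<theta> by (simp add: \<theta>hat_def decaying_def)

text \<open>The product in \<open>wigner1_fourier\<close> at m = (2 / e)(l + k). With this m the
  frequency of \<open>u\<close> is free of \<open>k\<close>, so that the integration over
  \<open>k\<close> meets a constant there.\<close>

definition uvhat :: "real^3 \<Rightarrow> real^3 \<Rightarrow> complex" where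
  "uvhat k l = fourier u (- ((1/e) *\<^sub>R l)) * fourier v (- ((1/e) *\<^sub>R l) + (- (2/e)) *\<^sub>R k)"

text \<open>Collects the Jacobian (2 / e)^3 of the substitution in \<xi>, the constants of
  \<open>wigner1_fourier\<close>, and the constant of the Fourier inversion of \<theta>.\<close>

definition K0 :: complex where
  "K0 = of_real ((2 / e) ^ 3) / (of_real (e ^ 3) * (2 * of_real pi) ^ 3 * (2 * of_real pi) ^ 3)"

text \<open>Expanding \<theta> in plane waves of frequency \<open>l\<close> turns the integral over
  \<xi> into a Fourier transform of the Wigner function in its position variable, and that transform
  factors.\<close>

lemma line_integral:
  "(\<integral>\<xi>. cis (k \<bullet> (\<xi> - z)) * wigner1 (x + (e / 2) *\<^sub>R (z + \<xi>)) k * \<theta> \<xi> x \<partial>lborel)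
    = (\<integral>l. K0 * uvhat k l * cis (- ((l + 2 *\<^sub>R k) \<bullet> z)) * cis (- (((2 / e) *\<^sub>R l + (2 / e) *\<^sub>R k) \<bullet> x)) * \<theta>hat l x \<partial>lborel)"
proof -
  define P where "P \<xi> = cis (k \<bullet> (\<xi> - z)) * wigner1 (x + (e / 2) *\<^sub>R (z + \<xi>)) k" for \<xi>
  have [measurable]: "P \<in> borel_measurable borel" unfolding P_def by measurable
  have "integrable lborel (\<lambda>\<xi>. wigner1 ((x + (e / 2) *\<^sub>R z) + (e / 2) *\<^sub>R \<xi>) k)"
    by (rule integrable_lborel_affine[OF wigner1_fourier(2)]) (use e_pos in simp)
  then have wi: "integrable lborel (\<lambda>\<xi>. wigner1 (x + (e / 2) *\<^sub>R (z + \<xi>)) k)"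
    by (simp add: scaleR_add_right add.assoc)
  have P: "integrable lborel P"
    by (rule Bochner_Integration.integrable_bound[OF wi]) (auto simp: P_def norm_mult)
  \<comment> \<open>With \<xi> = t + (2 / e) X the position argument of the Wigner function is
    X.\<close>
  define t where "t = - z - (2 / e) *\<^sub>R x"
  have PF: "(\<integral>\<xi>. cis (l \<bullet> \<xi>) * P \<xi> \<partial>lborel)
     = of_real ((2 / e) ^ 3) * (uvhat k l / (of_real (e ^ 3) * (2 * of_real pi) ^ 3)) * cis (- ((l + 2 *\<^sub>R k) \<bullet> z)) * cis (- (((2 / e) *\<^sub>R l + (2 / e) *\<^sub>R k) \<bullet> x))" for l
  proof -
    define m where "m = (2 / e) *\<^sub>R (l + k)"
    have "(\<integral>X. cis (l \<bullet> (t + (2 / e) *\<^sub>R X)) * P (t + (2 / e) *\<^sub>R X) \<partial>lborel) = (1 / \<bar>2 / e\<bar> ^ 3) *\<^sub>R (\<integral>\<xi>. cis (l \<bullet> \<xi>) * P \<xi> \<partial>lborel)"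
      using integral_lborel_affine[of "2 / e" "\<lambda>\<xi>. cis (l \<bullet> \<xi>) * P \<xi>" t] e_pos by simp
    then have "(\<integral>\<xi>. cis (l \<bullet> \<xi>) * P \<xi> \<partial>lborel) = of_real ((2 / e) ^ 3) * (\<integral>X. cis (l \<bullet> (t + (2 / e) *\<^sub>R X)) * P (t + (2 / e) *\<^sub>R X) \<partial>lborel)"
      using e_pos by (simp add: scaleR_conv_of_real)
    also have "(\<integral>X. cis (l \<bullet> (t + (2 / e) *\<^sub>R X)) * P (t + (2 / e) *\<^sub>R X) \<partial>lborel)
        = (\<integral>X. (cis (- ((l + 2 *\<^sub>R k) \<bullet> z)) * cis (- (((2 / e) *\<^sub>R l + (2 / e) *\<^sub>R k) \<bullet> x))) * (cis (m \<bullet> X) * wigner1 X k) \<partial>lborel)"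
    proof (rule Bochner_Integration.integral_cong[OF refl])
      fix X
      have arg: "x + (e / 2) *\<^sub>R (z + (t + (2 / e) *\<^sub>R X)) = X"
        using e_pos by (simp add: t_def algebra_simps)
      have ph: "l \<bullet> (t + (2 / e) *\<^sub>R X) + k \<bullet> (t + (2 / e) *\<^sub>R X - z)
        = - ((l + 2 *\<^sub>R k) \<bullet> z) + - (((2 / e) *\<^sub>R l + (2 / e) *\<^sub>R k) \<bullet> x) + m \<bullet> X"
        unfolding t_def m_def inner_add_left inner_add_right inner_diff_right inner_scaleR_left inner_scaleR_right inner_minus_right
        by (simp add: algebra_simps)
      have "cis (l \<bullet> (t + (2 / e) *\<^sub>R X)) * P (t + (2 / e) *\<^sub>R X) = cis (l \<bullet> (t + (2 / e) *\<^sub>R X) + k \<bullet> (t + (2 / e) *\<^sub>R X - z)) * wigner1 X k"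
        unfolding P_def arg cis_mult[symmetric] by simp
      then show "cis (l \<bullet> (t + (2 / e) *\<^sub>R X)) * P (t + (2 / e) *\<^sub>R X)
          = (cis (- ((l + 2 *\<^sub>R k) \<bullet> z)) * cis (- (((2 / e) *\<^sub>R l + (2 / e) *\<^sub>R k) \<bullet> x))) * (cis (m \<bullet> X) * wigner1 X k)"
        unfolding ph cis_mult[symmetric] by (simp add: mult.assoc)
    qed
    also have "\<dots> = (cis (- ((l + 2 *\<^sub>R k) \<bullet> z)) * cis (- (((2 / e) *\<^sub>R l + (2 / e) *\<^sub>R k) \<bullet> x))) * (\<integral>X. cis (m \<bullet> X) * wigner1 X k \<partial>lborel)"
      by (rule integral_mult_right_zero)
    also have "(\<integral>X. cis (m \<bullet> X) * wigner1 X k \<partial>lborel) = uvhat k l / (of_real (e ^ 3) * (2 * of_real pi) ^ 3)"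
    proof -
      have 1: "- ((1/2) *\<^sub>R m) + (1/e) *\<^sub>R k = - ((1/e) *\<^sub>R l)" by (simp add: m_def scaleR_add_right)
      have "(1/e) *\<^sub>R k + (1/e) *\<^sub>R k = (2/e) *\<^sub>R k" by (simp flip: scaleR_add_left)
      moreover have "- ((1/2) *\<^sub>R m) - (1/e) *\<^sub>R k = - ((1/e) *\<^sub>R l) - ((1/e) *\<^sub>R k + (1/e) *\<^sub>R k)"
        unfolding m_def scaleR_add_right scaleR_scaleR by simp
      ultimately have 2: "- ((1/2) *\<^sub>R m) - (1/e) *\<^sub>R k = - ((1/e) *\<^sub>R l) + (- (2/e)) *\<^sub>R k"
        by (simp only: scaleR_minus_left diff_conv_add_uminus)
      show ?thesis unfolding wigner1_fourier(1) 1 2 uvhat_def ..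
    qed
    finally show ?thesis by (simp add: mult_ac)
  qed
  have th: "\<theta> \<xi> x = (\<integral>l. cis (l \<bullet> \<xi>) * \<theta>hat l x \<partial>lborel) / (2 * of_real pi) ^ 3" for \<xi>
    unfolding \<theta>hat_def by (rule decaying_inversion(1)[OF \<theta>])
  have thi: "integrable lborel (\<lambda>l. \<theta>hat l x)"
    unfolding \<theta>hat_def using decaying_inversion(3)[OF \<theta>] by simp
  have prod: "integrable lborel (\<lambda>(\<xi>, l). P \<xi> * (cis (l \<bullet> \<xi>) * \<theta>hat l x))"
    by (rule integrable_lborel_prod_bound[OF P thi]) (auto simp: norm_mult)
  have "(\<integral>\<xi>. P \<xi> * \<theta> \<xi> x \<partial>lborel) = (\<integral>\<xi>. \<integral>l. P \<xi> * (cis (l \<bullet> \<xi>) * \<theta>hat l x) \<partial>lborel \<partial>lborel) / (2 * of_real pi) ^ 3"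
    unfolding th by simp
  also have "(\<integral>\<xi>. \<integral>l. P \<xi> * (cis (l \<bullet> \<xi>) * \<theta>hat l x) \<partial>lborel \<partial>lborel) = (\<integral>l. \<integral>\<xi>. P \<xi> * (cis (l \<bullet> \<xi>) * \<theta>hat l x) \<partial>lborel \<partial>lborel)"
    by (rule integral_lborel_swap[OF prod])
  also have "\<dots> = (\<integral>l. (\<integral>\<xi>. cis (l \<bullet> \<xi>) * P \<xi> \<partial>lborel) * \<theta>hat l x \<partial>lborel)"
    by (simp add: mult.assoc[symmetric] mult.commute[of "P _"])
  also have "\<dots> / (2 * of_real pi) ^ 3 = (\<integral>l. (\<integral>\<xi>. cis (l \<bullet> \<xi>) * P \<xi> \<partial>lborel) * \<theta>hat l x / (2 * of_real pi) ^ 3 \<partial>lborel)"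
    by simp
  also have "\<dots> = (\<integral>l. K0 * uvhat k l * cis (- ((l + 2 *\<^sub>R k) \<bullet> z)) * cis (- (((2 / e) *\<^sub>R l + (2 / e) *\<^sub>R k) \<bullet> x)) * \<theta>hat l x \<partial>lborel)"
    unfolding PF by (intro Bochner_Integration.integral_cong refl) (simp add: K0_def mult_ac)
  finally show ?thesis by (simp add: P_def)
qed

lemma uvhat_bound: "norm (uvhat k l) \<le> (\<integral>x. norm (u x) \<partial>lborel) * (\<integral>x. norm (v x) \<partial>lborel)"
  unfolding uvhat_def norm_mult by (intro mult_mono norm_fourier_le) auto

lemma uvhat_measurable [measurable (raw)]:
  assumes [measurable]: "f \<in> borel_measurable N" "g \<in> borel_measurable N"
  shows "(\<lambda>w. uvhat (f w) (g w)) \<in> borel_measurable N"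
  unfolding uvhat_def by measurable

text \<open>What still depends on the position \<open>x\<close> once the phases are taken out. Its
  Fourier transform in \<open>x\<close> is evaluated at (2 / e)(l + k).\<close>

definition amp :: "real^3 \<Rightarrow> real^3 \<Rightarrow> real^3 \<Rightarrow> complex" where
  "amp l z x = of_real (a (x + e *\<^sub>R z)) * \<theta>hat l x"

lemma amp_measurable [measurable (raw)]:
  assumes [measurable]: "f \<in> borel_measurable N" "g \<in> borel_measurable N" "h \<in> borel_measurable N"
  shows "(\<lambda>w. amp (f w) (g w) (h w)) \<in> borel_measurable N"
  unfolding amp_def by measurable

lemma amp_bound: "norm (amp l z x) \<le> Ca * B * wt l * wt x"
proof -
  have "norm (amp l z x) \<le> Ca * (B * (wt l * wt x))"
    unfolding amp_def norm_mult using a_le \<theta>hat_bound Ca_nonneg by (intro mult_mono) auto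
  then show ?thesis by (simp add: mult.assoc)
qed

lemma amp_integrable: "integrable lborel (amp l z)"
  by (rule integrable_const_mult_bound[OF integrable_wt _ amp_bound]) measurable

text \<open>The order of integration is changed so that \<open>x\<close> comes innermost, where it
  produces the Fourier transform of \<open>amp\<close>. The L1 norms of \<open>u\<close> and
  \<open>v\<close> justify the exchange through \<open>uvhat_bound\<close> and do not survive in the
  estimate.\<close>

lemma T_le: "ennreal (norm (T k)) \<le> (\<integral>\<^sup>+l. \<integral>\<^sup>+z. ennreal (norm K0 * norm (uvhat k l) * norm (s z) * norm (fourier (amp l z) ((2 / e) *\<^sub>R l + (2 / e) *\<^sub>R k))) \<partial>lborel \<partial>lborel)"
proof -
  define L where "L = (\<integral>x. norm (u x) \<partial>lborel) * (\<integral>x. norm (v x) \<partial>lborel)"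
  have L0: "0 \<le> L" by (simp add: L_def)
  define h where "h q l = K0 * uvhat k l * cis (- ((l + 2 *\<^sub>R k) \<bullet> snd q)) * s (snd q)
      * (cis (- (((2 / e) *\<^sub>R l + (2 / e) *\<^sub>R k) \<bullet> fst q)) * amp l (snd q) (fst q))" for q l
  have mq: "integrable lborel (\<lambda>q. wt (fst q :: real^3) * norm (s (snd q)))"
  proof -
    have "integrable lborel (\<lambda>(x :: real^3, z). wt x * norm (s z))"
      by (rule integrable_lborel_prod_bound[OF integrable_wt s_int]) (auto simp: abs_mult)
    then show ?thesis by (simp add: split_def)
  qed
  have hb: "norm (h q l) \<le> (norm K0 * L * Ca * B) * (wt (fst q) * norm (s (snd q)) * wt l)" for q l
  proof -
    have "norm (h q l) \<le> norm K0 * L * 1 * norm (s (snd q)) * (1 * (Ca * B * wt l * wt (fst q)))"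
      unfolding h_def norm_mult
      using L0 uvhat_bound[of k l] Ca_nonneg B_nonneg by (intro mult_mono amp_bound) (auto simp: L_def)
    then show ?thesis by (simp add: mult_ac)
  qed
  have h_int: "integrable lborel (\<lambda>(q, l). h q l)"
  proof (rule integrable_lborel_prod_bound[of "\<lambda>q. (norm K0 * L * Ca * B) * (wt (fst q) * norm (s (snd q)))" "wt"])
    show "integrable lborel (\<lambda>q :: (real^3) \<times> (real^3). (norm K0 * L * Ca * B) * (wt (fst q) * norm (s (snd q))))" using mq by simp
    show "(\<lambda>(q, l). h q l) \<in> borel_measurable (borel \<Otimes>\<^sub>M borel)" unfolding h_def by measurable
    show "norm (h q l) \<le> norm ((norm K0 * L * Ca * B) * (wt (fst q) * norm (s (snd q)))) * norm (wt l)" for q l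
      using hb[of q l] L0 Ca_nonneg B_nonneg by (simp add: abs_mult mult.assoc)
  qed (rule integrable_wt)
  have h_int_q: "integrable lborel (\<lambda>(x, z). h (x, z) l)" for l
  proof (rule Bochner_Integration.integrable_bound)
    show "integrable lborel (\<lambda>q :: (real^3) \<times> (real^3). (norm K0 * L * Ca * B * wt l) * (wt (fst q) * norm (s (snd q))))" using mq by simp
    have "(\<lambda>(x, z). h (x, z) l) \<in> borel_measurable (borel \<Otimes>\<^sub>M borel)" unfolding h_def by measurable
    then show "(\<lambda>(x, z). h (x, z) l) \<in> borel_measurable lborel" by (simp add: borel_prod)
    show "AE q in lborel. norm (case q of (x, z) \<Rightarrow> h (x, z) l) \<le> norm ((norm K0 * L * Ca * B * wt l) * (wt (fst q) * norm (s (snd q))))"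
      using hb L0 Ca_nonneg B_nonneg by (intro AE_I2) (simp add: abs_mult mult_ac split_def)
  qed
  have h_x: "(\<integral>x. h (x, z) l \<partial>lborel) = K0 * uvhat k l * cis (- ((l + 2 *\<^sub>R k) \<bullet> z)) * s z * fourier (amp l z) ((2 / e) *\<^sub>R l + (2 / e) *\<^sub>R k)" for z l
    unfolding h_def fourier_def by simp
  have "T k = (\<integral>(\<xi>, q). T_integrand k (\<xi>, q) \<partial>lborel)"
    unfolding T_def by (simp add: split_def)
  also have "\<dots> = (\<integral>q. \<integral>\<xi>. T_integrand k (\<xi>, q) \<partial>lborel \<partial>lborel)"
    by (rule integrable_lborel_iterated(4)) (use T_integrand_integrable in \<open>simp add: split_def\<close>)
  also have "\<dots> = (\<integral>q. \<integral>l. h q l \<partial>lborel \<partial>lborel)"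
  proof (rule Bochner_Integration.integral_cong[OF refl])
    fix q :: "(real^3) \<times> (real^3)"
    obtain x z where q: "q = (x, z)" by (cases q)
    have "(\<integral>\<xi>. T_integrand k (\<xi>, q) \<partial>lborel)
       = (\<integral>\<xi>. of_real (a (x + e *\<^sub>R z)) * s z * (cis (k \<bullet> (\<xi> - z)) * wigner1 (x + (e / 2) *\<^sub>R (z + \<xi>)) k * \<theta> \<xi> x) \<partial>lborel)"
      by (intro Bochner_Integration.integral_cong refl) (simp add: T_integrand_def q mult_ac)
    also have "\<dots> = of_real (a (x + e *\<^sub>R z)) * s z * (\<integral>l. K0 * uvhat k l * cis (- ((l + 2 *\<^sub>R k) \<bullet> z)) * cis (- (((2 / e) *\<^sub>R l + (2 / e) *\<^sub>R k) \<bullet> x)) * \<theta>hat l x \<partial>lborel)"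
      unfolding line_integral[symmetric] by (rule integral_mult_right_zero)
    also have "\<dots> = (\<integral>l. of_real (a (x + e *\<^sub>R z)) * s z * (K0 * uvhat k l * cis (- ((l + 2 *\<^sub>R k) \<bullet> z)) * cis (- (((2 / e) *\<^sub>R l + (2 / e) *\<^sub>R k) \<bullet> x)) * \<theta>hat l x) \<partial>lborel)"
      by (rule integral_mult_right_zero[symmetric])
    also have "\<dots> = (\<integral>l. h q l \<partial>lborel)"
      by (intro Bochner_Integration.integral_cong refl) (simp add: h_def amp_def q mult_ac)
    finally show "(\<integral>\<xi>. T_integrand k (\<xi>, q) \<partial>lborel) = (\<integral>l. h q l \<partial>lborel)" .
  qed
  also have "\<dots> = (\<integral>l. \<integral>q. h q l \<partial>lborel \<partial>lborel)"
    by (rule integral_lborel_swap[OF h_int])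
  finally have "ennreal (norm (T k)) \<le> (\<integral>\<^sup>+l. ennreal (norm (\<integral>q. h q l \<partial>lborel)) \<partial>lborel)"
    by (simp only:) (rule integral_norm_bound_ennreal[OF integrable_lborel_iterated(2)[OF h_int]])
  also have "\<dots> \<le> (\<integral>\<^sup>+l. \<integral>\<^sup>+z. ennreal (norm (\<integral>x. h (x, z) l \<partial>lborel)) \<partial>lborel \<partial>lborel)"
  proof (rule nn_integral_mono)
    fix l
    have "(\<integral>q. h q l \<partial>lborel) = (\<integral>z. \<integral>x. h (x, z) l \<partial>lborel \<partial>lborel)"
      using integrable_lborel_iterated(4)[OF h_int_q, of l] by (simp add: split_def)
    then show "ennreal (norm (\<integral>q. h q l \<partial>lborel)) \<le> (\<integral>\<^sup>+z. ennreal (norm (\<integral>x. h (x, z) l \<partial>lborel)) \<partial>lborel)"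
      by (simp only:) (rule integral_norm_bound_ennreal[OF integrable_lborel_iterated(2)[OF h_int_q]])
  qed
  also have "\<dots> = (\<integral>\<^sup>+l. \<integral>\<^sup>+z. ennreal (norm K0 * norm (uvhat k l) * norm (s z) * norm (fourier (amp l z) ((2 / e) *\<^sub>R l + (2 / e) *\<^sub>R k))) \<partial>lborel \<partial>lborel)"
    unfolding h_x by (simp add: norm_mult)
  finally show ?thesis .
qed

end

lemma nn_integral_fourier_affine_le:
  assumes f: "integrable lborel f" and c: "c \<noteq> 0"
  shows "(\<integral>\<^sup>+k. ennreal ((norm (fourier f (t + c *\<^sub>R k)))\<^sup>2) \<partial>lborel)
    \<le> ennreal ((2 * pi) ^ 3 / \<bar>c\<bar> ^ 3) * (\<integral>\<^sup>+x. ennreal ((norm (f x))\<^sup>2) \<partial>lborel)"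
proof -
  have [measurable]: "f \<in> borel_measurable borel" using f by auto
  have "(\<integral>\<^sup>+k. ennreal ((norm (fourier f (t + c *\<^sub>R k)))\<^sup>2) \<partial>lborel) = ennreal (1 / \<bar>c\<bar> ^ 3) * (\<integral>\<^sup>+k. ennreal ((norm (fourier f k))\<^sup>2) \<partial>lborel)"
    using nn_integral_lborel_affine[of "\<lambda>k. ennreal ((norm (fourier f k))\<^sup>2)" c t] c by simp
  also have "\<dots> \<le> ennreal (1 / \<bar>c\<bar> ^ 3) * (ennreal ((2 * pi) ^ 3) * (\<integral>\<^sup>+x. ennreal ((norm (f x))\<^sup>2) \<partial>lborel))"
    by (intro mult_left_mono Plancherel_inequality f) simp
  finally show ?thesis by (simp add: mult.assoc[symmetric] ennreal_mult[symmetric])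
qed

lemma nn_integral_wt_square_le: "(\<integral>\<^sup>+x. ennreal ((wt (x :: 'a::euclidean_space))\<^sup>2) \<partial>lborel) \<le> ennreal (\<integral>x. wt (x :: 'a) \<partial>lborel)"
proof -
  have "(\<integral>\<^sup>+x. ennreal ((wt (x :: 'a))\<^sup>2) \<partial>lborel) \<le> (\<integral>\<^sup>+x. ennreal (wt (x :: 'a)) \<partial>lborel)"
    by (intro nn_integral_mono ennreal_leI) (simp add: power2_eq_square mult_left_le wt_le_1)
  also have "\<dots> = ennreal (\<integral>x. wt (x :: 'a) \<partial>lborel)"
    by (rule nn_integral_eq_integral) (simp_all add: integrable_wt)
  finally show ?thesis .
qed

context wigner_source_L1
begin

definition Iwt :: real where "Iwt = (\<integral>x. wt (x :: real^3) \<partial>lborel)"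

lemma Iwt_nonneg [simp]: "0 \<le> Iwt"
  by (simp add: Iwt_def)

definition C2 :: real where "C2 = (2 * pi) ^ 3 / (2 / e) ^ 3 * M + (2 * pi) ^ 3 / (2 / e) ^ 3 * ((Ca * B)\<^sup>2 * Iwt)"

text \<open>Outside the locale its parameters are \<open>e\<close>, \<open>M\<close>,
  \<open>s\<close>, \<open>Ca\<close> and \<open>B\<close>. As \<open>u\<close> and \<open>v\<close>
  are absent, the same number serves all truncations and all wave vectors.\<close>

definition T_const :: real where
  "T_const = norm K0 * C2 * (\<integral>z. norm (s z) \<partial>lborel) * ((2 * pi) ^ 3 / (1 / e) ^ 3 * M + Iwt)"

lemma C2_nonneg: "0 \<le> C2"
  using e_pos M_nonneg by (simp add: C2_def)

text \<open>Plancherel for both factors. The squared L2 norm of \<open>amp l z\<close> carries the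
  square of \<open>wt l\<close>, that of \<open>v\<close> carries no weight; splitting the product
  with \<open>wt l\<close> and its inverse leaves exactly one \<open>wt l\<close> in each
  term.\<close>

lemma inner_bound:
  "(\<integral>\<^sup>+k. ennreal (norm (fourier v (- ((1/e) *\<^sub>R l) + (- (2/e)) *\<^sub>R k)) * norm (fourier (amp l z) ((2 / e) *\<^sub>R l + (2 / e) *\<^sub>R k))) \<partial>lborel)
    \<le> ennreal (wt l * C2)"
proof -
  have [simp]: "\<bar>e\<bar> = e" using e_pos by simp
  have "(\<integral>\<^sup>+k. ennreal (norm (fourier v (- ((1/e) *\<^sub>R l) + (- (2/e)) *\<^sub>R k)) * norm (fourier (amp l z) ((2 / e) *\<^sub>R l + (2 / e) *\<^sub>R k))) \<partial>lborel)
    \<le> ennreal (wt l) * (\<integral>\<^sup>+k. ennreal ((norm (fourier v (- ((1/e) *\<^sub>R l) + (- (2/e)) *\<^sub>R k)))\<^sup>2) \<partial>lborel)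
      + ennreal (1 / wt l) * (\<integral>\<^sup>+k. ennreal ((norm (fourier (amp l z) ((2 / e) *\<^sub>R l + (2 / e) *\<^sub>R k)))\<^sup>2) \<partial>lborel)"
    by (rule nn_integral_weighted_product) (measurable, rule wt_pos)
  also have "\<dots> \<le> ennreal (wt l) * (ennreal ((2 * pi) ^ 3 / \<bar>- (2/e)\<bar> ^ 3) * ennreal M)
      + ennreal (1 / wt l) * (ennreal ((2 * pi) ^ 3 / \<bar>2/e\<bar> ^ 3) * ennreal ((Ca * B * wt l)\<^sup>2 * Iwt))"
  proof (intro add_mono mult_left_mono)
    show "(\<integral>\<^sup>+k. ennreal ((norm (fourier v (- ((1/e) *\<^sub>R l) + (- (2/e)) *\<^sub>R k)))\<^sup>2) \<partial>lborel) \<le> ennreal ((2 * pi) ^ 3 / \<bar>- (2/e)\<bar> ^ 3) * ennreal M"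
      by (rule order_trans[OF nn_integral_fourier_affine_le[OF v_int]])
        (use e_pos in \<open>auto intro!: mult_left_mono v_sq\<close>)
    have "(\<integral>\<^sup>+x. ennreal ((norm (amp l z x))\<^sup>2) \<partial>lborel) \<le> (\<integral>\<^sup>+x. ennreal ((Ca * B * wt l)\<^sup>2) * ennreal ((wt (x :: real^3))\<^sup>2) \<partial>lborel)"
      by (intro nn_integral_mono) (auto simp: ennreal_mult[symmetric] power_mult_distrib[symmetric] intro!: ennreal_leI power_mono amp_bound)
    also have "\<dots> \<le> ennreal ((Ca * B * wt l)\<^sup>2) * ennreal Iwt"
      unfolding Iwt_def by (subst nn_integral_cmult) (auto intro!: mult_left_mono nn_integral_wt_square_le)
    also have "\<dots> = ennreal ((Ca * B * wt l)\<^sup>2 * Iwt)" by (simp add: ennreal_mult)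
    finally show "(\<integral>\<^sup>+k. ennreal ((norm (fourier (amp l z) ((2 / e) *\<^sub>R l + (2 / e) *\<^sub>R k)))\<^sup>2) \<partial>lborel)
       \<le> ennreal ((2 * pi) ^ 3 / \<bar>2/e\<bar> ^ 3) * ennreal ((Ca * B * wt l)\<^sup>2 * Iwt)"
      by (intro order_trans[OF nn_integral_fourier_affine_le[OF amp_integrable]]) (use e_pos in \<open>auto intro!: mult_left_mono\<close>)
  qed auto
  also have "\<dots> = ennreal (wt l * ((2 * pi) ^ 3 / (2 / e) ^ 3 * M) + 1 / wt l * ((2 * pi) ^ 3 / (2 / e) ^ 3 * ((Ca * B * wt l)\<^sup>2 * Iwt)))"
    using e_pos M_nonneg by (simp add: ennreal_mult[symmetric] ennreal_plus[symmetric] del: ennreal_plus)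
  also have "1 / wt l * ((2 * pi) ^ 3 / (2 / e) ^ 3 * ((Ca * B * wt l)\<^sup>2 * Iwt)) = wt l * ((2 * pi) ^ 3 / (2 / e) ^ 3 * ((Ca * B)\<^sup>2 * Iwt))"
    using wt_pos[of l] by (simp add: power2_eq_square)
  finally show ?thesis by (simp only: C2_def distrib_left)
qed

text \<open>By Tonelli \<open>k\<close> comes innermost, where \<open>inner_bound\<close> applies
  and the factor of \<open>u\<close> is constant. The remaining integral of that factor against
  \<open>wt l\<close> is finite by Plancherel for \<open>u\<close>.\<close>

lemma nn_integral_T_le: "(\<integral>\<^sup>+k. ennreal (norm (T k)) \<partial>lborel) \<le> ennreal T_const"
proof -
  define S where "S = (\<integral>z. norm (s z) \<partial>lborel)"
  have S: "(\<integral>\<^sup>+z. ennreal (norm (s z)) \<partial>lborel) = ennreal S" "0 \<le> S"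
    unfolding S_def by (auto intro!: nn_integral_eq_integral simp: s_int)
  have [simp]: "\<bar>e\<bar> = e" using e_pos by simp
  define f where "f k l z = ennreal (norm K0 * norm (uvhat k l) * norm (s z) * norm (fourier (amp l z) ((2 / e) *\<^sub>R l + (2 / e) *\<^sub>R k)))" for k l z
  have fourier_amp_meas [measurable]: "(\<lambda>w. fourier (amp (f1 w) (f2 w)) (f3 w)) \<in> borel_measurable N"
    if [measurable]: "f1 \<in> borel_measurable N" "f2 \<in> borel_measurable N" "f3 \<in> borel_measurable N" for f1 f2 f3 :: "_ \<Rightarrow> real^3" and N
    unfolding fourier_def by measurable
  have f_meas [measurable]: "(\<lambda>w. f (f1 w) (f2 w) (f3 w)) \<in> borel_measurable N"
    if [measurable]: "f1 \<in> borel_measurable N" "f2 \<in> borel_measurable N" "f3 \<in> borel_measurable N" for f1 f2 f3 :: "_ \<Rightarrow> real^3" and N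
    unfolding f_def by measurable
  have "(\<integral>\<^sup>+k. ennreal (norm (T k)) \<partial>lborel) \<le> (\<integral>\<^sup>+k. \<integral>\<^sup>+l. \<integral>\<^sup>+z. f k l z \<partial>lborel \<partial>lborel \<partial>lborel)"
    unfolding f_def by (intro nn_integral_mono T_le)
  also have "\<dots> = (\<integral>\<^sup>+l. \<integral>\<^sup>+k. \<integral>\<^sup>+z. f k l z \<partial>lborel \<partial>lborel \<partial>lborel)"
    by (rule lborel_pair.Fubini') measurable
  also have "\<dots> = (\<integral>\<^sup>+l. \<integral>\<^sup>+z. \<integral>\<^sup>+k. f k l z \<partial>lborel \<partial>lborel \<partial>lborel)"
    by (rule nn_integral_cong, rule lborel_pair.Fubini') measurable
  also have "\<dots> \<le> (\<integral>\<^sup>+l. \<integral>\<^sup>+z. ennreal (norm K0 * C2) * (ennreal (norm (fourier u (- ((1/e) *\<^sub>R l))) * wt l) * ennreal (norm (s z))) \<partial>lborel \<partial>lborel)"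
  proof (intro nn_integral_mono)
    fix l z
    have "(\<integral>\<^sup>+k. f k l z \<partial>lborel) = (\<integral>\<^sup>+k. ennreal (norm K0 * norm (fourier u (- ((1/e) *\<^sub>R l))) * norm (s z))
        * ennreal (norm (fourier v (- ((1/e) *\<^sub>R l) + (- (2/e)) *\<^sub>R k)) * norm (fourier (amp l z) ((2 / e) *\<^sub>R l + (2 / e) *\<^sub>R k))) \<partial>lborel)"
      unfolding f_def uvhat_def norm_mult by (intro nn_integral_cong) (simp add: ennreal_mult[symmetric] mult_ac)
    also have "\<dots> \<le> ennreal (norm K0 * norm (fourier u (- ((1/e) *\<^sub>R l))) * norm (s z)) * ennreal (wt l * C2)"
      by (subst nn_integral_cmult, measurable) (intro mult_left_mono inner_bound, simp)
    also have "\<dots> = ennreal (norm K0 * C2) * (ennreal (norm (fourier u (- ((1/e) *\<^sub>R l))) * wt l) * ennreal (norm (s z)))"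
      using C2_nonneg by (simp add: ennreal_mult[symmetric] mult_ac)
    finally show "(\<integral>\<^sup>+k. f k l z \<partial>lborel) \<le> ennreal (norm K0 * C2) * (ennreal (norm (fourier u (- ((1/e) *\<^sub>R l))) * wt l) * ennreal (norm (s z)))" .
  qed
  also have "\<dots> = ennreal (norm K0 * C2) * ((\<integral>\<^sup>+l. ennreal (norm (fourier u (- ((1/e) *\<^sub>R l))) * wt l) \<partial>lborel) * ennreal S)"
    by (simp add: nn_integral_cmult nn_integral_multc S)
  also have "\<dots> \<le> ennreal (norm K0 * C2) * (ennreal ((2 * pi) ^ 3 / (1 / e) ^ 3 * M + Iwt) * ennreal S)"
  proof (intro mult_left_mono mult_right_mono)
    have "(\<integral>\<^sup>+l. ennreal (norm (fourier u (- ((1/e) *\<^sub>R l))) * wt l) \<partial>lborel)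
       \<le> (\<integral>\<^sup>+l. ennreal ((norm (fourier u (- ((1/e) *\<^sub>R l))))\<^sup>2) \<partial>lborel) + (\<integral>\<^sup>+l. ennreal ((norm (wt (l :: real^3)))\<^sup>2) \<partial>lborel)"
      using nn_integral_mult_le_squares[of "\<lambda>l. fourier u (- ((1/e) *\<^sub>R l))" lborel wt] by simp
    also have "\<dots> \<le> ennreal ((2 * pi) ^ 3 / (1 / e) ^ 3) * ennreal M + ennreal Iwt"
    proof (intro add_mono)
      show "(\<integral>\<^sup>+l. ennreal ((norm (wt (l :: real^3)))\<^sup>2) \<partial>lborel) \<le> ennreal Iwt"
        unfolding Iwt_def using nn_integral_wt_square_le[where 'a="real^3"] by simp
      have "(\<integral>\<^sup>+l. ennreal ((norm (fourier u (0 + (- (1/e)) *\<^sub>R l)))\<^sup>2) \<partial>lborel) \<le> ennreal ((2 * pi) ^ 3 / \<bar>- (1 / e)\<bar> ^ 3) * ennreal M"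
        by (rule order_trans[OF nn_integral_fourier_affine_le[OF u_int]])
          (use e_pos in \<open>auto intro!: mult_left_mono u_sq\<close>)
      then show "(\<integral>\<^sup>+l. ennreal ((norm (fourier u (- ((1/e) *\<^sub>R l))))\<^sup>2) \<partial>lborel) \<le> ennreal ((2 * pi) ^ 3 / (1 / e) ^ 3) * ennreal M"
        by simp
    qed
    also have "\<dots> = ennreal ((2 * pi) ^ 3 / (1 / e) ^ 3 * M + Iwt)"
      using e_pos M_nonneg by (simp add: ennreal_mult[symmetric] ennreal_plus[symmetric] del: ennreal_plus)
    finally show "(\<integral>\<^sup>+l. ennreal (norm (fourier u (- ((1/e) *\<^sub>R l))) * wt l) \<partial>lborel) \<le> ennreal ((2 * pi) ^ 3 / (1 / e) ^ 3 * M + Iwt)" .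
  qed auto
  also have "\<dots> = ennreal T_const"
  proof -
    define R where "R = (2 * pi) ^ 3 / (1 / e) ^ 3 * M + Iwt"
    have "0 \<le> R" using e_pos M_nonneg by (simp add: R_def)
    then have "ennreal (norm K0 * C2) * (ennreal R * ennreal S) = ennreal (norm K0 * C2 * S * R)"
      using C2_nonneg S(2) by (simp add: ennreal_mult[symmetric] mult_ac)
    then show ?thesis by (simp only: T_const_def S_def[symmetric] R_def)
  qed
  finally show ?thesis .
qed

end

text \<open>The bound of \<open>\<integral> |T|\<close> depends on \<open>u\<close>, \<open>v\<close> only through their \<open>L\<^sup>2\<close> norms, hence it passes to
  functions that are not integrable by truncation and Fatou's lemma.\<close>

context wigner_source
begin

lemma T_integrable:
  shows "(\<integral>\<^sup>+k. ennreal (norm (T k)) \<partial>lborel) \<le> ennreal (wigner_source_L1.T_const e M s Ca B)"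
    and "integrable lborel T"
proof -
  let ?C = "wigner_source_L1.T_const e M s Ca B"
  \<comment> \<open>Restriction to balls makes a square-integrable function integrable, stays below
    the original pointwise, and agrees with it eventually at every point.\<close>
  define cut where "cut n f x = of_real (indicator (cball 0 (real n)) x) * f x" for n and f :: "real^3 \<Rightarrow> complex" and x
  have cut_meas [measurable]: "cut n f \<in> borel_measurable borel" if [measurable]: "f \<in> borel_measurable borel" for n f
  proof -
    have [measurable]: "cball (0 :: real^3) (real n) \<in> sets borel" by (intro borel_closed closed_cball)
    show ?thesis unfolding cut_def by measurable
  qed
  have cut_le: "norm (cut n f x) \<le> norm (f x)" for n f x
    by (auto simp: cut_def norm_mult indicator_def)
  have cut_lim: "\<forall>\<^sub>F n in sequentially. cut n f x = f x" for f x
  proof -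
    obtain m where m: "norm x \<le> real m" using real_arch_simple by blast
    have "cut n f x = f x" if "m \<le> n" for n
      using order_trans[OF m, of "real n"] that by (simp add: cut_def indicator_def)
    then show ?thesis by (rule eventually_sequentiallyI)
  qed
  have cut_sq: "(\<integral>\<^sup>+x. ennreal ((norm (cut n f x))\<^sup>2) \<partial>lborel) \<le> ennreal M" if "(\<integral>\<^sup>+x. ennreal ((norm (f x))\<^sup>2) \<partial>lborel) \<le> ennreal M" for n f
    by (rule order_trans[OF nn_integral_mono that]) (intro ennreal_leI power_mono cut_le norm_ge_zero)
  have cut_int: "integrable lborel (cut n f)" if f: "L2 f" for n f
  proof (rule Bochner_Integration.integrable_bound)
    have "integrable lborel (indicat_real (cball (0 :: real^3) (real n)))"
      using emeasure_lborel_cball_finite[of "0 :: real^3" "real n"] by (simp add: integrable_indicator_iff)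
    then show "integrable lborel (\<lambda>x. indicat_real (cball 0 (real n)) x + (norm (f x))\<^sup>2)"
      using L2_D(2)[OF f] by simp
    show "AE x in lborel. norm (cut n f x) \<le> norm (indicat_real (cball 0 (real n)) x + (norm (f x))\<^sup>2)"
    proof (intro AE_I2)
      fix x
      have "norm (f x) \<le> 1 + (norm (f x))\<^sup>2"
        using two_mult_le_squares[of "norm (f x)" 1] by (simp add: power2_eq_square) (use norm_ge_zero[of "f x"] in linarith)
      then show "norm (cut n f x) \<le> norm (indicat_real (cball 0 (real n)) x + (norm (f x))\<^sup>2)"
        by (auto simp: cut_def norm_mult indicator_def)
    qed
    have [measurable]: "f \<in> borel_measurable borel" by (rule L2_D(1)[OF f])
    show "cut n f \<in> borel_measurable lborel" by simp
  qed
  have loc: "wigner_source_L1 (cut n u) (cut n v) e M a s \<theta> Ca B" for n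
    by (intro_locales; unfold_locales)
      (simp_all add: cut_sq u_sq v_sq M_nonneg e_pos a_le s_int \<theta> cut_int L2_u L2_v)
  define Tn where "Tn n = wigner_source.T (cut n u) (cut n v) e a s \<theta>" for n
  \<comment> \<open>Two dominated convergences, in the \<open>y\<close>-integral of the Wigner
    function and in the integral over (\<xi>, x0, z). The majorants are those of the untruncated
    pair, since they involve the fields through \<open>M\<close> or through the moduli.\<close>
  have lim: "(\<lambda>n. Tn n k) \<longlonglongrightarrow> T k" for k
  proof -
    have w_lim: "(\<lambda>n. wigner_pair.wigner1 (cut n u) (cut n v) e x k) \<longlonglongrightarrow> wigner1 x k" for x
    proof -
      have W1: "wigner_pair.wigner1 (cut n u) (cut n v) e x k = (\<integral>y. cis (k \<bullet> y) / (2 * of_real pi) ^ 3 * (cut n u (x - (e / 2) *\<^sub>R y) * cut n v (x + (e / 2) *\<^sub>R y)) \<partial>lborel)" for n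
      proof -
        interpret n: wigner_source_L1 "cut n u" "cut n v" e M a s \<theta> Ca B by (rule loc)
        show ?thesis by (simp add: n.wigner1_def n.uv_def)
      qed
      show ?thesis
        unfolding W1 wigner1_def uv_def
      proof (rule integral_dominated_convergence[where w="\<lambda>y. 1 / (2 * pi) ^ 3 * norm (uv x y)"])
        show "integrable lborel (\<lambda>y. 1 / (2 * pi) ^ 3 * norm (uv x y))"
          using uv_integrable_y by simp
        show "AE y in lborel. (\<lambda>n. cis (k \<bullet> y) / (2 * of_real pi) ^ 3 * (cut n u (x - (e / 2) *\<^sub>R y) * cut n v (x + (e / 2) *\<^sub>R y)))
          \<longlonglongrightarrow> cis (k \<bullet> y) / (2 * of_real pi) ^ 3 * (u (x - (e / 2) *\<^sub>R y) * v (x + (e / 2) *\<^sub>R y))"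
          by (intro AE_I2 tendsto_mult tendsto_const tendsto_eventually cut_lim)
        show "AE y in lborel. norm (cis (k \<bullet> y) / (2 * of_real pi) ^ 3 * (cut n u (x - (e / 2) *\<^sub>R y) * cut n v (x + (e / 2) *\<^sub>R y))) \<le> 1 / (2 * pi) ^ 3 * norm (uv x y)" for n
        proof (intro AE_I2)
          fix y
          have "norm (cut n u (x - (e / 2) *\<^sub>R y)) * norm (cut n v (x + (e / 2) *\<^sub>R y)) \<le> norm (u (x - (e / 2) *\<^sub>R y)) * norm (v (x + (e / 2) *\<^sub>R y))"
            by (intro mult_mono cut_le) auto
          then have "1 / (2 * pi) ^ 3 * (norm (cut n u (x - (e / 2) *\<^sub>R y)) * norm (cut n v (x + (e / 2) *\<^sub>R y))) \<le> 1 / (2 * pi) ^ 3 * (norm (u (x - (e / 2) *\<^sub>R y)) * norm (v (x + (e / 2) *\<^sub>R y)))"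
            by (rule mult_left_mono) simp
          then show "norm (cis (k \<bullet> y) / (2 * of_real pi) ^ 3 * (cut n u (x - (e / 2) *\<^sub>R y) * cut n v (x + (e / 2) *\<^sub>R y))) \<le> 1 / (2 * pi) ^ 3 * norm (uv x y)"
            by (simp add: norm_mult norm_divide norm_power uv_def)
        qed
      qed measurable
    qed
    have Tn_eq: "Tn n k = (\<integral>r. wigner_source.T_integrand (cut n u) (cut n v) e a s \<theta> k r \<partial>lborel)" for n
    proof -
      interpret n: wigner_source_L1 "cut n u" "cut n v" e M a s \<theta> Ca B by (rule loc)
      show ?thesis by (simp add: Tn_def n.T_def)
    qed
    have In: "wigner_source.T_integrand (cut n u) (cut n v) e a s \<theta> k r = cis (k \<bullet> (fst r - snd (snd r))) * wigner_pair.wigner1 (cut n u) (cut n v) e (fst (snd r) + (e / 2) *\<^sub>R (snd (snd r) + fst r)) k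
     * (of_real (a (fst (snd r) + e *\<^sub>R snd (snd r))) * (s (snd (snd r)) * \<theta> (fst r) (fst (snd r))))"
      and Ib: "norm (wigner_source.T_integrand (cut n u) (cut n v) e a s \<theta> k r) \<le> W / (2 * pi) ^ 3 * Ca * B * majorant r"
      and Im: "wigner_source.T_integrand (cut n u) (cut n v) e a s \<theta> k \<in> borel_measurable borel" for n r
    proof -
      interpret n: wigner_source_L1 "cut n u" "cut n v" e M a s \<theta> Ca B by (rule loc)
      show "n.T_integrand k r = cis (k \<bullet> (fst r - snd (snd r))) * n.wigner1 (fst (snd r) + (e / 2) *\<^sub>R (snd (snd r) + fst r)) k
     * (of_real (a (fst (snd r) + e *\<^sub>R snd (snd r))) * (s (snd (snd r)) * \<theta> (fst r) (fst (snd r))))"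
        by (rule n.T_integrand_def)
      show "norm (n.T_integrand k r) \<le> W / (2 * pi) ^ 3 * Ca * B * majorant r"
        by (rule n.T_integrand_bound)
      show "n.T_integrand k \<in> borel_measurable borel" by measurable
    qed
    show ?thesis
      unfolding Tn_eq T_def
    proof (rule integral_dominated_convergence[where w="\<lambda>r. W / (2 * pi) ^ 3 * Ca * B * majorant r"])
      show "integrable lborel (\<lambda>r. W / (2 * pi) ^ 3 * Ca * B * majorant r)" using majorant_integrable by simp
      show "AE r in lborel. (\<lambda>n. wigner_source.T_integrand (cut n u) (cut n v) e a s \<theta> k r) \<longlonglongrightarrow> T_integrand k r"
        unfolding In T_integrand_def by (intro AE_I2 tendsto_intros w_lim)
      show "AE r in lborel. norm (wigner_source.T_integrand (cut n u) (cut n v) e a s \<theta> k r) \<le> W / (2 * pi) ^ 3 * Ca * B * majorant r" for n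
        by (intro AE_I2 Ib)
      show "wigner_source.T_integrand (cut n u) (cut n v) e a s \<theta> k \<in> borel_measurable lborel" for n using Im by simp
      show "T_integrand k \<in> borel_measurable lborel" by measurable
    qed
  qed
  have Tn_meas [measurable]: "Tn n \<in> borel_measurable borel" and Tn_le: "(\<integral>\<^sup>+k. ennreal (norm (Tn n k)) \<partial>lborel) \<le> ennreal ?C" for n
  proof -
    interpret n: wigner_source_L1 "cut n u" "cut n v" e M a s \<theta> Ca B by (rule loc)
    show "Tn n \<in> borel_measurable borel" unfolding Tn_def by measurable
    show "(\<integral>\<^sup>+k. ennreal (norm (Tn n k)) \<partial>lborel) \<le> ennreal ?C" unfolding Tn_def by (rule n.nn_integral_T_le)
  qed
  have "(\<integral>\<^sup>+k. ennreal (norm (T k)) \<partial>lborel) = (\<integral>\<^sup>+k. liminf (\<lambda>n. ennreal (norm (Tn n k))) \<partial>lborel)"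
    by (intro nn_integral_cong lim_imp_Liminf[symmetric] tendsto_ennrealI tendsto_norm lim) simp
  also have "\<dots> \<le> liminf (\<lambda>n. \<integral>\<^sup>+k. ennreal (norm (Tn n k)) \<partial>lborel)"
    by (rule nn_integral_liminf) measurable
  also have "\<dots> \<le> ennreal ?C"
    by (rule order_trans[OF Liminf_le_Limsup Limsup_bounded]) (auto intro!: always_eventually Tn_le)
  finally show le: "(\<integral>\<^sup>+k. ennreal (norm (T k)) \<partial>lborel) \<le> ennreal ?C" .
  show "integrable lborel T"
    by (rule integrableI_bounded) (use le in \<open>auto intro: le_less_trans\<close>)
qed

end

section \<open>Testing against Z, entry by entry\<close>

lemma wt_uminus [simp]: "wt (- x) = wt x"
  by (simp add: wt_def)

context wigner_pair
begin

lemma pairing_diff: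
  assumes s: "integrable lborel s"
    and F: "(\<lambda>(p, x). F p x) \<in> borel_measurable (borel \<Otimes>\<^sub>M borel)" "\<And>p x. norm (F p x) \<le> C * wt (snd p - fst p)"
    and H: "(\<lambda>(p, x). H p x) \<in> borel_measurable (borel \<Otimes>\<^sub>M borel)" "\<And>p x. norm (H p x) \<le> D * wt (snd p - fst p)"
  shows "pairing s F \<eta> - pairing s H \<eta> = pairing s (\<lambda>p x. F p x - H p x) \<eta>"
proof -
  have "(\<integral>r. (\<lambda>(p, x). pairing_integrand s F \<eta> p x) r - (\<lambda>(p, x). pairing_integrand s H \<eta> p x) r \<partial>lborel)
      = pairing s F \<eta> - pairing s H \<eta>"
    unfolding pairing_def
    by (rule Bochner_Integration.integral_diff) (rule pairing_integrable(1)[OF s F] pairing_integrable(1)[OF s H])+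
  moreover have "(\<lambda>(p, x). pairing_integrand s F \<eta> p x) r - (\<lambda>(p, x). pairing_integrand s H \<eta> p x) r
      = (\<lambda>(p, x). pairing_integrand s (\<lambda>p x. F p x - H p x) \<eta> p x) r" for r
    by (simp add: pairing_integrand_def split_def right_diff_distrib)
  ultimately show ?thesis by (simp add: pairing_def)
qed

end

context wigner_source
begin

text \<open>\<open>\<Theta>\<close> with its displacements of size \<open>e\<close> dropped.\<close>

definition \<Theta>0 :: "(real^3) \<times> (real^3) \<Rightarrow> real^3 \<Rightarrow> complex" where
  "\<Theta>0 p x = of_real (a x) * \<theta> (snd p - fst p) x"

lemma \<Theta>0_measurable: "(\<lambda>(p, x). \<Theta>0 p x) \<in> borel_measurable (borel \<Otimes>\<^sub>M borel)"
  unfolding \<Theta>0_def by measurable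

lemma \<Theta>0_bound: "norm (\<Theta>0 p x) \<le> Ca * B * wt (snd p - fst p)"
proof -
  have "norm (\<Theta>0 p x) \<le> Ca * (B * (wt (snd p - fst p) * wt x))"
    unfolding \<Theta>0_def norm_mult using a_le \<theta> Ca_nonneg by (intro mult_mono) (auto simp: decaying_def)
  also have "\<dots> \<le> Ca * (B * (wt (snd p - fst p) * 1))"
    by (intro mult_left_mono wt_le_1 Ca_nonneg B_nonneg) auto
  finally show ?thesis by (simp add: mult.assoc)
qed

text \<open>An entry of \<open>Z_fun\<close> up to conjugation and a constant: the double integral
  over z and \<xi> separates into two Fourier transforms.\<close>

definition Zc :: "real^3 \<Rightarrow> real^3 \<Rightarrow> complex" where
  "Zc x k = of_real (a x) * fourier s k * fourier (\<lambda>\<xi>. \<theta> \<xi> x) (- k)"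

lemma Zc_measurable [measurable (raw)]:
  assumes [measurable]: "f \<in> borel_measurable N" "g \<in> borel_measurable N"
  shows "(\<lambda>w. Zc (f w) (g w)) \<in> borel_measurable N"
  unfolding Zc_def fourier_def by measurable

definition s_norm :: real where "s_norm = (\<integral>z. norm (s z) \<partial>lborel)"

lemma s_norm_nonneg [simp]: "0 \<le> s_norm"
  by (simp add: s_norm_def)

text \<open>The decay in \<open>k\<close> comes entirely from the test function, since
  \<open>fourier s\<close> is merely bounded.\<close>

lemma Zc_bound: "norm (Zc x k) \<le> Ca * s_norm * B * (wt x * wt k)"
proof -
  have t: "norm (fourier (\<lambda>\<xi>. \<theta> \<xi> x) (- k)) \<le> B * (wt (- k) * wt x)"
    using \<theta> unfolding decaying_def by blast
  then have t: "norm (fourier (\<lambda>\<xi>. \<theta> \<xi> x) (- k)) \<le> B * (wt k * wt x)" by simp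
  have "norm (Zc x k) \<le> Ca * s_norm * (B * (wt (- k) * wt x))"
    unfolding Zc_def norm_mult using a_le Ca_nonneg norm_fourier_le[of s k]
    by (intro mult_mono mult_nonneg_nonneg) (simp_all add: s_norm_def t)
  then show ?thesis by (simp add: mult_ac)
qed

lemma Zc_integrable: "integrable lborel (Zc x)"
  by (rule integrable_const_mult_bound[OF integrable_wt, of _ "Ca * s_norm * B * wt x"])
    (use Zc_bound in \<open>auto simp: mult.assoc\<close>)

text \<open>The multiplication formula moves the transform from \<open>s\<close>, which is only
  integrable, to the test function, where inversion holds.\<close>

lemma Zc_fourier: "(\<integral>k. cis (k \<bullet> y) * Zc x k \<partial>lborel) = (2 * of_real pi) ^ 3 * (\<integral>z. s z * \<Theta>0 (y, z) x \<partial>lborel)"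
proof -
  have t3: "integrable lborel (fourier (\<lambda>\<xi>. \<theta> \<xi> x))" by (rule decaying_inversion(3)[OF \<theta>])
  then have "integrable lborel (\<lambda>k. fourier (\<lambda>\<xi>. \<theta> \<xi> x) (0 - k))"
    by (simp only: integrable_lborel_reflect_iff)
  then have t3': "integrable lborel (\<lambda>k. fourier (\<lambda>\<xi>. \<theta> \<xi> x) (- k))" by simp
  define h where "h k = cis (k \<bullet> y) * fourier (\<lambda>\<xi>. \<theta> \<xi> x) (- k)" for k
  have h: "integrable lborel h"
    unfolding h_def by (rule fourier_integrand_integrable[OF t3']) measurable
  have "fourier h z = (2 * of_real pi) ^ 3 * \<theta> (z - y) x" for z
  proof -
    have "fourier h z = (\<integral>k. cis ((0 - k) \<bullet> (z - y)) * fourier (\<lambda>\<xi>. \<theta> \<xi> x) (0 - k) \<partial>lborel)"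
      unfolding fourier_def[of h] h_def
      by (intro Bochner_Integration.integral_cong refl)
        (simp add: mult.assoc[symmetric] cis_mult inner_diff_right inner_commute)
    also have "\<dots> = (\<integral>k. cis (k \<bullet> (z - y)) * fourier (\<lambda>\<xi>. \<theta> \<xi> x) k \<partial>lborel)"
      by (rule integral_lborel_reflect)
    finally show ?thesis using decaying_inversion(1)[OF \<theta>, of "z - y" x] by simp
  qed
  note fh = this
  have "(\<integral>k. cis (k \<bullet> y) * Zc x k \<partial>lborel) = (\<integral>k. of_real (a x) * (fourier s k * h k) \<partial>lborel)"
    by (intro Bochner_Integration.integral_cong refl) (simp add: Zc_def h_def)
  also have "\<dots> = of_real (a x) * (\<integral>k. fourier s k * h k \<partial>lborel)"
    by (rule integral_mult_right_zero)
  also have "\<dots> = of_real (a x) * (\<integral>z. s z * fourier h z \<partial>lborel)"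
    unfolding integral_fourier_mult[OF s_int h] ..
  also have "\<dots> = (\<integral>z. (2 * of_real pi) ^ 3 * (s z * \<Theta>0 (y, z) x) \<partial>lborel)"
    unfolding fh integral_mult_right_zero[symmetric]
    by (intro Bochner_Integration.integral_cong refl) (simp add: \<Theta>0_def)
  finally show ?thesis by simp
qed

lemma wigner_Zc_bound: "norm (wigner1 x k * Zc x k) \<le> W / (2 * pi) ^ 3 * (Ca * s_norm * B) * (wt x * wt k)"
proof -
  have "norm (wigner1 x k * Zc x k) \<le> W / (2 * pi) ^ 3 * (Ca * s_norm * B * (wt x * wt k))"
    unfolding norm_mult using W_nonneg by (intro mult_mono wigner1_bound Zc_bound) auto
  then show ?thesis by (simp add: mult.assoc)
qed

text \<open>In contrast to \<open>T\<close>, the decay of \<open>Zc\<close> in both variables makes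
  the integrals converge absolutely together, so the integral over \<open>k\<close> can be carried
  out under the \<open>y\<close>-integral and yields \<open>\<Theta>0\<close>.\<close>

lemma wigner_Zc:
  shows "integrable lborel (\<lambda>(x, k). wigner1 x k * Zc x k)"
    and "(\<integral>x. \<integral>k. wigner1 x k * Zc x k \<partial>lborel \<partial>lborel) = pairing s \<Theta>0 0"
proof -
  note [measurable (raw)] = measurable_case_prodD[OF \<Theta>0_measurable]
  have ww: "integrable lborel (\<lambda>(x, k). wt (x :: real^3) * wt (k :: real^3))"
    by (rule integrable_lborel_prod_bound[OF integrable_wt integrable_wt]) (auto simp: abs_mult)
  show "integrable lborel (\<lambda>(x, k). wigner1 x k * Zc x k)"
  proof (rule integrable_const_mult_bound[OF ww, of _ "W / (2 * pi) ^ 3 * (Ca * s_norm * B)"])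
    have "(\<lambda>(x, k). wigner1 x k * Zc x k) \<in> borel_measurable (borel \<Otimes>\<^sub>M borel)" by measurable
    then show "(\<lambda>(x, k). wigner1 x k * Zc x k) \<in> borel_measurable lborel" by (simp add: borel_prod)
    show "norm (case p of (x, k) \<Rightarrow> wigner1 x k * Zc x k) \<le> W / (2 * pi) ^ 3 * (Ca * s_norm * B) * (case p of (x, k) \<Rightarrow> wt x * wt k)" for p
      using wigner_Zc_bound[of "fst p" "snd p"] by (simp add: split_def)
  qed
  have inner: "(\<integral>k. wigner1 x k * Zc x k \<partial>lborel) = (\<integral>y. uv x y * (\<integral>z. s z * \<Theta>0 (y, z) x \<partial>lborel) \<partial>lborel)" for x
  proof -
    define c0 where "c0 = 1 / (2 * complex_of_real pi) ^ 3"
    have "(\<integral>k. wigner1 x k * Zc x k \<partial>lborel) = (\<integral>k. \<integral>y. c0 * (cis (k \<bullet> y) * uv x y * Zc x k) \<partial>lborel \<partial>lborel)"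
    proof (rule Bochner_Integration.integral_cong[OF refl])
      fix k
      have "wigner1 x k * Zc x k = (\<integral>y. cis (k \<bullet> y) / (2 * of_real pi) ^ 3 * uv x y * Zc x k \<partial>lborel)"
        unfolding wigner1_def by (rule integral_mult_left_zero[symmetric])
      then show "wigner1 x k * Zc x k = (\<integral>y. c0 * (cis (k \<bullet> y) * uv x y * Zc x k) \<partial>lborel)"
        by (simp add: c0_def)
    qed
    also have "\<dots> = (\<integral>y. \<integral>k. c0 * (cis (k \<bullet> y) * uv x y * Zc x k) \<partial>lborel \<partial>lborel)"
    proof (rule integral_lborel_swap)
      have i: "integrable lborel (\<lambda>k. c0 * Zc x k)" using Zc_integrable by simp
      show "integrable lborel (\<lambda>(k, y). c0 * (cis (k \<bullet> y) * uv x y * Zc x k))"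
        by (rule integrable_lborel_prod_bound[OF i uv_integrable_y[of x]]) (auto simp: norm_mult)
    qed
    also have "\<dots> = (\<integral>y. uv x y * (\<integral>z. s z * \<Theta>0 (y, z) x \<partial>lborel) \<partial>lborel)"
    proof (rule Bochner_Integration.integral_cong[OF refl])
      fix y
      have "(\<integral>k. c0 * (cis (k \<bullet> y) * uv x y * Zc x k) \<partial>lborel) = (\<integral>k. (c0 * uv x y) * (cis (k \<bullet> y) * Zc x k) \<partial>lborel)"
        by (simp add: mult_ac)
      also have "\<dots> = (c0 * uv x y) * (\<integral>k. cis (k \<bullet> y) * Zc x k \<partial>lborel)"
        by (rule integral_mult_right_zero)
      finally show "(\<integral>k. c0 * (cis (k \<bullet> y) * uv x y * Zc x k) \<partial>lborel) = uv x y * (\<integral>z. s z * \<Theta>0 (y, z) x \<partial>lborel)"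
        unfolding Zc_fourier by (simp add: c0_def)
    qed
    finally show ?thesis .
  qed
  have int: "integrable lborel (\<lambda>(p, x). pairing_integrand s \<Theta>0 0 p x)"
    by (rule pairing_integrable(1)[OF s_int \<Theta>0_measurable \<Theta>0_bound])
  have "pairing s \<Theta>0 0 = (\<integral>x. \<integral>p. pairing_integrand s \<Theta>0 0 p x \<partial>lborel \<partial>lborel)"
    unfolding pairing_def by (rule integrable_lborel_iterated(4)[OF int])
  also have "\<dots> = (\<integral>x. \<integral>y. uv x y * (\<integral>z. s z * \<Theta>0 (y, z) x \<partial>lborel) \<partial>lborel \<partial>lborel)"
  \<comment> \<open>Integrability of the slice in (y, z) is known for almost every \<open>x\<close>,
    hence the Fubini step is made almost everywhere.\<close>
  proof (rule integral_cong_AE)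
    show "(\<lambda>x. \<integral>p. pairing_integrand s \<Theta>0 0 p x \<partial>lborel) \<in> borel_measurable lborel"
      using integrable_lborel_iterated(2)[OF int] by auto
    show "(\<lambda>x. \<integral>y. uv x y * (\<integral>z. s z * \<Theta>0 (y, z) x \<partial>lborel) \<partial>lborel) \<in> borel_measurable lborel"
      by measurable
    show "AE x in lborel. (\<integral>p. pairing_integrand s \<Theta>0 0 p x \<partial>lborel) = (\<integral>y. uv x y * (\<integral>z. s z * \<Theta>0 (y, z) x \<partial>lborel) \<partial>lborel)"
      using integrable_lborel_iterated(6)[OF int]
    proof eventually_elim
      case (elim x)
      have "integrable lborel (\<lambda>(y, z). pairing_integrand s \<Theta>0 0 (y, z) x)"
        using elim by (simp add: split_def)
      from integrable_lborel_iterated(3)[OF this]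
      have "(\<integral>p. pairing_integrand s \<Theta>0 0 p x \<partial>lborel) = (\<integral>y. \<integral>z. pairing_integrand s \<Theta>0 0 (y, z) x \<partial>lborel \<partial>lborel)"
        by (simp add: split_def)
      also have "\<dots> = (\<integral>y. uv x y * (\<integral>z. s z * \<Theta>0 (y, z) x \<partial>lborel) \<partial>lborel)"
      proof (rule Bochner_Integration.integral_cong[OF refl])
        fix y
        have "(\<integral>z. pairing_integrand s \<Theta>0 0 (y, z) x \<partial>lborel) = (\<integral>z. uv x y * (s z * \<Theta>0 (y, z) x) \<partial>lborel)"
          by (simp add: pairing_integrand_def mult.left_commute)
        then show "(\<integral>z. pairing_integrand s \<Theta>0 0 (y, z) x \<partial>lborel) = uv x y * (\<integral>z. s z * \<Theta>0 (y, z) x \<partial>lborel)"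
          by simp
      qed
      finally show ?case .
    qed
  qed
  finally show "(\<integral>x. \<integral>k. wigner1 x k * Zc x k \<partial>lborel \<partial>lborel) = pairing s \<Theta>0 0"
    unfolding inner by simp
qed

end

section \<open>Superposition over the wave vector\<close>

text \<open>\<open>g\<close> stands for the Fourier transform of the blurring kernel. The bounds of
  \<open>wigner_source\<close> hold for every \<open>q\<close> with the same constants, and joint
  measurability in (x, q) makes the average meaningful.\<close>

locale wigner_average =
  fixes u v :: "real^3 \<Rightarrow> real^3 \<Rightarrow> complex" and g :: "real^3 \<Rightarrow> complex" and e M :: real
    and a :: "real^3 \<Rightarrow> real" and s :: "real^3 \<Rightarrow> complex" and \<theta> :: "real^3 \<Rightarrow> real^3 \<Rightarrow> complex"
    and Ca B :: real
  assumes u_joint: "(\<lambda>(x, q). u x q) \<in> borel_measurable (borel \<Otimes>\<^sub>M borel)"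
    and v_joint: "(\<lambda>(x, q). v x q) \<in> borel_measurable (borel \<Otimes>\<^sub>M borel)"
    and g_int: "integrable lborel g"
    and source: "wigner_source (\<lambda>x. u x q) (\<lambda>x. v x q) e M a s \<theta> Ca B"
begin

sublocale S: wigner_source "\<lambda>x. u x q" "\<lambda>x. v x q" e M a s \<theta> Ca B for q
  by (rule source)

lemmas uq_measurable [measurable (raw)] = measurable_case_prodD[OF u_joint]
lemmas vq_measurable [measurable (raw)] = measurable_case_prodD[OF v_joint]

lemma g_measurable [measurable]: "g \<in> borel_measurable borel"
  using g_int by auto

lemma wigner1_q_measurable [measurable (raw)]:
  assumes [measurable]: "f \<in> borel_measurable N" "h \<in> borel_measurable N" "l \<in> borel_measurable N"
  shows "(\<lambda>w. S.wigner1 (f w) (h w) (l w)) \<in> borel_measurable N"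
  unfolding S.wigner1_def S.uv_def by measurable

lemma T_integrand_q_measurable [measurable (raw)]:
  assumes [measurable]: "f \<in> borel_measurable N" "h \<in> borel_measurable N" "l \<in> borel_measurable N"
  shows "(\<lambda>w. S.T_integrand (f w) (h w) (l w)) \<in> borel_measurable N"
  unfolding S.T_integrand_def by measurable

lemma T_q_measurable [measurable (raw)]:
  assumes [measurable]: "f \<in> borel_measurable N" "h \<in> borel_measurable N"
  shows "(\<lambda>w. S.T (f w) (h w)) \<in> borel_measurable N"
  unfolding S.T_def by measurable

lemma pairing_q_measurable:
  assumes "(\<lambda>(p, x). F p x) \<in> borel_measurable (borel \<Otimes>\<^sub>M borel)"
  shows "(\<lambda>q. S.pairing q s F \<eta>) \<in> borel_measurable borel"
proof -
  note [measurable (raw)] = measurable_case_prodD[OF assms]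
  show ?thesis
    unfolding S.pairing_def S.pairing_integrand_def S.uv_def split_def by measurable
qed

definition wavg :: "real^3 \<Rightarrow> real^3 \<Rightarrow> complex" where
  "wavg x k = (\<integral>q. g q * S.wigner1 q x k \<partial>lborel)"

definition back_kernel :: "real^3 \<Rightarrow> (real^3) \<times> (real^3) \<times> (real^3) \<Rightarrow> complex" where
  "back_kernel k r = cis (k \<bullet> (fst r - snd (snd r))) * wavg (fst (snd r) + (e / 2) *\<^sub>R (snd (snd r) + fst r)) k
     * (of_real (a (fst (snd r) + e *\<^sub>R snd (snd r))) * (s (snd (snd r)) * \<theta> (fst r) (fst (snd r))))"

lemma back_kernel_eq: "back_kernel k r = (\<integral>q. g q * S.T_integrand q k r \<partial>lborel)"
proof -
  define c where "c = cis (k \<bullet> (fst r - snd (snd r)))"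
  define d where "d = of_real (a (fst (snd r) + e *\<^sub>R snd (snd r))) * (s (snd (snd r)) * \<theta> (fst r) (fst (snd r)))"
  have "(\<integral>q. g q * S.T_integrand q k r \<partial>lborel) = (\<integral>q. (c * d) * (g q * S.wigner1 q (fst (snd r) + (e / 2) *\<^sub>R (snd (snd r) + fst r)) k) \<partial>lborel)"
    by (intro Bochner_Integration.integral_cong refl) (simp add: S.T_integrand_def c_def d_def)
  also have "\<dots> = (c * d) * wavg (fst (snd r) + (e / 2) *\<^sub>R (snd (snd r) + fst r)) k"
    unfolding wavg_def by (rule integral_mult_right_zero)
  finally show ?thesis by (simp add: back_kernel_def c_def d_def)
qed

lemma T_integrand_rq_integrable: "integrable lborel (\<lambda>(r, q). g q * S.T_integrand q k r)"
proof -
  have 1: "integrable lborel (\<lambda>r. (S.W / (2 * pi) ^ 3 * Ca * B) * S.majorant r)"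
    using S.majorant_integrable by simp
  show ?thesis
  proof (rule integrable_lborel_prod_bound[OF 1 g_int])
    show "(\<lambda>(r, q). g q * S.T_integrand q k r) \<in> borel_measurable (borel \<Otimes>\<^sub>M borel)" by measurable
    show "norm (g q * S.T_integrand q k r) \<le> norm (S.W / (2 * pi) ^ 3 * Ca * B * S.majorant r) * norm (g q)" for r q
      unfolding norm_mult[of "g q"] mult.commute[of "norm (g q)"]
      by (intro mult_right_mono order_trans[OF S.T_integrand_bound]) (simp_all only: real_norm_def abs_ge_self norm_ge_zero)
  qed
qed

lemma back_kernel_integrable: "integrable lborel (back_kernel k)"
  using integrable_lborel_iterated(1)[OF T_integrand_rq_integrable, of k] by (simp add: back_kernel_eq[abs_def])

lemma integral_back_kernel: "(\<integral>r. back_kernel k r \<partial>lborel) = (\<integral>q. g q * S.T q k \<partial>lborel)"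
  unfolding back_kernel_eq integral_lborel_swap[OF T_integrand_rq_integrable]
  by (simp add: S.T_def)

text \<open>The bound \<open>T_const\<close> is the same for all \<open>q\<close>, so integrability
  of \<open>g\<close> finishes the estimate.\<close>

lemma gT_integrable: "integrable lborel (\<lambda>(k, q). g q * S.T q k)"
proof (rule integrable_lborel_prodI')
  let ?C = "wigner_source_L1.T_const e M s Ca B"
  have "(\<integral>\<^sup>+q. \<integral>\<^sup>+k. ennreal (norm (g q * S.T q k)) \<partial>lborel \<partial>lborel)
     = (\<integral>\<^sup>+q. ennreal (norm (g q)) * (\<integral>\<^sup>+k. ennreal (norm (S.T q k)) \<partial>lborel) \<partial>lborel)"
    by (simp add: norm_mult ennreal_mult nn_integral_cmult)
  also have "\<dots> \<le> (\<integral>\<^sup>+q. ennreal (norm (g q)) * ennreal ?C \<partial>lborel)"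
    by (intro nn_integral_mono mult_left_mono S.T_integrable) simp
  also have "\<dots> < \<infinity>"
    using g_int by (simp add: nn_integral_multc ennreal_mult_less_top integrable_iff_bounded)
  finally show "(\<integral>\<^sup>+q. \<integral>\<^sup>+k. ennreal (norm (g q * S.T q k)) \<partial>lborel \<partial>lborel) < \<infinity>" .
qed measurable

theorem back_kernel_iterated:
  shows "integrable lborel (\<lambda>k. \<integral>r. back_kernel k r \<partial>lborel)"
    and "(\<integral>k. \<integral>r. back_kernel k r \<partial>lborel \<partial>lborel) = (\<integral>q. g q * S.pairing q s S.\<Theta> 0 \<partial>lborel)"
proof -
  show "integrable lborel (\<lambda>k. \<integral>r. back_kernel k r \<partial>lborel)"
    unfolding integral_back_kernel by (rule integrable_lborel_iterated(1)[OF gT_integrable])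
  show "(\<integral>k. \<integral>r. back_kernel k r \<partial>lborel \<partial>lborel) = (\<integral>q. g q * S.pairing q s S.\<Theta> 0 \<partial>lborel)"
    unfolding integral_back_kernel integral_lborel_swap[OF gT_integrable]
    by (simp add: S.integral_T[OF S.T_integrable(2)])
qed

lemma gwZ_integrable:
  shows "integrable lborel (\<lambda>((x, k), q). g q * (S.wigner1 q x k * S.Zc x k))"
    and "integrable lborel (\<lambda>(k, q). g q * (S.wigner1 q x k * S.Zc x k))"
proof -
  let ?C = "S.W / (2 * pi) ^ 3 * (Ca * S.s_norm * B)"
  have C: "0 \<le> ?C" using S.W_nonneg S.Ca_nonneg S.B_nonneg by simp
  have "integrable lborel (\<lambda>(x, k). wt (x :: real^3) * wt (k :: real^3))"
    by (rule integrable_lborel_prod_bound[OF integrable_wt integrable_wt]) (auto simp: abs_mult)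
  then have ww: "integrable lborel (\<lambda>p. ?C * (wt (fst p :: real^3) * wt (snd p :: real^3)))"
    by (simp add: split_def)
  have le: "norm (g q * (S.wigner1 q x k * S.Zc x k)) \<le> norm (?C * (wt x * wt k)) * norm (g q)" for q x k
    unfolding norm_mult[of "g q"] mult.commute[of "norm (g q)"]
    by (intro mult_right_mono order_trans[OF S.wigner_Zc_bound]) (simp_all only: real_norm_def abs_ge_self norm_ge_zero)
  have "integrable lborel (\<lambda>(p, q). g q * (S.wigner1 q (fst p) (snd p) * S.Zc (fst p) (snd p)))"
    by (rule integrable_lborel_prod_bound[OF ww g_int]) (use le in auto)
  then show "integrable lborel (\<lambda>((x, k), q). g q * (S.wigner1 q x k * S.Zc x k))"
    by (simp add: split_def)
  have w1: "integrable lborel (\<lambda>k. ?C * (wt x * wt (k :: real^3)))"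
    by (intro integrable_mult_right integrable_wt)
  show "integrable lborel (\<lambda>(k, q). g q * (S.wigner1 q x k * S.Zc x k))"
    by (rule integrable_lborel_prod_bound[OF w1 g_int]) (use le in auto)
qed

lemma wavg_Zc_eq: "wavg x k * S.Zc x k = (\<integral>q. g q * (S.wigner1 q x k * S.Zc x k) \<partial>lborel)"
  unfolding wavg_def by (simp add: mult.assoc[symmetric])

theorem wavg_Zc:
  shows "integrable lborel (\<lambda>k. wavg x k * S.Zc x k)"
    and "integrable lborel (\<lambda>x. \<integral>k. wavg x k * S.Zc x k \<partial>lborel)"
    and "(\<integral>x. \<integral>k. wavg x k * S.Zc x k \<partial>lborel \<partial>lborel) = (\<integral>q. g q * S.pairing q s S.\<Theta>0 0 \<partial>lborel)"
proof -
  show "integrable lborel (\<lambda>k. wavg x k * S.Zc x k)"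
    unfolding wavg_Zc_eq by (rule integrable_lborel_iterated(1)[OF gwZ_integrable(2)])
  have "integrable lborel (\<lambda>(p, q). g q * (S.wigner1 q (fst p) (snd p) * S.Zc (fst p) (snd p)))"
    using gwZ_integrable(1) by (simp add: split_def)
  note I = integrable_lborel_iterated[OF this]
  have J: "integrable lborel (\<lambda>(x, k). wavg x k * S.Zc x k)"
    unfolding wavg_Zc_eq split_def by (rule I(1))
  show "integrable lborel (\<lambda>x. \<integral>k. wavg x k * S.Zc x k \<partial>lborel)"
    by (rule integrable_lborel_iterated(1)[OF J])
  have "(\<integral>x. \<integral>k. wavg x k * S.Zc x k \<partial>lborel \<partial>lborel) = (\<integral>p. \<integral>q. g q * (S.wigner1 q (fst p) (snd p) * S.Zc (fst p) (snd p)) \<partial>lborel \<partial>lborel)"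
    unfolding integrable_lborel_iterated(3)[OF J, symmetric] by (simp add: wavg_Zc_eq split_def)
  also have "\<dots> = (\<integral>q. \<integral>p. g q * (S.wigner1 q (fst p) (snd p) * S.Zc (fst p) (snd p)) \<partial>lborel \<partial>lborel)"
    using I(3,4) by simp
  also have "\<dots> = (\<integral>q. g q * S.pairing q s S.\<Theta>0 0 \<partial>lborel)"
  proof (rule Bochner_Integration.integral_cong[OF refl])
    fix q
    have "(\<integral>p. g q * (S.wigner1 q (fst p) (snd p) * S.Zc (fst p) (snd p)) \<partial>lborel) = g q * (\<integral>(x, k). S.wigner1 q x k * S.Zc x k \<partial>lborel)"
      by (simp add: split_def)
    also have "(\<integral>(x, k). S.wigner1 q x k * S.Zc x k \<partial>lborel) = S.pairing q s S.\<Theta>0 0"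
      unfolding integrable_lborel_iterated(3)[OF S.wigner_Zc(1)] by (rule S.wigner_Zc(2))
    finally show "(\<integral>p. g q * (S.wigner1 q (fst p) (snd p) * S.Zc (fst p) (snd p)) \<partial>lborel) = g q * S.pairing q s S.\<Theta>0 0" .
  qed
  finally show "(\<integral>x. \<integral>k. wavg x k * S.Zc x k \<partial>lborel \<partial>lborel) = (\<integral>q. g q * S.pairing q s S.\<Theta>0 0 \<partial>lborel)" .
qed

text \<open>Used in two ways: to split the difference of averages in the limit, and, with a seminorm
  of the test function inside \<open>C\<close>, for temperedness of the signal.\<close>

lemma g_pairing:
  assumes F: "(\<lambda>(p, x). F p x) \<in> borel_measurable (borel \<Otimes>\<^sub>M borel)" "\<And>p x. norm (F p x) \<le> C * wt (snd p - fst p)"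
  shows "integrable lborel (\<lambda>q. g q * S.pairing q s F 0)"
    and "norm (\<integral>q. g q * S.pairing q s F 0 \<partial>lborel) \<le> (\<integral>q. norm (g q) \<partial>lborel) * (2 * M * (C * (\<integral>p. source_weight s p \<partial>lborel)))"
proof -
  have le: "norm (g q * S.pairing q s F 0) \<le> norm (g q) * (2 * M * (C * (\<integral>p. source_weight s p \<partial>lborel)))" for q
    unfolding norm_mult by (intro mult_left_mono S.pairing_integrable(2)[OF S.s_int F]) auto
  have i: "integrable lborel (\<lambda>q. norm (g q) * (2 * M * (C * (\<integral>p. source_weight s p \<partial>lborel))))"
    using g_int by simp
  note [measurable] = pairing_q_measurable[OF F(1)]
  show int: "integrable lborel (\<lambda>q. g q * S.pairing q s F 0)"
    by (rule integrable_const_mult_bound[OF i, of _ 1]) (use le in auto)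
  have "norm (\<integral>q. g q * S.pairing q s F 0 \<partial>lborel) \<le> (\<integral>q. norm (g q) * (2 * M * (C * (\<integral>p. source_weight s p \<partial>lborel))) \<partial>lborel)"
    by (rule order_trans[OF integral_norm_bound]) (intro integral_mono integrable_norm int i le)
  then show "norm (\<integral>q. g q * S.pairing q s F 0 \<partial>lborel) \<le> (\<integral>q. norm (g q) \<partial>lborel) * (2 * M * (C * (\<integral>p. source_weight s p \<partial>lborel)))"
    by simp
qed

end

section \<open>The limit\<close>

lemma wt_small:
  assumes "0 < r"
  obtains R where "0 < R" "\<And>x::'a::euclidean_space. R \<le> norm x \<Longrightarrow> wt x \<le> r"
proof -
  have "wt x \<le> r" if "1 / r \<le> norm x" for x :: 'a
  proof -
    have p: "1 \<le> 1 + norm x" "0 < 1 + norm x" using norm_ge_zero[of x] by linarith+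
    have "(1 + norm x) ^ 1 \<le> (1 + norm x) ^ (2 * DIM('a))"
      using p(1) DIM_positive[where 'a='a] by (intro power_increasing) auto
    then have "wt x \<le> 1 / (1 + norm x)"
      unfolding wt_def using p by (intro divide_left_mono) auto
    also have "\<dots> \<le> 1 / (1 / r)"
      using that assms p by (intro divide_left_mono mult_pos_pos) (auto intro: order_trans)
    finally show ?thesis by simp
  qed
  then show ?thesis using that[of "1 / r"] assms by simp
qed

text \<open>The Cauchy-Schwarz estimate in \<open>x\<close> asks for uniformity over the whole
  space. Outside a large ball the decay of \<psi> makes both products small because the coefficients
  are bounded; inside, uniform convergence and uniform continuity on a slightly larger ball
  apply.\<close>

lemma product_shift_uniform:
  fixes an :: "nat \<Rightarrow> real^3 \<Rightarrow> real" and \<psi> :: "real^3 \<Rightarrow> complex"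
  assumes an: "\<And>n x. \<bar>an n x\<bar> \<le> C" and a0: "\<And>x. \<bar>a0 x\<bar> \<le> C"
    and lim: "\<And>K. compact K \<Longrightarrow> uniform_limit K an a0 sequentially"
    and ca: "continuous_on UNIV a0" and c\<psi>: "continuous_on UNIV \<psi>"
    and \<psi>: "\<And>x. norm (\<psi> x) \<le> B * wt x"
    and h: "h \<longlonglongrightarrow> 0" and k: "k \<longlonglongrightarrow> 0" and r: "0 < r"
  shows "\<forall>\<^sub>F n in sequentially. \<forall>x. norm (of_real (an n (x + h n)) * \<psi> (x + k n) - of_real (a0 x) * \<psi> x) \<le> r"
proof -
  have C0: "0 \<le> C" using an[of 0 0] by linarith
  have B0: "0 \<le> B"
    using order_trans[OF norm_ge_zero \<psi>[of 0]] wt_pos[of "0 :: real^3"] by (simp add: zero_le_mult_iff)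
  define D where "D = 2 * C * B + 1"
  have D: "0 < D" using B0 C0 by (simp add: D_def add_nonneg_pos)
  obtain R where R: "0 < R" "\<And>x::real^3. R \<le> norm x \<Longrightarrow> wt x \<le> r / D"
    using wt_small[of "r / D"] r D by auto
  \<comment> \<open>The case distinction is at radius R + 1 and the displacements are shorter than
    1: points inside stay within radius R + 2, points outside stay beyond R.\<close>
  define K where "K = cball (0 :: real^3) (R + 2)"
  have K: "compact K" by (simp add: K_def)
  \<comment> \<open>The estimate inside is C d + 2 d B; the summand 2 keeps the denominator
    positive.\<close>
  define d where "d = r / (2 * C + 2 * B + 2)"
  have d: "0 < d" using r C0 B0 by (simp add: d_def)
  have "uniformly_continuous_on K a0" "uniformly_continuous_on K \<psi>"
    by (auto intro!: compact_uniformly_continuous K continuous_on_subset[OF ca] continuous_on_subset[OF c\<psi>])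
  then obtain d1 d2 where d1: "0 < d1" "\<And>x y. x \<in> K \<Longrightarrow> y \<in> K \<Longrightarrow> dist y x < d1 \<Longrightarrow> dist (a0 y) (a0 x) < d"
    and d2: "0 < d2" "\<And>x y. x \<in> K \<Longrightarrow> y \<in> K \<Longrightarrow> dist y x < d2 \<Longrightarrow> dist (\<psi> y) (\<psi> x) < d"
    unfolding uniformly_continuous_on_def using d by metis
  have "\<forall>\<^sub>F n in sequentially. \<forall>x\<in>K. dist (an n x) (a0 x) < d"
    using uniform_limitD[OF lim[OF K] d] .
  moreover have "\<forall>\<^sub>F n in sequentially. dist (h n) 0 < min 1 d1" "\<forall>\<^sub>F n in sequentially. dist (k n) 0 < min 1 d2"
    using tendstoD[OF h, of "min 1 d1"] tendstoD[OF k, of "min 1 d2"] d1(1) d2(1) by auto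
  ultimately show ?thesis
  proof eventually_elim
    case (elim n)
    show ?case
    proof
      fix x
      show "norm (of_real (an n (x + h n)) * \<psi> (x + k n) - of_real (a0 x) * \<psi> x) \<le> r"
      proof (cases "norm x \<le> R + 1")
        case True
        have xK: "x \<in> K" using True by (simp add: K_def)
        have xh: "x + h n \<in> K" and xk: "x + k n \<in> K"
          using elim(2,3) True norm_triangle_ineq[of x "h n"] norm_triangle_ineq[of x "k n"] by (auto simp: K_def)
        have 1: "\<bar>an n (x + h n) - a0 x\<bar> \<le> 2 * d"
        proof -
          have "\<bar>an n (x + h n) - a0 (x + h n)\<bar> < d" using elim(1) xh by (auto simp: dist_real_def)
          moreover have "\<bar>a0 (x + h n) - a0 x\<bar> < d" using d1(2)[OF xK xh] elim(2) by (auto simp: dist_norm)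
          ultimately show ?thesis by linarith
        qed
        have 2: "norm (\<psi> (x + k n) - \<psi> x) \<le> d" using d2(2)[OF xK xk] elim(3) by (auto simp: dist_norm)
        have 3: "norm (\<psi> x) \<le> B" using \<psi>[of x] mult_left_mono[OF wt_le_1 B0, of x] by simp
        have "of_real (an n (x + h n)) * \<psi> (x + k n) - of_real (a0 x) * \<psi> x
          = of_real (an n (x + h n)) * (\<psi> (x + k n) - \<psi> x) + of_real (an n (x + h n) - a0 x) * \<psi> x"
          by (simp add: algebra_simps)
        also have "norm \<dots> \<le> C * d + (2 * d) * B"
        proof (rule norm_triangle_le, rule add_mono)
          show "norm (of_real (an n (x + h n)) * (\<psi> (x + k n) - \<psi> x)) \<le> C * d"
            unfolding norm_mult using an 2 C0 by (intro mult_mono) auto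
          show "norm (of_real (an n (x + h n) - a0 x) * \<psi> x) \<le> (2 * d) * B"
            unfolding norm_mult norm_of_real using 1 3 d by (intro mult_mono) auto
        qed
        also have "\<dots> \<le> d * (2 * C + 2 * B + 2)" using d C0 by (simp add: algebra_simps)
        also have "\<dots> = r" using C0 B0 by (simp add: d_def add_nonneg_pos less_imp_neq[symmetric])
        finally show ?thesis .
      next
        case False
        have "norm x \<le> norm (x + k n) + norm (k n)" using norm_triangle_ineq4[of "x + k n" "k n"] by simp
        then have f: "R \<le> norm x" "R \<le> norm (x + k n)" using False elim(3) by (auto simp: dist_norm)
        have small: "C * norm (\<psi> y) \<le> C * (B * (r / D))" if "R \<le> norm y" for y
          using \<psi>[of y] mult_left_mono[OF R(2)[OF that] B0] C0 by (intro mult_left_mono) auto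
        have "norm (of_real (an n (x + h n)) * \<psi> (x + k n) - of_real (a0 x) * \<psi> x)
          \<le> C * norm (\<psi> (x + k n)) + C * norm (\<psi> x)"
          by (rule order_trans[OF norm_triangle_ineq4]) (auto simp: norm_mult intro!: add_mono mult_right_mono an a0)
        also have "\<dots> \<le> C * (B * (r / D)) + C * (B * (r / D))"
          by (intro add_mono small f)
        also have "\<dots> = r * (2 * C * B / D)" by simp
        also have "\<dots> \<le> r * 1"
          using D r by (intro mult_left_mono) (auto simp: divide_le_eq D_def)
        finally show ?thesis by simp
      qed
    qed
  qed
qed

text \<open>At fixed (y, z) the \<open>x\<close>-integral is at most 2M times the supremum of the
  kernel and so tends to 0; \<open>source_weight\<close> dominates in (y, z).\<close>

lemma pairing_limit:
  fixes u v :: "nat \<Rightarrow> real^3 \<Rightarrow> complex"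
  assumes loc: "\<And>n. wigner_pair (u n) (v n) (e n) M" and s: "integrable lborel s"
    and F: "\<And>n. (\<lambda>(p, x). F n p x) \<in> borel_measurable (borel \<Otimes>\<^sub>M borel)"
    and B: "\<And>n p x. norm (F n p x) \<le> B * wt (snd p - fst p)"
    and lim: "\<And>p r. 0 < r \<Longrightarrow> \<forall>\<^sub>F n in sequentially. \<forall>x. norm (F n p x) \<le> r"
  shows "(\<lambda>n. wigner_pair.pairing (u n) (v n) (e n) s (F n) 0) \<longlonglongrightarrow> 0"
proof -
  have M0: "0 \<le> M" using loc[of 0] by (rule wigner_pair.M_nonneg)
  define J where "J n p = (\<integral>x. wigner_pair.uv (u n) (v n) (e n) x (fst p + 0) * F n p x \<partial>lborel)" for n p
  have it: "wigner_pair.pairing (u n) (v n) (e n) s (F n) 0 = (\<integral>p. s (snd p) * J n p \<partial>lborel)" for n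
    unfolding J_def by (rule wigner_pair.pairing_iterated[OF loc s F B])
  have [measurable]: "s \<in> borel_measurable borel" using s by auto
  have J_meas: "J n \<in> borel_measurable borel" for n
  proof -
    interpret wigner_pair "u n" "v n" "e n" M by (rule loc)
    note [measurable (raw)] = measurable_case_prodD[OF F[of n]]
    show ?thesis unfolding J_def by measurable
  qed
  note [measurable] = J_meas
  have J_le: "norm (J n p) \<le> 2 * M * r" if "\<And>x. norm (F n p x) \<le> r" for n p r
  proof -
    interpret wigner_pair "u n" "v n" "e n" M by (rule loc)
    note [measurable (raw)] = measurable_case_prodD[OF F[of n]]
    show ?thesis unfolding J_def by (rule pairing_x_bound(2)[OF that]) measurable
  qed
  have J_lim: "(\<lambda>n. J n p) \<longlonglongrightarrow> 0" for p
  proof (rule tendstoI)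
    fix r :: real assume r: "0 < r"
    define r' where "r' = r / (2 * M + 1)"
    have r': "0 < r'" using r M0 by (simp add: r'_def add_nonneg_pos)
    have "\<forall>\<^sub>F n in sequentially. \<forall>x. norm (F n p x) \<le> r'" by (rule lim[OF r'])
    then show "\<forall>\<^sub>F n in sequentially. dist (J n p) 0 < r"
    proof eventually_elim
      case (elim n)
      then have "norm (J n p) \<le> 2 * M * r'" using J_le by blast
      also have "\<dots> < (2 * M + 1) * r'" using r' by (simp add: distrib_right)
      also have "\<dots> = r" using M0 by (simp add: r'_def)
      finally show ?case by simp
    qed
  qed
  have "(\<lambda>n. \<integral>p. s (snd p) * J n p \<partial>lborel) \<longlonglongrightarrow> (\<integral>p. s (snd p :: real^3) * 0 \<partial>(lborel :: ((real^3) \<times> (real^3)) measure))"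
  proof (rule integral_dominated_convergence[where w="\<lambda>p. 2 * M * B * source_weight s p"])
    show "integrable lborel (\<lambda>p. 2 * M * B * source_weight s p)"
      using integrable_source_weight(1)[OF s] by simp
    show "AE p in lborel. (\<lambda>n. s (snd p) * J n p) \<longlonglongrightarrow> s (snd p) * 0"
      by (intro AE_I2 tendsto_intros J_lim)
    show "AE p in lborel. norm (s (snd p) * J n p) \<le> 2 * M * B * source_weight s p" for n
    proof (intro AE_I2)
      fix p
      have "norm (s (snd p) * J n p) \<le> norm (s (snd p)) * (2 * M * (B * wt (snd p - fst p)))"
        unfolding norm_mult by (intro mult_left_mono J_le B) auto
      then show "norm (s (snd p) * J n p) \<le> 2 * M * B * source_weight s p"
        by (simp add: source_weight_def mult_ac)
    qed
  qed (auto intro!: borel_measurable_times)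
  then show ?thesis unfolding it by simp
qed

text \<open>The two averages share the fields and differ in the kernel, so linearity turns their
  difference into one pairing with a kernel that vanishes uniformly in \<open>x\<close>. The
  estimate is uniform over fields with the common bound \<open>M\<close>.\<close>

theorem average_limit:
  fixes u v :: "nat \<Rightarrow> real^3 \<Rightarrow> real^3 \<Rightarrow> complex"
  assumes loc: "\<And>n. wigner_average (u n) (v n) g (e n) M (a n) s \<theta> C B"
    and loc0: "\<And>n. wigner_average (u n) (v n) g (e n) M a0 s \<theta> C B"
    and lim: "\<And>K. compact K \<Longrightarrow> uniform_limit K a a0 sequentially"
    and ca: "continuous_on UNIV a0" and e: "e \<longlonglongrightarrow> 0"
  shows "(\<lambda>n. (\<integral>q. g q * wigner_pair.pairing (\<lambda>x. u n x q) (\<lambda>x. v n x q) (e n) s (wigner_source.\<Theta> (e n) (a n) \<theta>) 0 \<partial>lborel)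
     - (\<integral>q. g q * wigner_pair.pairing (\<lambda>x. u n x q) (\<lambda>x. v n x q) (e n) s (wigner_source.\<Theta>0 a0 \<theta>) 0 \<partial>lborel)) \<longlonglongrightarrow> 0"
proof -
  define F where "F n p x = wigner_source.\<Theta> (e n) (a n) \<theta> p x - wigner_source.\<Theta>0 a0 \<theta> p x" for n p x
  have \<theta>: "decaying \<theta> B" and s: "integrable lborel s" and g: "integrable lborel g"
    and an: "\<And>n x. \<bar>a n x\<bar> \<le> C" and a0: "\<And>x. \<bar>a0 x\<bar> \<le> C" and C0: "0 \<le> C" and B0: "0 \<le> B"
  proof -
    interpret wigner_average "u 0" "v 0" g "e 0" M "a 0" s \<theta> C B by (rule loc)
    show "decaying \<theta> B" "integrable lborel s" "integrable lborel g" "0 \<le> C" "0 \<le> B"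
      by (rule S.\<theta> S.s_int g_int S.Ca_nonneg S.B_nonneg)+
  next
    fix n x
    interpret n: wigner_average "u n" "v n" g "e n" M "a n" s \<theta> C B by (rule loc)
    show "\<bar>a n x\<bar> \<le> C" by (rule n.S.a_le)
  next
    fix x
    interpret n: wigner_average "u 0" "v 0" g "e 0" M a0 s \<theta> C B by (rule loc0)
    show "\<bar>a0 x\<bar> \<le> C" by (rule n.S.a_le)
  qed
  have pair: "wigner_pair (\<lambda>x. u n x q) (\<lambda>x. v n x q) (e n) M" for n q
  proof -
    interpret n: wigner_average "u n" "v n" g "e n" M "a n" s \<theta> C B by (rule loc)
    show ?thesis by unfold_locales
  qed
  have m1: "(\<lambda>(p, x). wigner_source.\<Theta> (e n) (a n) \<theta> p x) \<in> borel_measurable (borel \<Otimes>\<^sub>M borel)"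
    and b1: "norm (wigner_source.\<Theta> (e n) (a n) \<theta> p x) \<le> C * B * wt (snd p - fst p)"
    and d1: "wigner_source.\<Theta> (e n) (a n) \<theta> p x = of_real (a n (x + (e n / 2) *\<^sub>R fst p)) * \<theta> (snd p - fst p) (x - e n *\<^sub>R snd p + (e n / 2) *\<^sub>R fst p)" for n p x
  proof -
    interpret n: wigner_average "u n" "v n" g "e n" M "a n" s \<theta> C B by (rule loc)
    show "(\<lambda>(p, x). n.S.\<Theta> p x) \<in> borel_measurable (borel \<Otimes>\<^sub>M borel)" by (rule n.S.\<Theta>_measurable)
    show "norm (n.S.\<Theta> p x) \<le> C * B * wt (snd p - fst p)" by (rule n.S.\<Theta>_bound)
    show "n.S.\<Theta> p x = of_real (a n (x + (e n / 2) *\<^sub>R fst p)) * \<theta> (snd p - fst p) (x - e n *\<^sub>R snd p + (e n / 2) *\<^sub>R fst p)" by (rule n.S.\<Theta>_def)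
  qed
  have m2: "(\<lambda>(p, x). wigner_source.\<Theta>0 a0 \<theta> p x) \<in> borel_measurable (borel \<Otimes>\<^sub>M borel)"
    and b2: "norm (wigner_source.\<Theta>0 a0 \<theta> p x) \<le> C * B * wt (snd p - fst p)"
    and d2: "wigner_source.\<Theta>0 a0 \<theta> p x = of_real (a0 x) * \<theta> (snd p - fst p) x" for p x
  proof -
    interpret n: wigner_average "u 0" "v 0" g "e 0" M a0 s \<theta> C B by (rule loc0)
    show "(\<lambda>(p, x). n.S.\<Theta>0 p x) \<in> borel_measurable (borel \<Otimes>\<^sub>M borel)" by (rule n.S.\<Theta>0_measurable)
    show "norm (n.S.\<Theta>0 p x) \<le> C * B * wt (snd p - fst p)" by (rule n.S.\<Theta>0_bound)
    show "n.S.\<Theta>0 p x = of_real (a0 x) * \<theta> (snd p - fst p) x" by (rule n.S.\<Theta>0_def)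
  qed
  have Fm: "(\<lambda>(p, x). F n p x) \<in> borel_measurable (borel \<Otimes>\<^sub>M borel)" for n
    using borel_measurable_diff[OF m1[of n] m2] by (simp add: F_def split_def)
  have FB: "norm (F n p x) \<le> (2 * C * B) * wt (snd p - fst p)" for n p x
    using norm_triangle_ineq4[of "wigner_source.\<Theta> (e n) (a n) \<theta> p x" "wigner_source.\<Theta>0 a0 \<theta> p x"] b1[of n p x] b2[of p x]
    unfolding F_def by linarith
  have Flim: "\<forall>\<^sub>F n in sequentially. \<forall>x. norm (F n p x) \<le> r" if r: "0 < r" for p r
  proof -
    \<comment> \<open>At fixed p both kernels are a coefficient times a test function;
      \<open>h\<close> and \<open>k\<close> are the displacements of their arguments and vanish with
      \<open>e\<close>.\<close>
    define h where "h n = (e n / 2) *\<^sub>R fst p" for n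
    define k where "k n = - (e n *\<^sub>R snd p) + (e n / 2) *\<^sub>R fst p" for n
    have h: "h \<longlonglongrightarrow> 0" and k: "k \<longlonglongrightarrow> 0"
      unfolding h_def k_def by (auto intro!: tendsto_eq_intros e)
    define \<psi> where "\<psi> = \<theta> (snd p - fst p)"
    have "continuous_on UNIV (\<lambda>x. (\<lambda>(\<xi>, x). \<theta> \<xi> x) (snd p - fst p, x))"
      by (rule continuous_on_compose2[OF _ continuous_on_Pair[OF continuous_on_const continuous_on_id]])
        (use \<theta> in \<open>auto simp: decaying_def\<close>)
    then have c\<psi>: "continuous_on UNIV \<psi>" by (simp add: \<psi>_def)
    have b\<psi>: "norm (\<psi> x) \<le> B * wt x" for x
    proof -
      have "norm (\<psi> x) \<le> B * (wt (snd p - fst p) * wt x)" using \<theta> by (simp add: \<psi>_def decaying_def)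
      also have "\<dots> \<le> B * (1 * wt x)" by (intro mult_left_mono mult_right_mono wt_le_1 B0) auto
      finally show ?thesis by simp
    qed
    have eq: "F n p x = of_real (a n (x + h n)) * \<psi> (x + k n) - of_real (a0 x) * \<psi> x" for n x
    proof -
      have "x - e n *\<^sub>R snd p + (e n / 2) *\<^sub>R fst p = x + k n" by (simp add: k_def)
      then show ?thesis unfolding F_def d1 d2 h_def \<psi>_def by (simp only:)
    qed
    show ?thesis unfolding eq
      by (rule product_shift_uniform[OF an a0 lim ca c\<psi> b\<psi> h k r])
  qed
  define P where "P n q = wigner_pair.pairing (\<lambda>x. u n x q) (\<lambda>x. v n x q) (e n) s (F n) 0" for n q
  have P0: "(\<lambda>n. P n q) \<longlonglongrightarrow> 0" for q
    unfolding P_def by (rule pairing_limit[OF pair s Fm FB Flim])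
  have Pb: "norm (P n q) \<le> 2 * M * (2 * C * B * (\<integral>p. source_weight s p \<partial>lborel))" for n q
    unfolding P_def by (rule wigner_pair.pairing_integrable(2)[OF pair s Fm FB])
  have Pm: "P n \<in> borel_measurable borel" for n
  proof -
    interpret n: wigner_average "u n" "v n" g "e n" M "a n" s \<theta> C B by (rule loc)
    show ?thesis unfolding P_def by (rule n.pairing_q_measurable[OF Fm])
  qed
  have [measurable]: "g \<in> borel_measurable borel" using g by auto
  note [measurable] = Pm
  have "(\<lambda>n. \<integral>q. g q * P n q \<partial>lborel) \<longlonglongrightarrow> (\<integral>q. g q * 0 \<partial>lborel)"
  proof (rule integral_dominated_convergence[where w="\<lambda>q. norm (g q) * (2 * M * (2 * C * B * (\<integral>p. source_weight s p \<partial>lborel)))"])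
    show "integrable lborel (\<lambda>q. norm (g q) * (2 * M * (2 * C * B * (\<integral>p. source_weight s p \<partial>lborel))))" using g by simp
    show "AE q in lborel. (\<lambda>n. g q * P n q) \<longlonglongrightarrow> g q * 0" by (intro AE_I2 tendsto_intros P0)
    show "AE q in lborel. norm (g q * P n q) \<le> norm (g q) * (2 * M * (2 * C * B * (\<integral>p. source_weight s p \<partial>lborel)))" for n
      unfolding norm_mult by (intro AE_I2 mult_left_mono Pb) simp
  qed auto
  moreover have "(\<integral>q. g q * P n q \<partial>lborel) = (\<integral>q. g q * wigner_pair.pairing (\<lambda>x. u n x q) (\<lambda>x. v n x q) (e n) s (wigner_source.\<Theta> (e n) (a n) \<theta>) 0 \<partial>lborel)
     - (\<integral>q. g q * wigner_pair.pairing (\<lambda>x. u n x q) (\<lambda>x. v n x q) (e n) s (wigner_source.\<Theta>0 a0 \<theta>) 0 \<partial>lborel)" for n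
  proof -
    interpret n: wigner_average "u n" "v n" g "e n" M "a n" s \<theta> C B by (rule loc)
    have "P n q = n.S.pairing q s (wigner_source.\<Theta> (e n) (a n) \<theta>) 0 - n.S.pairing q s (wigner_source.\<Theta>0 a0 \<theta>) 0" for q
      unfolding P_def F_def by (rule n.S.pairing_diff[OF s m1 b1 m2 b2, symmetric])
    then show ?thesis
      using n.g_pairing(1)[OF m1 b1] n.g_pairing(1)[OF m2 b2] by (simp add: right_diff_distrib)
  qed
  ultimately show ?thesis by simp
qed

section \<open>Schwartz functions\<close>

lemma schwartz_D:
  assumes "schwartz f" "bs \<in> lists Basis"
  shows "pderivs bs f differentiable (at x)" and "continuous_on UNIV (pderivs bs f)"
proof -
  show d: "pderivs bs f differentiable (at x)" for x using assms by (simp add: schwartz_def)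
  then show "continuous_on UNIV (pderivs bs f)"
    by (simp add: continuous_on_eq_continuous_at differentiable_imp_continuous_within)
qed

text \<open>The power 12 is the exponent of \<open>wt_pair_le\<close> for two copies of
  \<open>real^3\<close>.\<close>

lemma schwartz_wt_bound:
  fixes f :: "(real^3) \<times> (real^3) \<Rightarrow> cvec"
  assumes "schwartz f" "bs \<in> lists Basis"
  obtains C where "0 \<le> C" "\<And>\<xi> x. norm (pderivs bs f (\<xi>, x)) \<le> C * (wt \<xi> * wt x)"
proof -
  obtain C where C: "\<And>p. norm ((1 + norm p) ^ 12 *\<^sub>R pderivs bs f p) \<le> C"
    using assms unfolding schwartz_def bounded_iff by blast
  have C0: "0 \<le> C" using order_trans[OF norm_ge_zero C] .
  have "norm (pderivs bs f (\<xi>, x)) \<le> C * (wt \<xi> * wt x)" for \<xi> x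
  proof -
    have p: "0 < (1 + norm (\<xi>, x)) ^ 12" by (intro zero_less_power add_pos_nonneg) auto
    have "norm (pderivs bs f (\<xi>, x)) * (1 + norm (\<xi>, x)) ^ 12 \<le> C"
      using C[of "(\<xi>, x)"] p by (simp add: mult.commute)
    then have "norm (pderivs bs f (\<xi>, x)) \<le> C * (1 / (1 + norm (\<xi>, x)) ^ 12)"
      using p by (simp add: pos_le_divide_eq)
    also have "\<dots> \<le> C * (wt \<xi> * wt x)"
      using wt_pair_le[of \<xi> x] by (intro mult_left_mono C0) simp
    finally show ?thesis .
  qed
  then show ?thesis using that C0 by blast
qed

text \<open>A shift of length at most 1 changes \<open>1 + norm x\<close> by a factor of at most 2;
  on \<open>real^3\<close> this gives the constant 2 ^ 6 = 64 used below.\<close>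

lemma wt_shift_le: "norm h \<le> 1 \<Longrightarrow> wt (x + h) \<le> 2 ^ (2 * DIM('a)) * wt x"
  for x h :: "'a::euclidean_space"
proof -
  assume h: "norm h \<le> 1"
  have "norm x \<le> norm (x + h) + norm h" using norm_triangle_ineq4[of "x + h" h] by simp
  then have "1 + norm x \<le> 2 * (1 + norm (x + h))" using h norm_ge_zero[of "x + h"] unfolding distrib_left by linarith
  then have "(1 + norm x) ^ (2 * DIM('a)) \<le> 2 ^ (2 * DIM('a)) * (1 + norm (x + h)) ^ (2 * DIM('a))"
    unfolding power_mult_distrib[symmetric] by (intro power_mono) auto
  moreover have "0 < (1 + norm x) ^ (2 * DIM('a))" "0 < (1 + norm (x + h)) ^ (2 * DIM('a))"
    by (intro zero_less_power add_pos_nonneg; simp)+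
  ultimately show ?thesis by (simp add: wt_def field_simps)
qed

text \<open>By translation invariance the transform of the difference quotient is (cis (t (k
  \<bullet> b)) - 1) / t times that of \<open>F\<close>. On the other side dominated convergence
  applies, since the mean value inequality bounds the quotients by a multiple of \<open>wt\<close>.
  This takes the place of an integration by parts.\<close>

lemma fourier_derivative:
  fixes F F' :: "real^3 \<Rightarrow> complex"
  assumes deriv: "\<And>\<xi> t. ((\<lambda>t. F (\<xi> + t *\<^sub>R b)) has_vector_derivative F' (\<xi> + t *\<^sub>R b)) (at t)"
    and b: "norm b = 1"
    and F: "F \<in> borel_measurable borel" "\<And>\<xi>. norm (F \<xi>) \<le> C * wt \<xi>"
    and F': "F' \<in> borel_measurable borel" "\<And>\<xi>. norm (F' \<xi>) \<le> C' * wt \<xi>"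
  shows "fourier F' k = \<i> * of_real (k \<bullet> b) * fourier F k"
proof -
  note [measurable] = F(1) F'(1)
  have C'0: "0 \<le> C'"
    using order_trans[OF norm_ge_zero F'(2)[of 0]] wt_pos[of "0 :: real^3"] by (simp add: zero_le_mult_iff)
  have iF: "integrable lborel F" by (rule integrable_const_mult_bound[OF integrable_wt _ F(2)]) measurable
  define t where "t n = 1 / real (Suc n)" for n
  have t: "0 < t n" "t n \<le> 1" for n by (auto simp: t_def)
  have t0: "t \<longlonglongrightarrow> 0" unfolding t_def using LIMSEQ_inverse_real_of_nat by (simp add: inverse_eq_divide)
  have tat: "filterlim t (at 0) sequentially"
    using t0 t(1) by (simp add: filterlim_at less_imp_neq[symmetric] always_eventually)
  define Dq where "Dq n \<xi> = (1 / t n) *\<^sub>R (F (\<xi> + t n *\<^sub>R b) - F \<xi>)" for n \<xi>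
  have Dq_lim: "(\<lambda>n. Dq n \<xi>) \<longlonglongrightarrow> F' \<xi>" for \<xi>
  proof -
    have "((\<lambda>t. F (\<xi> + t *\<^sub>R b)) has_derivative (\<lambda>h. h *\<^sub>R F' \<xi>)) (at 0)"
      using deriv[of \<xi> 0] by (simp add: has_vector_derivative_def)
    then have "((\<lambda>h. norm (F (\<xi> + h *\<^sub>R b) - F \<xi> - h *\<^sub>R F' \<xi>) / norm h) \<longlongrightarrow> 0) (at 0)"
      by (simp add: has_derivative_at)
    then have "(\<lambda>n. norm (F (\<xi> + t n *\<^sub>R b) - F \<xi> - t n *\<^sub>R F' \<xi>) / norm (t n)) \<longlonglongrightarrow> 0"
      by (rule filterlim_compose[OF _ tat])
    moreover have "norm (F (\<xi> + t n *\<^sub>R b) - F \<xi> - t n *\<^sub>R F' \<xi>) / norm (t n) = norm (Dq n \<xi> - F' \<xi>)" for n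
    proof -
      have "Dq n \<xi> - F' \<xi> = (1 / t n) *\<^sub>R (F (\<xi> + t n *\<^sub>R b) - F \<xi> - t n *\<^sub>R F' \<xi>)"
        using t(1)[of n] by (simp add: Dq_def scaleR_diff_right)
      then show ?thesis using t(1)[of n] by simp
    qed
    ultimately show ?thesis by (simp add: tendsto_norm_zero_iff LIM_zero_cancel)
  qed
  have Dq_le: "norm (Dq n \<xi>) \<le> C' * 64 * wt \<xi>" for n \<xi>
  proof -
    have "norm (F (\<xi> + t n *\<^sub>R b) - F (\<xi> + 0 *\<^sub>R b)) \<le> (C' * 64 * wt \<xi>) * norm (t n - 0)"
    proof (rule differentiable_bound[where S="{0..1}" and f="\<lambda>t. F (\<xi> + t *\<^sub>R b)"])
      fix s :: real assume s: "s \<in> {0..1}"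
      show "((\<lambda>t. F (\<xi> + t *\<^sub>R b)) has_derivative (\<lambda>h. h *\<^sub>R F' (\<xi> + s *\<^sub>R b))) (at s within {0..1})"
        using deriv[of \<xi> s] by (simp add: has_vector_derivative_def has_derivative_at_withinI)
      have "norm (F' (\<xi> + s *\<^sub>R b)) \<le> C' * wt (\<xi> + s *\<^sub>R b)" by (rule F'(2))
      also have "\<dots> \<le> C' * (2 ^ (2 * DIM(real^3)) * wt \<xi>)"
        using s b by (intro mult_left_mono wt_shift_le C'0) simp
      finally have "norm (F' (\<xi> + s *\<^sub>R b)) \<le> C' * 64 * wt \<xi>" by simp
      then show "onorm (\<lambda>h. h *\<^sub>R F' (\<xi> + s *\<^sub>R b)) \<le> C' * 64 * wt \<xi>"
        by (intro onorm_le) (simp add: mult.commute mult_left_mono)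
    qed (use t in \<open>auto intro: less_imp_le\<close>)
    then show ?thesis using t(1)[of n] by (simp add: Dq_def pos_divide_le_eq divide_simps)
  qed
  have "(\<lambda>n. \<integral>\<xi>. cis (- (k \<bullet> \<xi>)) * Dq n \<xi> \<partial>lborel) \<longlonglongrightarrow> (\<integral>\<xi>. cis (- (k \<bullet> \<xi>)) * F' \<xi> \<partial>lborel)"
  proof (rule integral_dominated_convergence[where w="\<lambda>\<xi>. C' * 64 * wt \<xi>"])
    show "integrable lborel (\<lambda>\<xi>::real^3. C' * 64 * wt \<xi>)" by (intro integrable_mult_right integrable_wt)
    show "AE \<xi> in lborel. (\<lambda>n. cis (- (k \<bullet> \<xi>)) * Dq n \<xi>) \<longlonglongrightarrow> cis (- (k \<bullet> \<xi>)) * F' \<xi>"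
      by (intro AE_I2 tendsto_intros Dq_lim)
    show "AE \<xi> in lborel. norm (cis (- (k \<bullet> \<xi>)) * Dq n \<xi>) \<le> C' * 64 * wt \<xi>" for n
      using Dq_le by (simp add: norm_mult)
    show "(\<lambda>\<xi>. cis (- (k \<bullet> \<xi>)) * Dq n \<xi>) \<in> borel_measurable lborel" for n
      unfolding Dq_def by measurable
  qed measurable
  moreover have "(\<integral>\<xi>. cis (- (k \<bullet> \<xi>)) * Dq n \<xi> \<partial>lborel) = (1 / t n) *\<^sub>R (cis (t n * (k \<bullet> b)) - 1) * fourier F k" for n
  proof -
    have i1: "integrable lborel (\<lambda>\<xi>. cis (- (k \<bullet> \<xi>)) * F \<xi>)"
      by (rule fourier_integrand_integrable[OF iF]) measurable
    have "integrable lborel (\<lambda>\<xi>. cis (- (k \<bullet> (\<xi> + t n *\<^sub>R b))) * F (\<xi> + t n *\<^sub>R b))"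
      using i1 by (simp only: integrable_lborel_shift_iff[of "\<lambda>\<xi>. cis (- (k \<bullet> \<xi>)) * F \<xi>"])
    then have i2: "integrable lborel (\<lambda>\<xi>. cis (t n * (k \<bullet> b)) * (cis (- (k \<bullet> (\<xi> + t n *\<^sub>R b))) * F (\<xi> + t n *\<^sub>R b)))" by simp
    have "cis (- (k \<bullet> \<xi>)) * Dq n \<xi> = (1 / t n) *\<^sub>R (cis (t n * (k \<bullet> b)) * (cis (- (k \<bullet> (\<xi> + t n *\<^sub>R b))) * F (\<xi> + t n *\<^sub>R b)) - cis (- (k \<bullet> \<xi>)) * F \<xi>)" for \<xi>
    proof -
      have "cis (t n * (k \<bullet> b)) * cis (- (k \<bullet> (\<xi> + t n *\<^sub>R b))) = cis (- (k \<bullet> \<xi>))"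
        by (simp add: cis_mult inner_add_right)
      then show ?thesis
        unfolding mult.assoc[symmetric] Dq_def by (simp add: right_diff_distrib)
    qed
    then have "(\<integral>\<xi>. cis (- (k \<bullet> \<xi>)) * Dq n \<xi> \<partial>lborel)
      = (1 / t n) *\<^sub>R (cis (t n * (k \<bullet> b)) * (\<integral>\<xi>. cis (- (k \<bullet> (\<xi> + t n *\<^sub>R b))) * F (\<xi> + t n *\<^sub>R b) \<partial>lborel) - (\<integral>\<xi>. cis (- (k \<bullet> \<xi>)) * F \<xi> \<partial>lborel))"
      using i1 i2 by simp
    also have "(\<integral>\<xi>. cis (- (k \<bullet> (\<xi> + t n *\<^sub>R b))) * F (\<xi> + t n *\<^sub>R b) \<partial>lborel) = fourier F k"
      unfolding fourier_def by (rule integral_lborel_shift[of "\<lambda>\<xi>. cis (- (k \<bullet> \<xi>)) * F \<xi>"])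
    finally show ?thesis by (simp add: fourier_def left_diff_distrib)
  qed
  moreover have "(\<lambda>n. (1 / t n) *\<^sub>R (cis (t n * (k \<bullet> b)) - 1) * fourier F k) \<longlonglongrightarrow> \<i> * of_real (k \<bullet> b) * fourier F k"
  proof (rule tendsto_mult_right)
    have "((\<lambda>t. cis (t * (k \<bullet> b))) has_vector_derivative (k \<bullet> b) *\<^sub>R (\<i> * cis (0 * (k \<bullet> b)))) (at 0)"
      by (rule vector_diff_chain_at[of "\<lambda>t. t * (k \<bullet> b)" _ _ cis, unfolded o_def])
        (auto intro!: derivative_eq_intros simp: has_vector_derivative_def)
    then have "((\<lambda>t. cis (t * (k \<bullet> b))) has_derivative (\<lambda>h. h *\<^sub>R (\<i> * of_real (k \<bullet> b)))) (at 0)"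
      by (simp add: has_vector_derivative_def scaleR_conv_of_real mult_ac)
    then have "((\<lambda>h. norm (cis (h * (k \<bullet> b)) - 1 - h *\<^sub>R (\<i> * of_real (k \<bullet> b))) / norm h) \<longlongrightarrow> 0) (at 0)"
      by (simp add: has_derivative_at)
    then have "(\<lambda>n. norm (cis (t n * (k \<bullet> b)) - 1 - t n *\<^sub>R (\<i> * of_real (k \<bullet> b))) / norm (t n)) \<longlonglongrightarrow> 0"
      by (rule filterlim_compose[OF _ tat])
    moreover have "norm (cis (t n * (k \<bullet> b)) - 1 - t n *\<^sub>R (\<i> * of_real (k \<bullet> b))) / norm (t n) = norm ((1 / t n) *\<^sub>R (cis (t n * (k \<bullet> b)) - 1) - \<i> * of_real (k \<bullet> b))" for n
    proof -
      have "(1 / t n) *\<^sub>R (cis (t n * (k \<bullet> b)) - 1) - \<i> * of_real (k \<bullet> b) = (1 / t n) *\<^sub>R (cis (t n * (k \<bullet> b)) - 1 - t n *\<^sub>R (\<i> * of_real (k \<bullet> b)))"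
        using t(1)[of n] by (simp add: scaleR_diff_right)
      then show ?thesis using t(1)[of n] by simp
    qed
    ultimately show "(\<lambda>n. (1 / t n) *\<^sub>R (cis (t n * (k \<bullet> b)) - 1)) \<longlonglongrightarrow> \<i> * of_real (k \<bullet> b)"
      by (simp only: tendsto_norm_zero_iff LIM_zero_cancel)
  qed
  ultimately have "(\<integral>\<xi>. cis (- (k \<bullet> \<xi>)) * F' \<xi> \<partial>lborel) = \<i> * of_real (k \<bullet> b) * fourier F k"
    using LIMSEQ_unique by simp
  then show ?thesis by (simp add: fourier_def)
qed

section \<open>Linear operations on Schwartz functions and decay of their Fourier transforms\<close>

lemma pderivs_add:
  assumes "schwartz f" "schwartz g" "bs \<in> lists Basis"
  shows "pderivs bs (\<lambda>x. f x + g x) = (\<lambda>x. pderivs bs f x + pderivs bs g x)"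
  using assms(3)
proof (induction bs)
  case (Cons b bs)
  then have bs: "bs \<in> lists Basis" by simp
  have "((\<lambda>x. pderivs bs f x + pderivs bs g x) has_derivative
      (\<lambda>h. frechet_derivative (pderivs bs f) (at x) h + frechet_derivative (pderivs bs g) (at x) h)) (at x)" for x
    using schwartz_D(1)[OF assms(1) bs] schwartz_D(1)[OF assms(2) bs]
    by (intro has_derivative_add) (auto simp: frechet_derivative_works[symmetric])
  from frechet_derivative_at[OF this] show ?case
    by (simp add: Cons.IH bs fun_eq_iff)
qed simp

lemma schwartz_add:
  assumes "schwartz f" "schwartz g"
  shows "schwartz (\<lambda>x. f x + g x)"
  unfolding schwartz_def
proof (intro ballI conjI allI)
  fix bs :: "'a list" and n :: nat assume bs: "bs \<in> lists Basis"
  show "pderivs bs (\<lambda>x. f x + g x) differentiable (at x)" for x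
    unfolding pderivs_add[OF assms bs] using schwartz_D(1)[OF assms(1) bs] schwartz_D(1)[OF assms(2) bs]
    by (intro differentiable_add)
  have "bounded (range (\<lambda>x. (1 + norm x) ^ n *\<^sub>R pderivs bs f x))" "bounded (range (\<lambda>x. (1 + norm x) ^ n *\<^sub>R pderivs bs g x))"
    using assms bs by (auto simp: schwartz_def)
  from bounded_plus_comp[OF this]
  show "bounded (range (\<lambda>x. (1 + norm x) ^ n *\<^sub>R pderivs bs (\<lambda>x. f x + g x) x))"
    unfolding pderivs_add[OF assms bs] by (simp add: scaleR_add_right)
qed

lemma pderivs_bounded_linear:
  assumes f: "schwartz f" and L: "bounded_linear L" and "bs \<in> lists Basis"
  shows "pderivs bs (\<lambda>x. L (f x)) = (\<lambda>x. L (pderivs bs f x))"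
  using assms(3)
proof (induction bs)
  case (Cons b bs)
  then have bs: "bs \<in> lists Basis" by simp
  have "((\<lambda>x. L (pderivs bs f x)) has_derivative (\<lambda>h. L (frechet_derivative (pderivs bs f) (at x) h))) (at x)" for x
    using schwartz_D(1)[OF f bs] by (intro bounded_linear.has_derivative[OF L]) (simp add: frechet_derivative_works[symmetric])
  from frechet_derivative_at[OF this] show ?case
    by (simp add: Cons.IH bs fun_eq_iff)
qed simp

lemma schwartz_bounded_linear:
  assumes f: "schwartz f" and L: "bounded_linear L"
  shows "schwartz (\<lambda>x. L (f x))"
  unfolding schwartz_def
proof (intro ballI conjI allI)
  fix bs :: "'a list" and n :: nat assume bs: "bs \<in> lists Basis"
  show "pderivs bs (\<lambda>x. L (f x)) differentiable (at x)" for x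
    unfolding pderivs_bounded_linear[OF f L bs]
    using bounded_linear.has_derivative[OF L] schwartz_D(1)[OF f bs] unfolding differentiable_def by blast
  have "bounded (range (\<lambda>x. (1 + norm x) ^ n *\<^sub>R pderivs bs f x))"
    using assms bs by (auto simp: schwartz_def)
  from bounded_linear_image[OF this L]
  show "bounded (range (\<lambda>x. (1 + norm x) ^ n *\<^sub>R pderivs bs (\<lambda>x. L (f x)) x))"
    unfolding pderivs_bounded_linear[OF f L bs] image_image linear_scale[OF bounded_linear.linear[OF L]] .
qed

lemma schwartz_vector_scale:
  fixes f :: "'a::euclidean_space \<Rightarrow> cvec"
  assumes "schwartz f"
  shows "schwartz (\<lambda>x. c *s f x)"
proof (rule schwartz_bounded_linear[OF assms])
  show "bounded_linear (\<lambda>v :: cvec. c *s v)"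
    unfolding linear_conv_bounded_linear[symmetric]
    by (rule linearI) (simp_all add: vec_eq_iff distrib_left)
qed

text \<open>In \<open>pderivs\<close> the head of the list is differentiated last, so a further
  derivative along the line puts the direction \<open>(b, 0)\<close> in front.\<close>

lemma pderivs_line_derivative:
  fixes f :: "(real^3) \<times> (real^3) \<Rightarrow> cvec"
  assumes f: "schwartz f" and bs: "bs \<in> lists Basis"
  shows "((\<lambda>t. pderivs bs f (\<xi> + t *\<^sub>R b, x) $ m) has_vector_derivative pderivs ((b, 0) # bs) f (\<xi> + t *\<^sub>R b, x) $ m) (at t)"
proof -
  let ?f = "pderivs bs f"
  have outer: "(?f has_derivative frechet_derivative ?f (at (\<xi> + t *\<^sub>R b, x))) (at (\<xi> + t *\<^sub>R b, x))"
    using schwartz_D(1)[OF f bs] frechet_derivative_works by blast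
  have inner: "((\<lambda>t. (\<xi> + t *\<^sub>R b, x)) has_derivative (\<lambda>h. (h *\<^sub>R b, 0))) (at t)"
    by (auto intro!: derivative_eq_intros)
  have d: "((\<lambda>t. ?f (\<xi> + t *\<^sub>R b, x)) has_derivative (\<lambda>h. frechet_derivative ?f (at (\<xi> + t *\<^sub>R b, x)) (h *\<^sub>R b, 0))) (at t)"
    by (rule has_derivative_compose[OF inner outer])
  have lin: "linear (frechet_derivative ?f (at (\<xi> + t *\<^sub>R b, x)))"
    by (rule linear_frechet_derivative[OF schwartz_D(1)[OF f bs]])
  have "frechet_derivative ?f (at (\<xi> + t *\<^sub>R b, x)) (h *\<^sub>R b, 0) = h *\<^sub>R pderivs ((b, 0) # bs) f (\<xi> + t *\<^sub>R b, x)" for h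
    using linear_scale[OF lin, of h "(b, 0)"] by simp
  with d have "((\<lambda>t. ?f (\<xi> + t *\<^sub>R b, x)) has_derivative (\<lambda>h. h *\<^sub>R pderivs ((b, 0) # bs) f (\<xi> + t *\<^sub>R b, x))) (at t)"
    by simp
  from bounded_linear.has_derivative[OF bounded_linear_vec_nth this, of m]
  show ?thesis by (simp add: has_vector_derivative_def)
qed

lemma schwartz_nth_measurable:
  fixes f :: "(real^3) \<times> (real^3) \<Rightarrow> cvec"
  assumes f: "schwartz f" and bs: "bs \<in> lists Basis"
  shows "(\<lambda>\<xi>. pderivs bs f (\<xi>, x) $ m) \<in> borel_measurable borel"
proof -
  have "continuous_on UNIV (\<lambda>\<xi>. pderivs bs f (\<xi>, x))"
    by (rule continuous_on_compose2[OF schwartz_D(2)[OF f bs] continuous_on_Pair[OF continuous_on_id continuous_on_const]]) simp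
  then show ?thesis by (intro borel_measurable_continuous_onI continuous_intros)
qed

lemma schwartz_fourier_power:
  fixes f :: "(real^3) \<times> (real^3) \<Rightarrow> cvec"
  assumes f: "schwartz f" and b: "b \<in> Basis"
  shows "fourier (\<lambda>\<xi>. pderivs (replicate n (b, 0)) f (\<xi>, x) $ m) k = (\<i> * of_real (k \<bullet> b)) ^ n * fourier (\<lambda>\<xi>. f (\<xi>, x) $ m) k"
proof (induction n)
  case (Suc n)
  have bs: "replicate n (b, 0) \<in> lists (Basis :: ((real^3) \<times> (real^3)) set)" for n
    using b by (auto simp: Basis_prod_def in_lists_conv_set)
  obtain C where C: "0 \<le> C" "\<And>\<xi> x. norm (pderivs (replicate n (b, 0)) f (\<xi>, x)) \<le> C * (wt \<xi> * wt x)"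
    using schwartz_wt_bound[OF f bs] by blast
  obtain C' where C': "0 \<le> C'" "\<And>\<xi> x. norm (pderivs (replicate (Suc n) (b, 0)) f (\<xi>, x)) \<le> C' * (wt \<xi> * wt x)"
    using schwartz_wt_bound[OF f bs] by blast
  have "fourier (\<lambda>\<xi>. pderivs (replicate (Suc n) (b, 0)) f (\<xi>, x) $ m) k
     = \<i> * of_real (k \<bullet> b) * fourier (\<lambda>\<xi>. pderivs (replicate n (b, 0)) f (\<xi>, x) $ m) k"
  proof (rule fourier_derivative)
    show "((\<lambda>t. pderivs (replicate n (b, 0)) f (\<xi> + t *\<^sub>R b, x) $ m) has_vector_derivative pderivs (replicate (Suc n) (b, 0)) f (\<xi> + t *\<^sub>R b, x) $ m) (at t)" for \<xi> t
      using pderivs_line_derivative[OF f bs] by simp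
    show "norm b = 1" using b by simp
    show "norm (pderivs (replicate n (b, 0)) f (\<xi>, x) $ m) \<le> (C * wt x) * wt \<xi>" for \<xi>
      using order_trans[OF Finite_Cartesian_Product.norm_nth_le C(2)[of \<xi> x]] by (simp add: mult_ac)
    show "norm (pderivs (replicate (Suc n) (b, 0)) f (\<xi>, x) $ m) \<le> (C' * wt x) * wt \<xi>" for \<xi>
      using order_trans[OF Finite_Cartesian_Product.norm_nth_le C'(2)[of \<xi> x]] by (simp add: mult_ac)
  qed (rule schwartz_nth_measurable[OF f bs])+
  then show ?case using Suc.IH by (simp add: mult_ac)
qed simp

text \<open>With m the maximum of 1 and the largest coordinate, 1 + norm k \<le> 1 + 3m \<le> 4m,
  and the sixth power of m is at most 1 plus the sum of the sixth powers. Pure derivatives of order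
  6 therefore control the weight.\<close>

lemma power_one_plus_norm_le:
  "(1 + norm k) ^ 6 \<le> 4 ^ 6 * (1 + (\<Sum>b\<in>Basis. \<bar>k \<bullet> b\<bar> ^ 6))" for k :: "real^3"
proof -
  obtain b where b: "b \<in> Basis" "\<And>c. c \<in> Basis \<Longrightarrow> \<bar>k \<bullet> c\<bar> \<le> \<bar>k \<bullet> b\<bar>"
  proof -
    have "finite ((\<lambda>c. \<bar>k \<bullet> c\<bar>) ` Basis)" "(\<lambda>c. \<bar>k \<bullet> c\<bar>) ` (Basis :: (real^3) set) \<noteq> {}" by auto
    from Max_in[OF this] Max_ge[OF this(1)] show ?thesis using that by fastforce
  qed
  define m where "m = max 1 \<bar>k \<bullet> b\<bar>"
  have "norm k \<le> (\<Sum>c\<in>Basis. \<bar>k \<bullet> c\<bar>)" by (rule norm_le_l1)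
  also have "\<dots> \<le> (\<Sum>c\<in>(Basis :: (real^3) set). m)" by (intro sum_mono) (use b(2) in \<open>force simp: m_def\<close>)
  finally have "1 + norm k \<le> 4 * m" by (simp add: m_def)
  then have "(1 + norm k) ^ 6 \<le> (4 * m) ^ 6" by (intro power_mono) auto
  also have "m ^ 6 \<le> 1 + (\<Sum>b\<in>Basis. \<bar>k \<bullet> b\<bar> ^ 6)"
  proof -
    have "\<bar>k \<bullet> b\<bar> ^ 6 \<le> (\<Sum>b\<in>Basis. \<bar>k \<bullet> b\<bar> ^ 6)" by (rule member_le_sum[OF b(1)]) auto
    moreover have "0 \<le> (\<Sum>b\<in>Basis. \<bar>k \<bullet> b\<bar> ^ 6)" by (rule sum_nonneg) simp
    ultimately show ?thesis by (cases "1 \<le> \<bar>k \<bullet> b\<bar>") (simp_all add: m_def max_def)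
  qed
  then have "(4 * m) ^ 6 \<le> 4 ^ 6 * (1 + (\<Sum>b\<in>Basis. \<bar>k \<bullet> b\<bar> ^ 6))"
    unfolding power_mult_distrib by (intro mult_left_mono) auto
  finally show ?thesis .
qed

text \<open>Decay of the transform comes from six derivatives along each coordinate of \<xi>, each
  bounded by \<open>wt \<xi> * wt x\<close>; six is the exponent of \<open>wt\<close> on
  \<open>real^3\<close>.\<close>

lemma schwartz_decaying:
  fixes f :: "(real^3) \<times> (real^3) \<Rightarrow> cvec"
  assumes f: "schwartz f"
  shows "\<exists>B. decaying (\<lambda>\<xi> x. f (\<xi>, x) $ m) B"
proof -
  have bs: "replicate n (b, 0) \<in> lists (Basis :: ((real^3) \<times> (real^3)) set)" if "b \<in> Basis" for n and b :: "real^3"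
    using that by (auto simp: Basis_prod_def in_lists_conv_set)
  have nil: "[] \<in> lists (Basis :: ((real^3) \<times> (real^3)) set)" by simp
  have cf: "continuous_on UNIV f" using schwartz_D(2)[OF f nil] by simp
  obtain C0 where C0: "0 \<le> C0" "\<And>\<xi> x. norm (f (\<xi>, x)) \<le> C0 * (wt \<xi> * wt x)"
    using schwartz_wt_bound[OF f nil] by auto
  have "\<forall>b\<in>Basis. \<exists>C. 0 \<le> C \<and> (\<forall>\<xi> x. norm (pderivs (replicate 6 (b :: real^3, 0)) f (\<xi>, x)) \<le> C * (wt \<xi> * wt x))"
    using schwartz_wt_bound[OF f bs] by metis
  then obtain C where C: "\<And>b. b \<in> Basis \<Longrightarrow> 0 \<le> C b"
    "\<And>b \<xi> x. b \<in> Basis \<Longrightarrow> norm (pderivs (replicate 6 (b :: real^3, 0)) f (\<xi>, x)) \<le> C b * (wt \<xi> * wt x)"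
    by metis
  define I where "I = (\<integral>x. wt (x :: real^3) \<partial>lborel)"
  have I0: "0 \<le> I" by (simp add: I_def)
  have bound: "norm (fourier F k) \<le> D * wt x * I"
    if "F \<in> borel_measurable borel" "\<And>\<xi>. norm (F \<xi>) \<le> D * (wt \<xi> * wt x)" for F k D and x :: "real^3"
  proof -
    have le: "norm (F \<xi>) \<le> (D * wt x) * wt \<xi>" for \<xi> using that(2)[of \<xi>] by (simp add: mult_ac)
    have m: "F \<in> borel_measurable lborel" using that(1) by simp
    have i: "integrable lborel F" by (rule integrable_const_mult_bound[OF integrable_wt m le])
    have "norm (fourier F k) \<le> (\<integral>\<xi>. norm (F \<xi>) \<partial>lborel)" by (rule norm_fourier_le)
    also have "\<dots> \<le> (\<integral>\<xi>. (D * wt x) * wt (\<xi> :: real^3) \<partial>lborel)"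
      by (rule Bochner_Integration.integral_mono[OF integrable_norm[OF i] integrable_mult_right[OF integrable_wt] le])
    finally show ?thesis by (simp add: I_def)
  qed
  define E where "E = 4 ^ 6 * ((C0 + (\<Sum>b\<in>Basis. C b)) * I)"
  have four: "norm (fourier (\<lambda>\<xi>. f (\<xi>, x) $ m) k) \<le> E * (wt k * wt x)" for x k
  proof -
    let ?F = "norm (fourier (\<lambda>\<xi>. f (\<xi>, x) $ m) k)"
    have "?F \<le> C0 * wt x * I"
      using schwartz_nth_measurable[OF f nil, of x m] order_trans[OF Finite_Cartesian_Product.norm_nth_le C0(2)]
      by (intro bound) auto
    moreover have "\<bar>k \<bullet> b\<bar> ^ 6 * ?F \<le> C b * wt x * I" if b: "b \<in> Basis" for b
    proof -
      have "norm (fourier (\<lambda>\<xi>. pderivs (replicate 6 (b, 0)) f (\<xi>, x) $ m) k) \<le> C b * wt x * I"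
        by (intro bound schwartz_nth_measurable[OF f bs[OF b]] order_trans[OF Finite_Cartesian_Product.norm_nth_le C(2)[OF b]])
      then show ?thesis
        unfolding schwartz_fourier_power[OF f b] by (simp add: norm_mult norm_power)
    qed
    ultimately have le: "?F + (\<Sum>b\<in>Basis. \<bar>k \<bullet> b\<bar> ^ 6 * ?F) \<le> C0 * wt x * I + (\<Sum>b\<in>Basis. C b * wt x * I)"
      by (intro add_mono sum_mono) auto
    have 1: "(1 + (\<Sum>b\<in>Basis. \<bar>k \<bullet> b\<bar> ^ 6)) * ?F \<le> (C0 + (\<Sum>b\<in>Basis. C b)) * I * wt x"
    proof -
      have "C0 * wt x * I + (\<Sum>b\<in>Basis. C b * wt x * I) = (C0 + (\<Sum>b\<in>Basis. C b)) * (wt x * I)"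
        by (simp only: distrib_right sum_distrib_right mult.assoc)
      moreover have "?F + (\<Sum>b\<in>Basis. \<bar>k \<bullet> b\<bar> ^ 6 * ?F) = (1 + (\<Sum>b\<in>Basis. \<bar>k \<bullet> b\<bar> ^ 6)) * ?F"
        by (simp only: distrib_right sum_distrib_right mult_1_left)
      ultimately show ?thesis using le by (simp only: mult_ac)
    qed
    have "(1 + norm k) ^ 6 * ?F \<le> 4 ^ 6 * (1 + (\<Sum>b\<in>Basis. \<bar>k \<bullet> b\<bar> ^ 6)) * ?F"
      by (intro mult_right_mono power_one_plus_norm_le) simp
    also have "\<dots> \<le> 4 ^ 6 * ((C0 + (\<Sum>b\<in>Basis. C b)) * I * wt x)"
      unfolding mult.assoc[of "4 ^ 6"] by (intro mult_left_mono 1) simp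
    finally have "?F * (1 + norm k) ^ 6 \<le> E * wt x" by (simp add: E_def mult_ac)
    moreover have "0 < (1 + norm k) ^ 6" by (intro zero_less_power add_pos_nonneg) auto
    ultimately show ?thesis by (simp add: wt_def[of k] pos_le_divide_eq mult_ac)
  qed
  have E0: "0 \<le> E" using C0(1) C(1) I0 by (simp add: E_def sum_nonneg)
  have "decaying (\<lambda>\<xi> x. f (\<xi>, x) $ m) (max C0 E)"
    unfolding decaying_def
  proof (intro conjI allI)
    show "continuous_on UNIV (\<lambda>(\<xi>, x). f (\<xi>, x) $ m)"
      unfolding split_def prod.collapse by (intro continuous_intros cf)
    show "norm (f (\<xi>, x) $ m) \<le> max C0 E * (wt \<xi> * wt x)" for \<xi> x
      by (rule order_trans[OF order_trans[OF Finite_Cartesian_Product.norm_nth_le C0(2)]]) (auto intro!: mult_right_mono)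
    show "norm (fourier (\<lambda>\<xi>. f (\<xi>, x) $ m) l) \<le> max C0 E * (wt l * wt x)" for l x
      by (rule order_trans[OF four]) (auto intro!: mult_right_mono)
  qed
  then show ?thesis ..
qed

text \<open>Conjugation reflects the frequency, and \<open>wt\<close> is even. Conjugates of test
  functions arise because the duality products are sesquilinear.\<close>

lemma decaying_cnj:
  assumes "decaying \<theta> B"
  shows "decaying (\<lambda>\<xi> x. cnj (\<theta> \<xi> x)) B"
  unfolding decaying_def
proof (intro conjI allI)
  have "continuous_on UNIV (\<lambda>p. cnj ((\<lambda>(\<xi>, x). \<theta> \<xi> x) p))"
    using assms by (intro continuous_intros) (auto simp: decaying_def)
  then show "continuous_on UNIV (\<lambda>(\<xi>, x). cnj (\<theta> \<xi> x))" by (simp add: split_def)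
  show "norm (cnj (\<theta> \<xi> x)) \<le> B * (wt \<xi> * wt x)" for \<xi> x using assms by (simp add: decaying_def)
  fix l x
  have "fourier (\<lambda>\<xi>. cnj (\<theta> \<xi> x)) l = (\<integral>\<xi>. cnj (cis (- ((- l) \<bullet> \<xi>)) * \<theta> \<xi> x) \<partial>lborel)"
    unfolding fourier_def by (intro Bochner_Integration.integral_cong refl) (simp add: cis_cnj)
  also have "\<dots> = cnj (fourier (\<lambda>\<xi>. \<theta> \<xi> x) (- l))"
    unfolding fourier_def by (rule Bochner_Integration.integral_cnj)
  finally have "norm (fourier (\<lambda>\<xi>. cnj (\<theta> \<xi> x)) l) = norm (fourier (\<lambda>\<xi>. \<theta> \<xi> x) (- l))" by simp
  also have "\<dots> \<le> B * (wt (- l) * wt x)" using assms unfolding decaying_def by blast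
  finally show "norm (fourier (\<lambda>\<xi>. cnj (\<theta> \<xi> x)) l) \<le> B * (wt l * wt x)" by simp
qed

section \<open>The dual test function \<open>Z\<close>\<close>

text \<open>Evaluation of an entry is bounded linear, and the sum of the entry norms dominates the
  matrix norm; matrix integrals may thus be computed entrywise.\<close>

lemma cmat_integrable:
  fixes F :: "'a \<Rightarrow> cmat"
  assumes "\<And>i j. integrable M (\<lambda>x. F x $ i $ j)"
  shows "integrable M F" and "(\<integral>x. F x \<partial>M) $ i $ j = (\<integral>x. F x $ i $ j \<partial>M)"
proof -
  have "(\<lambda>x. (\<chi> i j. F x $ i $ j)) \<in> borel_measurable M"
    using assms by (intro borel_measurable_vec_lambda) auto
  then have m: "F \<in> borel_measurable M" by (simp add: vec_lambda_eta)
  show int: "integrable M F"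
  proof (rule Bochner_Integration.integrable_bound)
    show "integrable M (\<lambda>x. \<Sum>i\<in>UNIV. \<Sum>j\<in>UNIV. norm (F x $ i $ j))" using assms by simp
    show "AE x in M. norm (F x) \<le> norm (\<Sum>i\<in>UNIV. \<Sum>j\<in>UNIV. norm (F x $ i $ j))"
      by (intro AE_I2) (simp only: real_norm_def order_trans[OF norm_cmat_le_sum abs_ge_self])
  qed (rule m)
  have "bounded_linear (\<lambda>N :: cmat. N $ i $ j)"
    by (rule bounded_linear_compose[OF bounded_linear_vec_nth bounded_linear_vec_nth])
  from integral_bounded_linear[OF this int]
  show "(\<integral>x. F x \<partial>M) $ i $ j = (\<integral>x. F x $ i $ j \<partial>M)" by simp
qed

definition sign4 :: "4 \<Rightarrow> real" where
  "sign4 m = (if m = 4 then 1 else - 1)"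

text \<open>Conjugation by \<open>Gam\<close> multiplies entry (m, l) by a product of two signs; the
  constant prefactor of the signal is included.\<close>

definition coef :: "4 \<Rightarrow> 4 \<Rightarrow> complex" where
  "coef m l = of_real (sign4 m * sign4 l) / (2 * of_real pi) ^ 3"

lemma cnj_coef [simp]: "cnj (coef m l) = coef m l"
  by (simp add: coef_def)

lemma Gam_mult_left: "(Gam ** M) $ i $ j = of_real (sign4 i) * M $ i $ j"
  by (simp add: Gam_def diag_mat_mult_left sign4_def)

lemma Gam_mult_right: "(M ** Gam) $ i $ j = M $ i $ j * of_real (sign4 j)"
  by (simp add: Gam_def diag_mat_mult_right sign4_def)

text \<open>Instantiated both with the coefficients at scale \<open>e\<close> and with their limits,
  so that the entries of the signal and those of \<open>Z_fun\<close> are computed by the same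
  lemmas.\<close>

locale source_matrix =
  fixes \<rho> \<kappa> :: "real^3 \<Rightarrow> real" and C :: real and S :: "real^3 \<Rightarrow> cvec"
  assumes \<rho>_meas: "\<rho> \<in> borel_measurable borel" and \<kappa>_meas: "\<kappa> \<in> borel_measurable borel"
    and \<rho>_le: "\<bar>\<rho> x\<bar> \<le> C" and \<kappa>_le: "\<bar>\<kappa> x\<bar> \<le> C"
    and S_int: "integrable lborel S"
begin

definition A :: "real^3 \<Rightarrow> cmat" where "A x = diag_mat (\<rho> x) (\<kappa> x)"
definition a :: "4 \<Rightarrow> real^3 \<Rightarrow> real" where "a l x = (if l = 4 then \<kappa> x else \<rho> x)"
definition s :: "4 \<Rightarrow> real^3 \<Rightarrow> complex" where "s l z = S z $ l"

lemma a_meas: "a l \<in> borel_measurable borel"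
  using \<rho>_meas \<kappa>_meas by (cases "l = 4") (simp_all add: a_def[abs_def])

lemma a_le: "\<bar>a l x\<bar> \<le> C"
  using \<rho>_le \<kappa>_le by (simp add: a_def)

lemma s_int: "integrable lborel (s l)"
  unfolding s_def by (rule integrable_bounded_linear[OF bounded_linear_vec_nth S_int])

text \<open>The facts about \<open>Zc\<close> and \<open>\<Theta>0\<close> alone do not involve the
  fields, yet they live in \<open>wigner_source\<close>; zero fields give access to them.\<close>

lemma trivial_source: "decaying \<theta> B \<Longrightarrow> wigner_source (\<lambda>_. 0) (\<lambda>_. 0) 1 0 (a l) (s l) \<theta> C B"
  by unfold_locales (auto simp: a_meas a_le s_int)

definition test :: "((real^3) \<times> (real^3) \<Rightarrow> cvec) \<Rightarrow> 4 \<Rightarrow> real^3 \<Rightarrow> real^3 \<Rightarrow> complex" where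
  "test \<phi> m \<xi> x = cnj (\<phi> (\<xi>, x) $ m)"

lemma test_decaying: "schwartz \<phi> \<Longrightarrow> \<exists>B. decaying (test \<phi> m) B"
  using schwartz_decaying[of \<phi> m] decaying_cnj unfolding test_def by blast

definition Zs :: "((real^3) \<times> (real^3) \<Rightarrow> cvec) \<Rightarrow> 4 \<Rightarrow> 4 \<Rightarrow> real^3 \<Rightarrow> real^3 \<Rightarrow> complex" where
  "Zs \<phi> m l = wigner_source.Zc (a l) (s l) (test \<phi> m)"

lemma Zs_eq:
  assumes "schwartz \<phi>"
  shows "Zs \<phi> m l x k = of_real (a l x) * fourier (s l) k * fourier (\<lambda>\<xi>. test \<phi> m \<xi> x) (- k)"
proof -
  obtain B where "decaying (test \<phi> m) B" using test_decaying[OF assms] by blast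
  then interpret wigner_source "\<lambda>_. 0" "\<lambda>_. 0" 1 0 "a l" "s l" "test \<phi> m" C B by (rule trivial_source)
  show ?thesis by (simp add: Zs_def Zc_def)
qed

text \<open>Once the conjugation is pulled out of the entry, the phase splits into a transform of
  the source at \<open>k\<close> and one of the conjugated test function at \<open>- k\<close>. The
  outer conjugation is undone by \<open>mat_dual\<close>.\<close>

lemma Z_nth:
  assumes \<phi>: "schwartz \<phi>"
  shows "Z_fun A S \<phi> x k $ m $ l = cnj (coef m l * Zs \<phi> m l x k)"
proof -
  define F where "F p = cscale (cis (k \<bullet> (fst p - snd p)) / (2 * of_real pi) ^ 3) (Gam ** outer (\<phi> (snd p, x)) (S (fst p)) ** A x ** Gam)" for p
  have cis_split: "cis (k \<bullet> (fst p - snd p)) = cis (k \<bullet> fst p) * cis (- (k \<bullet> snd p))" for p :: "(real^3) \<times> (real^3)"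
    by (simp add: cis_mult inner_diff_right)
  have Fnth: "F p $ m $ l = cnj (coef m l * of_real (a l x) * ((cis (- (k \<bullet> fst p)) * s l (fst p)) * (cis (- ((- k) \<bullet> snd p)) * test \<phi> m (snd p) x)))" for p m l
    by (simp add: F_def cscale_def Gam_mult_right Gam_mult_left A_def diag_mat_mult_right outer_def coef_def a_def s_def test_def
        cis_cnj cis_split)
  have Fint: "integrable lborel (\<lambda>p. (cis (- (k \<bullet> fst p)) * s l (fst p)) * (cis (- ((- k) \<bullet> snd p)) * test \<phi> m (snd p) x))"
    and Feq: "(\<integral>p. (cis (- (k \<bullet> fst p)) * s l (fst p)) * (cis (- ((- k) \<bullet> snd p)) * test \<phi> m (snd p) x) \<partial>lborel) = fourier (s l) k * fourier (\<lambda>\<xi>. test \<phi> m \<xi> x) (- k)" for m l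
  proof -
    obtain B where B: "decaying (test \<phi> m) B" using test_decaying[OF \<phi>] by blast
    have i1: "integrable lborel (\<lambda>z. cis (- (k \<bullet> z)) * s l z)"
      by (rule fourier_integrand_integrable[OF s_int]) measurable
    have i2: "integrable lborel (\<lambda>\<xi>. cis (- ((- k) \<bullet> \<xi>)) * test \<phi> m \<xi> x)"
      by (rule fourier_integrand_integrable[OF decaying_inversion(2)[OF B]]) measurable
    have [measurable]: "(\<lambda>z. cis (- (k \<bullet> z)) * s l z) \<in> borel_measurable borel" "(\<lambda>\<xi>. cis (- ((- k) \<bullet> \<xi>)) * test \<phi> m \<xi> x) \<in> borel_measurable borel"
      using i1 i2 by auto
    have i: "integrable lborel (\<lambda>(z, \<xi>). (cis (- (k \<bullet> z)) * s l z) * (cis (- ((- k) \<bullet> \<xi>)) * test \<phi> m \<xi> x))"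
      by (rule integrable_lborel_prod_bound[OF i1 i2]) (measurable, simp add: norm_mult)
    then show "integrable lborel (\<lambda>p. (cis (- (k \<bullet> fst p)) * s l (fst p)) * (cis (- ((- k) \<bullet> snd p)) * test \<phi> m (snd p) x))"
      by (simp add: split_def)
    have "(\<integral>p. (cis (- (k \<bullet> fst p)) * s l (fst p)) * (cis (- ((- k) \<bullet> snd p)) * test \<phi> m (snd p) x) \<partial>lborel)
       = (\<integral>z. \<integral>\<xi>. (cis (- (k \<bullet> z)) * s l z) * (cis (- ((- k) \<bullet> \<xi>)) * test \<phi> m \<xi> x) \<partial>lborel \<partial>lborel)"
      using integrable_lborel_iterated(3)[OF i] by (simp add: split_def)
    also have "\<dots> = fourier (s l) k * fourier (\<lambda>\<xi>. test \<phi> m \<xi> x) (- k)"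
      unfolding fourier_def integral_mult_right_zero integral_mult_left_zero ..
    finally show "(\<integral>p. (cis (- (k \<bullet> fst p)) * s l (fst p)) * (cis (- ((- k) \<bullet> snd p)) * test \<phi> m (snd p) x) \<partial>lborel) = fourier (s l) k * fourier (\<lambda>\<xi>. test \<phi> m \<xi> x) (- k)" .
  qed
  have "Z_fun A S \<phi> x k = (\<integral>p. F p \<partial>lborel)"
    unfolding Z_fun_def F_def by (simp add: split_def)
  then have "Z_fun A S \<phi> x k $ m $ l = (\<integral>p. F p \<partial>lborel) $ m $ l" by simp
  also have "\<dots> = (\<integral>p. F p $ m $ l \<partial>lborel)"
    unfolding Fnth by (intro cmat_integrable(2)[of lborel F, unfolded Fnth complex_integrable_cnj] integrable_mult_right Fint)
  also have "\<dots> = cnj (coef m l * of_real (a l x) * (fourier (s l) k * fourier (\<lambda>\<xi>. test \<phi> m \<xi> x) (- k)))"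
    unfolding Fnth Bochner_Integration.integral_cnj integral_mult_right_zero Feq ..
  finally show ?thesis by (simp add: Zs_eq[OF \<phi>] mult.assoc)
qed

lemma Z_add:
  assumes \<phi>: "schwartz \<phi>" and \<psi>: "schwartz \<psi>"
  shows "Z_fun A S (\<lambda>p. \<phi> p + \<psi> p) = (\<lambda>x k. Z_fun A S \<phi> x k + Z_fun A S \<psi> x k)"
proof (intro ext)
  fix x k
  have "fourier (\<lambda>\<xi>. test (\<lambda>p. \<phi> p + \<psi> p) m \<xi> x) l = fourier (\<lambda>\<xi>. test \<phi> m \<xi> x) l + fourier (\<lambda>\<xi>. test \<psi> m \<xi> x) l" for m l
  proof -
    have int: "integrable lborel (\<lambda>\<xi>. cis (- (l \<bullet> \<xi>)) * test \<phi> m \<xi> x)" if f: "schwartz \<phi>" for \<phi>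
    proof -
      obtain B where B: "decaying (test \<phi> m) B" using test_decaying[OF f] by blast
      show ?thesis by (rule fourier_integrand_integrable[OF decaying_inversion(2)[OF B]]) measurable
    qed
    from int[OF \<phi>] int[OF \<psi>] show ?thesis by (simp add: fourier_def test_def distrib_left)
  qed
  then show "Z_fun A S (\<lambda>p. \<phi> p + \<psi> p) x k = Z_fun A S \<phi> x k + Z_fun A S \<psi> x k"
    by (simp add: vec_eq_iff Z_nth \<phi> \<psi> schwartz_add Zs_eq distrib_left)
qed

lemma Z_scale:
  assumes \<phi>: "schwartz \<phi>"
  shows "Z_fun A S (\<lambda>p. c *s \<phi> p) = (\<lambda>x k. cscale c (Z_fun A S \<phi> x k))"
proof (intro ext)
  fix x k
  have "fourier (\<lambda>\<xi>. test (\<lambda>p. c *s \<phi> p) m \<xi> x) l = cnj c * fourier (\<lambda>\<xi>. test \<phi> m \<xi> x) l" for m l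
    unfolding fourier_def test_def by (simp add: mult.left_commute)
  then show "Z_fun A S (\<lambda>p. c *s \<phi> p) x k = cscale c (Z_fun A S \<phi> x k)"
    by (simp add: vec_eq_iff cscale_def Z_nth \<phi> schwartz_vector_scale Zs_eq mult_ac)
qed

definition Z_const :: real where
  "Z_const = C * (\<Sum>m\<in>(UNIV :: 4 set). \<Sum>l\<in>UNIV. \<integral>p. source_weight (s l) p \<partial>lborel)"

lemma C_nonneg: "0 \<le> C"
  using \<rho>_le[of 0] by linarith

lemma Z_fourier_k_nth:
  assumes \<phi>: "schwartz \<phi>"
  shows "integrable lborel (\<lambda>k. Z_fun A S \<phi> x k $ m $ l)"
    and "fourier_k (Z_fun A S \<phi>) x y $ m $ l = of_real (sign4 m * sign4 l) * cnj (\<integral>z. s l z * (of_real (a l x) * test \<phi> m (z - y) x) \<partial>lborel)"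
proof -
  have *: "integrable lborel (\<lambda>k. cis (k \<bullet> y) * Zs \<phi> m l x k)"
    "(\<integral>k. cis (k \<bullet> y) * Zs \<phi> m l x k \<partial>lborel) = (2 * of_real pi) ^ 3 * (\<integral>z. s l z * (of_real (a l x) * test \<phi> m (z - y) x) \<partial>lborel)" for m l y
  proof -
    obtain B where "decaying (test \<phi> m) B" using test_decaying[OF \<phi>] by blast
    then interpret wigner_source "\<lambda>_. 0" "\<lambda>_. 0" 1 0 "a l" "s l" "test \<phi> m" C B by (rule trivial_source)
    show "integrable lborel (\<lambda>k. cis (k \<bullet> y) * Zs \<phi> m l x k)"
      unfolding Zs_def by (rule fourier_integrand_integrable[OF Zc_integrable]) measurable
    show "(\<integral>k. cis (k \<bullet> y) * Zs \<phi> m l x k \<partial>lborel) = (2 * of_real pi) ^ 3 * (\<integral>z. s l z * (of_real (a l x) * test \<phi> m (z - y) x) \<partial>lborel)"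
      unfolding Zs_def Zc_fourier by (simp add: \<Theta>0_def)
  qed
  define F where "F k = cscale (cis (- (k \<bullet> y))) (Z_fun A S \<phi> x k)" for k
  have Fnth: "F k $ m $ l = cnj (coef m l * (cis (k \<bullet> y) * Zs \<phi> m l x k))" for k m l
    by (simp add: F_def cscale_def Z_nth[OF \<phi>] cis_cnj)
  have Fi: "integrable lborel (\<lambda>k. F k $ m $ l)" for m l
    unfolding Fnth complex_integrable_cnj by (intro integrable_mult_right *(1))
  have "fourier_k (Z_fun A S \<phi>) x y $ m $ l = (\<integral>k. F k $ m $ l \<partial>lborel)"
    unfolding fourier_k_def F_def[symmetric] by (rule cmat_integrable(2)[OF Fi])
  also have "\<dots> = cnj (coef m l * ((2 * of_real pi) ^ 3 * (\<integral>z. s l z * (of_real (a l x) * test \<phi> m (z - y) x) \<partial>lborel)))"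
    unfolding Fnth Bochner_Integration.integral_cnj integral_mult_right_zero *(2) ..
  finally show "fourier_k (Z_fun A S \<phi>) x y $ m $ l = of_real (sign4 m * sign4 l) * cnj (\<integral>z. s l z * (of_real (a l x) * test \<phi> m (z - y) x) \<partial>lborel)"
    by (simp add: coef_def)
  show "integrable lborel (\<lambda>k. Z_fun A S \<phi> x k $ m $ l)"
    using *(1)[of 0 m l] by (simp add: Z_nth[OF \<phi>])
qed

text \<open>The transform in \<open>k\<close> is bounded uniformly in \<open>x\<close>, because
  \<open>a\<close> and \<open>wt x\<close> are bounded; so the supremum in \<open>A_norm\<close> is
  harmless and \<open>source_weight\<close> is what remains to be integrated. Linearity in
  \<open>R\<close> is kept for temperedness.\<close>

lemma Z_A_norm:
  assumes \<phi>: "schwartz \<phi>" and R: "\<And>\<xi> x. norm (\<phi> (\<xi>, x)) \<le> R * (wt \<xi> * wt x)"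
  shows "A_norm (Z_fun A S \<phi>) \<le> ennreal (Z_const * R)"
proof -
  have R0: "0 \<le> R"
    using order_trans[OF norm_ge_zero R[of 0 0]] mult_pos_pos[OF wt_pos[of "0::real^3"] wt_pos[of "0::real^3"]]
    by (simp add: zero_le_mult_iff)
  have [measurable]: "s l \<in> borel_measurable borel" for l using s_int by auto
  have meas: "(\<lambda>y. \<integral>\<^sup>+z. ennreal (C * R * source_weight (s l) (y, z)) \<partial>lborel) \<in> borel_measurable lborel" for l
    unfolding source_weight_def by measurable
  have pt: "ennreal (norm (fourier_k (Z_fun A S \<phi>) x y)) \<le> (\<Sum>m\<in>(UNIV :: 4 set). \<Sum>l\<in>UNIV. \<integral>\<^sup>+z. ennreal (C * R * source_weight (s l) (y, z)) \<partial>lborel)" for x y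
  proof -
    have e: "ennreal (norm (fourier_k (Z_fun A S \<phi>) x y $ m $ l)) \<le> (\<integral>\<^sup>+z. ennreal (C * R * source_weight (s l) (y, z)) \<partial>lborel)" for m l
    proof -
      obtain B where B: "decaying (test \<phi> m) B" using test_decaying[OF \<phi>] by blast
      note [measurable (raw)] = measurable_case_prodD[OF decaying_measurable[OF B]]
      have t: "norm (test \<phi> m \<xi> x) \<le> R * wt \<xi>" for \<xi>
      proof -
        have "norm (test \<phi> m \<xi> x) \<le> R * (wt \<xi> * wt x)"
          using order_trans[OF Finite_Cartesian_Product.norm_nth_le R] by (simp add: test_def)
        also have "\<dots> \<le> R * (wt \<xi> * 1)" by (intro mult_left_mono wt_le_1 R0) auto
        finally show ?thesis by simp
      qed
      have pw: "norm (s l z * (of_real (a l x) * test \<phi> m (z - y) x)) \<le> C * R * source_weight (s l) (y, z)" for z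
      proof -
        have "norm (s l z * (of_real (a l x) * test \<phi> m (z - y) x)) \<le> norm (s l z) * (C * (R * wt (z - y)))"
          unfolding norm_mult using a_le C_nonneg by (intro mult_left_mono mult_mono t) auto
        then show ?thesis by (simp add: source_weight_def mult_ac)
      qed
      have int: "integrable lborel (\<lambda>z. s l z * (of_real (a l x) * test \<phi> m (z - y) x))"
      proof (rule Bochner_Integration.integrable_bound)
        show "integrable lborel (\<lambda>z. C * R * norm (s l z))" using s_int by simp
        have "C * R * source_weight (s l) (y, z) \<le> C * R * norm (s l z)" for z
          using C_nonneg R0 wt_le_1[of "z - y"] by (intro mult_left_mono) (auto simp: source_weight_def mult_left_le)
        then show "AE z in lborel. norm (s l z * (of_real (a l x) * test \<phi> m (z - y) x)) \<le> norm (C * R * norm (s l z))"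
          unfolding real_norm_def by (intro AE_I2 order_trans[OF order_trans[OF pw] abs_ge_self])
        show "(\<lambda>z. s l z * (of_real (a l x) * test \<phi> m (z - y) x)) \<in> borel_measurable lborel" by measurable
      qed
      have "ennreal (norm (fourier_k (Z_fun A S \<phi>) x y $ m $ l)) = ennreal (norm (\<integral>z. s l z * (of_real (a l x) * test \<phi> m (z - y) x) \<partial>lborel))"
        unfolding Z_fourier_k_nth(2)[OF \<phi>] by (simp add: norm_mult sign4_def)
      also have "\<dots> \<le> (\<integral>\<^sup>+z. ennreal (norm (s l z * (of_real (a l x) * test \<phi> m (z - y) x))) \<partial>lborel)"
        by (rule integral_norm_bound_ennreal[OF int])
      also have "\<dots> \<le> (\<integral>\<^sup>+z. ennreal (C * R * source_weight (s l) (y, z)) \<partial>lborel)"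
        by (intro nn_integral_mono ennreal_leI pw)
      finally show ?thesis .
    qed
    have "ennreal (norm (fourier_k (Z_fun A S \<phi>) x y)) \<le> ennreal (\<Sum>m\<in>(UNIV :: 4 set). \<Sum>l\<in>UNIV. norm (fourier_k (Z_fun A S \<phi>) x y $ m $ l))"
      by (rule ennreal_leI[OF norm_cmat_le_sum])
    also have "\<dots> = (\<Sum>m\<in>(UNIV :: 4 set). \<Sum>l\<in>UNIV. ennreal (norm (fourier_k (Z_fun A S \<phi>) x y $ m $ l)))"
      by (simp add: sum_nonneg)
    also have "\<dots> \<le> (\<Sum>m\<in>(UNIV :: 4 set). \<Sum>l\<in>UNIV. \<integral>\<^sup>+z. ennreal (C * R * source_weight (s l) (y, z)) \<partial>lborel)"
      by (intro sum_mono e)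
    finally show ?thesis .
  qed
  have "A_norm (Z_fun A S \<phi>) \<le> (\<integral>\<^sup>+y. (\<Sum>m\<in>(UNIV :: 4 set). \<Sum>l\<in>UNIV. \<integral>\<^sup>+z. ennreal (C * R * source_weight (s l) (y, z)) \<partial>lborel) \<partial>lborel)"
    unfolding A_norm_def by (intro nn_integral_mono SUP_least pt)
  also have "\<dots> = (\<Sum>m\<in>(UNIV :: 4 set). \<integral>\<^sup>+y. (\<Sum>l\<in>UNIV. \<integral>\<^sup>+z. ennreal (C * R * source_weight (s l) (y, z)) \<partial>lborel) \<partial>lborel)"
    by (rule nn_integral_sum) (intro borel_measurable_sum meas)
  also have "\<dots> = (\<Sum>m\<in>(UNIV :: 4 set). \<Sum>l\<in>UNIV. \<integral>\<^sup>+y. \<integral>\<^sup>+z. ennreal (C * R * source_weight (s l) (y, z)) \<partial>lborel \<partial>lborel)"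
    by (intro sum.cong refl nn_integral_sum meas)
  also have "\<dots> = (\<Sum>m\<in>(UNIV :: 4 set). \<Sum>l\<in>UNIV. ennreal (C * R * (\<integral>p. source_weight (s l) p \<partial>lborel)))"
  proof (intro sum.cong refl)
    fix l
    have "(\<integral>\<^sup>+y. \<integral>\<^sup>+z. ennreal (C * R * source_weight (s l) (y, z)) \<partial>lborel \<partial>lborel) = (\<integral>\<^sup>+p. ennreal (C * R * source_weight (s l) p) \<partial>lborel)"
      by (subst nn_integral_lborel_prod_iterated(1)) simp_all
    also have "\<dots> = ennreal (\<integral>p. C * R * source_weight (s l) p \<partial>lborel)"
      using C_nonneg R0 integrable_source_weight(1)[OF s_int, of l] by (intro nn_integral_eq_integral) auto
    finally show "(\<integral>\<^sup>+y. \<integral>\<^sup>+z. ennreal (C * R * source_weight (s l) (y, z)) \<partial>lborel \<partial>lborel) = ennreal (C * R * (\<integral>p. source_weight (s l) p \<partial>lborel))"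
      by simp
  qed
  also have "\<dots> = ennreal (\<Sum>m\<in>(UNIV :: 4 set). \<Sum>l\<in>UNIV. C * R * (\<integral>p. source_weight (s l) p \<partial>lborel))"
  proof -
    have nn: "0 \<le> C * R * (\<integral>p. source_weight (s l) p \<partial>lborel)" for l
      using C_nonneg R0 by (intro mult_nonneg_nonneg Bochner_Integration.integral_nonneg) (auto simp: source_weight_def)
    show ?thesis by (simp add: nn sum_nonneg del: sum_constant)
  qed
  also have "\<dots> = ennreal (Z_const * R)"
    by (simp add: Z_const_def sum_distrib_left sum_distrib_right mult_ac)
  finally show ?thesis .
qed

lemma Z_in_A_space:
  assumes \<phi>: "schwartz \<phi>"
  shows "Z_fun A S \<phi> \<in> A_space"
  unfolding A_space_def mem_Collect_eq
proof (intro conjI allI)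
  have nil: "[] \<in> lists (Basis :: ((real^3) \<times> (real^3)) set)" by simp
  obtain R where "0 \<le> R" "\<And>\<xi> x. norm (\<phi> (\<xi>, x)) \<le> R * (wt \<xi> * wt x)"
    using schwartz_wt_bound[OF \<phi> nil] by auto
  from Z_A_norm[OF \<phi> this(2)] show "A_norm (Z_fun A S \<phi>) < \<infinity>" by (auto intro: le_less_trans)
  show "integrable lborel (Z_fun A S \<phi> x)" for x
    by (rule cmat_integrable(1)) (rule Z_fourier_k_nth(1)[OF \<phi>])
  have "(\<lambda>p. Z_fun A S \<phi> (fst p) (snd p) $ m $ l) \<in> borel_measurable (borel \<Otimes>\<^sub>M borel)" for m l
  proof -
    obtain B where "decaying (test \<phi> m) B" using test_decaying[OF \<phi>] by blast
    then interpret wigner_source "\<lambda>_. 0" "\<lambda>_. 0" 1 0 "a l" "s l" "test \<phi> m" C B by (rule trivial_source)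
    show ?thesis unfolding Z_nth[OF \<phi>] Zs_def by measurable
  qed
  then have "(\<lambda>p. (\<chi> m l. Z_fun A S \<phi> (fst p) (snd p) $ m $ l) :: cmat) \<in> borel_measurable (borel \<Otimes>\<^sub>M borel)"
    by (intro borel_measurable_vec_lambda)
  then show "(\<lambda>(x, k). Z_fun A S \<phi> x k) \<in> borel_measurable borel"
    by (simp add: vec_lambda_eta split_def borel_prod)
qed

end

section \<open>Seminorm bounds and temperedness of the limit\<close>

lemma decaying_zero: "decaying (\<lambda>_ _. 0) 0"
  by (simp add: decaying_def fourier_def split_def)

lemma seminorm_wt_bound:
  fixes \<phi> :: "(real^3) \<times> (real^3) \<Rightarrow> cvec"
  assumes "\<And>p. (1 + norm p) ^ 12 * norm (\<phi> p) \<le> R"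
  shows "norm (\<phi> (\<xi>, x)) \<le> R * (wt \<xi> * wt x)"
proof -
  have p: "0 < (1 + norm (\<xi>, x)) ^ 12" by (intro zero_less_power add_pos_nonneg) auto
  have "0 \<le> (1 + norm (\<xi>, x)) ^ 12 * norm (\<phi> (\<xi>, x))" using p by simp
  then have R: "0 \<le> R" using assms[of "(\<xi>, x)"] by linarith
  have "norm (\<phi> (\<xi>, x)) \<le> R * (1 / (1 + norm (\<xi>, x)) ^ 12)"
    using assms[of "(\<xi>, x)"] p by (simp add: pos_le_divide_eq mult.commute)
  also have "\<dots> \<le> R * (wt \<xi> * wt x)"
    using wt_pair_le[of \<xi> x] by (intro mult_left_mono R) simp
  finally show ?thesis .
qed

text \<open>A single weighted supremum without derivatives is enough: \<open>tempered\<close> is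
  satisfied with N = 12, and its bound is used for the empty list of derivatives.\<close>

lemma temperedI:
  fixes u :: "((real^3) \<times> (real^3) \<Rightarrow> cvec) \<Rightarrow> complex"
  assumes add: "\<And>\<phi> \<psi>. schwartz \<phi> \<Longrightarrow> schwartz \<psi> \<Longrightarrow> u (\<lambda>x. \<phi> x + \<psi> x) = u \<phi> + u \<psi>"
    and scale: "\<And>\<phi> c. schwartz \<phi> \<Longrightarrow> u (\<lambda>x. c *s \<phi> x) = cnj c * u \<phi>"
    and bound: "\<And>\<phi> R. schwartz \<phi> \<Longrightarrow> (\<And>\<xi> x. norm (\<phi> (\<xi>, x)) \<le> R * (wt \<xi> * wt x)) \<Longrightarrow> norm (u \<phi>) \<le> K * R"
  shows "tempered u"
  unfolding tempered_def
proof (intro conjI allI impI add scale)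
  have "norm (u \<phi>) \<le> K * R" if \<phi>: "schwartz \<phi>"
    and R: "\<forall>bs\<in>lists Basis. length bs \<le> 12 \<longrightarrow> (\<forall>x. (1 + norm x) ^ 12 * norm (pderivs bs \<phi> x) \<le> R)" for \<phi> R
  proof (rule bound[OF \<phi>])
    have "(1 + norm p) ^ 12 * norm (\<phi> p) \<le> R" for p
      using R[rule_format, of "[]" p] by simp
    then show "norm (\<phi> (\<xi>, x)) \<le> R * (wt \<xi> * wt x)" for \<xi> x by (rule seminorm_wt_bound)
  qed
  then show "\<exists>C. \<exists>N::nat. \<forall>\<phi> M. schwartz \<phi> \<longrightarrow>
        (\<forall>bs \<in> lists Basis. length bs \<le> N \<longrightarrow> (\<forall>x. (1 + norm x) ^ N * norm (pderivs bs \<phi> x) \<le> M)) \<longrightarrow>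
        cmod (u \<phi>) \<le> C * M"
    by blast
qed

lemma (in source_matrix) back_signal_limit_tempered:
  assumes W: "W \<in> A_dual"
  shows "tempered (back_signal_limit W A S)"
proof -
  obtain K where K: "\<And>\<phi>. \<phi> \<in> A_space \<Longrightarrow> norm (W \<phi>) \<le> K * enn2real (A_norm \<phi>)"
    using W unfolding A_dual_def by blast
  show ?thesis
  proof (rule temperedI)
    show "back_signal_limit W A S (\<lambda>x. \<phi> x + \<psi> x) = back_signal_limit W A S \<phi> + back_signal_limit W A S \<psi>"
      if "schwartz \<phi>" "schwartz \<psi>" for \<phi> \<psi>
      using W Z_in_A_space[OF that(1)] Z_in_A_space[OF that(2)] unfolding back_signal_limit_def Z_add[OF that] A_dual_def by blast
    show "back_signal_limit W A S (\<lambda>x. c *s \<phi> x) = cnj c * back_signal_limit W A S \<phi>" if "schwartz \<phi>" for \<phi> c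
      using W Z_in_A_space[OF that(1)] unfolding back_signal_limit_def Z_scale[OF that] A_dual_def by blast
    show "norm (back_signal_limit W A S \<phi>) \<le> (\<bar>K\<bar> * Z_const) * R"
      if \<phi>: "schwartz \<phi>" and R: "\<And>\<xi> x. norm (\<phi> (\<xi>, x)) \<le> R * (wt \<xi> * wt x)" for \<phi> R
    proof -
      have R0: "0 \<le> R"
        using order_trans[OF norm_ge_zero R[of 0 0]] mult_pos_pos[OF wt_pos[of "0::real^3"] wt_pos[of "0::real^3"]]
        by (simp add: zero_le_mult_iff)
      have Zc: "0 \<le> Z_const"
        unfolding Z_const_def by (intro mult_nonneg_nonneg C_nonneg sum_nonneg Bochner_Integration.integral_nonneg) simp
      have "norm (back_signal_limit W A S \<phi>) \<le> K * enn2real (A_norm (Z_fun A S \<phi>))"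
        unfolding back_signal_limit_def by (rule K[OF Z_in_A_space[OF \<phi>]])
      also have "\<dots> \<le> \<bar>K\<bar> * enn2real (A_norm (Z_fun A S \<phi>))"
        by (intro mult_right_mono) auto
      also have "\<dots> \<le> \<bar>K\<bar> * (Z_const * R)"
        using Z_A_norm[OF \<phi> R] R0 Zc by (intro mult_left_mono) (auto intro: enn2real_leI)
      finally show ?thesis by (simp add: mult.assoc)
    qed
  qed
qed

section \<open>The back-propagated signal\<close>

text \<open>The fields at one fixed time, known through measurability and their energy bounds; the
  evolution equations do not occur inside this locale.\<close>

locale time_reversal = source_matrix +
  fixes Q Qs :: "real^3 \<Rightarrow> real^3 \<Rightarrow> cmat" and f :: "real^3 \<Rightarrow> complex" and e M :: real
  assumes Q_joint: "(\<lambda>(x, q). Q x q) \<in> borel_measurable (borel \<Otimes>\<^sub>M borel)"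
    and Qs_joint: "(\<lambda>(x, q). Qs x q) \<in> borel_measurable (borel \<Otimes>\<^sub>M borel)"
    and f_int: "integrable lborel (fourier f)"
    and Q_sq: "(\<integral>\<^sup>+x. ennreal ((norm (Q x q))\<^sup>2) \<partial>lborel) \<le> ennreal M"
    and Qs_sq: "(\<integral>\<^sup>+x. ennreal ((norm (Qs x q))\<^sup>2) \<partial>lborel) \<le> ennreal M"
    and M_nonneg: "0 \<le> M" and e_pos: "0 < e"
begin

lemma average:
  assumes "decaying \<theta> B"
  shows "wigner_average (\<lambda>x q. Q x q $ m $ r) (\<lambda>x q. Qs x q $ r $ l) (fourier f) e M (a l) (s l) \<theta> C B"
proof -
  have u: "(\<lambda>(x, q). Q x q $ m $ r) \<in> borel_measurable (borel \<Otimes>\<^sub>M borel)"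
    using borel_measurable_nth[OF borel_measurable_nth[OF Q_joint, of m], of r] by (simp add: split_def)
  have v: "(\<lambda>(x, q). Qs x q $ r $ l) \<in> borel_measurable (borel \<Otimes>\<^sub>M borel)"
    using borel_measurable_nth[OF borel_measurable_nth[OF Qs_joint, of r], of l] by (simp add: split_def)
  note [measurable (raw)] = measurable_case_prodD[OF u] measurable_case_prodD[OF v]
  have sq: "(\<integral>\<^sup>+x. ennreal ((norm (N x q $ i $ j))\<^sup>2) \<partial>lborel) \<le> ennreal M"
    if "(\<integral>\<^sup>+x. ennreal ((norm (N x q))\<^sup>2) \<partial>lborel) \<le> ennreal M" for N :: "real^3 \<Rightarrow> real^3 \<Rightarrow> cmat" and q i j
    by (rule order_trans[OF _ that]) (intro nn_integral_mono ennreal_leI power_mono norm_cmat_nth_le norm_ge_zero)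
  show ?thesis
  proof (unfold_locales)
    show "(\<lambda>(x, q). Q x q $ m $ r) \<in> borel_measurable (borel \<Otimes>\<^sub>M borel)" by (rule u)
    show "(\<lambda>(x, q). Qs x q $ r $ l) \<in> borel_measurable (borel \<Otimes>\<^sub>M borel)" by (rule v)
    show "(\<lambda>x. Q x q $ m $ r) \<in> borel_measurable borel" "(\<lambda>x. Qs x q $ r $ l) \<in> borel_measurable borel" for q
      by measurable
  qed (simp_all add: f_int M_nonneg e_pos a_meas a_le s_int assms sq Q_sq Qs_sq)
qed

text \<open>One summand, for the inner index \<open>r\<close> of the matrix product, of entry (m, l)
  of the Wigner transform.\<close>

definition V :: "4 \<Rightarrow> 4 \<Rightarrow> 4 \<Rightarrow> real^3 \<Rightarrow> real^3 \<Rightarrow> complex" where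
  "V m l r = wigner_average.wavg (\<lambda>x q. Q x q $ m $ r) (\<lambda>x q. Qs x q $ r $ l) (fourier f) e"

lemma wigner_nth: "wigner f Q Qs e x k $ m $ l = (\<Sum>r\<in>UNIV. V m l r x k)"
proof -
  define w where "w m l r q = wigner_pair.wigner1 (\<lambda>x. Q x q $ m $ r) (\<lambda>x. Qs x q $ r $ l) e x k" for m l r q
  have U: "wigner_U (\<lambda>x. Q x q) (\<lambda>x. Qs x q) e x k $ m $ l = (\<Sum>r\<in>UNIV. w m l r q)" for q m l
  proof -
    define c where "c y = cis (k \<bullet> y) / (2 * complex_of_real pi) ^ 3" for y
    define F where "F y = cscale (c y) (Q (x - (e / 2) *\<^sub>R y) q ** Qs (x + (e / 2) *\<^sub>R y) q)" for y
    define h where "h m l r y = c y * (Q (x - (e / 2) *\<^sub>R y) q $ m $ r * Qs (x + (e / 2) *\<^sub>R y) q $ r $ l)" for m l r y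
    have Fnth: "F y $ m $ l = (\<Sum>r\<in>UNIV. h m l r y)" for y m l
      by (simp add: F_def h_def cscale_def matrix_matrix_mult_def sum_distrib_left)
    have hi: "integrable lborel (h m l r)" and hw: "(\<integral>y. h m l r y \<partial>lborel) = w m l r q" for m l r
    proof -
      \<comment> \<open>The zero test function serves here, as the facts to be used concern the
        fields.\<close>
      interpret wigner_average "\<lambda>x q. Q x q $ m $ r" "\<lambda>x q. Qs x q $ r $ l" "fourier f" e M "a l" "s l" "\<lambda>_ _. 0" C 0
        by (rule average[OF decaying_zero])
      have h: "h m l r = (\<lambda>y. cis (k \<bullet> y) / (2 * of_real pi) ^ 3 * S.uv q x y)"
        by (simp add: h_def c_def S.uv_def fun_eq_iff)
      have "integrable lborel (\<lambda>y. cis (k \<bullet> y) * S.uv q x y)"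
        by (rule fourier_integrand_integrable[OF S.uv_integrable_y]) measurable
      then have "integrable lborel (\<lambda>y. 1 / (2 * of_real pi) ^ 3 * (cis (k \<bullet> y) * S.uv q x y))"
        by (rule integrable_mult_right)
      then show "integrable lborel (h m l r)" unfolding h by simp
      show "(\<integral>y. h m l r y \<partial>lborel) = w m l r q"
        unfolding h w_def S.wigner1_def ..
    qed
    have Fi: "integrable lborel (\<lambda>y. F y $ m $ l)" for m l
      unfolding Fnth by (intro Bochner_Integration.integrable_sum hi)
    have "wigner_U (\<lambda>x. Q x q) (\<lambda>x. Qs x q) e x k $ m $ l = (\<integral>y. F y \<partial>lborel) $ m $ l"
      by (simp add: wigner_U_def F_def c_def)
    also have "\<dots> = (\<integral>y. F y $ m $ l \<partial>lborel)" by (rule cmat_integrable(2)[OF Fi])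
    also have "\<dots> = (\<Sum>r\<in>UNIV. \<integral>y. h m l r y \<partial>lborel)"
      unfolding Fnth by (intro Bochner_Integration.integral_sum hi)
    finally show ?thesis unfolding hw .
  qed
  define G where "G q = cscale (fourier f q) (wigner_U (\<lambda>x. Q x q) (\<lambda>x. Qs x q) e x k)" for q
  have Gnth: "G q $ m $ l = (\<Sum>r\<in>UNIV. fourier f q * w m l r q)" for q m l
    by (simp add: G_def cscale_def U sum_distrib_left)
  have gi: "integrable lborel (\<lambda>q. fourier f q * w m l r q)" and gV: "(\<integral>q. fourier f q * w m l r q \<partial>lborel) = V m l r x k" for m l r
  proof -
    interpret wigner_average "\<lambda>x q. Q x q $ m $ r" "\<lambda>x q. Qs x q $ r $ l" "fourier f" e M "a l" "s l" "\<lambda>_ _. 0" C 0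
      by (rule average[OF decaying_zero])
    show "(\<integral>q. fourier f q * w m l r q \<partial>lborel) = V m l r x k"
      unfolding V_def wavg_def w_def ..
    show "integrable lborel (\<lambda>q. fourier f q * w m l r q)"
    proof (rule integrable_const_mult_bound)
      show "integrable lborel (\<lambda>q. norm (fourier f q))" using f_int by (rule integrable_norm)
      show "(\<lambda>q. fourier f q * w m l r q) \<in> borel_measurable lborel" unfolding w_def by measurable
      show "norm (fourier f q * w m l r q) \<le> S.W / (2 * pi) ^ 3 * norm (fourier f q)" for q
        unfolding norm_mult w_def mult.commute[of "norm (fourier f q)"] by (intro mult_right_mono S.wigner1_bound) simp
    qed
  qed
  have Gi: "integrable lborel (\<lambda>q. G q $ m $ l)" for m l
    unfolding Gnth by (intro Bochner_Integration.integrable_sum gi)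
  have "wigner f Q Qs e x k $ m $ l = (\<integral>q. G q \<partial>lborel) $ m $ l"
    by (simp add: wigner_def G_def)
  also have "\<dots> = (\<integral>q. G q $ m $ l \<partial>lborel)" by (rule cmat_integrable(2)[OF Gi])
  also have "\<dots> = (\<Sum>r\<in>UNIV. \<integral>q. fourier f q * w m l r q \<partial>lborel)"
    unfolding Gnth by (intro Bochner_Integration.integral_sum gi)
  finally show ?thesis unfolding gV .
qed

definition K :: "((real^3) \<times> (real^3) \<Rightarrow> cvec) \<Rightarrow> 4 \<Rightarrow> 4 \<Rightarrow> 4 \<Rightarrow> real^3 \<Rightarrow> (real^3) \<times> (real^3) \<times> (real^3) \<Rightarrow> complex" where
  "K \<phi> m l r = wigner_average.back_kernel (\<lambda>x q. Q x q $ m $ r) (\<lambda>x q. Qs x q $ r $ l) (fourier f) e (a l) (s l) (test \<phi> m)"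

text \<open>Outside the locale it carries no coefficients: they enter through the kernel
  \<open>F\<close>. This makes the values for the coefficients at scale \<open>e\<close> and for
  their limits directly comparable.\<close>

definition average_pairing :: "4 \<Rightarrow> 4 \<Rightarrow> 4 \<Rightarrow> ((real^3) \<times> (real^3) \<Rightarrow> real^3 \<Rightarrow> complex) \<Rightarrow> complex" where
  "average_pairing m l r F = (\<integral>q. fourier f q * wigner_pair.pairing (\<lambda>x. Q x q $ m $ r) (\<lambda>x. Qs x q $ r $ l) e (s l) F 0 \<partial>lborel)"

lemma K_eq:
  assumes \<phi>: "schwartz \<phi>"
  shows "K \<phi> m l r k (\<xi>, x0, z) = cis (k \<bullet> (\<xi> - z)) * V m l r (x0 + (e / 2) *\<^sub>R (z + \<xi>)) k
     * (of_real (a l (x0 + e *\<^sub>R z)) * (s l z * test \<phi> m \<xi> x0))"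
proof -
  obtain B where "decaying (test \<phi> m) B" using test_decaying[OF \<phi>] by blast
  then interpret wigner_average "\<lambda>x q. Q x q $ m $ r" "\<lambda>x q. Qs x q $ r $ l" "fourier f" e M "a l" "s l" "test \<phi> m" C B
    by (rule average)
  show ?thesis by (simp add: K_def V_def back_kernel_def)
qed

lemma K_integral:
  assumes \<phi>: "schwartz \<phi>"
  shows "integrable lborel (K \<phi> m l r k)"
    and "integrable lborel (\<lambda>k. \<integral>p. K \<phi> m l r k p \<partial>lborel)"
    and "(\<integral>k. \<integral>p. K \<phi> m l r k p \<partial>lborel \<partial>lborel) = average_pairing m l r (wigner_source.\<Theta> e (a l) (test \<phi> m))"
proof -
  obtain B where "decaying (test \<phi> m) B" using test_decaying[OF \<phi>] by blast
  then interpret wigner_average "\<lambda>x q. Q x q $ m $ r" "\<lambda>x q. Qs x q $ r $ l" "fourier f" e M "a l" "s l" "test \<phi> m" C B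
    by (rule average)
  show "integrable lborel (K \<phi> m l r k)"
    unfolding K_def by (rule back_kernel_integrable)
  show "integrable lborel (\<lambda>k. \<integral>p. K \<phi> m l r k p \<partial>lborel)"
    unfolding K_def by (rule back_kernel_iterated(1))
  show "(\<integral>k. \<integral>p. K \<phi> m l r k p \<partial>lborel \<partial>lborel) = average_pairing m l r (wigner_source.\<Theta> e (a l) (test \<phi> m))"
    unfolding K_def average_pairing_def by (rule back_kernel_iterated(2))
qed

lemma V_Z:
  assumes \<phi>: "schwartz \<phi>"
  shows "integrable lborel (\<lambda>k. V m l r x k * Zs \<phi> m l x k)"
    and "integrable lborel (\<lambda>x. \<integral>k. V m l r x k * Zs \<phi> m l x k \<partial>lborel)"
    and "(\<integral>x. \<integral>k. V m l r x k * Zs \<phi> m l x k \<partial>lborel \<partial>lborel) = average_pairing m l r (wigner_source.\<Theta>0 (a l) (test \<phi> m))"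
proof -
  obtain B where "decaying (test \<phi> m) B" using test_decaying[OF \<phi>] by blast
  then interpret wigner_average "\<lambda>x q. Q x q $ m $ r" "\<lambda>x q. Qs x q $ r $ l" "fourier f" e M "a l" "s l" "test \<phi> m" C B
    by (rule average)
  show "integrable lborel (\<lambda>k. V m l r x k * Zs \<phi> m l x k)"
    unfolding V_def Zs_def by (rule wavg_Zc(1))
  show "integrable lborel (\<lambda>x. \<integral>k. V m l r x k * Zs \<phi> m l x k \<partial>lborel)"
    unfolding V_def Zs_def by (rule wavg_Zc(2))
  show "(\<integral>x. \<integral>k. V m l r x k * Zs \<phi> m l x k \<partial>lborel \<partial>lborel) = average_pairing m l r (wigner_source.\<Theta>0 (a l) (test \<phi> m))"
    unfolding V_def Zs_def average_pairing_def by (rule wavg_Zc(3))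
qed

lemma back_integrand_eq:
  assumes \<phi>: "schwartz \<phi>"
  shows "back_integrand (wigner f Q Qs e) A S e \<phi> k p = (\<Sum>m\<in>UNIV. \<Sum>l\<in>UNIV. \<Sum>r\<in>UNIV. coef m l * K \<phi> m l r k p)"
proof -
  obtain \<xi> x0 z where p: "p = (\<xi>, x0, z)" by (metis prod.exhaust)
  define w where "w = wigner f Q Qs e (x0 + (e / 2) *\<^sub>R (z + \<xi>)) k"
  have GA: "(Gam ** w ** Gam ** A (x0 + e *\<^sub>R z)) $ m $ l = of_real (sign4 m) * w $ m $ l * of_real (sign4 l) * of_real (a l (x0 + e *\<^sub>R z))" for m l
    by (simp add: A_def diag_mat_mult_right Gam_mult_right Gam_mult_left a_def)
  have "back_integrand (wigner f Q Qs e) A S e \<phi> k p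
     = (\<Sum>m\<in>UNIV. \<Sum>l\<in>UNIV. coef m l * (w $ m $ l * (cis (k \<bullet> (\<xi> - z)) * (of_real (a l (x0 + e *\<^sub>R z)) * (s l z * test \<phi> m \<xi> x0)))))"
    unfolding back_integrand_def p prod.case w_def[symmetric] vec_dual_def vector_scalar_mult_def
      matrix_vector_mult_def vec_lambda_beta GA vector_smult_component sum_distrib_left sum_distrib_right
    by (intro sum.cong refl) (simp add: coef_def s_def test_def)
  also have "\<dots> = (\<Sum>m\<in>UNIV. \<Sum>l\<in>UNIV. \<Sum>r\<in>UNIV. coef m l * K \<phi> m l r k p)"
    unfolding w_def wigner_nth p K_eq[OF \<phi>] sum_distrib_left sum_distrib_right
    by (intro sum.cong refl) (simp only: mult_ac)
  finally show ?thesis .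
qed

lemma mat_dual_Z:
  assumes \<phi>: "schwartz \<phi>"
  shows "mat_dual (wigner f Q Qs e x k) (Z_fun A S \<phi> x k)
     = (\<Sum>m\<in>UNIV. \<Sum>l\<in>UNIV. \<Sum>r\<in>UNIV. coef m l * (V m l r x k * Zs \<phi> m l x k))"
  unfolding mat_dual_def wigner_nth Z_nth[OF \<phi>] complex_cnj_cnj sum_distrib_right
  by (intro sum.cong refl) (simp only: mult_ac)

lemma back_signal_integrals:
  assumes \<phi>: "schwartz \<phi>"
  shows "integrable lborel (back_integrand (wigner f Q Qs e) A S e \<phi> k)"
    and "integrable lborel (\<lambda>k. \<integral>p. back_integrand (wigner f Q Qs e) A S e \<phi> k p \<partial>lborel)"
    and "back_signal (wigner f Q Qs e) A S e \<phi>
      = (\<Sum>m\<in>UNIV. \<Sum>l\<in>UNIV. \<Sum>r\<in>UNIV. coef m l * average_pairing m l r (wigner_source.\<Theta> e (a l) (test \<phi> m)))"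
proof -
  note Ki = K_integral[OF \<phi>]
  have eq: "back_integrand (wigner f Q Qs e) A S e \<phi> k = (\<lambda>p. \<Sum>m\<in>UNIV. \<Sum>l\<in>UNIV. \<Sum>r\<in>UNIV. coef m l * K \<phi> m l r k p)" for k
    by (rule ext) (rule back_integrand_eq[OF \<phi>])
  have inner: "(\<integral>p. back_integrand (wigner f Q Qs e) A S e \<phi> k p \<partial>lborel)
     = (\<Sum>m\<in>UNIV. \<Sum>l\<in>UNIV. \<Sum>r\<in>UNIV. coef m l * (\<integral>p. K \<phi> m l r k p \<partial>lborel))" for k
    unfolding eq by (simp add: Bochner_Integration.integral_sum Ki(1))
  show "integrable lborel (back_integrand (wigner f Q Qs e) A S e \<phi> k)"
    unfolding eq by (intro Bochner_Integration.integrable_sum integrable_mult_right Ki(1))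
  show "integrable lborel (\<lambda>k. \<integral>p. back_integrand (wigner f Q Qs e) A S e \<phi> k p \<partial>lborel)"
    unfolding inner by (intro Bochner_Integration.integrable_sum integrable_mult_right Ki(2))
  show "back_signal (wigner f Q Qs e) A S e \<phi>
      = (\<Sum>m\<in>UNIV. \<Sum>l\<in>UNIV. \<Sum>r\<in>UNIV. coef m l * average_pairing m l r (wigner_source.\<Theta> e (a l) (test \<phi> m)))"
    unfolding back_signal_def inner Ki(3)[symmetric] by (simp add: Bochner_Integration.integral_sum Ki(2))
qed

lemma back_signal_converges: "back_signal_converges (wigner f Q Qs e) A S e"
  unfolding back_signal_converges_def using back_signal_integrals by blast

lemma A_functional_Z:
  assumes \<phi>: "schwartz \<phi>"
  shows "A_functional (wigner f Q Qs e) (Z_fun A S \<phi>)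
      = (\<Sum>m\<in>UNIV. \<Sum>l\<in>UNIV. \<Sum>r\<in>UNIV. coef m l * average_pairing m l r (wigner_source.\<Theta>0 (a l) (test \<phi> m)))"
proof -
  note Vi = V_Z[OF \<phi>]
  have inner: "(\<integral>k. mat_dual (wigner f Q Qs e x k) (Z_fun A S \<phi> x k) \<partial>lborel)
     = (\<Sum>m\<in>UNIV. \<Sum>l\<in>UNIV. \<Sum>r\<in>UNIV. coef m l * (\<integral>k. V m l r x k * Zs \<phi> m l x k \<partial>lborel))" for x
    unfolding mat_dual_Z[OF \<phi>] by (simp add: Bochner_Integration.integral_sum Vi(1))
  show ?thesis
    unfolding A_functional_def inner Vi(3)[symmetric] by (simp add: Bochner_Integration.integral_sum Vi(2))
qed

definition signal_const :: real where
  "signal_const = (\<Sum>m\<in>(UNIV :: 4 set). \<Sum>l\<in>UNIV. \<Sum>r\<in>(UNIV :: 4 set).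
     norm (coef m l) * ((\<integral>q. norm (fourier f q) \<partial>lborel) * (2 * M * (C * (\<integral>p. source_weight (s l) p \<partial>lborel)))))"

text \<open>The constant of \<open>decaying\<close> also contains the decay of the Fourier
  transform, so it is not controlled by a supremum without derivatives. The kernel is therefore
  estimated again, by \<open>R\<close>.\<close>

lemma back_signal_bound:
  assumes \<phi>: "schwartz \<phi>" and R: "\<And>\<xi> x. norm (\<phi> (\<xi>, x)) \<le> R * (wt \<xi> * wt x)"
  shows "norm (back_signal (wigner f Q Qs e) A S e \<phi>) \<le> signal_const * R"
proof -
  have R0: "0 \<le> R"
    using order_trans[OF norm_ge_zero R[of 0 0]] mult_pos_pos[OF wt_pos[of "0::real^3"] wt_pos[of "0::real^3"]]
    by (simp add: zero_le_mult_iff)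
  have "norm (average_pairing m l r (wigner_source.\<Theta> e (a l) (test \<phi> m)))
     \<le> (\<integral>q. norm (fourier f q) \<partial>lborel) * (2 * M * (C * R * (\<integral>p. source_weight (s l) p \<partial>lborel)))" for m l r
  proof -
    obtain B where "decaying (test \<phi> m) B" using test_decaying[OF \<phi>] by blast
    then interpret wigner_average "\<lambda>x q. Q x q $ m $ r" "\<lambda>x q. Qs x q $ r $ l" "fourier f" e M "a l" "s l" "test \<phi> m" C B
      by (rule average)
    have "norm (S.\<Theta> p x) \<le> C * R * wt (snd p - fst p)" for p x
    proof -
      have t: "norm (test \<phi> m \<xi> y) \<le> R * wt \<xi>" for \<xi> y
      proof -
        have "norm (test \<phi> m \<xi> y) \<le> R * (wt \<xi> * wt y)"
          using order_trans[OF Finite_Cartesian_Product.norm_nth_le R] by (simp add: test_def)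
        also have "\<dots> \<le> R * (wt \<xi> * 1)" by (intro mult_left_mono wt_le_1 R0) auto
        finally show ?thesis by simp
      qed
      have "norm (S.\<Theta> p x) \<le> C * (R * wt (snd p - fst p))"
        unfolding S.\<Theta>_def norm_mult using a_le C_nonneg by (intro mult_mono t) auto
      then show ?thesis by (simp add: mult.assoc)
    qed
    from g_pairing(2)[OF S.\<Theta>_measurable this] show ?thesis
      unfolding average_pairing_def .
  qed
  note P = this
  have "norm (back_signal (wigner f Q Qs e) A S e \<phi>) \<le> (\<Sum>m\<in>(UNIV :: 4 set). \<Sum>l\<in>UNIV. \<Sum>r\<in>(UNIV :: 4 set).
     norm (coef m l) * ((\<integral>q. norm (fourier f q) \<partial>lborel) * (2 * M * (C * R * (\<integral>p. source_weight (s l) p \<partial>lborel)))))"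
    unfolding back_signal_integrals(3)[OF \<phi>]
    by (intro order_trans[OF norm_sum] sum_mono) (unfold norm_mult, intro mult_left_mono P norm_ge_zero)
  also have "\<dots> = signal_const * R"
    unfolding signal_const_def sum_distrib_right by (intro sum.cong refl) (simp only: mult_ac)
  finally show ?thesis .
qed

lemma back_signal_tempered: "tempered (back_signal (wigner f Q Qs e) A S e)"
proof (rule temperedI)
  let ?b = "back_integrand (wigner f Q Qs e) A S e"
  show "back_signal (wigner f Q Qs e) A S e (\<lambda>x. \<phi> x + \<psi> x)
      = back_signal (wigner f Q Qs e) A S e \<phi> + back_signal (wigner f Q Qs e) A S e \<psi>"
    if "schwartz \<phi>" "schwartz \<psi>" for \<phi> \<psi>
  proof -
    have "?b (\<lambda>x. \<phi> x + \<psi> x) k p = ?b \<phi> k p + ?b \<psi> k p" for k p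
      by (simp add: back_integrand_def split_def vec_dual_def distrib_left sum.distrib)
    then show ?thesis
      using back_signal_integrals(1,2)[OF that(1)] back_signal_integrals(1,2)[OF that(2)] by (simp add: back_signal_def)
  qed
  show "back_signal (wigner f Q Qs e) A S e (\<lambda>x. c *s \<phi> x) = cnj c * back_signal (wigner f Q Qs e) A S e \<phi>" for \<phi> c
  proof -
    have "?b (\<lambda>x. c *s \<phi> x) k p = cnj c * ?b \<phi> k p" for k p
      unfolding back_integrand_def split_def vec_dual_def sum_distrib_left by (intro sum.cong refl) (simp add: mult_ac)
    then show ?thesis by (simp add: back_signal_def)
  qed
qed (rule back_signal_bound)

end

text \<open>Signal and tested Wigner transform are sums over (m, l, r) with the same weights
  \<open>coef m l\<close> and the same fields, taken with two sets of coefficients; each difference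
  of summands is an instance of \<open>average_limit\<close>.\<close>

theorem signal_limit:
  assumes TR: "\<And>n. time_reversal (\<rho> n) (\<kappa> n) C S (Q n) (Qs n) f (e n) M"
    and TR0: "\<And>n. time_reversal \<rho>0 \<kappa>0 C S (Q n) (Qs n) f (e n) M"
    and lim: "\<And>K. compact K \<Longrightarrow> uniform_limit K \<rho> \<rho>0 sequentially" "\<And>K. compact K \<Longrightarrow> uniform_limit K \<kappa> \<kappa>0 sequentially"
    and cont: "continuous_on UNIV \<rho>0" "continuous_on UNIV \<kappa>0"
    and e: "e \<longlonglongrightarrow> 0" and \<phi>: "schwartz \<phi>"
  shows "(\<lambda>n. back_signal (wigner f (Q n) (Qs n) (e n)) (\<lambda>x. diag_mat (\<rho> n x) (\<kappa> n x)) S (e n) \<phi>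
     - A_functional (wigner f (Q n) (Qs n) (e n)) (Z_fun (\<lambda>x. diag_mat (\<rho>0 x) (\<kappa>0 x)) S \<phi>)) \<longlonglongrightarrow> 0"
proof -
  define b where "b n l = source_matrix.a (\<rho> n) (\<kappa> n) l" for n l
  define b0 where "b0 l = source_matrix.a \<rho>0 \<kappa>0 l" for l
  define P where "P n m l r F = time_reversal.average_pairing S (Q n) (Qs n) f (e n) m l r F" for n m l r F
  define \<theta> where "\<theta> m = source_matrix.test \<phi> m" for m
  have sum_eq: "back_signal (wigner f (Q n) (Qs n) (e n)) (\<lambda>x. diag_mat (\<rho> n x) (\<kappa> n x)) S (e n) \<phi>
     = (\<Sum>m\<in>UNIV. \<Sum>l\<in>UNIV. \<Sum>r\<in>UNIV. coef m l * P n m l r (wigner_source.\<Theta> (e n) (b n l) (\<theta> m)))" for n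
  proof -
    interpret time_reversal "\<rho> n" "\<kappa> n" C S "Q n" "Qs n" f "e n" M by (rule TR)
    show ?thesis using back_signal_integrals(3)[OF \<phi>] unfolding b_def P_def \<theta>_def A_def[abs_def] .
  qed
  have sum0_eq: "A_functional (wigner f (Q n) (Qs n) (e n)) (Z_fun (\<lambda>x. diag_mat (\<rho>0 x) (\<kappa>0 x)) S \<phi>)
     = (\<Sum>m\<in>UNIV. \<Sum>l\<in>UNIV. \<Sum>r\<in>UNIV. coef m l * P n m l r (wigner_source.\<Theta>0 (b0 l) (\<theta> m)))" for n
  proof -
    interpret time_reversal \<rho>0 \<kappa>0 C S "Q n" "Qs n" f "e n" M by (rule TR0)
    show ?thesis using A_functional_Z[OF \<phi>] unfolding b0_def P_def \<theta>_def A_def[abs_def] .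
  qed
  have P: "(\<lambda>n. P n m l r (wigner_source.\<Theta> (e n) (b n l) (\<theta> m)) - P n m l r (wigner_source.\<Theta>0 (b0 l) (\<theta> m))) \<longlonglongrightarrow> 0" for m l r
  proof -
    interpret T0: time_reversal \<rho>0 \<kappa>0 C S "Q 0" "Qs 0" f "e 0" M by (rule TR0)
    have b0: "b0 l = (if l = 4 then \<kappa>0 else \<rho>0)" by (auto simp: b0_def T0.a_def)
    have b: "b n l = (if l = 4 then \<kappa> n else \<rho> n)" for n
    proof -
      interpret time_reversal "\<rho> n" "\<kappa> n" C S "Q n" "Qs n" f "e n" M by (rule TR)
      show ?thesis by (auto simp: b_def a_def)
    qed
    obtain B where B: "decaying (\<theta> m) B" unfolding \<theta>_def using T0.test_decaying[OF \<phi>] by blast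
    show ?thesis
      unfolding P_def
    proof (subst (1 2) time_reversal.average_pairing_def[OF TR], rule average_limit)
      show "wigner_average (\<lambda>x q. Q n x q $ m $ r) (\<lambda>x q. Qs n x q $ r $ l) (fourier f) (e n) M (b n l) (source_matrix.s S l) (\<theta> m) C B" for n
        unfolding b_def by (rule time_reversal.average[OF TR B])
      show "wigner_average (\<lambda>x q. Q n x q $ m $ r) (\<lambda>x q. Qs n x q $ r $ l) (fourier f) (e n) M (b0 l) (source_matrix.s S l) (\<theta> m) C B" for n
        unfolding b0_def by (rule time_reversal.average[OF TR0 B])
      show "uniform_limit K (\<lambda>n. b n l) (b0 l) sequentially" if "compact K" for K
        unfolding b b0 using lim[OF that] by (cases "l = 4") simp_all
      show "continuous_on UNIV (b0 l)" unfolding b0 using cont by simp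
    qed (rule e)
  qed
  have "(\<lambda>n. \<Sum>m\<in>UNIV. \<Sum>l\<in>UNIV. \<Sum>r\<in>UNIV. coef m l * (P n m l r (wigner_source.\<Theta> (e n) (b n l) (\<theta> m)) - P n m l r (wigner_source.\<Theta>0 (b0 l) (\<theta> m))))
     \<longlonglongrightarrow> (\<Sum>m\<in>(UNIV :: 4 set). \<Sum>l\<in>(UNIV :: 4 set). \<Sum>r\<in>(UNIV :: 4 set). coef m l * 0)"
    by (intro tendsto_sum tendsto_mult_left P)
  then show ?thesis
    unfolding sum_eq sum0_eq right_diff_distrib sum_subtractf by simp
qed

section \<open>Energy bounds for the given fields and conclusion\<close>

lemma solution_nn_bound:
  fixes Q :: "real \<Rightarrow> real^3 \<Rightarrow> cmat" and A :: "real^3 \<Rightarrow> cmat"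
  assumes sol: "solves_forward A Q0 Q \<or> solves_adjoint A Q0 Q"
    and A: "\<And>x. A x = diag_mat (\<rho> x) (\<kappa> x)"
    and bd: "\<And>x. c \<le> \<rho> x" "\<And>x. c \<le> \<kappa> x" "\<And>x. \<rho> x \<le> C" "\<And>x. \<kappa> x \<le> C" and c: "0 < c"
    and Ac: "continuous_on UNIV A"
    and m: "(\<lambda>(t, x). Q (max 0 t) x) \<in> borel_measurable (borel \<Otimes>\<^sub>M borel)"
    and t: "0 \<le> t"
    and init: "\<And>x. norm (Q0 x) \<le> K * norm (h x :: complex)" and h: "L2 h"
  shows "(\<integral>\<^sup>+x. ennreal ((norm (Q t x))\<^sup>2) \<partial>lborel) \<le> ennreal (C * (K\<^sup>2 * (\<integral>x. (norm (h x))\<^sup>2 \<partial>lborel)) / c)"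
proof -
  note b = solution_bound[OF sol A bd c Ac m t init h]
  have "(\<integral>\<^sup>+x. ennreal ((norm (Q t x))\<^sup>2) \<partial>lborel) = ennreal (\<integral>x. (norm (Q t x))\<^sup>2 \<partial>lborel)"
    using b(1) unfolding L2_def by (intro nn_integral_eq_integral) auto
  also have "\<dots> \<le> ennreal (C * (K\<^sup>2 * (\<integral>x. (norm (h x))\<^sup>2 \<partial>lborel)) / c)"
    using b(2) c by (intro ennreal_leI) (simp add: pos_le_divide_eq mult.commute)
  finally show ?thesis .
qed

theorem proposition3p2:
  fixes T :: real
    and chi :: "real^3 \<Rightarrow> complex"
    and f :: "real^3 \<Rightarrow> complex"
    and S :: "real^3 \<Rightarrow> complex^4"
    and \<rho> \<kappa> :: "real \<Rightarrow> real^3 \<Rightarrow> real"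
    and A :: "real \<Rightarrow> real^3 \<Rightarrow> complex^4^4"
    and A0 :: "real^3 \<Rightarrow> complex^4^4"
    and Q Qs :: "real \<Rightarrow> real \<Rightarrow> real^3 \<Rightarrow> real^3 \<Rightarrow> complex^4^4"
    and Weps :: "real \<Rightarrow> real \<Rightarrow> real^3 \<Rightarrow> real^3 \<Rightarrow> complex^4^4"
    and W :: "(real^3 \<Rightarrow> real^3 \<Rightarrow> complex^4^4) \<Rightarrow> complex"
    and eps :: "nat \<Rightarrow> real"
  assumes T: "0 < T"
    and chi: "L2 chi" "bounded (range chi)"
    and f: "integrable lborel f" "integrable lborel (fourier f)"
    and S: "integrable lborel S"
    and A_def: "\<And>e x. A e x = diag_mat (\<rho> e x) (\<kappa> e x)"
    and A_bounds: "\<exists>c>0. \<exists>C. \<forall>e>0. \<forall>x. c \<le> \<rho> e x \<and> \<rho> e x \<le> C \<and> c \<le> \<kappa> e x \<and> \<kappa> e x \<le> C"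
    and A_continuous: "\<And>e. 0 < e \<Longrightarrow> continuous_on UNIV (A e)"
    and A_limit: "\<And>K. compact K \<Longrightarrow> uniform_limit K A A0 (at_right 0)"
    and Q_meas: "\<And>e. 0 < e \<Longrightarrow> jointly_measurable (Q e)"
    and Q: "\<And>e q. 0 < e \<Longrightarrow>
          solves_forward (A e) (\<lambda>x. mat (chi x * cis ((q \<bullet> x) / e))) (\<lambda>t x. Q e t x q)"
    and Qs_meas: "\<And>e. 0 < e \<Longrightarrow> jointly_measurable (Qs e)"
    and Qs: "\<And>e q. 0 < e \<Longrightarrow>
          solves_adjoint (A e)
            (\<lambda>x. cscale (chi x * cis (- (q \<bullet> x) / e)) (matrix_inv (A e x))) (\<lambda>t x. Qs e t x q)"
    and Weps_def: "\<And>e t. Weps e t = wigner f (Q e t) (Qs e t) e"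
    and eps: "\<And>n. 0 < eps n" "eps \<longlonglongrightarrow> 0"
    and W: "W \<in> A_dual"
    and W_limit: "\<And>\<phi>. \<phi> \<in> A_space \<Longrightarrow>
          (\<lambda>n. A_functional (Weps (eps n) T) \<phi>) \<longlonglongrightarrow> W \<phi>"
  shows "(\<forall>n. back_signal_converges (Weps (eps n) T) (A (eps n)) S (eps n)) \<and>
         (\<forall>\<phi>. schwartz \<phi> \<longrightarrow> Z_fun A0 S \<phi> \<in> A_space) \<and>
         tempered_weakly_converges
           (\<lambda>n. back_signal (Weps (eps n) T) (A (eps n)) S (eps n))
           (back_signal_limit W A0 S)"
proof -
  obtain c C where c: "0 < c"
    and bd: "\<And>e x. 0 < e \<Longrightarrow> c \<le> \<rho> e x" "\<And>e x. 0 < e \<Longrightarrow> c \<le> \<kappa> e x"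
      "\<And>e x. 0 < e \<Longrightarrow> \<rho> e x \<le> C" "\<And>e x. 0 < e \<Longrightarrow> \<kappa> e x \<le> C"
    using A_bounds by blast
  \<comment> \<open>The coefficients are read off the diagonal by a bounded linear map, so that
    uniform convergence of the matrices passes to them; the diagonal form of \<open>A0\<close> is
    derived afterwards.\<close>
  define a where "a l = (\<lambda>n x. Re (A (eps n) x $ l $ l))" for l :: 4
  define a0 where "a0 l = (\<lambda>x. Re (A0 x $ l $ l))" for l :: 4
  have a_eq: "a l n x = (if l = 4 then \<kappa> (eps n) x else \<rho> (eps n) x)" for l n x
    by (simp add: a_def A_def diag_mat_def)
  have bl: "bounded_linear (\<lambda>N :: cmat. Re (N $ l $ l))" for l
    by (intro bounded_linear_compose[OF bounded_linear_Re] bounded_linear_compose[OF bounded_linear_vec_nth bounded_linear_vec_nth])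
  have "eps n \<noteq> 0" for n using eps(1)[of n] by simp
  then have eps0: "filterlim eps (at_right 0) sequentially"
    unfolding filterlim_at using eps by (auto intro!: always_eventually)
  have A_lim: "uniform_limit K (\<lambda>n. A (eps n)) A0 sequentially" if "compact K" for K
    unfolding uniform_limit_iff
  proof (intro allI impI)
    fix r :: real assume "0 < r"
    then have "\<forall>\<^sub>F e in at_right 0. \<forall>x\<in>K. dist (A e x) (A0 x) < r"
      using A_limit[OF that] unfolding uniform_limit_iff by blast
    then show "\<forall>\<^sub>F n in sequentially. \<forall>x\<in>K. dist (A (eps n) x) (A0 x) < r"
      by (rule eventually_compose_filterlim[OF _ eps0])
  qed
  have a_lim: "uniform_limit K (a l) (a0 l) sequentially" if "compact K" for K l
    unfolding a_def a0_def by (rule bounded_linear.uniform_limit[OF bl A_lim[OF that]])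
  have a_tendsto: "(\<lambda>n. a l n x) \<longlonglongrightarrow> a0 l x" for l x
    by (rule tendsto_uniform_limitI[OF a_lim[of "{x}"]]) auto
  have a_cont: "continuous_on UNIV (a l n)" for l n
    unfolding a_def by (intro continuous_intros A_continuous eps)
  \<comment> \<open>Continuity at a point is obtained on the unit ball around it, where the
    convergence is uniform.\<close>
  have a0_cont: "continuous_on UNIV (a0 l)" for l
  proof (intro continuous_at_imp_continuous_on ballI)
    fix x
    have "continuous_on (cball x 1) (a0 l)"
      by (rule uniform_limit_theorem[OF _ a_lim]) (auto intro!: always_eventually continuous_on_subset[OF a_cont])
    then show "isCont (a0 l) x"
      by (rule continuous_on_interior) simp
  qed
  have a_bd: "c \<le> a l n x" "a l n x \<le> C" for l n x
    using bd[OF eps(1)[of n]] by (simp_all add: a_eq)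
  have a0_bd: "c \<le> a0 l x" "a0 l x \<le> C" for l x
    by (rule LIMSEQ_le_const[OF a_tendsto] LIMSEQ_le_const2[OF a_tendsto]; use a_bd in blast)+
  \<comment> \<open>The velocity entries of \<open>A (eps n)\<close> coincide, so entry 1 represents
    them all in the limit.\<close>
  have A0_diag: "A0 x = diag_mat (a0 1 x) (a0 4 x)" for x
  proof (rule LIMSEQ_unique)
    show "(\<lambda>n. A (eps n) x) \<longlonglongrightarrow> A0 x"
      by (rule tendsto_uniform_limitI[OF A_lim[of "{x}"]]) auto
    have "A (eps n) x = diag_mat (a 1 n x) (a 4 n x)" for n
      by (simp add: A_def a_eq)
    then show "(\<lambda>n. A (eps n) x) \<longlonglongrightarrow> diag_mat (a0 1 x) (a0 4 x)"
      unfolding diag_mat_def by (intro vec_tendstoI) (auto intro!: tendsto_intros a_tendsto)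
  qed
  have A_diag: "A (eps n) = (\<lambda>x. diag_mat (a 1 n x) (a 4 n x))" for n
    by (simp add: fun_eq_iff A_def a_eq)
  define N where "N = (\<integral>x. (norm (chi x))\<^sup>2 \<partial>lborel)"
  \<comment> \<open>The two values are the energy bounds for \<open>Q\<close> and \<open>Qs\<close>.
    The initial matrices are diagonal with entries of modulus at most \<open>norm (chi x)\<close>
    and \<open>norm (chi x) / c\<close>, and 4 comes from \<open>norm_diagonal_le\<close>.\<close>
  define M where "M = max (C * (4\<^sup>2 * N) / c) (C * ((4 / c)\<^sup>2 * N) / c)"
  have C0: "0 \<le> C" using a_bd[of 1 0 0] c by linarith
  have N0: "0 \<le> N" by (simp add: N_def)
  have M0: "0 \<le> M" using C0 N0 c by (simp add: M_def le_max_iff_disj)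
  \<comment> \<open>The coefficients are left arbitrary within the bounds, because the same fields
    are used with the entries of \<open>A (eps n)\<close> and with those of
    \<open>A0\<close>.\<close>
  have TR: "time_reversal r k C S (Q (eps n) T) (Qs (eps n) T) f (eps n) M"
    if "continuous_on UNIV r" "continuous_on UNIV k" "\<And>x. c \<le> r x" "\<And>x. r x \<le> C" "\<And>x. c \<le> k x" "\<And>x. k x \<le> C" for r k n
  proof unfold_locales
    show "r \<in> borel_measurable borel" "k \<in> borel_measurable borel"
      using that(1,2) by (auto intro: borel_measurable_continuous_onI)
    show "\<bar>r x\<bar> \<le> C" "\<bar>k x\<bar> \<le> C" for x
      using that(3-6)[of x] c by linarith+
    show "(\<integral>\<^sup>+x. ennreal ((norm (Q (eps n) T x q))\<^sup>2) \<partial>lborel) \<le> ennreal M" for q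
    proof (rule order_trans)
      show "(\<integral>\<^sup>+x. ennreal ((norm (Q (eps n) T x q))\<^sup>2) \<partial>lborel) \<le> ennreal (C * (4\<^sup>2 * N) / c)"
        unfolding N_def
      proof (rule solution_nn_bound[OF disjI1[OF Q[OF eps(1)]] A_def bd[OF eps(1)] c A_continuous[OF eps(1)]
            solution_measurable(1)[OF Q_meas[OF eps(1)]] less_imp_le[OF T] _ chi(1)])
        show "norm (mat (chi x * cis ((q \<bullet> x) / eps n)) :: cmat) \<le> 4 * norm (chi x)" for x
          by (rule norm_diagonal_le) (simp_all add: mat_def norm_mult)
      qed
      show "ennreal (C * (4\<^sup>2 * N) / c) \<le> ennreal M" by (rule ennreal_leI) (simp add: M_def)
    qed
    show "(\<integral>\<^sup>+x. ennreal ((norm (Qs (eps n) T x q))\<^sup>2) \<partial>lborel) \<le> ennreal M" for q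
    proof (rule order_trans)
      show "(\<integral>\<^sup>+x. ennreal ((norm (Qs (eps n) T x q))\<^sup>2) \<partial>lborel) \<le> ennreal (C * ((4 / c)\<^sup>2 * N) / c)"
        unfolding N_def
      proof (rule solution_nn_bound[OF disjI2[OF Qs[OF eps(1)]] A_def bd[OF eps(1)] c A_continuous[OF eps(1)]
            solution_measurable(1)[OF Qs_meas[OF eps(1)]] less_imp_le[OF T] _ chi(1)])
        fix x
        let ?N = "cscale (chi x * cis (- (q \<bullet> x) / eps n)) (matrix_inv (A (eps n) x))"
        have pos: "0 < \<rho> (eps n) x" "0 < \<kappa> (eps n) x"
          using bd(1,2)[OF eps(1), of n x] c by linarith+
        have inv: "matrix_inv (A (eps n) x) = diag_mat (1 / \<rho> (eps n) x) (1 / \<kappa> (eps n) x)"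
          unfolding A_def using pos by (intro matrix_inv_diag_mat) auto
        have le: "\<bar>1 / \<rho> (eps n) x\<bar> \<le> 1 / c" "\<bar>1 / \<kappa> (eps n) x\<bar> \<le> 1 / c"
          using pos bd(1,2)[OF eps(1), of n x] c by (simp_all add: frac_le)
        have "norm ?N \<le> 4 * (norm (chi x) * (1 / c))"
        proof (rule norm_diagonal_le)
          show "?N $ i $ j = 0" if "i \<noteq> j" for i j using that by (simp add: inv cscale_def diag_mat_def)
          show "norm (?N $ i $ i) \<le> norm (chi x) * (1 / c)" for i
          proof -
            have "norm (diag_mat (1 / \<rho> (eps n) x) (1 / \<kappa> (eps n) x) $ i $ i) \<le> 1 / c"
              using le unfolding diag_mat_def by (cases "i = 4") (simp_all only: vec_lambda_beta if_True if_False norm_of_real simp_thms)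
            then have "norm (chi x) * norm (diag_mat (1 / \<rho> (eps n) x) (1 / \<kappa> (eps n) x) $ i $ i) \<le> norm (chi x) * (1 / c)"
              by (rule mult_left_mono) simp
            then show ?thesis unfolding inv cscale_def vec_lambda_beta norm_mult norm_cis mult_1_right .
          qed
        qed
        then show "norm ?N \<le> 4 / c * norm (chi x)" by (simp add: mult_ac)
      qed
      show "ennreal (C * ((4 / c)\<^sup>2 * N) / c) \<le> ennreal M" by (rule ennreal_leI) (simp add: M_def)
    qed
  qed (use S f M0 eps solution_measurable(2)[OF Q_meas[OF eps(1)]] solution_measurable(2)[OF Qs_meas[OF eps(1)]] T in auto)
  have TRn: "time_reversal (a 1 n) (a 4 n) C S (Q (eps n) T) (Qs (eps n) T) f (eps n) M" for n
    by (rule TR[OF a_cont a_cont a_bd a_bd])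
  have TR0: "time_reversal (a0 1) (a0 4) C S (Q (eps n) T) (Qs (eps n) T) f (eps n) M" for n
    by (rule TR[OF a0_cont a0_cont a0_bd a0_bd])
  interpret T0: time_reversal "a0 1" "a0 4" C S "Q (eps 0) T" "Qs (eps 0) T" f "eps 0" M by (rule TR0)
  have A0_eq: "A0 = T0.A" by (simp add: fun_eq_iff T0.A_def A0_diag)
  have signal: "back_signal_converges (Weps (eps n) T) (A (eps n)) S (eps n)"
    "tempered (back_signal (Weps (eps n) T) (A (eps n)) S (eps n))" for n
  proof -
    interpret time_reversal "a 1 n" "a 4 n" C S "Q (eps n) T" "Qs (eps n) T" f "eps n" M by (rule TRn)
    have A_eq: "A (eps n) = local.A" by (simp add: fun_eq_iff local.A_def A_diag)
    show "back_signal_converges (Weps (eps n) T) (A (eps n)) S (eps n)"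
      unfolding Weps_def A_eq by (rule back_signal_converges)
    show "tempered (back_signal (Weps (eps n) T) (A (eps n)) S (eps n))"
      unfolding Weps_def A_eq by (rule back_signal_tempered)
  qed
  have lim: "(\<lambda>n. back_signal (Weps (eps n) T) (A (eps n)) S (eps n) \<phi>) \<longlonglongrightarrow> back_signal_limit W A0 S \<phi>" if \<phi>: "schwartz \<phi>" for \<phi>
  proof -
    have "(\<lambda>n. back_signal (Weps (eps n) T) (A (eps n)) S (eps n) \<phi> - A_functional (Weps (eps n) T) (Z_fun A0 S \<phi>)) \<longlonglongrightarrow> 0"
      using signal_limit[OF TRn TR0 a_lim a_lim a0_cont a0_cont eps(2) \<phi>]
      unfolding Weps_def A_diag A0_diag[abs_def] .
    \<comment> \<open>The weak limit is tested on the fixed element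
      \<open>Z_fun A0 S \<phi>\<close>; the dependence of the coefficients on \<open>eps n\<close>
      has been absorbed by the vanishing difference.\<close>
    from tendsto_add[OF this W_limit[OF T0.Z_in_A_space[OF \<phi>, folded A0_eq]]]
    show ?thesis by (simp add: back_signal_limit_def)
  qed
  show ?thesis
    unfolding tempered_weakly_converges_def
    using signal lim T0.Z_in_A_space T0.back_signal_limit_tempered[OF W] unfolding A0_eq by blast
qed

end
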